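(* Let $\mathsf{Y}=(\mathrm{Spf}\, R[[z]])\otimes K$ be an open rigid disk over $K$ and let $G\subset\mathrm{Aut}_K(\mathsf{Y})$ be a finite group of automorphisms. Suppose that the set of fixed points $\Delta\subset\mathsf{Y}$ (the points with nontrivial stabilizer in $G$) is nonempty. Then there exists a Hurwitz tree $\mathcal{T}$ of type $(G,p)$ with $$\delta_{\mathcal{T}}=\delta_{\mathsf{Y}}^G,\qquad a_{\mathcal{T}}=a_{\mathsf{Y}}^G.$$
   Context: **Base field.** $K$ is a field of characteristic zero, complete with respect to a discrete valuation $\mathrm{val}:K^\times\to\mathbb{Q}$, with valuation ring $R$, prime element $\pi$, and residue field $k=R/(\pi)$ algebraically closed of characteristic $p>0$; $\mathrm{val}(p)=1$. Extend $\mathrm{val}$ to an algebraic closure $\bar K$. $\mathsf{Y}=(\mathrm{Spf}\,R[[z]])\otimes K$ is the rigid open unit disk $\{z\mid \mathrm{val}(z)>0\}$. A finite subgroup $G\subset\mathrm{Aut}_K(\mathsf{Y})$ is the same as a finite group of $R$-algebra automorphisms of $R[[z]]$. For $\sigma\in G\setminus\{1\}$, $\Delta_\sigma\subset\mathsf{Y}(\bar K)$ is the set of geometric fixed points of $\sigma$, and $\Delta=\bigcup_{\sigma\ne1}\Delta_\sigma$. **Depth and Artin character of $(\mathsf{Y},G)$.** Let $\mathrm{val}_{\mathsf{Y}}(\sum a_iz^i)=\min_i\mathrm{val}(a_i)$ be the Gauss valuation on $R[[z]]$. For $0\neq f\in R[[z]]$ put $\#_{\mathsf{Y}}f:=\mathrm{ord}_z(\overline{f/c})$,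 where $c\in R$ has $\mathrm{val}(c)=\mathrm{val}_{\mathsf{Y}}(f)$, the bar is reduction modulo $\pi$, and $\mathrm{ord}_z$ is the order in $k[[z]]$. Define class functions on $G$ by: for $\sigma\neq1$, $$\delta_{\mathsf{Y}}^G(\sigma)=-|G|\cdot\mathrm{val}_{\mathsf{Y}}(\sigma(z)-z),\qquad a_{\mathsf{Y}}^G(\sigma)=-\#_{\mathsf{Y}}(\sigma(z)-z),$$ and $\delta_{\mathsf{Y}}^G(1)=-\sum_{\sigma\ne1}\delta_{\mathsf{Y}}^G(\sigma)$, $a_{\mathsf{Y}}^G(1)=-\sum_{\sigma\neq1}a_{\mathsf{Y}}^G(\sigma)$. **Characters.** For a finite group $G$, $R(G)$ is the Grothendieck group of finitely generated $\mathbb{C}[G]$-modules, identified with virtual characters; $R^+(G)\subset R(G)$ is the submonoid of true characters. $1_G$, $r_G$ are the unit and regular characters and $u_G=r_G-1_G$. The scalar product is $\langle\chi_1,\chi_2\rangle_G=|G|^{-1}\sum_{\sigma}\overline{\chi_1(\sigma)}\chi_2(\sigma)$. $R(G,\mathbb{Q})=R(G)\otimes\mathbb{Q}$; an element $\chi$ is viewed as a class function or as the linear form $\psi\mapsto\chi(\psi):=\langle\psi,\chi\rangle_G$ on $R(G)$. $R^+(G,\mathbb{Q})$ consists of those $\chi\in R(G,\mathbb{Q})$ with $\chi(\psi)\ge0$ for all $\psi\in R^+(G)$. For a subgroup $H\subset G$ and $\chi$ a (virtual, $\mathbb{Q}$-valued) character of $H$, $\chi^*$ denotes the induced one on $G$.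 For a cyclic group $P=\langle\sigma\rangle$ of order $p^m$, $\delta_P^{\mathrm{mult}}\in R(P,\mathbb{Q})$ is the class function with $\delta_P^{\mathrm{mult}}(\sigma^a)=-p^{i+1}/(p-1)$ for $a\not\equiv0\bmod p^m$, $i=\mathrm{ord}_p(a)<m$, and $\delta_P^{\mathrm{mult}}(1)=mp^m$. **Metric trees.** A rooted tree is a finite connected tree $T$ with vertex set $V$, edge set $E$ and a distinguished vertex $v_0$ (the root) adjacent to exactly one edge $e_0$ (the trunk). Edges are oriented away from the root: for $e\in E$, the source $s(e)$ is the endpoint in the same component of $T\setminus\{e\}$ as $v_0$, and the target $t(e)$ is the other one. If $v=s(e)$, $v'=t(e)$, then $v'$ is a successor of $v$, written $v\to v'$. Write $v_1\le v_2$ if there is an oriented path from $v_1$ to $v_2$. Leaves are the maximal vertices; $B$ is the set of leaves. A metric is a map $\epsilon:E\to\mathbb{Q}_{\ge0}$, $e\mapsto\epsilon_e$, with $\epsilon_e=0$ iff $t(e)\in B$. **Hurwitz trees.** A Hurwitz tree of type $(G,p)$ is a datum $\mathcal{T}=(T,[G_v],a_e,\delta_v)$ with $T=(T,\epsilon)$ a metric tree, $[G_v]$ the conjugacy class of a subgroup $G_v\subset G$ for each vertex $v$, $a_e\in R^+(G)$ for each edge $e$, and $\delta_v\in R^+(G,\mathbb{Q})$ for each vertex $v$, such that: - (H1) For every vertex $v$ and successor $v'$ of $v$, $G_{v'}\subset G_v$ up to conjugation in $G$. For every non-leaf $v\neq v_0$, $\sum_{v\to v'}[G_v:G_{v'}]>1$.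 The root $v_0$ has exactly one successor $v'$, and $G_{v_0}=G_{v'}=G$. - (H2) $G_b$ is nontrivial and cyclic for every $b\in B$. - (H3) For all $e\in E$: $a_e=\sum_{e':\,s(e')=t(e)}a_{e'}$ if $t(e)\notin B$, and $a_e=u_{G_b}^*$ if $b=t(e)\in B$. - (H4) For all $e\in E$: $\delta_{t(e)}=\delta_{s(e)}+\epsilon_e\cdot s_e$, where $s_e:=a_e-u_{G_{t(e)}}^*$. - (H5) For $b\in B$, $\delta_b=(\delta_{P_b}^{\mathrm{mult}})^*$, where $P_b$ is the Sylow $p$-subgroup of $G_b$. Put $\delta_{\mathcal{T}}:=\delta_{v_0}$ and $a_{\mathcal{T}}:=a_{e_0}$. *)

theory Defs
  imports
    "HOL-Algebra.Algebra"
    "HOL-Algebra.Algebraic_Closure_Type"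
    "HOL-Computational_Algebra.Formal_Power_Series"
    "HOL-Library.Nonpos_Ints"
    "Jordan_Normal_Form.Matrix"
begin

section \<open>The base field and its valuation\<close>

text \<open>Valuations are functions on the whole field; the value at \<open>0\<close> is irrelevant,
  and every definition below treats \<open>0\<close> separately (as having valuation \<open>\<infinity>\<close>).\<close>

locale valuation =
  fixes v :: "'a::field \<Rightarrow> rat"
  assumes val_mult: "x \<noteq> 0 \<Longrightarrow> y \<noteq> 0 \<Longrightarrow> v (x * y) = v x + v y"
    and val_add: "x \<noteq> 0 \<Longrightarrow> y \<noteq> 0 \<Longrightarrow> x + y \<noteq> 0 \<Longrightarrow> min (v x) (v y) \<le> v (x + y)"

definition val_close :: "('a::field \<Rightarrow> rat) \<Rightarrow> rat \<Rightarrow> 'a \<Rightarrow> 'a \<Rightarrow> bool" where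
  "val_close v C x y \<longleftrightarrow> x = y \<or> C < v (x - y)"

definition val_Cauchy :: "('a::field \<Rightarrow> rat) \<Rightarrow> (nat \<Rightarrow> 'a) \<Rightarrow> bool" where
  "val_Cauchy v s \<longleftrightarrow> (\<forall>C. \<exists>N. \<forall>m\<ge>N. \<forall>n\<ge>N. val_close v C (s m) (s n))"

definition val_tendsto :: "('a::field \<Rightarrow> rat) \<Rightarrow> (nat \<Rightarrow> 'a) \<Rightarrow> 'a \<Rightarrow> bool" where
  "val_tendsto v s l \<longleftrightarrow> (\<forall>C. \<exists>N. \<forall>n\<ge>N. val_close v C (s n) l)"

definition val_ring :: "('k::field \<Rightarrow> rat) \<Rightarrow> 'k ring" where
  "val_ring v = ring_of_type_algebra\<lparr>carrier := {x. x = 0 \<or> 0 \<le> v x}\<rparr>"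

abbreviation prime_ideal_of :: "('k::field \<Rightarrow> rat) \<Rightarrow> 'k \<Rightarrow> 'k set" where
  "prime_ideal_of v \<pi> \<equiv> PIdl\<^bsub>val_ring v\<^esub> \<pi>"

definition residue_field :: "('k::field \<Rightarrow> rat) \<Rightarrow> 'k \<Rightarrow> 'k set ring" where
  "residue_field v \<pi> = val_ring v Quot prime_ideal_of v \<pi>"

text \<open>\<open>discrete\<close> says that the value group is generated by \<open>val \<pi>\<close>; \<open>prime_p\<close> and
  \<open>residue_char\<close> together say that the residue field has characteristic \<open>p\<close>.\<close>

locale complete_dvf = valuation val for val :: "'k::field_char_0 \<Rightarrow> rat" +
  fixes \<pi> :: 'k and p :: nat
  assumes prime_elem: "\<pi> \<noteq> 0" "0 < val \<pi>"
    and discrete: "x \<noteq> 0 \<Longrightarrow> \<exists>n::int. val x = of_int n * val \<pi>"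
    and complete: "val_Cauchy val s \<Longrightarrow> \<exists>l. val_tendsto val s l"
    and residue_alg_closed: "algebraically_closed (residue_field val \<pi>)"
    and prime_p: "Factorial_Ring.prime p"
    and residue_char:
      "[p] \<cdot>\<^bsub>residue_field val \<pi>\<^esub> \<one>\<^bsub>residue_field val \<pi>\<^esub> = \<zero>\<^bsub>residue_field val \<pi>\<^esub>"
    and val_p: "val (of_nat p) = 1"

locale valuation_extension = valuation valbar for valbar :: "'k::field alg_closure \<Rightarrow> rat" +
  fixes val :: "'k \<Rightarrow> rat"
  assumes extends: "x \<noteq> 0 \<Longrightarrow> valbar (to_ac x) = val x"

section \<open>The open disk and its automorphisms\<close>

definition disk_ring :: "('k::field \<Rightarrow> rat) \<Rightarrow> 'k fps ring" where
  "disk_ring val = ring_of_type_algebra\<lparr>carrier := {f. \<forall>n. fps_nth f n \<in> carrier (val_ring val)}\<rparr>"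

definition disk_aut :: "('k::field \<Rightarrow> rat) \<Rightarrow> ('k fps \<Rightarrow> 'k fps) monoid" where
  "disk_aut val = BijGroup (carrier (disk_ring val))
     \<lparr>carrier := {\<sigma> \<in> Bij (carrier (disk_ring val)).
        \<sigma> \<in> ring_iso (disk_ring val) (disk_ring val) \<and>
        (\<forall>c\<in>carrier (val_ring val). \<sigma> (fps_const c) = fps_const c)}\<rparr>"

definition disk_points :: "('k::field alg_closure \<Rightarrow> rat) \<Rightarrow> 'k alg_closure set" where
  "disk_points valbar = {x. x = 0 \<or> 0 < valbar x}"

definition fps_value ::
    "('k::field alg_closure \<Rightarrow> rat) \<Rightarrow> 'k fps \<Rightarrow> 'k alg_closure \<Rightarrow> 'k alg_closure \<Rightarrow> bool" where
  "fps_value valbar f x y \<longleftrightarrow> val_tendsto valbar (\<lambda>n. \<Sum>i<n. to_ac (fps_nth f i) * x ^ i) y"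

text \<open>An automorphism \<open>\<sigma>\<close> of \<open>R[[z]]\<close> acts on geometric points by evaluating
  the power series \<open>\<sigma>(z)\<close>.\<close>

definition fixed_points ::
    "('k::field alg_closure \<Rightarrow> rat) \<Rightarrow> ('k fps \<Rightarrow> 'k fps) \<Rightarrow> 'k alg_closure set" where
  "fixed_points valbar \<sigma> = {x \<in> disk_points valbar. fps_value valbar (\<sigma> fps_X) x x}"

definition all_fixed_points ::
    "('k::field \<Rightarrow> rat) \<Rightarrow> ('k alg_closure \<Rightarrow> rat) \<Rightarrow> ('k fps \<Rightarrow> 'k fps) set \<Rightarrow> 'k alg_closure set" where
  "all_fixed_points val valbar G = (\<Union>\<sigma>\<in>G - {\<one>\<^bsub>disk_aut val\<^esub>}. fixed_points valbar \<sigma>)"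

section \<open>Depth and Artin character of the disk\<close>

definition gauss_val :: "('k::field \<Rightarrow> rat) \<Rightarrow> 'k fps \<Rightarrow> rat" where
  "gauss_val val f = (LEAST q. \<exists>i. fps_nth f i \<noteq> 0 \<and> q = val (fps_nth f i))"

text \<open>The reduction in \<open>k[[z]]\<close>, given by its sequence of coefficients (the \<open>fps\<close> type
  is not available over \<open>k\<close>, which is a carrier-based ring).\<close>

definition fps_reduction :: "('k::field \<Rightarrow> rat) \<Rightarrow> 'k \<Rightarrow> 'k fps \<Rightarrow> nat \<Rightarrow> 'k set" where
  "fps_reduction val \<pi> f n = prime_ideal_of val \<pi> +>\<^bsub>val_ring val\<^esub> fps_nth f n"

definition ord_z :: "('a, 'm) ring_scheme \<Rightarrow> (nat \<Rightarrow> 'a) \<Rightarrow> nat" where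
  "ord_z k a = (LEAST n. a n \<noteq> \<zero>\<^bsub>k\<^esub>)"

definition num_zeros :: "('k::field \<Rightarrow> rat) \<Rightarrow> 'k \<Rightarrow> 'k fps \<Rightarrow> nat" where
  "num_zeros val \<pi> f =
     (let c = (SOME c. c \<in> carrier (val_ring val) \<and> c \<noteq> 0 \<and> val c = gauss_val val f)
      in ord_z (residue_field val \<pi>) (fps_reduction val \<pi> (fps_const (inverse c) * f)))"

definition disk_depth ::
    "('k::field \<Rightarrow> rat) \<Rightarrow> ('k fps \<Rightarrow> 'k fps) set \<Rightarrow> ('k fps \<Rightarrow> 'k fps) \<Rightarrow> complex" where
  "disk_depth val G \<sigma> =
     (let d = (\<lambda>\<tau>. - of_nat (card G) * of_rat (gauss_val val (\<tau> fps_X - fps_X)))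
      in if \<sigma> = \<one>\<^bsub>disk_aut val\<^esub> then - (\<Sum>\<tau>\<in>G - {\<one>\<^bsub>disk_aut val\<^esub>}. d \<tau>) else d \<sigma>)"

definition disk_artin ::
    "('k::field \<Rightarrow> rat) \<Rightarrow> 'k \<Rightarrow> ('k fps \<Rightarrow> 'k fps) set \<Rightarrow> ('k fps \<Rightarrow> 'k fps) \<Rightarrow> complex" where
  "disk_artin val \<pi> G \<sigma> =
     (let a = (\<lambda>\<tau>. - of_nat (num_zeros val \<pi> (\<tau> fps_X - fps_X)))
      in if \<sigma> = \<one>\<^bsub>disk_aut val\<^esub> then - (\<Sum>\<tau>\<in>G - {\<one>\<^bsub>disk_aut val\<^esub>}. a \<tau>) else a \<sigma>)"

section \<open>Characters of finite groups\<close>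

text \<open>Class functions on \<open>G\<close> are functions on the ambient type, of which only the values on
  \<open>carrier G\<close> matter.  Finitely generated \<open>\<complex>[G]\<close>-modules are given as matrix
  representations of arbitrary (possibly zero) finite dimension.\<close>

definition mat_representation ::
    "('g, 'm) monoid_scheme \<Rightarrow> nat \<Rightarrow> ('g \<Rightarrow> complex mat) \<Rightarrow> bool" where
  "mat_representation G n \<rho> \<longleftrightarrow>
     (\<forall>g\<in>carrier G. \<rho> g \<in> carrier_mat n n) \<and> \<rho> \<one>\<^bsub>G\<^esub> = 1\<^sub>m n \<and>
     (\<forall>g\<in>carrier G. \<forall>h\<in>carrier G. \<rho> (g \<otimes>\<^bsub>G\<^esub> h) = \<rho> g * \<rho> h)"

definition true_characters :: "('g, 'm) monoid_scheme \<Rightarrow> ('g \<Rightarrow> complex) set" where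
  "true_characters G = {\<chi>. \<exists>n \<rho>. mat_representation G n \<rho> \<and>
     (\<forall>g\<in>carrier G. \<chi> g = (\<Sum>i<n. \<rho> g $$ (i, i)))}"

definition virtual_characters :: "('g, 'm) monoid_scheme \<Rightarrow> ('g \<Rightarrow> complex) set" where
  "virtual_characters G = {\<chi>. \<exists>\<chi>1\<in>true_characters G. \<exists>\<chi>2\<in>true_characters G.
     \<forall>g\<in>carrier G. \<chi> g = \<chi>1 g - \<chi>2 g}"

text \<open>Elements of \<open>R(G) \<otimes> \<rat>\<close>: every one is of the form \<open>\<psi> / N\<close> with \<open>\<psi> \<in> R(G)\<close>.\<close>

definition rational_characters :: "('g, 'm) monoid_scheme \<Rightarrow> ('g \<Rightarrow> complex) set" where
  "rational_characters G = {\<chi>. \<exists>N::nat. 0 < N \<and> (\<lambda>g. of_nat N * \<chi> g) \<in> virtual_characters G}"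

definition char_scalar ::
    "('g, 'm) monoid_scheme \<Rightarrow> ('g \<Rightarrow> complex) \<Rightarrow> ('g \<Rightarrow> complex) \<Rightarrow> complex" where
  "char_scalar G \<chi>1 \<chi>2 = (\<Sum>g\<in>carrier G. cnj (\<chi>1 g) * \<chi>2 g) / of_nat (card (carrier G))"

definition nonneg_rational_characters :: "('g, 'm) monoid_scheme \<Rightarrow> ('g \<Rightarrow> complex) set" where
  "nonneg_rational_characters G = {\<chi> \<in> rational_characters G.
     \<forall>\<psi>\<in>true_characters G. char_scalar G \<psi> \<chi> \<in> \<real>\<^sub>\<ge>\<^sub>0}"

definition unit_char :: "('g, 'm) monoid_scheme \<Rightarrow> 'g \<Rightarrow> complex" where
  "unit_char G g = 1"

definition regular_char :: "('g, 'm) monoid_scheme \<Rightarrow> 'g \<Rightarrow> complex" where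
  "regular_char G g = (if g = \<one>\<^bsub>G\<^esub> then of_nat (card (carrier G)) else 0)"

definition u_char :: "('g, 'm) monoid_scheme \<Rightarrow> 'g \<Rightarrow> complex" where
  "u_char G g = regular_char G g - unit_char G g"

definition induced_char ::
    "('g, 'm) monoid_scheme \<Rightarrow> 'g set \<Rightarrow> ('g \<Rightarrow> complex) \<Rightarrow> 'g \<Rightarrow> complex" where
  "induced_char G H \<chi> g =
     (\<Sum>x \<in> {x \<in> carrier G. inv\<^bsub>G\<^esub> x \<otimes>\<^bsub>G\<^esub> g \<otimes>\<^bsub>G\<^esub> x \<in> H}.
        \<chi> (inv\<^bsub>G\<^esub> x \<otimes>\<^bsub>G\<^esub> g \<otimes>\<^bsub>G\<^esub> x)) / of_nat (card H)"

text \<open>For a cyclic group \<open>P\<close> of order \<open>p ^ m\<close>; the value does not depend on the generator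
  \<open>\<sigma>\<close>, nor on the exponent \<open>a\<close> modulo \<open>p ^ m\<close>.\<close>

definition delta_mult :: "nat \<Rightarrow> ('g, 'm) monoid_scheme \<Rightarrow> 'g \<Rightarrow> complex" where
  "delta_mult p P g =
     (let m = multiplicity p (card (carrier P));
          \<sigma> = (SOME \<sigma>. \<sigma> \<in> carrier P \<and> generate P {\<sigma>} = carrier P);
          a = (LEAST a::nat. g = \<sigma> [^]\<^bsub>P\<^esub> a)
      in if g = \<one>\<^bsub>P\<^esub> then of_nat (m * p ^ m)
         else - of_nat (p ^ (multiplicity p a + 1)) / (of_nat p - 1))"

definition sylow_subgroup :: "nat \<Rightarrow> ('g, 'm) monoid_scheme \<Rightarrow> 'g set \<Rightarrow> bool" where
  "sylow_subgroup p G P \<longleftrightarrow> subgroup P G \<and> card P = p ^ multiplicity p (card (carrier G))"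

definition conjugate :: "('g, 'm) monoid_scheme \<Rightarrow> 'g \<Rightarrow> 'g set \<Rightarrow> 'g set" where
  "conjugate G x H = (\<lambda>h. x \<otimes>\<^bsub>G\<^esub> h \<otimes>\<^bsub>G\<^esub> inv\<^bsub>G\<^esub> x) ` H"

definition conj_class :: "('g, 'm) monoid_scheme \<Rightarrow> 'g set \<Rightarrow> 'g set set" where
  "conj_class G H = {conjugate G x H | x. x \<in> carrier G}"

section \<open>Metric trees\<close>

text \<open>An edge is the two-element set of its endpoints.\<close>

record 'v rooted_tree =
  tverts :: "'v set"
  tedges :: "'v set set"
  troot :: 'v

definition adjacency :: "'v set set \<Rightarrow> ('v \<times> 'v) set" where
  "adjacency E = {(x, y). {x, y} \<in> E}"

definition has_cycle :: "'v set set \<Rightarrow> bool" where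
  "has_cycle E \<longleftrightarrow> (\<exists>vs. 3 \<le> length vs \<and> distinct vs \<and>
     (\<forall>i<length vs. {vs ! i, vs ! ((i + 1) mod length vs)} \<in> E))"

definition rooted_tree :: "('v, 'm) rooted_tree_scheme \<Rightarrow> bool" where
  "rooted_tree T \<longleftrightarrow>
     finite (tverts T) \<and> troot T \<in> tverts T \<and>
     (\<forall>e\<in>tedges T. e \<subseteq> tverts T \<and> card e = 2) \<and>
     (\<forall>x\<in>tverts T. \<forall>y\<in>tverts T. (x, y) \<in> (adjacency (tedges T))\<^sup>*) \<and>
     \<not> has_cycle (tedges T) \<and>
     (\<exists>!e. e \<in> tedges T \<and> troot T \<in> e)"

definition trunk :: "('v, 'm) rooted_tree_scheme \<Rightarrow> 'v set" where
  "trunk T = (THE e. e \<in> tedges T \<and> troot T \<in> e)"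

definition edge_source :: "('v, 'm) rooted_tree_scheme \<Rightarrow> 'v set \<Rightarrow> 'v" where
  "edge_source T e = (THE x. x \<in> e \<and> (troot T, x) \<in> (adjacency (tedges T - {e}))\<^sup>*)"

definition edge_target :: "('v, 'm) rooted_tree_scheme \<Rightarrow> 'v set \<Rightarrow> 'v" where
  "edge_target T e = (THE x. x \<in> e \<and> x \<noteq> edge_source T e)"

definition successors :: "('v, 'm) rooted_tree_scheme \<Rightarrow> 'v \<Rightarrow> 'v set" where
  "successors T v = {edge_target T e | e. e \<in> tedges T \<and> edge_source T e = v}"

definition tree_le :: "('v, 'm) rooted_tree_scheme \<Rightarrow> 'v \<Rightarrow> 'v \<Rightarrow> bool" where
  "tree_le T v w \<longleftrightarrow> (v, w) \<in> {(x, y). y \<in> successors T x}\<^sup>*"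

definition leaves :: "('v, 'm) rooted_tree_scheme \<Rightarrow> 'v set" where
  "leaves T = {b \<in> tverts T. \<forall>w\<in>tverts T. tree_le T b w \<longrightarrow> w = b}"

definition tree_metric :: "('v, 'm) rooted_tree_scheme \<Rightarrow> ('v set \<Rightarrow> rat) \<Rightarrow> bool" where
  "tree_metric T \<epsilon> \<longleftrightarrow> (\<forall>e\<in>tedges T. 0 \<le> \<epsilon> e \<and> (\<epsilon> e = 0 \<longleftrightarrow> edge_target T e \<in> leaves T))"

section \<open>Hurwitz trees\<close>

record ('v, 'g) hurwitz_datum = "'v rooted_tree" +
  thickness :: "'v set \<Rightarrow> rat"
  monodromy :: "'v \<Rightarrow> 'g set set"  \<comment> \<open>the conjugacy class \<open>[G\<^sub>v]\<close>\<close>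
  artin :: "'v set \<Rightarrow> 'g \<Rightarrow> complex"
  depth :: "'v \<Rightarrow> 'g \<Rightarrow> complex"

text \<open>In the following \<open>Gv\<close> is a choice of representatives of the classes \<open>[G\<^sub>v]\<close>; all
  the conditions are invariant under replacing a \<open>Gv v\<close> by a conjugate.  The index
  \<open>[G\<^sub>v : G\<^sub>w]\<close> is computed as a quotient of orders, since \<open>G\<^sub>w\<close> is contained in
  \<open>G\<^sub>v\<close> only up to conjugation.\<close>

definition hurwitz_H1 ::
    "('g, 'm) monoid_scheme \<Rightarrow> ('v, 'n) rooted_tree_scheme \<Rightarrow> ('v \<Rightarrow> 'g set) \<Rightarrow> bool" where
  "hurwitz_H1 G T Gv \<longleftrightarrow>
     (\<forall>v\<in>tverts T. \<forall>w\<in>successors T v. \<exists>x\<in>carrier G. conjugate G x (Gv w) \<subseteq> Gv v) \<and>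
     (\<forall>v\<in>tverts T - leaves T - {troot T}.
        1 < (\<Sum>w\<in>successors T v. of_nat (card (Gv v)) / of_nat (card (Gv w)) :: rat)) \<and>
     (\<exists>w. successors T (troot T) = {w} \<and> Gv (troot T) = carrier G \<and> Gv w = carrier G)"

definition hurwitz_H2 ::
    "('g, 'm) monoid_scheme \<Rightarrow> ('v, 'n) rooted_tree_scheme \<Rightarrow> ('v \<Rightarrow> 'g set) \<Rightarrow> bool" where
  "hurwitz_H2 G T Gv \<longleftrightarrow>
     (\<forall>b\<in>leaves T. Gv b \<noteq> {\<one>\<^bsub>G\<^esub>} \<and> cyclic_group (G\<lparr>carrier := Gv b\<rparr>))"

definition hurwitz_H3 ::
    "('g, 'm) monoid_scheme \<Rightarrow> ('v, 'g, 'n) hurwitz_datum_scheme \<Rightarrow> ('v \<Rightarrow> 'g set) \<Rightarrow> bool" where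
  "hurwitz_H3 G T Gv \<longleftrightarrow>
     (\<forall>e\<in>tedges T. \<forall>g\<in>carrier G. artin T e g =
        (if edge_target T e \<notin> leaves T
         then \<Sum>e'\<in>{e' \<in> tedges T. edge_source T e' = edge_target T e}. artin T e' g
         else induced_char G (Gv (edge_target T e))
                (u_char (G\<lparr>carrier := Gv (edge_target T e)\<rparr>)) g))"

definition hurwitz_H4 ::
    "('g, 'm) monoid_scheme \<Rightarrow> ('v, 'g, 'n) hurwitz_datum_scheme \<Rightarrow> ('v \<Rightarrow> 'g set) \<Rightarrow> bool" where
  "hurwitz_H4 G T Gv \<longleftrightarrow>
     (\<forall>e\<in>tedges T. \<forall>g\<in>carrier G. depth T (edge_target T e) g =
        depth T (edge_source T e) g + of_rat (thickness T e) *
          (artin T e g - induced_char G (Gv (edge_target T e))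
                           (u_char (G\<lparr>carrier := Gv (edge_target T e)\<rparr>)) g))"

definition hurwitz_H5 ::
    "nat \<Rightarrow> ('g, 'm) monoid_scheme \<Rightarrow> ('v, 'g, 'n) hurwitz_datum_scheme \<Rightarrow> ('v \<Rightarrow> 'g set) \<Rightarrow> bool" where
  "hurwitz_H5 p G T Gv \<longleftrightarrow>
     (\<forall>b\<in>leaves T. \<exists>P. sylow_subgroup p (G\<lparr>carrier := Gv b\<rparr>) P \<and>
        (\<forall>g\<in>carrier G. depth T b g = induced_char G P (delta_mult p (G\<lparr>carrier := P\<rparr>)) g))"

definition hurwitz_tree ::
    "('g, 'm) monoid_scheme \<Rightarrow> nat \<Rightarrow> ('v, 'g, 'n) hurwitz_datum_scheme \<Rightarrow> bool" where
  "hurwitz_tree G p T \<longleftrightarrow>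
     rooted_tree T \<and> tree_metric T (thickness T) \<and>
     (\<forall>e\<in>tedges T. artin T e \<in> true_characters G) \<and>
     (\<forall>v\<in>tverts T. depth T v \<in> nonneg_rational_characters G) \<and>
     (\<exists>Gv. (\<forall>v\<in>tverts T. subgroup (Gv v) G \<and> monodromy T v = conj_class G (Gv v)) \<and>
        hurwitz_H1 G T Gv \<and> hurwitz_H2 G T Gv \<and> hurwitz_H3 G T Gv \<and>
        hurwitz_H4 G T Gv \<and> hurwitz_H5 p G T Gv)"

definition tree_depth :: "('v, 'g, 'n) hurwitz_datum_scheme \<Rightarrow> 'g \<Rightarrow> complex" where
  "tree_depth T = depth T (troot T)"

definition tree_artin :: "('v, 'g, 'n) hurwitz_datum_scheme \<Rightarrow> 'g \<Rightarrow> complex" where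
  "tree_artin T = artin T (trunk T)"

end

theory Submission
  imports Defs "Jordan_Normal_Form.Schur_Decomposition"
begin

text \<open>By Weierstrass preparation, \<open>\<sigma>(z) - z\<close> is the product of a constant of valuation \<open>c(\<sigma>)\<close>, a unit and
  the linear factors of the fixed points of \<open>\<sigma>\<close>, which are simple: the derivative at a fixed point
  embeds its stabilizer into the roots of unity, so the stabilizer is moreover cyclic.

  The finite ultrametric space \<open>\<Delta>\<close> has a tree of clusters, the intersections of \<open>\<Delta>\<close> with disks. The
  Hurwitz tree consists of the \<open>G\<close>-orbits of clusters and an additional root, with edges
  weighted by differences of radii. For a cluster of radius \<open>r\<close> and \<open>\<sigma>\<close> in its stabilizer, let
  \<open>\<lambda>(\<sigma>)\<close> be the valuation of \<open>(\<sigma>(y) - y) / \<pi>\<^sup>r\<close> at a generic point \<open>y\<close> of the disk; the depth at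
  this vertex is the character induced from \<open>-\<lambda>\<close>. By the product formula \<open>\<lambda>\<close> is \<open>c(\<sigma>) - r\<close> plus
  the sum of the distances to the fixed points, truncated at \<open>r\<close>, and its variation along an
  edge is governed by the number of fixed points beyond the edge; this is (H4). The sets \<open>{\<lambda> \<ge> s}\<close>
  are subgroups, so the depth is a nonnegative combination of induced augmentation characters.
  At a leaf, \<open>\<lambda>(\<sigma>)\<close> is the valuation of \<open>\<zeta> - 1\<close> for a root of unity \<open>\<zeta>\<close> of the order of \<open>\<sigma>\<close>.\<close>

subsection \<open>True characters\<close>

text \<open>The algebraic closure is not complete, so convergence of a power series at a geometric
  point is not automatic. Values are obtained from Weierstrass division by a distinguished
  polynomial that vanishes at the point: the polynomial remainder has a value. Automorphisms are
  known only as algebra homomorphisms, so an identity involving an infinite series is proved by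
  splitting off a finite part and estimating the rest.

  Depths are sums over conjugating elements that are not divided by the order of the stabilizer.
  This matches the factor \<open>|G|\<close> in the depth of the disk, and it makes the thickness of
  the edge into a cluster the difference of radii times the order of the stabilizer of that cluster.

  The action on the reduction of a disk is never formed. In its place stands the displacement of a
  single generic point: its valuation is level plus radius, and a lower bound on it defines a
  subgroup. The combinatorial half of the proof sees only the axioms of
  \<open>hurwitz_action\<close>, the arithmetic half only has to verify them.\<close>

lemma true_characters_cong:
  assumes "\<chi> \<in> true_characters G" "\<And>g. g \<in> carrier G \<Longrightarrow> \<chi> g = \<chi>' g"
  shows "\<chi>' \<in> true_characters G"
proof -
  from assms(1) obtain n \<rho> where "mat_representation G n \<rho>"
    "\<forall>g\<in>carrier G. \<chi> g = (\<Sum>i<n. \<rho> g $$ (i, i))" unfolding true_characters_def by auto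
  then show ?thesis unfolding true_characters_def using assms(2) by auto
qed

lemma true_characters_zero: "(\<lambda>g. 0) \<in> true_characters G"
  unfolding true_characters_def mat_representation_def
  by (auto intro!: exI[of _ 0] exI[of _ "\<lambda>g. 1\<^sub>m 0"])

lemma true_characters_add:
  assumes "\<chi>1 \<in> true_characters G" "\<chi>2 \<in> true_characters G"
  shows "(\<lambda>g. \<chi>1 g + \<chi>2 g) \<in> true_characters G"
proof -
  from assms(1) obtain n \<rho> where r: "mat_representation G n \<rho>"
    and rc: "\<And>g. g\<in>carrier G \<Longrightarrow> \<chi>1 g = (\<Sum>i<n. \<rho> g $$ (i, i))" unfolding true_characters_def by auto
  from assms(2) obtain m \<tau> where t: "mat_representation G m \<tau>"
    and tc: "\<And>g. g\<in>carrier G \<Longrightarrow> \<chi>2 g = (\<Sum>i<m. \<tau> g $$ (i, i))" unfolding true_characters_def by auto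
  have rd: "\<rho> g \<in> carrier_mat n n" "\<tau> g \<in> carrier_mat m m" if "g \<in> carrier G" for g
    using r t that unfolding mat_representation_def by auto
  define \<sigma> where "\<sigma> g = four_block_mat (\<rho> g) (0\<^sub>m n m) (0\<^sub>m m n) (\<tau> g)" for g
  have "mat_representation G (n + m) \<sigma>"
    unfolding mat_representation_def
  proof (intro conjI ballI)
    fix g h assume g: "g \<in> carrier G" and h: "h \<in> carrier G"
    show "\<sigma> g \<in> carrier_mat (n + m) (n + m)" using rd[OF g] by (simp add: \<sigma>_def)
    have "\<sigma> g * \<sigma> h = four_block_mat (\<rho> g * \<rho> h) (0\<^sub>m n m) (0\<^sub>m m n) (\<tau> g * \<tau> h)"
      unfolding \<sigma>_def using rd[OF g] rd[OF h]
      by (subst mult_four_block_mat[of _ n n _ m _ m _ _ n _ m]) auto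
    then show "\<sigma> (g \<otimes>\<^bsub>G\<^esub> h) = \<sigma> g * \<sigma> h"
      using r t g h unfolding mat_representation_def \<sigma>_def by auto
  next
    show "\<sigma> \<one>\<^bsub>G\<^esub> = 1\<^sub>m (n + m)"
      using r t unfolding mat_representation_def \<sigma>_def by (auto simp: four_block_one_mat)
  qed
  moreover have "\<chi>1 g + \<chi>2 g = (\<Sum>i<n+m. \<sigma> g $$ (i, i))" if g: "g \<in> carrier G" for g
  proof -
    have "(\<Sum>i<n+m. \<sigma> g $$ (i, i)) = (\<Sum>i<n. \<sigma> g $$ (i, i)) + (\<Sum>i<m. \<sigma> g $$ (n+i, n+i))"
      using sum.atLeastLessThan_concat[of 0 n "n+m" "\<lambda>i. \<sigma> g $$ (i, i)"]
        sum.shift_bounds_nat_ivl[of "\<lambda>i. \<sigma> g $$ (i, i)" 0 n m]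
      by (simp add: lessThan_atLeast0 add.commute)
    also have "(\<Sum>i<n. \<sigma> g $$ (i, i)) = \<chi>1 g"
      unfolding rc[OF g] using rd[OF g] by (intro sum.cong) (auto simp: \<sigma>_def)
    also have "(\<Sum>i<m. \<sigma> g $$ (n+i, n+i)) = \<chi>2 g"
      unfolding tc[OF g] using rd[OF g] by (intro sum.cong) (auto simp: \<sigma>_def)
    finally show ?thesis by simp
  qed
  ultimately show ?thesis unfolding true_characters_def by blast
qed

lemma true_characters_sum:
  assumes "finite S" "\<And>s. s \<in> S \<Longrightarrow> f s \<in> true_characters G"
  shows "(\<lambda>g. \<Sum>s\<in>S. f s g) \<in> true_characters G"
  using assms by (induction S rule: finite_induct) (auto simp: true_characters_zero true_characters_add)

lemma true_characters_nat_mult: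
  assumes "f \<in> true_characters G"
  shows "(\<lambda>g. of_nat n * f g) \<in> true_characters G"
  using true_characters_sum[of "{..<n}" "\<lambda>_. f" G] assms by simp

subsection \<open>Induced augmentation characters\<close>

text \<open>\<open>card (conjugators G H g) / card H\<close> is the number of cosets
  \<open>x H\<close> fixed by \<open>g\<close>, the permutation character of \<open>G/H\<close> at
  \<open>g\<close>.\<close>

definition conjugators :: "('g, 'm) monoid_scheme \<Rightarrow> 'g set \<Rightarrow> 'g \<Rightarrow> 'g set" where
  "conjugators G H g = {x \<in> carrier G. inv\<^bsub>G\<^esub> x \<otimes>\<^bsub>G\<^esub> g \<otimes>\<^bsub>G\<^esub> x \<in> H}"

lemma (in group) conj_one_iff:
  assumes "x \<in> carrier G" "g \<in> carrier G"
  shows "inv x \<otimes> g \<otimes> x = \<one> \<longleftrightarrow> g = \<one>"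
  by (metis assms inv_closed inv_equality inv_inv m_assoc m_closed r_inv r_one l_one inv_solve_left)

text \<open>Induction sends the regular character to the regular character and the unit character to
  the permutation character of \<open>G/H\<close>.\<close>

lemma (in group) induced_u_char:
  assumes H: "subgroup H G" and fin: "finite (carrier G)" and g: "g \<in> carrier G"
  shows "induced_char G H (u_char (G\<lparr>carrier := H\<rparr>)) g =
    (if g = \<one> then of_nat (card (carrier G)) else 0) - of_nat (card (conjugators G H g)) / of_nat (card H)"
proof -
  have H0: "card H \<noteq> 0" using H fin subgroup.subset[OF H] subgroup.one_closed[OF H]
    by (metis card_0_eq empty_iff finite_subset)
  have f: "finite (conjugators G H g)" unfolding conjugators_def using fin by auto
  have one: "g = \<one> \<Longrightarrow> conjugators G H g = carrier G"
    unfolding conjugators_def using H subgroup.one_closed by fastforce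
  have "induced_char G H (u_char (G\<lparr>carrier := H\<rparr>)) g
     = (\<Sum>x\<in>conjugators G H g. (if g = \<one> then of_nat (card H) else 0) - 1) / of_nat (card H)"
    unfolding induced_char_def u_char_def regular_char_def unit_char_def conjugators_def
    using g by (intro arg_cong2[where f="(/)"] refl sum.cong) (auto simp: conj_one_iff)
  also have "\<dots> = (if g = \<one> then of_nat (card (carrier G)) else 0) - of_nat (card (conjugators G H g)) / of_nat (card H)"
    using H0 one by (auto simp: sum_subtractf field_simps)
  finally show ?thesis .
qed

text \<open>The regular character minus the permutation character is afforded by the kernel of
  \<open>C[G] -> C[G/H]\<close>. A basis of this kernel consists of the differences
  \<open>g - c g\<close>, where \<open>c g\<close> is a chosen element of the coset of
  \<open>g\<close> and \<open>g\<close> runs through the elements that were not chosen.\<close>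

lemma (in group) induced_u_true_character:
  assumes H: "subgroup H G" and fin: "finite (carrier G)"
  shows "induced_char G H (u_char (G\<lparr>carrier := H\<rparr>)) \<in> true_characters G"
proof -
  interpret H: subgroup H G by fact
  have fH: "finite H" using fin H.subset finite_subset by blast
  \<comment> \<open>The choice depends only on the coset as a set, which makes \<open>c\<close>
    constant on cosets and idempotent.\<close>
  define c where "c g = (SOME x. x \<in> g <# H)" for g
  have gg: "g \<in> g <# H" if "g \<in> carrier G" for g
    using lcos_self[OF that H] .
  have c_in: "c g \<in> g <# H" if "g \<in> carrier G" for g
    unfolding c_def using gg[OF that] by (rule someI)
  have cG: "c g \<in> carrier G" if "g \<in> carrier G" for g
    using c_in[OF that] that l_coset_subset_G[OF H.subset that] by auto
  have cos: "y <# H = x <# H" if "x \<in> carrier G" "y \<in> x <# H" for x y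
    using l_repr_independence[OF that(2) that(1) H] by simp
  have c_eq: "c y = c x" if "x \<in> carrier G" "y \<in> x <# H" for x y
    unfolding c_def using cos[OF that] by simp
  have cc: "c (c g) = c g" if "g \<in> carrier G" for g
    using c_eq[OF that c_in[OF that]] .
  have ckc: "c (k \<otimes> c g) = c (k \<otimes> g)" if g: "g \<in> carrier G" and k: "k \<in> carrier G" for k g
  proof -
    obtain h where h: "h \<in> H" "c g = g \<otimes> h" using c_in[OF g] unfolding l_coset_def by auto
    have "k \<otimes> c g = (k \<otimes> g) \<otimes> h" using h g k H.subset by (simp add: m_assoc subsetD)
    then show ?thesis using c_eq[of "k \<otimes> g" "k \<otimes> c g"] g k h unfolding l_coset_def by auto
  qed
  define I where "I = {g \<in> carrier G. c g \<noteq> g}"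
  have fI: "finite I" unfolding I_def using fin by auto
  define n where "n = card I"
  obtain e where e: "bij_betw e {..<n} I"
    using ex_bij_betw_nat_finite[OF fI] unfolding n_def lessThan_atLeast0 by auto
  have eI: "e i \<in> I" if "i < n" for i using e that unfolding bij_betw_def by auto
  have eG: "e i \<in> carrier G" if "i < n" for i using eI[OF that] unfolding I_def by auto
  \<comment> \<open>The image of \<open>g - c g\<close> under \<open>h\<close> is
    \<open>h g - h (c g)\<close>, and both terms lie in one coset. Its coefficient at the basis
    vector of \<open>a\<close> is therefore \<open>[a = h g] - [a = h (c g)]\<close>.\<close>
  define F :: "'a \<Rightarrow> 'a \<Rightarrow> 'a \<Rightarrow> complex" where "F a h g = of_bool (a = h \<otimes> g) - of_bool (a = h \<otimes> c g)" for a h g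
  define \<rho> :: "'a \<Rightarrow> complex mat" where "\<rho> h = mat n n (\<lambda>(i,j). F (e i) h (e j))" for h
  \<comment> \<open>The formula also covers a \<open>y\<close> that indexes no basis vector: then
    \<open>c y = y\<close>, and \<open>F a h y\<close> is 0 like the sum.\<close>
  have sumF: "(\<Sum>l<n. F a h (e l) * of_bool (e l = y)) = F a h y" if "y \<in> carrier G" for a h y
  proof -
    have "(\<Sum>l<n. F a h (e l) * of_bool (e l = y)) = (\<Sum>x\<in>I. F a h x * of_bool (x = y))"
      using sum.reindex_bij_betw[OF e, of "\<lambda>x. F a h x * of_bool (x = y)"] by simp
    also have "\<dots> = (\<Sum>x\<in>I. if y = x then F a h x else 0)" by (intro sum.cong) auto
    also have "\<dots> = (if y \<in> I then F a h y else 0)" using fI by (simp add: sum.delta)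
    also have "\<dots> = F a h y" using that unfolding I_def F_def by auto
    finally show ?thesis .
  qed
  have "mat_representation G n \<rho>"
    unfolding mat_representation_def
  proof (intro conjI ballI)
    fix h k assume h: "h \<in> carrier G" and k: "k \<in> carrier G"
    show "\<rho> h \<in> carrier_mat n n" by (simp add: \<rho>_def)
    show "\<rho> (h \<otimes> k) = \<rho> h * \<rho> k"
    proof (rule eq_matI)
      fix i j assume "i < dim_row (\<rho> h * \<rho> k)" "j < dim_col (\<rho> h * \<rho> k)"
      then have ij: "i < n" "j < n" by (auto simp: \<rho>_def)
      let ?g = "e j"
      have "(\<rho> h * \<rho> k) $$ (i,j) = (\<Sum>l<n. F (e i) h (e l) * F (e l) k ?g)"
        using ij by (simp add: \<rho>_def scalar_prod_def lessThan_atLeast0)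
      also have "\<dots> = (\<Sum>l<n. F (e i) h (e l) * of_bool (e l = k \<otimes> ?g)) - (\<Sum>l<n. F (e i) h (e l) * of_bool (e l = k \<otimes> c ?g))"
        unfolding sum_subtractf[symmetric] by (intro sum.cong refl) (simp add: F_def[of _ k] algebra_simps)
      also have "\<dots> = F (e i) h (k \<otimes> ?g) - F (e i) h (k \<otimes> c ?g)"
        using sumF[OF m_closed[OF k eG[OF ij(2)]]] sumF[OF m_closed[OF k cG[OF eG[OF ij(2)]]]]
        by (simp only:)
      also have "\<dots> = F (e i) (h \<otimes> k) ?g"
        using eG[OF ij(2)] cG h k by (simp add: F_def ckc m_assoc)
      finally show "\<rho> (h \<otimes> k) $$ (i, j) = (\<rho> h * \<rho> k) $$ (i, j)" using ij by (simp add: \<rho>_def)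
    qed (auto simp: \<rho>_def)
  next
    show "\<rho> \<one> = 1\<^sub>m n"
    proof (rule eq_matI)
      fix i j assume "i < dim_row (1\<^sub>m n :: complex mat)" "j < dim_col (1\<^sub>m n :: complex mat)"
      then have ij: "i < n" "j < n" by auto
      have "e i \<noteq> c (e j)" using eI[OF ij(1)] eG[OF ij(2)] cc unfolding I_def by force
      moreover have "e i = e j \<longleftrightarrow> i = j" using e ij unfolding bij_betw_def inj_on_def by auto
      ultimately show "\<rho> \<one> $$ (i, j) = 1\<^sub>m n $$ (i, j)"
        using ij eG cG by (simp add: \<rho>_def F_def)
    qed (auto simp: \<rho>_def)
  qed
  moreover have "induced_char G H (u_char (G\<lparr>carrier := H\<rparr>)) h = (\<Sum>i<n. \<rho> h $$ (i,i))" if h: "h \<in> carrier G" for h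
  proof -
    \<comment> \<open>The chosen elements of the cosets fixed by \<open>h\<close>. The negative part
      of the trace counts them, through the bijection \<open>r -> h r\<close>.\<close>
    define R where "R = {r \<in> c ` carrier G. inv r \<otimes> h \<otimes> r \<in> H}"
    have RG: "r \<in> carrier G" "c r = r" if "r \<in> R" for r using that cG cc unfolding R_def by auto
    have "(\<Sum>i<n. \<rho> h $$ (i,i)) = (\<Sum>i<n. F (e i) h (e i))" by (simp add: \<rho>_def)
    also have "\<dots> = (\<Sum>g\<in>I. F g h g)" using sum.reindex_bij_betw[OF e, of "\<lambda>x. F x h x"] by simp
    also have "\<dots> = (\<Sum>g\<in>carrier G. F g h g)"
      using fin by (intro sum.mono_neutral_left) (auto simp: I_def F_def)
    also have "\<dots> = (\<Sum>g\<in>carrier G. of_bool (g = h \<otimes> g)) - (\<Sum>g\<in>carrier G. of_bool (g = h \<otimes> c g))"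
      by (simp add: F_def sum_subtractf)
    also have "(\<Sum>g\<in>carrier G. of_bool (g = h \<otimes> g)) = (if h = \<one> then of_nat (card (carrier G)) else (0::complex))"
    proof -
      have "of_bool (g = h \<otimes> g) = (if h = \<one> then 1 else (0::complex))" if "g \<in> carrier G" for g
        using that h by (auto simp: r_cancel_one')
      then show ?thesis by simp
    qed
    also have "(\<Sum>g\<in>carrier G. of_bool (g = h \<otimes> c g)) = (of_nat (card {g\<in>carrier G. g = h \<otimes> c g}) :: complex)"
      using fin by (simp add: of_bool_def sum.If_cases Int_def)
    also have "card {g\<in>carrier G. g = h \<otimes> c g} = card R"
    proof (rule bij_betw_same_card[symmetric], rule bij_betw_byWitness[where f' = c])
      show "\<forall>a\<in>R. c (h \<otimes> a) = a"
      proof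
        fix r assume r: "r \<in> R"
        have "h \<otimes> r = r \<otimes> (inv r \<otimes> h \<otimes> r)" using RG[OF r] h by (simp add: m_assoc[symmetric])
        then have "h \<otimes> r \<in> r <# H" using r unfolding R_def l_coset_def by auto
        then show "c (h \<otimes> r) = r" using c_eq RG[OF r] by metis
      qed
      then show "(\<otimes>) h ` R \<subseteq> {g \<in> carrier G. g = h \<otimes> c g}" using RG h by auto
      show "\<forall>a'\<in>{g \<in> carrier G. g = h \<otimes> c g}. h \<otimes> c a' = a'" by auto
      show "c ` {g \<in> carrier G. g = h \<otimes> c g} \<subseteq> R"
      proof clarify
        fix g assume g: "g \<in> carrier G" and gh: "g = h \<otimes> c g"
        obtain k where k: "k \<in> H" "c g = g \<otimes> k" using c_in[OF g] unfolding l_coset_def by auto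
        have kG: "k \<in> carrier G" using k H.subset by auto
        have "inv (c g) \<otimes> h \<otimes> c g = inv (c g) \<otimes> g" using g h cG[OF g] gh by (simp add: m_assoc)
        also have "\<dots> = inv k \<otimes> inv g \<otimes> g" using k(2) g kG by (simp add: inv_mult_group)
        also have "\<dots> = inv k" using g kG by (simp add: m_assoc)
        finally show "c g \<in> R" unfolding R_def using k(1) g by auto
      qed
    qed
    also have "(of_nat (card R)::complex) = of_nat (card (conjugators G H h)) / of_nat (card H)"
    proof -
      have "bij_betw (\<lambda>(r,k). r \<otimes> k) (R \<times> H) (conjugators G H h)"
      proof (rule bij_betwI')
        fix x y assume x: "x \<in> R \<times> H" and y: "y \<in> R \<times> H"
        obtain r k where rk: "x = (r,k)" "r \<in> R" "k \<in> H" using x by auto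
        obtain s l where sl: "y = (s,l)" "s \<in> R" "l \<in> H" using y by auto
        have "r = s \<and> k = l" if eq: "r \<otimes> k = s \<otimes> l"
        proof -
          have "c (r \<otimes> k) = r" "c (s \<otimes> l) = s"
            using c_eq[OF RG(1)[OF rk(2)], of "r \<otimes> k"] RG(2)[OF rk(2)]
              c_eq[OF RG(1)[OF sl(2)], of "s \<otimes> l"] RG(2)[OF sl(2)] rk sl unfolding l_coset_def by auto
          then have "r = s" using eq by simp
          then show ?thesis using eq rk sl RG H.subset by (metis H.mem_carrier l_cancel)
        qed
        then show "((case x of (r, k) \<Rightarrow> r \<otimes> k) = (case y of (r, k) \<Rightarrow> r \<otimes> k)) = (x = y)"
          using rk sl by auto
      next
        have conj: "inv (r \<otimes> k) \<otimes> h \<otimes> (r \<otimes> k) = inv k \<otimes> (inv r \<otimes> h \<otimes> r) \<otimes> k" if "r \<in> carrier G" "k \<in> H" for r k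
          using that h H.subset by (simp add: inv_mult_group m_assoc subsetD)
        {
          fix x assume "x \<in> R \<times> H"
          then obtain r k where rk: "x = (r,k)" "r \<in> R" "k \<in> H" by auto
          have "inv k \<otimes> (inv r \<otimes> h \<otimes> r) \<otimes> k \<in> H" using rk unfolding R_def by auto
          then show "(case x of (r, k) \<Rightarrow> r \<otimes> k) \<in> conjugators G H h"
            using conj RG rk unfolding conjugators_def by auto
        next
          fix x assume x: "x \<in> conjugators G H h"
          then have xG: "x \<in> carrier G" and xH: "inv x \<otimes> h \<otimes> x \<in> H" unfolding conjugators_def by auto
          obtain k where k: "k \<in> H" "c x = x \<otimes> k" using c_in[OF xG] unfolding l_coset_def by auto
          have "inv (c x) \<otimes> h \<otimes> c x \<in> H" using conj[OF xG k(1)] k xH by simp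
          then have "c x \<in> R" unfolding R_def using xG by auto
          moreover have "x = c x \<otimes> inv k" using k xG H.subset by (simp add: m_assoc subsetD)
          ultimately show "\<exists>y\<in>R \<times> H. x = (case y of (r, k) \<Rightarrow> r \<otimes> k)"
            using k by (intro bexI[of _ "(c x, inv k)"]) auto
        }
      qed
      then have "card (conjugators G H h) = card R * card H"
        using bij_betw_same_card card_cartesian_product by metis
      moreover have "card H \<noteq> 0" using fH H.one_closed card_0_eq by blast
      ultimately show ?thesis by simp
    qed
    finally show ?thesis unfolding induced_u_char[OF H fin h] by simp
  qed
  ultimately show ?thesis unfolding true_characters_def by blast
qed

lemma trace_mult_commute:
  fixes A :: "'a::comm_semiring_0 mat"
  assumes A: "A \<in> carrier_mat n n" and B: "B \<in> carrier_mat n n"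
  shows "(\<Sum>i<n. (A * B) $$ (i,i)) = (\<Sum>i<n. (B * A) $$ (i,i))"
proof -
  have "(\<Sum>i<n. (A * B) $$ (i,i)) = (\<Sum>i<n. \<Sum>j<n. A $$ (i,j) * B $$ (j,i))"
    using A B by (intro sum.cong refl) (simp add: scalar_prod_def lessThan_atLeast0)
  also have "\<dots> = (\<Sum>j<n. \<Sum>i<n. A $$ (i,j) * B $$ (j,i))" by (rule sum.swap)
  also have "\<dots> = (\<Sum>i<n. (B * A) $$ (i,i))"
    using A B by (intro sum.cong refl) (simp add: scalar_prod_def lessThan_atLeast0 mult.commute)
  finally show ?thesis .
qed

text \<open>A Schur triangular form of \<open>A\<close> is again idempotent, so its diagonal entries
  are 0 or 1 and the trace counts the ones. For an averaging operator this number is the dimension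
  of the invariants.\<close>

lemma idempotent_trace:
  fixes A :: "complex mat"
  assumes A: "A \<in> carrier_mat n n" and idem: "A * A = A"
  shows "\<exists>k\<le>n. (\<Sum>i<n. A $$ (i,i)) = of_nat k"
proof -
  from char_poly_factorized[OF A] obtain es where es: "char_poly A = (\<Prod>a\<leftarrow>es. [:- a, 1:])" by auto
  define B where "B = schur_upper_triangular A es"
  have B: "B \<in> carrier_mat n n" "upper_triangular B" "similar_mat A B"
    using schur_upper_triangular[OF A es] unfolding B_def by auto
  obtain P Q where w: "similar_mat_wit A B P Q" using B(3) unfolding similar_mat_def by auto
  note d = similar_mat_witD[of n, OF _ w]
  have dr: "n = dim_row A" using A by auto
  have P: "P \<in> carrier_mat n n" and Q: "Q \<in> carrier_mat n n" and PQ: "P * Q = 1\<^sub>m n" "Q * P = 1\<^sub>m n" "A = P * B * Q"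
    using d[OF dr] by auto
  have "B = (Q * P) * B * (Q * P)" using PQ B by simp
  also have "\<dots> = Q * A * P" unfolding PQ(3) using P Q B(1)
    by (simp add: assoc_mult_mat[of _ n n _ n _ n])
  finally have BA: "B = Q * A * P" .
  have "B * B = Q * A * (P * Q) * A * P" unfolding BA using P Q A
    by (simp add: assoc_mult_mat[of _ n n _ n _ n])
  also have "\<dots> = Q * (A * A) * P" unfolding PQ(1) using P Q A
    by (simp add: assoc_mult_mat[of _ n n _ n _ n])
  finally have BB: "B * B = B" using idem BA by simp
  have diag: "B $$ (i,i) = 0 \<or> B $$ (i,i) = 1" if i: "i < n" for i
  proof -
    have "B $$ (i,i) = (\<Sum>l<n. B $$ (i,l) * B $$ (l,i))"
      using B(1) i by (subst BB[symmetric]) (simp add: scalar_prod_def lessThan_atLeast0)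
    also have "\<dots> = (\<Sum>l<n. if l = i then B $$ (i,i) * B $$ (i,i) else 0)"
    proof (intro sum.cong refl)
      fix l assume "l \<in> {..<n}"
      then show "B $$ (i,l) * B $$ (l,i) = (if l = i then B $$ (i,i) * B $$ (i,i) else 0)"
        using upper_triangularD[OF B(2), of i l] upper_triangularD[OF B(2), of l i] B(1) i
        by (cases l i rule: linorder_cases) auto
    qed
    also have "\<dots> = B $$ (i,i) * B $$ (i,i)" using i by simp
    finally show ?thesis by simp
  qed
  have "(\<Sum>i<n. A $$ (i,i)) = (\<Sum>j<n. (Q * (P * B)) $$ (j,j))"
    unfolding PQ(3) using P B(1) Q by (intro trace_mult_commute) auto
  also have "Q * (P * B) = (Q * P) * B" using P B(1) Q by (simp add: assoc_mult_mat[of _ n n _ n _ n])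
  also have "\<dots> = B" using PQ B by simp
  also have "(\<Sum>j<n. B $$ (j,j)) = (\<Sum>j<n. if B $$ (j,j) = 1 then 1 else 0)"
    using diag by (intro sum.cong refl) auto
  also have "\<dots> = of_nat (card {j\<in>{..<n}. B $$ (j,j) = 1})"
    by (simp add: sum.If_cases Int_def)
  finally have e: "(\<Sum>i<n. A $$ (i,i)) = of_nat (card {j\<in>{..<n}. B $$ (j,j) = 1})" .
  have "card {j\<in>{..<n}. B $$ (j,j) = 1} \<le> card {..<n}" by (intro card_mono) auto
  then show ?thesis using e by auto
qed

subsection \<open>The cone of nonnegative rational characters\<close>

lemma true_imp_virtual: "f \<in> true_characters G \<Longrightarrow> f \<in> virtual_characters G"
  unfolding virtual_characters_def using true_characters_zero[of G] by force

lemma virtual_characters_combine: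
  assumes "f1 \<in> virtual_characters G" "f2 \<in> virtual_characters G"
  shows "(\<lambda>g. of_nat a * f1 g + of_nat b * f2 g) \<in> virtual_characters G"
proof -
  from assms obtain u1 v1 u2 v2 where t: "u1 \<in> true_characters G" "v1 \<in> true_characters G"
    "u2 \<in> true_characters G" "v2 \<in> true_characters G"
    "\<forall>g\<in>carrier G. f1 g = u1 g - v1 g" "\<forall>g\<in>carrier G. f2 g = u2 g - v2 g"
    unfolding virtual_characters_def by auto
  show ?thesis unfolding virtual_characters_def
    by (rule CollectI, rule bexI[of _ "\<lambda>g. of_nat a * u1 g + of_nat b * u2 g"],
      rule bexI[of _ "\<lambda>g. of_nat a * v1 g + of_nat b * v2 g"])
      (use t in \<open>auto intro!: true_characters_add true_characters_nat_mult simp: right_diff_distrib\<close>)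
qed

lemma virtual_characters_cong:
  assumes "f \<in> virtual_characters G" "\<And>g. g \<in> carrier G \<Longrightarrow> f g = f' g"
  shows "f' \<in> virtual_characters G"
  using assms unfolding virtual_characters_def by auto

lemma char_scalar_cong:
  assumes "\<And>g. g \<in> carrier G \<Longrightarrow> f g = f' g"
  shows "char_scalar G \<psi> f = char_scalar G \<psi> f'"
  unfolding char_scalar_def using assms by (auto intro: sum.cong)

lemma nonneg_rational_cong:
  assumes "f \<in> nonneg_rational_characters G" "\<And>g. g \<in> carrier G \<Longrightarrow> f g = f' g"
  shows "f' \<in> nonneg_rational_characters G"
proof -
  from assms(1) obtain N where N: "0 < N" "(\<lambda>g. of_nat N * f g) \<in> virtual_characters G"
    unfolding nonneg_rational_characters_def rational_characters_def by auto
  have "(\<lambda>g. of_nat N * f' g) \<in> virtual_characters G"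
    by (rule virtual_characters_cong[OF N(2)]) (simp add: assms(2))
  then show ?thesis using assms(1) N(1) char_scalar_cong[OF assms(2), of G]
    unfolding nonneg_rational_characters_def rational_characters_def by auto
qed

lemma nonneg_rational_combine:
  assumes f: "f1 \<in> nonneg_rational_characters G" "f2 \<in> nonneg_rational_characters G" and q: "(0::rat) \<le> q"
  shows "(\<lambda>g. f1 g + of_rat q * f2 g) \<in> nonneg_rational_characters G"
proof -
  from f(1) obtain N where N: "0 < N" "(\<lambda>g. of_nat N * f1 g) \<in> virtual_characters G"
    unfolding nonneg_rational_characters_def rational_characters_def by auto
  from f(2) obtain M where M: "0 < M" "(\<lambda>g. of_nat M * f2 g) \<in> virtual_characters G"
    unfolding nonneg_rational_characters_def rational_characters_def by auto
  obtain a b where ab: "quotient_of q = (a, b)" by fastforce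
  have b: "b > 0" using ab by (rule quotient_of_denom_pos)
  have qab: "q = of_int a / of_int b" using ab by (rule quotient_of_div)
  have a: "a \<ge> 0" using q qab b by (simp add: zero_le_divide_iff)
  have qn: "q = of_nat (nat a) / of_nat (nat b)" using qab a b by simp
  have "q * of_nat (nat b) = of_nat (nat a)" using qn b by simp
  then have "of_rat (q * of_nat (nat b)) = (of_rat (of_nat (nat a)) :: complex)" by simp
  then have q': "of_rat q * of_nat (nat b) = (of_nat (nat a) :: complex)" by (simp only: of_rat_mult of_rat_of_nat_eq)
  \<comment> \<open>With \<open>q = a / b\<close>, the integer \<open>N * M * b\<close> clears the
    denominators of both characters and of \<open>q\<close>.\<close>
  have "(\<lambda>g. of_nat (M * nat b) * (of_nat N * f1 g) + of_nat (N * nat a) * (of_nat M * f2 g)) \<in> virtual_characters G"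
    by (rule virtual_characters_combine[OF N(2) M(2)])
  then have "(\<lambda>g. of_nat (N * M * nat b) * (f1 g + of_rat q * f2 g)) \<in> virtual_characters G"
    by (rule virtual_characters_cong) (simp only: of_nat_mult q'[symmetric] distrib_left mult_ac)
  then have r: "(\<lambda>g. f1 g + of_rat q * f2 g) \<in> rational_characters G"
    unfolding rational_characters_def using N(1) M(1) b by (auto intro!: exI[of _ "N * M * nat b"])
  have "char_scalar G \<psi> (\<lambda>g. f1 g + of_rat q * f2 g) \<in> \<real>\<^sub>\<ge>\<^sub>0" if "\<psi> \<in> true_characters G" for \<psi>
  proof -
    have "char_scalar G \<psi> (\<lambda>g. f1 g + of_rat q * f2 g) = char_scalar G \<psi> f1 + of_rat q * char_scalar G \<psi> f2"
      unfolding char_scalar_def by (simp add: sum.distrib sum_distrib_left add_divide_distrib algebra_simps)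
    moreover have "of_rat q \<in> (\<real>\<^sub>\<ge>\<^sub>0 :: complex set)"
      using q qn by (metis nonneg_Reals_divide_I nonneg_Reals_of_nat_I of_rat_divide of_rat_of_nat_eq)
    ultimately show ?thesis
      using f that unfolding nonneg_rational_characters_def by auto
  qed
  then show ?thesis using r unfolding nonneg_rational_characters_def by auto
qed

lemma nonneg_rational_zero: "(\<lambda>g. 0) \<in> nonneg_rational_characters G"
  unfolding nonneg_rational_characters_def rational_characters_def char_scalar_def
  using true_imp_virtual[OF true_characters_zero] by (auto intro!: exI[of _ 1])

lemma (in group) conj_cancel:
  assumes x: "x \<in> carrier G" and g: "g \<in> carrier G"
  shows "inv x \<otimes> (x \<otimes> g \<otimes> inv x) \<otimes> x = g" "x \<otimes> (inv x \<otimes> g \<otimes> x) \<otimes> inv x = g"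
proof -
  have "inv x \<otimes> (x \<otimes> g \<otimes> inv x) \<otimes> x = (inv x \<otimes> x) \<otimes> g \<otimes> (inv x \<otimes> x)"
    using x g by (simp only: m_assoc m_closed inv_closed)
  then show "inv x \<otimes> (x \<otimes> g \<otimes> inv x) \<otimes> x = g" using x g by simp
  have "x \<otimes> (inv x \<otimes> g \<otimes> x) \<otimes> inv x = (x \<otimes> inv x) \<otimes> g \<otimes> (x \<otimes> inv x)"
    using x g by (simp only: m_assoc m_closed inv_closed)
  then show "x \<otimes> (inv x \<otimes> g \<otimes> x) \<otimes> inv x = g" using x g by simp
qed

text \<open>The substitution \<open>h = x^-1 g x\<close> exchanges pairs \<open>(g, x)\<close> with
  pairs \<open>(h, x)\<close>. This is Frobenius reciprocity before any division by orders.\<close>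

lemma (in group) sum_over_conjugators:
  fixes F :: "'a \<Rightarrow> 'a \<Rightarrow> 'c::comm_semiring_1"
  assumes H: "subgroup H G" and fin: "finite (carrier G)"
  shows "(\<Sum>g\<in>carrier G. \<Sum>x\<in>conjugators G H g. F (inv x \<otimes> g \<otimes> x) x)
       = (\<Sum>x\<in>carrier G. \<Sum>h\<in>H. F h x)"
proof -
  interpret H: subgroup H G by fact
  have "(\<Sum>g\<in>carrier G. \<Sum>x\<in>conjugators G H g. F (inv x \<otimes> g \<otimes> x) x)
      = (\<Sum>g\<in>carrier G. \<Sum>x\<in>carrier G. if inv x \<otimes> g \<otimes> x \<in> H then F (inv x \<otimes> g \<otimes> x) x else 0)"
    unfolding conjugators_def using fin by (simp add: sum.inter_filter)
  also have "\<dots> = (\<Sum>x\<in>carrier G. \<Sum>g\<in>carrier G. if inv x \<otimes> g \<otimes> x \<in> H then F (inv x \<otimes> g \<otimes> x) x else 0)"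
    by (rule sum.swap)
  also have "\<dots> = (\<Sum>x\<in>carrier G. \<Sum>h\<in>H. F h x)"
  proof (rule sum.cong[OF refl])
    fix x assume x: "x \<in> carrier G"
    have "(\<Sum>g\<in>carrier G. if inv x \<otimes> g \<otimes> x \<in> H then F (inv x \<otimes> g \<otimes> x) x else 0)
        = (\<Sum>g\<in>{g\<in>carrier G. inv x \<otimes> g \<otimes> x \<in> H}. F (inv x \<otimes> g \<otimes> x) x)"
      using fin by (simp add: sum.inter_filter)
    also have "\<dots> = (\<Sum>h\<in>H. F h x)"
    proof (rule sum.reindex_bij_witness[of _ "\<lambda>h. x \<otimes> h \<otimes> inv x" "\<lambda>g. inv x \<otimes> g \<otimes> x"])
      fix a assume "a \<in> {g \<in> carrier G. inv x \<otimes> g \<otimes> x \<in> H}"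
      then show "x \<otimes> (inv x \<otimes> a \<otimes> x) \<otimes> inv x = a" "inv x \<otimes> a \<otimes> x \<in> H"
        using x conj_cancel by auto
    next
      fix b assume b: "b \<in> H"
      have bG: "b \<in> carrier G" using b H.subset by auto
      show e: "inv x \<otimes> (x \<otimes> b \<otimes> inv x) \<otimes> x = b"
        using x bG conj_cancel by simp
      show "x \<otimes> b \<otimes> inv x \<in> {g \<in> carrier G. inv x \<otimes> g \<otimes> x \<in> H}"
        using e b x bG by auto
    qed auto
    finally show "(\<Sum>g\<in>carrier G. if inv x \<otimes> g \<otimes> x \<in> H then F (inv x \<otimes> g \<otimes> x) x else 0) = (\<Sum>h\<in>H. F h x)" .
  qed
  finally show ?thesis .
qed

lemma (in group) sum_induced_char:
  assumes H: "subgroup H G" and fin: "finite (carrier G)"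
  shows "(\<Sum>g\<in>carrier G. induced_char G H \<phi> g) = of_nat (card (carrier G)) / of_nat (card H) * (\<Sum>h\<in>H. \<phi> h)"
proof -
  have "(\<Sum>g\<in>carrier G. induced_char G H \<phi> g) = (\<Sum>g\<in>carrier G. \<Sum>x\<in>conjugators G H g. \<phi> (inv x \<otimes> g \<otimes> x)) / of_nat (card H)"
    unfolding induced_char_def conjugators_def by (simp add: sum_divide_distrib)
  also have "(\<Sum>g\<in>carrier G. \<Sum>x\<in>conjugators G H g. \<phi> (inv x \<otimes> g \<otimes> x)) = (\<Sum>x\<in>carrier G. \<Sum>h\<in>H. \<phi> h)"
    using sum_over_conjugators[OF H fin, of "\<lambda>h x. \<phi> h"] .
  finally show ?thesis by simp
qed

lemma (in group) trace_conjugate: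
  assumes r: "mat_representation G n \<rho>" and x: "x \<in> carrier G" and g: "g \<in> carrier G"
  shows "(\<Sum>i<n. \<rho> (x \<otimes> g \<otimes> inv x) $$ (i,i)) = (\<Sum>i<n. \<rho> g $$ (i,i))"
proof -
  have d: "\<rho> y \<in> carrier_mat n n" if "y \<in> carrier G" for y using r that unfolding mat_representation_def by auto
  have m: "\<rho> (y \<otimes> z) = \<rho> y * \<rho> z" if "y \<in> carrier G" "z \<in> carrier G" for y z
    using r that unfolding mat_representation_def by auto
  have "(\<Sum>i<n. \<rho> (x \<otimes> g \<otimes> inv x) $$ (i,i)) = (\<Sum>i<n. (\<rho> (inv x) * \<rho> (x \<otimes> g)) $$ (i,i))"
    using m[of "x \<otimes> g" "inv x"] trace_mult_commute[OF d d, of "x \<otimes> g" "inv x"] x g by simp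
  also have "\<rho> (inv x) * \<rho> (x \<otimes> g) = \<rho> (inv x \<otimes> (x \<otimes> g))" using m x g by simp
  also have "inv x \<otimes> (x \<otimes> g) = g" using x g by (simp flip: m_assoc)
  finally show ?thesis .
qed

text \<open>By Frobenius reciprocity the scalar product is \<open>\<psi>(1)\<close> minus the
  multiplicity of \<open>1_H\<close> in the restriction of \<open>\<psi>\<close>, that is, the
  dimension of the representation minus that of its \<open>H\<close>-invariants.\<close>

lemma (in group) scalar_induced_u:
  assumes H: "subgroup H G" and fin: "finite (carrier G)" and \<psi>: "\<psi> \<in> true_characters G"
  shows "char_scalar G \<psi> (induced_char G H (u_char (G\<lparr>carrier := H\<rparr>))) \<in> \<real>\<^sub>\<ge>\<^sub>0"
proof -
  interpret H: subgroup H G by fact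
  have fH: "finite H" using fin H.subset finite_subset by blast
  have cH: "card H \<noteq> 0" using fH H.one_closed card_0_eq by blast
  have cG: "card (carrier G) \<noteq> 0" using fin one_closed card_0_eq by blast
  from \<psi> obtain n \<rho> where r: "mat_representation G n \<rho>"
    and rc: "\<And>g. g\<in>carrier G \<Longrightarrow> \<psi> g = (\<Sum>i<n. \<rho> g $$ (i, i))" unfolding true_characters_def by auto
  have d: "\<rho> y \<in> carrier_mat n n" if "y \<in> carrier G" for y using r that unfolding mat_representation_def by auto
  \<comment> \<open>The averaging projector onto the \<open>H\<close>-invariants. Its trace is a
    natural number, so the complex conjugation in the scalar product has no effect.\<close>
  define E where "E = mat n n (\<lambda>(i,j). (\<Sum>h\<in>H. \<rho> h $$ (i,j)) / of_nat (card H))"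
  have E: "E \<in> carrier_mat n n" unfolding E_def by auto
  have "E * E = E"
  proof (rule eq_matI)
    fix i j assume "i < dim_row E" "j < dim_col E"
    then have ij: "i < n" "j < n" using E by auto
    have shift: "(\<Sum>k\<in>H. \<rho> (h \<otimes> k) $$ (i,j)) = (\<Sum>k\<in>H. \<rho> k $$ (i,j))" if h: "h \<in> H" for h
      by (rule sum.reindex_bij_witness[of _ "\<lambda>k. inv h \<otimes> k" "\<lambda>k. h \<otimes> k"])
        (use h H.mem_carrier in \<open>auto simp flip: m_assoc\<close>)
    have "(E * E) $$ (i,j) = (\<Sum>l<n. ((\<Sum>h\<in>H. \<rho> h $$ (i,l)) / of_nat (card H)) * ((\<Sum>k\<in>H. \<rho> k $$ (l,j)) / of_nat (card H)))"
      using ij by (simp add: E_def scalar_prod_def lessThan_atLeast0)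
    also have "\<dots> = (\<Sum>l<n. \<Sum>h\<in>H. \<Sum>k\<in>H. \<rho> h $$ (i,l) * \<rho> k $$ (l,j)) / (of_nat (card H))^2"
      by (simp add: sum_product sum_divide_distrib power2_eq_square)
    also have "(\<Sum>l<n. \<Sum>h\<in>H. \<Sum>k\<in>H. \<rho> h $$ (i,l) * \<rho> k $$ (l,j)) = (\<Sum>h\<in>H. \<Sum>l<n. \<Sum>k\<in>H. \<rho> h $$ (i,l) * \<rho> k $$ (l,j))"
      by (rule sum.swap)
    also have "\<dots> = (\<Sum>h\<in>H. \<Sum>k\<in>H. \<Sum>l<n. \<rho> h $$ (i,l) * \<rho> k $$ (l,j))"
      by (intro sum.cong refl sum.swap)
    also have "\<dots> = (\<Sum>h\<in>H. \<Sum>k\<in>H. \<rho> (h \<otimes> k) $$ (i,j))"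
    proof (intro sum.cong refl)
      fix h k assume "h \<in> H" "k \<in> H"
      then have hk: "h \<in> carrier G" "k \<in> carrier G" using H.mem_carrier by auto
      have "\<rho> (h \<otimes> k) = \<rho> h * \<rho> k" using r hk unfolding mat_representation_def by auto
      then show "(\<Sum>l<n. \<rho> h $$ (i,l) * \<rho> k $$ (l,j)) = \<rho> (h \<otimes> k) $$ (i,j)"
        using d[OF hk(1)] d[OF hk(2)] ij by (simp add: scalar_prod_def lessThan_atLeast0)
    qed
    also have "\<dots> = (\<Sum>h\<in>H. \<Sum>k\<in>H. \<rho> k $$ (i,j))" by (intro sum.cong refl shift)
    also have "\<dots> = of_nat (card H) * (\<Sum>k\<in>H. \<rho> k $$ (i,j))" by simp
    also have "\<dots> / (of_nat (card H))^2 = E $$ (i,j)" using ij cH by (simp add: E_def power2_eq_square)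
    finally show "(E * E) $$ (i,j) = E $$ (i,j)" .
  qed (auto simp: E_def)
  then obtain k where k: "k \<le> n" "(\<Sum>i<n. E $$ (i,i)) = of_nat k" using idempotent_trace[OF E] by auto
  have trE: "(\<Sum>h\<in>H. \<psi> h) = of_nat (card H) * of_nat k"
  proof -
    have "(\<Sum>h\<in>H. \<psi> h) = (\<Sum>h\<in>H. \<Sum>i<n. \<rho> h $$ (i,i))" using rc H.mem_carrier by (intro sum.cong) auto
    also have "\<dots> = (\<Sum>i<n. \<Sum>h\<in>H. \<rho> h $$ (i,i))" by (rule sum.swap)
    also have "\<dots> = (\<Sum>i<n. of_nat (card H) * E $$ (i,i))" using cH by (intro sum.cong refl) (simp add: E_def)
    finally show ?thesis using k(2) by (simp flip: sum_distrib_left)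
  qed
  have p1: "\<psi> \<one> = of_nat n" using rc[OF one_closed] r unfolding mat_representation_def by auto
  have pc: "\<psi> (x \<otimes> h \<otimes> inv x) = \<psi> h" if "x \<in> carrier G" "h \<in> carrier G" for x h
    using rc that trace_conjugate[OF r that] by simp
  have "(\<Sum>g\<in>carrier G. cnj (\<psi> g) * induced_char G H (u_char (G\<lparr>carrier := H\<rparr>)) g)
     = (\<Sum>g\<in>carrier G. (if g = \<one> then cnj (\<psi> \<one>) * of_nat (card (carrier G)) else 0))
       - (\<Sum>g\<in>carrier G. cnj (\<psi> g) * of_nat (card (conjugators G H g))) / of_nat (card H)"
    by (auto simp: induced_u_char[OF H fin] sum_divide_distrib algebra_simps sum_subtractf[symmetric] intro!: sum.cong)
  also have "(\<Sum>g\<in>carrier G. (if g = \<one> then cnj (\<psi> \<one>) * of_nat (card (carrier G)) else 0)) = of_nat n * of_nat (card (carrier G))"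
    using fin p1 by (simp add: sum.delta')
  also have "(\<Sum>g\<in>carrier G. cnj (\<psi> g) * of_nat (card (conjugators G H g)))
     = (\<Sum>g\<in>carrier G. \<Sum>x\<in>conjugators G H g. cnj (\<psi> (x \<otimes> (inv x \<otimes> g \<otimes> x) \<otimes> inv x)))"
  proof (intro sum.cong refl)
    fix g assume g: "g \<in> carrier G"
    have "x \<otimes> (inv x \<otimes> g \<otimes> x) \<otimes> inv x = g" if "x \<in> conjugators G H g" for x
      using that g conj_cancel unfolding conjugators_def by auto
    then show "cnj (\<psi> g) * of_nat (card (conjugators G H g)) = (\<Sum>x\<in>conjugators G H g. cnj (\<psi> (x \<otimes> (inv x \<otimes> g \<otimes> x) \<otimes> inv x)))"
      by simp
  qed
  also have "\<dots> = (\<Sum>x\<in>carrier G. \<Sum>h\<in>H. cnj (\<psi> (x \<otimes> h \<otimes> inv x)))"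
    using sum_over_conjugators[OF H fin, of "\<lambda>h x. cnj (\<psi> (x \<otimes> h \<otimes> inv x))"] .
  also have "\<dots> = (\<Sum>x\<in>carrier G. \<Sum>h\<in>H. cnj (\<psi> h))"
    using pc H.mem_carrier by (intro sum.cong refl) auto
  also have "\<dots> = of_nat (card (carrier G)) * (of_nat (card H) * of_nat k)"
    using trE by (simp flip: cnj_sum)
  finally have "char_scalar G \<psi> (induced_char G H (u_char (G\<lparr>carrier := H\<rparr>))) = of_nat n - of_nat k"
    unfolding char_scalar_def using cG cH by (simp add: field_simps)
  also have "\<dots> = of_nat (n - k)" using k(1) by (simp add: of_nat_diff)
  finally show ?thesis by simp
qed

lemma (in group) induced_u_nonneg_rational:
  assumes H: "subgroup H G" and fin: "finite (carrier G)"
  shows "induced_char G H (u_char (G\<lparr>carrier := H\<rparr>)) \<in> nonneg_rational_characters G"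
  unfolding nonneg_rational_characters_def rational_characters_def
  using true_imp_virtual[OF induced_u_true_character[OF H fin]] scalar_induced_u[OF H fin]
  by (auto intro!: exI[of _ 1])

text \<open>The two disk characters, the induced augmentation characters and the depths of clusters
  are all orthogonal to \<open>1_G\<close>, hence determined by their values off the identity.
  Identities between them need to be checked at nontrivial elements only.\<close>

definition zero_sum :: "('g, 'm) monoid_scheme \<Rightarrow> ('g \<Rightarrow> complex) \<Rightarrow> 'g \<Rightarrow> complex" where
  "zero_sum G f g = (if g = \<one>\<^bsub>G\<^esub> then - (\<Sum>h\<in>carrier G - {\<one>\<^bsub>G\<^esub>}. f h) else f g)"

lemma zero_sum_add: "zero_sum G (\<lambda>g. f1 g + f2 g) g = zero_sum G f1 g + zero_sum G f2 g"
  by (simp add: zero_sum_def sum.distrib)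

lemma zero_sum_scale: "zero_sum G (\<lambda>g. c * f g) g = c * zero_sum G f g"
  by (simp add: zero_sum_def sum_distrib_left)

lemma zero_sum_sum: "zero_sum G (\<lambda>g. \<Sum>s\<in>S. f s g) g = (\<Sum>s\<in>S. zero_sum G (f s) g)"
  by (auto simp add: zero_sum_def sum_negf[symmetric] intro: sum.swap)

lemma zero_sum_cong:
  assumes "\<And>h. h \<in> carrier G \<Longrightarrow> h \<noteq> \<one>\<^bsub>G\<^esub> \<Longrightarrow> f h = f' h" "g \<in> carrier G"
  shows "zero_sum G f g = zero_sum G f' g"
  using assms by (auto simp: zero_sum_def intro: sum.cong)

lemma (in group) zero_sum_unique:
  assumes fin: "finite (carrier G)" and s: "(\<Sum>h\<in>carrier G. f h) = 0"
    and e: "\<And>h. h \<in> carrier G \<Longrightarrow> h \<noteq> \<one> \<Longrightarrow> f h = f' h" and g: "g \<in> carrier G"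
  shows "f g = zero_sum G f' g"
proof (cases "g = \<one>")
  case True
  have "(\<Sum>h\<in>carrier G. f h) = f \<one> + (\<Sum>h\<in>carrier G - {\<one>}. f h)"
    using fin by (intro sum.remove) auto
  then have "f \<one> = - (\<Sum>h\<in>carrier G - {\<one>}. f h)" using s by (simp add: eq_neg_iff_add_eq_0)
  also have "(\<Sum>h\<in>carrier G - {\<one>}. f h) = (\<Sum>h\<in>carrier G - {\<one>}. f' h)" using e by (intro sum.cong) auto
  finally show ?thesis using True by (simp add: zero_sum_def)
qed (use e g in \<open>auto simp: zero_sum_def\<close>)

lemma (in group) induced_char_zero_sum:
  assumes H: "subgroup H G" and fin: "finite (carrier G)" and s: "(\<Sum>h\<in>H. \<phi> h) = 0" and g: "g \<in> carrier G"
  shows "induced_char G H \<phi> g = zero_sum G (\<lambda>g. (\<Sum>x\<in>conjugators G H g. \<phi> (inv x \<otimes> g \<otimes> x)) / of_nat (card H)) g"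
proof (rule zero_sum_unique[OF fin _ _ g])
  show "(\<Sum>h\<in>carrier G. induced_char G H \<phi> h) = 0"
    using sum_induced_char[OF H fin, of \<phi>] s by simp
qed (simp add: induced_char_def conjugators_def)

lemma (in group) induced_u_zero_sum:
  assumes H: "subgroup H G" and fin: "finite (carrier G)" and g: "g \<in> carrier G"
  shows "induced_char G H (u_char (G\<lparr>carrier := H\<rparr>)) g
    = zero_sum G (\<lambda>g. - of_nat (card (conjugators G H g)) / of_nat (card H)) g"
proof (rule zero_sum_unique[OF fin _ _ g])
  interpret H: subgroup H G by fact
  have fH: "finite H" using fin H.subset finite_subset by blast
  have "(\<Sum>h\<in>H. u_char (G\<lparr>carrier := H\<rparr>) h) = 0"
    unfolding u_char_def regular_char_def unit_char_def using fH
    by (simp add: sum_subtractf sum.delta')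
  then show "(\<Sum>h\<in>carrier G. induced_char G H (u_char (G\<lparr>carrier := H\<rparr>)) h) = 0"
    by (simp add: sum_induced_char[OF H fin])
qed (simp add: induced_u_char[OF H fin])

text \<open>This is \<open>card H\<close> times the character induced from \<open>- l\<close>, with
  the value of \<open>- l\<close> at the identity chosen so that the sum is zero. Without division
  by \<open>card H\<close> it reproduces the factor \<open>|G|\<close> of the disk depth when
  \<open>H\<close> is the whole group.\<close>

definition conj_depth :: "('g, 'm) monoid_scheme \<Rightarrow> 'g set \<Rightarrow> ('g \<Rightarrow> rat) \<Rightarrow> 'g \<Rightarrow> complex" where
  "conj_depth G H l = zero_sum G (\<lambda>g. - of_rat (\<Sum>x\<in>conjugators G H g. l (inv\<^bsub>G\<^esub> x \<otimes>\<^bsub>G\<^esub> g \<otimes>\<^bsub>G\<^esub> x)))"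

lemma (in group) conj_depth_cong:
  assumes "\<And>h. h \<in> H \<Longrightarrow> h \<noteq> \<one> \<Longrightarrow> l h = l' h" and g: "g \<in> carrier G"
  shows "conj_depth G H l g = conj_depth G H l' g"
  unfolding conj_depth_def
  by (rule zero_sum_cong[OF _ g])
    (auto simp: conjugators_def conj_one_iff assms intro!: arg_cong[of _ _ of_rat] sum.cong)

text \<open>The function is removed in layers. Let \<open>s\<close> be its smallest positive value
  and \<open>K\<close> the subgroup on which it is at least \<open>s\<close>. Subtracting
  \<open>s\<close> on \<open>K\<close> splits off \<open>s * card K\<close> times the augmentation
  character induced from \<open>K\<close>, and leaves a function with fewer positive values.\<close>

lemma (in group) conj_depth_nonneg_rational:
  assumes H: "subgroup H G" and fin: "finite (carrier G)"
    and nonneg: "\<And>h. h \<in> H \<Longrightarrow> h \<noteq> \<one> \<Longrightarrow> 0 \<le> l h"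
    and filt: "\<And>s. 0 < s \<Longrightarrow> subgroup {h \<in> H. h = \<one> \<or> s \<le> l h} G"
  shows "conj_depth G H l \<in> nonneg_rational_characters G"
  using nonneg filt
proof (induction "card {h \<in> H - {\<one>}. 0 < l h}" arbitrary: l rule: less_induct)
  case less
  interpret H: subgroup H G by fact
  have fH: "finite H" using fin H.subset finite_subset by blast
  define P where "P = {h \<in> H - {\<one>}. 0 < l h}"
  have fP: "finite P" unfolding P_def using fH by auto
  show ?case
  proof (cases "P = {}")
    case True
    then have "l h = 0" if "h \<in> H" "h \<noteq> \<one>" for h
      using less.prems(1)[OF that] that unfolding P_def by force
    then have "conj_depth G H l g = conj_depth G H (\<lambda>_. 0) g" if "g \<in> carrier G" for g
      using that by (intro conj_depth_cong) auto
    then have "conj_depth G H l g = 0" if "g \<in> carrier G" for g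
      using that by (simp add: conj_depth_def zero_sum_def)
    then show ?thesis using nonneg_rational_cong[OF nonneg_rational_zero] by metis
  next
    case False
    define s where "s = Min (l ` P)"
    have s_in: "s \<in> l ` P" unfolding s_def using fP False by (intro Min_in) auto
    have s_le: "s \<le> l h" if "h \<in> P" for h unfolding s_def using fP that by (intro Min_le) auto
    have s0: "0 < s" using s_in unfolding P_def by auto
    define K where "K = {h \<in> H. h = \<one> \<or> s \<le> l h}"
    have K: "subgroup K G" unfolding K_def by (rule less.prems(2)[OF s0])
    \<comment> \<open>For \<open>t > 0\<close> the condition \<open>t \<le> l' h\<close> means
      \<open>t + s \<le> l h\<close>, so the filtration of \<open>l'\<close> consists of subgroups
      already known.\<close>
    define l' where "l' h = max 0 (l h - s)" for h
    have KP: "h \<in> K \<longleftrightarrow> h \<in> P" if "h \<in> H" "h \<noteq> \<one>" for h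
      using that s_le s0 unfolding K_def P_def by force
    have ll': "l h = l' h + (if h \<in> K then s else 0)" if "h \<in> H" "h \<noteq> \<one>" for h
      using KP[OF that] that s_le[of h] less.prems(1)[OF that] s0
      by (cases "h \<in> K") (auto simp: l'_def P_def max_def)
    have "{h \<in> H - {\<one>}. 0 < l' h} \<subset> P"
    proof
      show "{h \<in> H - {\<one>}. 0 < l' h} \<subseteq> P" unfolding l'_def P_def using s0 by auto
      obtain h where "h \<in> P" "l h = s" using s_in by auto
      then show "{h \<in> H - {\<one>}. 0 < l' h} \<noteq> P" unfolding l'_def by auto
    qed
    then have "card {h \<in> H - {\<one>}. 0 < l' h} < card P" using fP by (intro psubset_card_mono)
    moreover have "subgroup {h \<in> H. h = \<one> \<or> t \<le> l' h} G" if t: "0 < t" for t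
    proof -
      have "t \<le> l' h \<longleftrightarrow> t + s \<le> l h" for h unfolding l'_def using t by auto
      then show ?thesis using less.prems(2)[of "t + s"] t s0 by simp
    qed
    ultimately have IH: "conj_depth G H l' \<in> nonneg_rational_characters G"
      using less.hyps[of l'] unfolding P_def l'_def by auto
    have cK: "card K \<noteq> 0"
      using subgroup.one_closed[OF K] fH unfolding K_def by (metis (no_types, lifting) card_0_eq empty_iff finite_subset mem_Collect_eq subsetI)
    have eq: "conj_depth G H l g = conj_depth G H l' g + of_rat (s * of_nat (card K)) * induced_char G K (u_char (G\<lparr>carrier := K\<rparr>)) g"
      if g: "g \<in> carrier G" for g
    proof -
      have "- of_rat (\<Sum>x\<in>conjugators G H h. l (inv x \<otimes> h \<otimes> x))
        = - of_rat (\<Sum>x\<in>conjugators G H h. l' (inv x \<otimes> h \<otimes> x))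
          + of_rat (s * of_nat (card K)) * (- of_nat (card (conjugators G K h)) / of_nat (card K) :: complex)"
        if h: "h \<in> carrier G" "h \<noteq> \<one>" for h
      proof -
        have "(\<Sum>x\<in>conjugators G H h. l (inv x \<otimes> h \<otimes> x))
          = (\<Sum>x\<in>conjugators G H h. l' (inv x \<otimes> h \<otimes> x) + (if inv x \<otimes> h \<otimes> x \<in> K then s else 0))"
          using h by (intro sum.cong refl ll') (auto simp: conjugators_def conj_one_iff)
        also have "\<dots> = (\<Sum>x\<in>conjugators G H h. l' (inv x \<otimes> h \<otimes> x)) + (\<Sum>x\<in>conjugators G H h. if inv x \<otimes> h \<otimes> x \<in> K then s else 0)"
          by (rule sum.distrib)
        also have "(\<Sum>x\<in>conjugators G H h. if inv x \<otimes> h \<otimes> x \<in> K then s else 0) = (\<Sum>x\<in>conjugators G K h. s)"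
          using fin by (intro sum.mono_neutral_cong_right) (auto simp: conjugators_def K_def)
        finally show ?thesis using cK by (simp add: of_rat_add of_rat_mult)
      qed
      then show ?thesis
        unfolding conj_depth_def induced_u_zero_sum[OF K fin g] zero_sum_scale[symmetric] zero_sum_add[symmetric]
        by (intro zero_sum_cong g)
    qed
    have "(\<lambda>g. conj_depth G H l' g + of_rat (s * of_nat (card K)) * induced_char G K (u_char (G\<lparr>carrier := K\<rparr>)) g) \<in> nonneg_rational_characters G"
      using s0 by (intro nonneg_rational_combine IH induced_u_nonneg_rational K fin) auto
    then show ?thesis by (rule nonneg_rational_cong) (simp add: eq)
  qed
qed

subsection \<open>The multiplicative depth character\<close>

text \<open>This is the valuation of \<open>\<zeta> - 1\<close> for a root of unity \<open>\<zeta>\<close> of order \<open>n\<close>.\<close>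

definition cyclotomic_val :: "nat \<Rightarrow> nat \<Rightarrow> rat" where
  "cyclotomic_val p n = (if n = p ^ multiplicity p n \<and> 1 < n
     then 1 / (of_nat (p ^ (multiplicity p n - 1)) * (of_nat p - 1)) else 0)"

lemma cyclotomic_val_prime_power:
  assumes "Factorial_Ring.prime p" "0 < k"
  shows "cyclotomic_val p (p ^ k) = 1 / (of_nat (p ^ (k - 1)) * (of_nat p - 1))"
proof -
  have "1 < p ^ k" using assms one_less_power prime_gt_1_nat by blast
  moreover have "multiplicity p (p ^ k) = k"
    using assms by (simp add: multiplicity_same_power not_prime_0 not_prime_unit)
  ultimately show ?thesis by (simp add: cyclotomic_val_def)
qed

text \<open>Equivalent to the vanishing of the sum of \<open>delta_mult\<close> over a cyclic group
  of order \<open>p^m\<close>. In the induction the multiples of \<open>p\<close> reproduce the sum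
  for \<open>m\<close>, scaled by \<open>p\<close>, and the \<open>p^(m+1) - p^m\<close> other
  indices contribute 1 each.\<close>

lemma sum_prime_power_multiplicity:
  assumes p: "Factorial_Ring.prime p"
  shows "p * (\<Sum>a\<in>{1..<p^m}. p ^ multiplicity p a) + m * p ^ m = m * p ^ (m + 1)"
proof (induction m)
  case (Suc m)
  have p1: "1 < p" using p prime_gt_1_nat by blast
  let ?D = "{a\<in>{1..<p^Suc m}. p dvd a}" and ?N = "{a\<in>{1..<p^Suc m}. \<not> p dvd a}"
  have "?D = (*) p ` {1..<p^m}"
  proof (intro equalityI subsetI)
    fix a assume "a \<in> ?D"
    then obtain b where "a = p * b" "1 \<le> a" "a < p ^ Suc m" by auto
    then have "p * b < p * p ^ m" "0 < p * b" by auto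
    then have "b \<in> {1..<p^m}" by (simp only: nat_mult_less_cancel_disj nat_0_less_mult_iff) auto
    then show "a \<in> (*) p ` {1..<p^m}" using \<open>a = p * b\<close> by blast
  qed (use p1 in auto)
  then have "(\<Sum>a\<in>?D. p ^ multiplicity p a) = (\<Sum>b\<in>{1..<p^m}. p ^ multiplicity p (p * b))"
    using p1 by (simp add: sum.reindex inj_on_def)
  also have "\<dots> = (\<Sum>b\<in>{1..<p^m}. p * p ^ multiplicity p b)"
    using p p1 by (intro sum.cong refl) (auto simp: multiplicity_times_same)
  finally have D: "(\<Sum>a\<in>?D. p ^ multiplicity p a) = p * (\<Sum>b\<in>{1..<p^m}. p ^ multiplicity p b)"
    by (simp add: sum_distrib_left)
  have "(\<Sum>a\<in>?N. p ^ multiplicity p a) = (\<Sum>a\<in>?N. 1)"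
    by (intro sum.cong refl) (simp add: not_dvd_imp_multiplicity_0)
  then have N: "(\<Sum>a\<in>?N. p ^ multiplicity p a) = card ?N" by simp
  have DN: "{1..<p^Suc m} = ?D \<union> ?N" by auto
  then have "(\<Sum>a\<in>{1..<p^Suc m}. p ^ multiplicity p a) = (\<Sum>a\<in>?D \<union> ?N. p ^ multiplicity p a)"
    by (rule arg_cong)
  also have "\<dots> = p * (\<Sum>b\<in>{1..<p^m}. p ^ multiplicity p b) + card ?N"
    unfolding D[symmetric] N[symmetric] by (rule sum.union_disjoint) auto
  finally have S: "(\<Sum>a\<in>{1..<p^Suc m}. p ^ multiplicity p a) = p * (\<Sum>b\<in>{1..<p^m}. p ^ multiplicity p b) + card ?N" .
  have "card ?D = p ^ m - 1" using \<open>?D = (*) p ` {1..<p^m}\<close> p1 by (simp add: card_image inj_on_def)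
  moreover have "card ({1..<p^Suc m}) = card ?D + card ?N"
    unfolding arg_cong[OF DN, of card] by (rule card_Un_disjoint) auto
  moreover have "card {1..<p^Suc m} = p ^ Suc m - 1" by simp
  moreover have "1 \<le> p ^ m" using p1 by simp
  moreover have "1 \<le> p ^ Suc m" using p1 by simp
  ultimately have cN: "card ?N + p ^ m = p ^ Suc m" by linarith
  have "p * (\<Sum>a\<in>{1..<p^Suc m}. p ^ multiplicity p a) + Suc m * p ^ Suc m
    = p * (p * (\<Sum>b\<in>{1..<p^m}. p ^ multiplicity p b) + m * p ^ m) + p * (card ?N + p ^ m)"
    unfolding S by (simp add: algebra_simps)
  also have "\<dots> = Suc m * p ^ (Suc m + 1)"
    unfolding Suc.IH cN by (simp add: algebra_simps)
  finally show ?case .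
qed auto

text \<open>If \<open>p^i\<close> exactly divides \<open>a\<close>, then \<open>s^a\<close> has
  order \<open>p^(m-i)\<close>, and \<open>p^(i+1) / (p-1)\<close> is \<open>p^m\<close> times the
  valuation \<open>1 / (p^(m-i-1) (p-1))\<close> belonging to that order. So off the identity
  \<open>delta_mult\<close> is \<open>- |P|\<close> times \<open>cyclotomic_val\<close>.\<close>

lemma (in group) delta_mult_cyclic:
  assumes fin: "finite (carrier G)" and p: "Factorial_Ring.prime p"
    and t: "t \<in> carrier G" "ord t = p ^ m" and P: "P = generate G {t}"
  shows "delta_mult p (G\<lparr>carrier := P\<rparr>) \<one> = of_nat (m * p ^ m)"
    and "\<And>g. g \<in> P \<Longrightarrow> g \<noteq> \<one> \<Longrightarrow> delta_mult p (G\<lparr>carrier := P\<rparr>) g = - of_nat (p ^ m) * of_rat (cyclotomic_val p (ord g))"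
    and "(\<Sum>g\<in>P. delta_mult p (G\<lparr>carrier := P\<rparr>) g) = 0"
proof -
  have p1: "1 < p" using p prime_gt_1_nat by blast
  have Psub: "subgroup P G" unfolding P using t by (intro generate_is_subgroup) auto
  interpret P: subgroup P G by fact
  have cP: "card P = p ^ m" unfolding P using generate_pow_card[OF t(1)] t(2) by simp
  have mp: "multiplicity p (card (carrier (G\<lparr>carrier := P\<rparr>))) = m"
    using p by (simp add: cP multiplicity_same_power not_prime_0 not_prime_unit)
  show one: "delta_mult p (G\<lparr>carrier := P\<rparr>) \<one> = of_nat (m * p ^ m)"
    unfolding delta_mult_def Let_def mp by simp
  \<comment> \<open>The generator selected inside \<open>delta_mult\<close>. It need not be
    \<open>t\<close>, so orders and exponents are computed with respect to \<open>s\<close>.\<close>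
  define s where "s = (SOME \<sigma>. \<sigma> \<in> carrier (G\<lparr>carrier := P\<rparr>) \<and> generate (G\<lparr>carrier := P\<rparr>) {\<sigma>} = carrier (G\<lparr>carrier := P\<rparr>))"
  have tP: "t \<in> P" unfolding P by (intro generate.incl) auto
  have "t \<in> carrier (G\<lparr>carrier := P\<rparr>) \<and> generate (G\<lparr>carrier := P\<rparr>) {t} = carrier (G\<lparr>carrier := P\<rparr>)"
    using generate_consistent[OF _ Psub, of "{t}"] tP by (simp add: P)
  then have "s \<in> carrier (G\<lparr>carrier := P\<rparr>) \<and> generate (G\<lparr>carrier := P\<rparr>) {s} = carrier (G\<lparr>carrier := P\<rparr>)"
    unfolding s_def by (rule someI)
  then have sP: "s \<in> P" and sgen: "generate G {s} = P"
    using generate_consistent[OF _ Psub, of "{s}"] by auto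
  have sG: "s \<in> carrier G" using sP by auto
  have os: "ord s = p ^ m" using generate_pow_card[OF sG] sgen cP by simp
  have pw: "s [^]\<^bsub>G\<lparr>carrier := P\<rparr>\<^esub> (a::nat) = s [^] a" for a by (simp add: nat_pow_consistent[symmetric])
  have gval: "delta_mult p (G\<lparr>carrier := P\<rparr>) (s [^] a) = - of_nat (p ^ (multiplicity p a + 1)) / (of_nat p - 1)"
    and oval: "ord (s [^] a) = p ^ (m - multiplicity p a)"
    and ne1: "s [^] a \<noteq> \<one>" and mlt: "multiplicity p a < m"
    if a: "a \<in> {1..<p^m}" for a
  proof -
    let ?i = "multiplicity p a"
    have "p ^ ?i dvd a" by (rule multiplicity_dvd)
    then have "p ^ ?i \<le> a" using a by (intro dvd_imp_le) auto
    then have "p ^ ?i < p ^ m" using a by auto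
    then show im: "?i < m" using p1 by (simp)
    show ne: "s [^] a \<noteq> \<one>" using pow_eq_id[OF sG, of a] a os by (auto dest: dvd_imp_le)
    have "(LEAST b. s [^] a = s [^] (b::nat)) = a"
    proof (rule Least_equality)
      fix b :: nat assume b: "s [^] a = s [^] b"
      show "a \<le> b"
      proof (rule ccontr)
        assume ab: "\<not> a \<le> b"
        then have "a \<in> {0..ord s - 1}" "b \<in> {0..ord s - 1}" using a os by auto
        then show False using ord_inj[OF sG] b ab unfolding inj_on_def by force
      qed
    qed simp
    then show "delta_mult p (G\<lparr>carrier := P\<rparr>) (s [^] a) = - of_nat (p ^ (?i + 1)) / (of_nat p - 1)"
      unfolding delta_mult_def Let_def mp s_def[symmetric] pw using ne by simp
    obtain c where c: "a = p ^ ?i * c" "\<not> p dvd c"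
      using multiplicity_decompose'[of a p] a p1 by (metis atLeastLessThan_iff nat_dvd_1_iff_1 not_one_le_zero less_irrefl)
    have "gcd (p ^ m) a = gcd (p ^ ?i * p ^ (m - ?i)) (p ^ ?i * c)"
      using c(1) im by (simp flip: power_add)
    also have "\<dots> = p ^ ?i * gcd (p ^ (m - ?i)) c" by (simp add: gcd_mult_distrib_nat)
    also have "gcd (p ^ (m - ?i)) c = 1"
      using c(2) p by (metis coprime_iff_gcd_eq_1 coprime_power_left_iff prime_imp_coprime_nat)
    finally have "gcd (p ^ m) a = p ^ ?i" by simp
    then show "ord (s [^] a) = p ^ (m - ?i)"
      using ord_pow_gen[OF sG, of a] a os p1 im by (simp add: power_diff)
  qed
  have img: "(\<lambda>a. s [^] a) ` {1..<p^m} = P - {\<one>}" and inj: "inj_on (\<lambda>a. s [^] a) {1..<p^m}"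
  proof -
    show inj: "inj_on (\<lambda>a. s [^] a) {1..<p^m}"
      by (rule inj_on_subset[OF ord_inj[OF sG]]) (auto simp: os)
    have sub: "(\<lambda>a. s [^] a) ` {1..<p^m} \<subseteq> P - {\<one>}"
      using ne1 sP P.subgroup_axioms by (auto simp: subgroup_int_pow_closed int_pow_int[symmetric])
    have fP: "finite P" using cP p1 by (intro card_ge_0_finite) simp
    show "(\<lambda>a. s [^] a) ` {1..<p^m} = P - {\<one>}"
    proof (rule card_subset_eq[OF _ sub])
      show "card ((\<lambda>a. s [^] a) ` {1..<p^m}) = card (P - {\<one>})"
        unfolding card_image[OF inj] by (simp add: cP card_Diff_singleton)
    qed (use fP in simp)
  qed
  have val: "of_nat (p ^ (multiplicity p a + 1)) / (of_nat p - 1) = of_nat (p ^ m) * (of_rat (cyclotomic_val p (ord (s [^] a))) :: complex)"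
    if a: "a \<in> {1..<p^m}" for a
  proof -
    have "0 < m - multiplicity p a" using mlt[OF a] by simp
    then have "cyclotomic_val p (ord (s [^] a)) = 1 / (of_nat (p ^ (m - multiplicity p a - 1)) * (of_nat p - 1))"
      unfolding oval[OF a] by (rule cyclotomic_val_prime_power[OF p])
    then have B: "(of_rat (cyclotomic_val p (ord (s [^] a))) :: complex) = 1 / (of_nat (p ^ (m - multiplicity p a - 1)) * (of_nat p - 1))"
      by (simp only: of_rat_divide of_rat_mult of_rat_diff of_rat_of_nat_eq of_rat_1)
    have "(multiplicity p a + 1) + (m - multiplicity p a - 1) = m" using mlt[OF a] by simp
    then have "p ^ m = p ^ (multiplicity p a + 1) * p ^ (m - multiplicity p a - 1)"
      by (metis power_add)
    then have A: "(of_nat (p ^ m) :: complex) = of_nat (p ^ (multiplicity p a + 1)) * of_nat (p ^ (m - multiplicity p a - 1))"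
      by (metis of_nat_mult)
    have "(of_nat p - 1 :: complex) \<noteq> 0" using p1 by (metis eq_iff_diff_eq_0 less_irrefl of_nat_eq_1_iff)
    moreover have "(of_nat (p ^ (m - multiplicity p a - 1)) :: complex) \<noteq> 0" using p1 by simp
    ultimately show ?thesis unfolding A B by (simp only: mult_1_right times_divide_eq_right nonzero_mult_divide_mult_cancel_right2 mult.assoc) (simp add: field_simps)
  qed
  show "delta_mult p (G\<lparr>carrier := P\<rparr>) g = - of_nat (p ^ m) * of_rat (cyclotomic_val p (ord g))"
    if g: "g \<in> P" "g \<noteq> \<one>" for g
  proof -
    from g obtain a where a: "a \<in> {1..<p^m}" "g = s [^] a" using img by blast
    show ?thesis unfolding a(2) gval[OF a(1)] minus_divide_left[symmetric] val[OF a(1)] by simp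
  qed
  have fP: "finite P" using cP p1 by (intro card_ge_0_finite) simp
  have "(\<Sum>g\<in>P. delta_mult p (G\<lparr>carrier := P\<rparr>) g) = of_nat (m * p ^ m) + (\<Sum>g\<in>P - {\<one>}. delta_mult p (G\<lparr>carrier := P\<rparr>) g)"
    by (simp only: sum.remove[OF fP P.one_closed] one)
  also have "(\<Sum>g\<in>P - {\<one>}. delta_mult p (G\<lparr>carrier := P\<rparr>) g) = (\<Sum>a\<in>{1..<p^m}. - of_nat (p ^ (multiplicity p a + 1)) / (of_nat p - 1))"
    unfolding img[symmetric] sum.reindex[OF inj] comp_def by (intro sum.cong refl gval)
  also have "\<dots> = - (of_nat (p * (\<Sum>a\<in>{1..<p^m}. p ^ multiplicity p a)) / (of_nat p - 1))"
    by (simp add: sum_divide_distrib sum_negf sum_distrib_left)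
  also have "of_nat (p * (\<Sum>a\<in>{1..<p^m}. p ^ multiplicity p a)) = (of_nat (m * p ^ m) * (of_nat p - 1) :: complex)"
  proof -
    have "of_nat (p * (\<Sum>a\<in>{1..<p^m}. p ^ multiplicity p a) + m * p ^ m) = (of_nat (m * p ^ (m + 1)) :: complex)"
      by (simp only: sum_prime_power_multiplicity[OF p])
    then show ?thesis by (simp only: of_nat_add) (simp add: algebra_simps eq_diff_eq)
  qed
  also have "of_nat (m * p ^ m) + - (of_nat (m * p ^ m) * (of_nat p - 1) / (of_nat p - 1)) = (0::complex)"
  proof -
    have "(of_nat p - 1 :: complex) \<noteq> 0" using p1 by (metis eq_iff_diff_eq_0 less_irrefl of_nat_eq_1_iff)
    then show ?thesis by simp
  qed
  finally show "(\<Sum>g\<in>P. delta_mult p (G\<lparr>carrier := P\<rparr>) g) = 0" .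
qed

text \<open>\<open>cyclotomic_val\<close> vanishes unless the order is a power of \<open>p\<close>,
  and in the cyclic group \<open>H\<close> the elements of such order form the Sylow subgroup
  \<open>P\<close>. Conjugators into \<open>H\<close> may thus be replaced by conjugators into
  \<open>P\<close>, and the factor \<open>|P|\<close> in \<open>delta_mult\<close> cancels the
  denominator of the induced character.\<close>

lemma (in group) conj_depth_cyclic:
  assumes fin: "finite (carrier G)" and p: "Factorial_Ring.prime p"
    and s: "s \<in> carrier G" and H: "H = generate G {s}"
  shows "\<exists>P. sylow_subgroup p (G\<lparr>carrier := H\<rparr>) P \<and>
    (\<forall>g\<in>carrier G. conj_depth G H (\<lambda>h. cyclotomic_val p (ord h)) g
       = induced_char G P (delta_mult p (G\<lparr>carrier := P\<rparr>)) g)"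
proof -
  have p1: "1 < p" using p prime_gt_1_nat by blast
  have Hsub: "subgroup H G" unfolding H using s by (intro generate_is_subgroup) auto
  interpret H: subgroup H G by fact
  define n where "n = ord s"
  have n0: "n > 0" unfolding n_def using ord_ge_1[OF fin s] by simp
  have cH: "card H = n" unfolding H n_def using generate_pow_card[OF s] by simp
  define m where "m = multiplicity p n"
  obtain q where q: "n = p ^ m * q" "\<not> p dvd q"
    unfolding m_def using multiplicity_decompose'[of n p] n0 p1 by (metis nat_dvd_1_iff_1 less_irrefl neq0_conv)
  have q0: "q > 0" using q n0 by (cases q) auto
  \<comment> \<open>\<open>q\<close> is the part of the order prime to \<open>p\<close>, so
    \<open>t\<close> generates the Sylow subgroup.\<close>
  define t where "t = s [^] q"
  have t: "t \<in> carrier G" unfolding t_def using s by simp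
  have ot: "ord t = p ^ m" unfolding t_def using ord_pow[OF s, of q] q q0 n_def by simp
  define P where "P = generate G {t}"
  have Psub: "subgroup P G" unfolding P_def using t by (intro generate_is_subgroup) auto
  have sH: "s \<in> H" unfolding H by (intro generate.incl) auto
  have spow: "s [^] (a::nat) \<in> H" for a
    using subgroup_int_pow_closed[OF Hsub sH, of "int a"] by (simp add: int_pow_int)
  have PH: "P \<subseteq> H" unfolding P_def t_def using spow Hsub by (intro generate_subgroup_incl) auto
  have cP: "card P = p ^ m" unfolding P_def using generate_pow_card[OF t] ot by simp
  have syl: "sylow_subgroup p (G\<lparr>carrier := H\<rparr>) P"
    unfolding sylow_subgroup_def using subgroup_incl[OF Psub Hsub PH] cP by (simp add: cH m_def)
  note dm = delta_mult_cyclic[OF fin p t ot P_def]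
  have tpow: "t [^] (a::nat) \<in> P" for a
    using subgroup_int_pow_closed[OF Psub, of t "int a"] unfolding P_def
    by (simp add: int_pow_int generate.incl)
  have zero: "cyclotomic_val p (ord h) = 0" if h: "h \<in> H" "h \<notin> P" for h
  proof (rule ccontr)
    assume "cyclotomic_val p (ord h) \<noteq> 0"
    then obtain k where k: "ord h = p ^ k" unfolding cyclotomic_val_def by (meson)
    obtain a :: nat where a: "h = s [^] a"
      using h(1) unfolding H generate_pow_on_finite_carrier[OF fin s] by auto
    have "(s [^] a) [^] (p ^ k) = \<one>" using pow_eq_id[of "s [^] a" "p ^ k"] k a s by simp
    then have "s [^] (a * p ^ k) = \<one>" using s by (simp add: nat_pow_pow)
    then have "n dvd a * p ^ k" using pow_eq_id[OF s] n_def by simp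
    then have "q dvd a * p ^ k" using q(1) dvd_mult_right by blast
    moreover have "coprime q (p ^ k)"
      using q(2) p by (metis coprime_commute coprime_power_right_iff prime_imp_coprime_nat)
    ultimately have "q dvd a" by (simp add: coprime_dvd_mult_left_iff)
    then obtain b where "a = q * b" by auto
    then have "h = t [^] b" unfolding a t_def using s by (simp add: nat_pow_pow)
    then show False using tpow h(2) by simp
  qed
  have "conj_depth G H (\<lambda>h. cyclotomic_val p (ord h)) g = induced_char G P (delta_mult p (G\<lparr>carrier := P\<rparr>)) g"
    if g: "g \<in> carrier G" for g
    unfolding induced_char_zero_sum[OF Psub fin dm(3) g] conj_depth_def
  proof (rule zero_sum_cong[OF _ g])
    fix h assume h: "h \<in> carrier G" "h \<noteq> \<one>"
    have "(\<Sum>x\<in>conjugators G P h. delta_mult p (G\<lparr>carrier := P\<rparr>) (inv x \<otimes> h \<otimes> x))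
      = (\<Sum>x\<in>conjugators G P h. - of_nat (p ^ m) * of_rat (cyclotomic_val p (ord (inv x \<otimes> h \<otimes> x))))"
      using h by (intro sum.cong refl dm(2)) (auto simp: conjugators_def conj_one_iff)
    also have "\<dots> = - of_nat (p ^ m) * of_rat (\<Sum>x\<in>conjugators G P h. cyclotomic_val p (ord (inv x \<otimes> h \<otimes> x)))"
      by (simp add: of_rat_sum sum_distrib_left)
    also have "(\<Sum>x\<in>conjugators G P h. cyclotomic_val p (ord (inv x \<otimes> h \<otimes> x)))
      = (\<Sum>x\<in>conjugators G H h. cyclotomic_val p (ord (inv x \<otimes> h \<otimes> x)))"
      using fin PH zero by (intro sum.mono_neutral_left) (auto simp: conjugators_def)
    finally show "- of_rat (\<Sum>x\<in>conjugators G H h. cyclotomic_val p (ord (inv x \<otimes> h \<otimes> x)))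
      = (\<Sum>x\<in>conjugators G P h. delta_mult p (G\<lparr>carrier := P\<rparr>) (inv x \<otimes> h \<otimes> x)) / of_nat (card P)"
      using p1 by (simp add: cP)
  qed
  then show ?thesis using syl by blast
qed

subsection \<open>Trees given by parent functions\<close>

text \<open>The strict increase of \<open>rk\<close> from parent to child excludes cycles and
  supports induction along ancestors. The uniqueness in \<open>root_child\<close> yields the single
  trunk.\<close>

locale parent_tree =
  fixes V :: "'v set" and r :: 'v and par :: "'v \<Rightarrow> 'v" and rk :: "'v \<Rightarrow> nat"
  assumes finite_verts: "finite V" and root_vert: "r \<in> V"
    and parent_vert: "v \<in> V - {r} \<Longrightarrow> par v \<in> V"
    and rank_parent: "v \<in> V - {r} \<Longrightarrow> rk (par v) < rk v"
    and root_child: "\<exists>!v. v \<in> V - {r} \<and> par v = r"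
begin

definition "edge v = {v, par v}"

lemma edge_inj: "u \<in> V - {r} \<Longrightarrow> v \<in> V - {r} \<Longrightarrow> edge u = edge v \<Longrightarrow> u = v"
  unfolding edge_def doubleton_eq_iff using rank_parent by (metis less_asym)

lemma parent_neq: "v \<in> V - {r} \<Longrightarrow> par v \<noteq> v"
  using rank_parent by fastforce

lemma adjacency_sym: "(x, y) \<in> adjacency E \<Longrightarrow> (y, x) \<in> adjacency E"
  unfolding adjacency_def by (simp add: insert_commute)

text \<open>The bound on ranks records that the path descends through ancestors of \<open>v\<close>.
  Applied to the parent of a vertex, it shows that the path avoids the edge of that vertex.\<close>

lemma root_reaches:
  assumes "v \<in> V"
  shows "(r, v) \<in> (adjacency {edge u | u. u \<in> V - {r} \<and> rk u \<le> rk v})\<^sup>*"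
  using assms
proof (induction "rk v" arbitrary: v rule: less_induct)
  case less
  show ?case
  proof (cases "v = r")
    case False
    then have v: "v \<in> V - {r}" using less.prems by auto
    have "(r, par v) \<in> (adjacency {edge u | u. u \<in> V - {r} \<and> rk u \<le> rk (par v)})\<^sup>*"
      using less.hyps[OF rank_parent[OF v] parent_vert[OF v]] .
    then have "(r, par v) \<in> (adjacency {edge u | u. u \<in> V - {r} \<and> rk u \<le> rk v})\<^sup>*"
      by (rule rtrancl_mono[THEN subsetD, rotated])
        (use rank_parent[OF v] in \<open>auto simp: adjacency_def intro: less_imp_le order_trans\<close>)
    moreover have "(par v, v) \<in> adjacency {edge u | u. u \<in> V - {r} \<and> rk u \<le> rk v}"
      unfolding adjacency_def edge_def using v by (auto simp: insert_commute)
    ultimately show ?thesis by (rule rtrancl_into_rtrancl)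
  qed auto
qed

lemma neighbour_cases:
  assumes "{x, y} \<in> edge ` (V - {r})" "rk x \<le> rk y"
  shows "x = par y" "y \<in> V - {r}"
proof -
  obtain v where v: "v \<in> V - {r}" "{x, y} = {v, par v}" using assms(1) unfolding edge_def by auto
  then have "y = v \<and> x = par v" using assms(2) rank_parent[OF v(1)] by (auto simp: doubleton_eq_iff)
  then show "x = par y" "y \<in> V - {r}" using v by auto
qed

text \<open>A vertex of maximal rank on a cycle has two distinct neighbours there of no larger rank,
  and each of them would have to be its parent.\<close>

lemma acyclic_edges: "\<not> has_cycle (edge ` (V - {r}))"
proof
  assume "has_cycle (edge ` (V - {r}))"
  then obtain vs where vs: "3 \<le> length vs" "distinct vs"
    "\<And>i. i < length vs \<Longrightarrow> {vs ! i, vs ! ((i + 1) mod length vs)} \<in> edge ` (V - {r})"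
    unfolding has_cycle_def by auto
  define n where "n = length vs"
  have n: "3 \<le> n" using vs(1) n_def by simp
  define M where "M = Max ((\<lambda>i. rk (vs ! i)) ` {..<n})"
  have fin: "finite ((\<lambda>i. rk (vs ! i)) ` {..<n})" by simp
  have "M \<in> (\<lambda>i. rk (vs ! i)) ` {..<n}" unfolding M_def using n by (intro Max_in fin) (auto simp: lessThan_empty_iff)
  then obtain k where k: "k < n" "M = rk (vs ! k)" by auto
  have mx: "rk (vs ! i) \<le> rk (vs ! k)" if "i < n" for i
    using k(2) Max_ge[OF fin] that M_def by auto
  define j where "j = (k + 1) mod n"
  \<comment> \<open>The cyclic predecessor of \<open>k\<close>; adding \<open>n - 1\<close> avoids a
    subtraction at \<open>k = 0\<close>.\<close>
  define i where "i = (k + (n - 1)) mod n"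
  have ij: "i < n" "j < n" unfolding i_def j_def using n by auto
  have ik: "(i + 1) mod n = k" unfolding i_def using n k(1) by (simp add: mod_simps)
  have jv: "j = (if k + 1 = n then 0 else k + 1)" unfolding j_def using k(1) by (auto)
  have iv: "i = (if k = 0 then n - 1 else k - 1)"
  proof (cases "k = 0")
    case False
    then have "k + (n - 1) = n + (k - 1)" using n by simp
    then have "i = (k - 1) mod n" unfolding i_def by (simp only: mod_add_self1)
    then show ?thesis using k(1) False by simp
  qed (use n in \<open>simp add: i_def\<close>)
  have "i \<noteq> j" unfolding iv jv using n k(1) by auto
  have "{vs ! j, vs ! k} \<in> edge ` (V - {r})" using vs(3)[of k] k(1) n_def j_def by (simp add: insert_commute)
  then have 1: "vs ! j = par (vs ! k)" using mx[OF ij(2)] neighbour_cases(1) by blast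
  have "{vs ! i, vs ! k} \<in> edge ` (V - {r})" using vs(3)[of i] ij(1) ik n_def by simp
  then have "vs ! i = par (vs ! k)" using mx[OF ij(1)] neighbour_cases(1) by blast
  then show False using 1 \<open>i \<noteq> j\<close> ij vs(2) n_def nth_eq_iff_index_eq by metis
qed

context
  fixes T :: "('v, 'm) rooted_tree_scheme"
  assumes T: "tverts T = V" "tedges T = edge ` (V - {r})" "troot T = r"
begin

lemma root_edge_iff: "v \<in> V - {r} \<Longrightarrow> r \<in> edge v \<longleftrightarrow> par v = r"
  unfolding edge_def by auto

lemma parent_rooted_tree: "rooted_tree T"
  unfolding rooted_tree_def T
proof (intro conjI ballI)
  fix e assume "e \<in> edge ` (V - {r})"
  then obtain v where v: "v \<in> V - {r}" "e = edge v" by auto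
  show "e \<subseteq> V" using v parent_vert[OF v(1)] unfolding edge_def by auto
  show "card e = 2" using v parent_neq[OF v(1)] unfolding edge_def by auto
next
  have sym: "sym (adjacency (edge ` (V - {r})))" using adjacency_sym by (auto simp: sym_def)
  have reach: "(r, v) \<in> (adjacency (edge ` (V - {r})))\<^sup>*" if "v \<in> V" for v
    by (rule rtrancl_mono[THEN subsetD, OF _ root_reaches[OF that]]) (auto simp: adjacency_def)
  fix x y assume "x \<in> V" "y \<in> V"
  then have "(x, r) \<in> (adjacency (edge ` (V - {r})))\<^sup>*" "(r, y) \<in> (adjacency (edge ` (V - {r})))\<^sup>*"
    using reach sym_rtrancl[OF sym] by (auto simp: sym_def)
  then show "(x, y) \<in> (adjacency (edge ` (V - {r})))\<^sup>*" by (rule rtrancl_trans)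
next
  obtain v where v: "v \<in> V - {r}" "par v = r" and u: "\<And>w. w \<in> V - {r} \<Longrightarrow> par w = r \<Longrightarrow> w = v"
    using root_child by auto
  show "\<exists>!e. e \<in> edge ` (V - {r}) \<and> r \<in> e"
  proof (rule ex1I[of _ "edge v"])
    show "edge v \<in> edge ` (V - {r}) \<and> r \<in> edge v" using v(1,2) root_edge_iff by blast
    fix e assume "e \<in> edge ` (V - {r}) \<and> r \<in> e"
    then obtain w where "w \<in> V - {r}" "e = edge w" "par w = r" using root_edge_iff by blast
    then show "e = edge v" using u by blast
  qed
qed (use finite_verts root_vert acyclic_edges in auto)

lemma trunk_eq:
  assumes "v \<in> V - {r}" "par v = r"
  shows "trunk T = edge v"
  unfolding trunk_def T
proof (rule the_equality)
  show "edge v \<in> edge ` (V - {r}) \<and> r \<in> edge v" using assms root_edge_iff by blast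
  fix e assume "e \<in> edge ` (V - {r}) \<and> r \<in> e"
  then obtain w where "w \<in> V - {r}" "e = edge w" "par w = r" using root_edge_iff by blast
  then show "e = edge v" using root_child assms by blast
qed

text \<open>The parent is reached through vertices of smaller rank, hence without using the edge.
  Conversely, a path from the root that avoids the edge never enters the subtree of
  \<open>v\<close>.\<close>

lemma edge_source_eq:
  assumes v: "v \<in> V - {r}"
  shows "edge_source T (edge v) = par v"
  unfolding edge_source_def T
proof (rule the_equality)
  have "(r, par v) \<in> (adjacency {edge u | u. u \<in> V - {r} \<and> rk u \<le> rk (par v)})\<^sup>*"
    using root_reaches parent_vert[OF v] .
  moreover have "{edge u | u. u \<in> V - {r} \<and> rk u \<le> rk (par v)} \<subseteq> edge ` (V - {r}) - {edge v}"
  proof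
    fix e assume "e \<in> {edge u | u. u \<in> V - {r} \<and> rk u \<le> rk (par v)}"
    then obtain u where u: "u \<in> V - {r}" "rk u \<le> rk (par v)" "e = edge u" by blast
    then have "u \<noteq> v" using rank_parent[OF v] by auto
    then have "edge u \<noteq> edge v" using edge_inj[OF u(1) v] by blast
    then show "e \<in> edge ` (V - {r}) - {edge v}" using u by blast
  qed
  then have "adjacency {edge u | u. u \<in> V - {r} \<and> rk u \<le> rk (par v)} \<subseteq> adjacency (edge ` (V - {r}) - {edge v})"
    unfolding adjacency_def by blast
  ultimately have "(r, par v) \<in> (adjacency (edge ` (V - {r}) - {edge v}))\<^sup>*"
    using rtrancl_mono by blast
  then show "par v \<in> edge v \<and> (r, par v) \<in> (adjacency (edge ` (V - {r}) - {edge v}))\<^sup>*"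
    by (simp add: edge_def)
next
  define P where "P = {(x, par x) | x. x \<in> V - {r}}"
  have anc: "rk w \<le> rk x" if "(x, w) \<in> P\<^sup>*" for x w
    using that by (induction rule: rtrancl_induct) (use rank_parent in \<open>auto simp: P_def intro: less_imp_le less_le_trans\<close>)
  \<comment> \<open>Not having \<open>v\<close> as an ancestor (or as itself) is inherited along
    every edge other than that of \<open>v\<close>.\<close>
  have nanc: "(x, v) \<notin> P\<^sup>*" if "(r, x) \<in> (adjacency (edge ` (V - {r}) - {edge v}))\<^sup>*" for x
    using that
  proof (induction rule: rtrancl_induct)
    case base
    show ?case
    proof
      assume "(r, v) \<in> P\<^sup>*"
      then show False by (cases rule: converse_rtranclE) (use v in \<open>auto simp: P_def\<close>)
    qed
  next
    case (step x y)
    obtain u where u: "u \<in> V - {r}" "{x, y} = {u, par u}" "u \<noteq> v"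
      using step.hyps(2) unfolding adjacency_def edge_def by auto
    show ?case
    proof
      assume y: "(y, v) \<in> P\<^sup>*"
      consider "x = u" "y = par u" | "y = u" "x = par u" using u(2) by (auto simp: doubleton_eq_iff)
      then show False
      proof cases
        case 1
        then have "(x, y) \<in> P" using u unfolding P_def by auto
        then show False using y step.IH by (meson converse_rtrancl_into_rtrancl)
      next
        case 2
        from y show False
          by (cases rule: converse_rtranclE) (use 2 u step.IH in \<open>auto simp: P_def\<close>)
      qed
    qed
  qed
  fix x assume x: "x \<in> edge v \<and> (r, x) \<in> (adjacency (edge ` (V - {r}) - {edge v}))\<^sup>*"
  then have "x \<noteq> v" using nanc by blast
  then show "x = par v" using x unfolding edge_def by auto
qed

lemma edge_target_eq:
  assumes v: "v \<in> V - {r}"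
  shows "edge_target T (edge v) = v"
  unfolding edge_target_def edge_source_eq[OF v]
  by (rule the_equality) (use parent_neq[OF v] in \<open>auto simp: edge_def\<close>)

lemma successors_eq: "successors T v = {w \<in> V - {r}. par w = v}"
proof -
  have "successors T v = {edge_target T (edge u) | u. u \<in> V - {r} \<and> edge_source T (edge u) = v}"
    unfolding successors_def T by blast
  also have "\<dots> = {u \<in> V - {r}. par u = v}"
    using edge_source_eq edge_target_eq by (metis (no_types, lifting))
  finally show ?thesis .
qed

lemma leaves_eq: "leaves T = {v \<in> V. \<forall>w\<in>V - {r}. par w \<noteq> v}"
proof -
  have "(\<forall>w\<in>V. tree_le T v w \<longrightarrow> w = v) \<longleftrightarrow> (\<forall>w\<in>V - {r}. par w \<noteq> v)" if "v \<in> V" for v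
  proof
    assume l: "\<forall>w\<in>V. tree_le T v w \<longrightarrow> w = v"
    show "\<forall>w\<in>V - {r}. par w \<noteq> v"
    proof (intro ballI notI)
      fix w assume w: "w \<in> V - {r}" "par w = v"
      then have "tree_le T v w" unfolding tree_le_def successors_eq by auto
      moreover have "w \<in> V" using w(1) by simp
      ultimately have "w = v" using l by blast
      then show False using w(2) parent_neq[OF w(1)] by simp
    qed
  next
    assume l: "\<forall>w\<in>V - {r}. par w \<noteq> v"
    show "\<forall>w\<in>V. tree_le T v w \<longrightarrow> w = v"
    proof (intro ballI impI)
      fix w assume "tree_le T v w"
      then have "(v, w) \<in> {(x, y). y \<in> {w \<in> V - {r}. par w = x}}\<^sup>*" unfolding tree_le_def successors_eq .
      then show "w = v"
      proof (cases rule: converse_rtranclE)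
        case (step y)
        then have "y \<in> V - {r}" "par y = v" by auto
        then show ?thesis using l by blast
      qed simp
    qed
  qed
  then show ?thesis unfolding leaves_def T by auto
qed

end

end

text \<open>Edges are indexed by their targets, so that all the data of a Hurwitz tree live on vertices.\<close>

lemma hurwitz_tree_of_parents:
  fixes V :: "'v set" and r :: 'v and Gv :: "'v \<Rightarrow> 'g set" and a \<delta> :: "'v \<Rightarrow> 'g \<Rightarrow> complex"
    and \<epsilon> :: "'v \<Rightarrow> rat" and G :: "('g, 'm) monoid_scheme"
  assumes tree: "parent_tree V r par rk"
  defines "lf \<equiv> {v \<in> V. \<forall>w\<in>V - {r}. par w \<noteq> v}"
  assumes metric: "\<And>v. v \<in> V - {r} \<Longrightarrow> 0 \<le> \<epsilon> v \<and> (\<epsilon> v = 0 \<longleftrightarrow> v \<in> lf)"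
    and artin: "\<And>v. v \<in> V - {r} \<Longrightarrow> a v \<in> true_characters G"
    and depth: "\<And>v. v \<in> V \<Longrightarrow> \<delta> v \<in> nonneg_rational_characters G"
    and sub: "\<And>v. v \<in> V \<Longrightarrow> subgroup (Gv v) G"
    and H1: "\<And>v. v \<in> V - {r} \<Longrightarrow> \<exists>x\<in>carrier G. conjugate G x (Gv v) \<subseteq> Gv (par v)"
      "\<And>v. v \<in> V - {r} \<Longrightarrow> v \<notin> lf \<Longrightarrow>
         1 < (\<Sum>w\<in>{w \<in> V - {r}. par w = v}. of_nat (card (Gv v)) / of_nat (card (Gv w)) :: rat)"
      "Gv r = carrier G" "\<And>v. v \<in> V - {r} \<Longrightarrow> par v = r \<Longrightarrow> Gv v = carrier G"
    and H2: "\<And>v. v \<in> lf \<Longrightarrow> Gv v \<noteq> {\<one>\<^bsub>G\<^esub>} \<and> cyclic_group (G\<lparr>carrier := Gv v\<rparr>)"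
    and H3: "\<And>v g. v \<in> V - {r} \<Longrightarrow> v \<notin> lf \<Longrightarrow> g \<in> carrier G \<Longrightarrow> a v g = (\<Sum>w\<in>{w \<in> V - {r}. par w = v}. a w g)"
      "\<And>v g. v \<in> lf \<Longrightarrow> g \<in> carrier G \<Longrightarrow> a v g = induced_char G (Gv v) (u_char (G\<lparr>carrier := Gv v\<rparr>)) g"
    and H4: "\<And>v g. v \<in> V - {r} \<Longrightarrow> g \<in> carrier G \<Longrightarrow> \<delta> v g = \<delta> (par v) g + of_rat (\<epsilon> v) *
          (a v g - induced_char G (Gv v) (u_char (G\<lparr>carrier := Gv v\<rparr>)) g)"
    and H5: "\<And>v. v \<in> lf \<Longrightarrow> \<exists>P. sylow_subgroup p (G\<lparr>carrier := Gv v\<rparr>) P \<and>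
        (\<forall>g\<in>carrier G. \<delta> v g = induced_char G P (delta_mult p (G\<lparr>carrier := P\<rparr>)) g)"
  shows "\<exists>T :: ('v, 'g) hurwitz_datum. hurwitz_tree G p T \<and> tree_depth T = \<delta> r \<and>
     (\<forall>v\<in>V - {r}. par v = r \<longrightarrow> tree_artin T = a v)"
proof -
  interpret parent_tree V r par rk by fact
  \<comment> \<open>Edges are two-element sets in the record; \<open>tgt\<close> recovers the
    endpoint at which the data of an edge are stored.\<close>
  define tgt where "tgt e = (THE v. v \<in> V - {r} \<and> e = edge v)" for e
  have tgt: "tgt (edge v) = v" if "v \<in> V - {r}" for v
    unfolding tgt_def by (rule the_equality) (use that edge_inj in auto)
  define T :: "('v, 'g) hurwitz_datum" where
    "T = \<lparr>tverts = V, tedges = edge ` (V - {r}), troot = r, thickness = (\<lambda>e. \<epsilon> (tgt e)),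
      monodromy = (\<lambda>v. conj_class G (Gv v)), artin = (\<lambda>e. a (tgt e)), depth = \<delta>\<rparr>"
  have T: "tverts T = V" "tedges T = edge ` (V - {r})" "troot T = r" "thickness T = (\<lambda>e. \<epsilon> (tgt e))"
    "monodromy T = (\<lambda>v. conj_class G (Gv v))" "artin T = (\<lambda>e. a (tgt e))" "depth T = \<delta>"
    unfolding T_def by auto
  note src = edge_source_eq[OF T(1-3)] and tg = edge_target_eq[OF T(1-3)] and suc = successors_eq[OF T(1-3)]
  have lv: "leaves T = lf" unfolding leaves_eq[OF T(1-3)] lf_def ..
  have r_lf: "r \<notin> lf" unfolding lf_def using root_child by auto
  obtain c where c: "c \<in> V - {r}" "par c = r" "\<And>w. w \<in> V - {r} \<Longrightarrow> par w = r \<Longrightarrow> w = c"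
    using root_child by auto
  have rep: "\<forall>v\<in>tverts T. subgroup (Gv v) G \<and> monodromy T v = conj_class G (Gv v)" unfolding T using sub by auto
  have "rooted_tree T" by (rule parent_rooted_tree[OF T(1-3)])
  moreover have "tree_metric T (thickness T)" unfolding tree_metric_def T lv using metric tg tgt by auto
  moreover have "\<forall>e\<in>tedges T. hurwitz_datum.artin T e \<in> true_characters G" unfolding T using artin tgt by auto
  moreover have "\<forall>v\<in>tverts T. hurwitz_datum.depth T v \<in> nonneg_rational_characters G" unfolding T using depth by auto
  moreover have "hurwitz_H1 G T Gv" unfolding hurwitz_H1_def suc lv
    proof (intro conjI)
      have "{w \<in> V - {r}. par w = r} = {c}" using c by blast
      then show "\<exists>w. {w \<in> V - {r}. par w = troot T} = {w} \<and> Gv (troot T) = carrier G \<and> Gv w = carrier G"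
        unfolding T using H1(3) H1(4)[OF c(1,2)] by blast
      show "\<forall>v\<in>tverts T. \<forall>w\<in>{w \<in> V - {r}. par w = v}. \<exists>x\<in>carrier G. conjugate G x (Gv w) \<subseteq> Gv v"
        using H1(1) by blast
      show "\<forall>v\<in>tverts T - lf - {troot T}.
        1 < (\<Sum>w\<in>{w \<in> V - {r}. par w = v}. of_nat (card (Gv v)) / of_nat (card (Gv w)) :: rat)"
        unfolding T using H1(2) by blast
    qed
  moreover have "hurwitz_H2 G T Gv" unfolding hurwitz_H2_def lv using H2 by auto
  moreover have "hurwitz_H3 G T Gv" unfolding hurwitz_H3_def lv
    proof (intro ballI)
      fix e g assume "e \<in> tedges T" and g: "g \<in> carrier G"
      then obtain v where v: "v \<in> V - {r}" "e = edge v" unfolding T by auto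
      have "{e' \<in> tedges T. edge_source T e' = v} = edge ` {w \<in> V - {r}. par w = v}"
        unfolding T using src by auto
      then have "(\<Sum>e'\<in>{e' \<in> tedges T. edge_source T e' = v}. hurwitz_datum.artin T e' g) = (\<Sum>w\<in>{w \<in> V - {r}. par w = v}. a w g)"
        using edge_inj tgt by (auto simp: T sum.reindex inj_on_def)
      then show "hurwitz_datum.artin T e g = (if edge_target T e \<notin> lf
         then \<Sum>e'\<in>{e' \<in> tedges T. edge_source T e' = edge_target T e}. hurwitz_datum.artin T e' g
         else induced_char G (Gv (edge_target T e)) (u_char (G\<lparr>carrier := Gv (edge_target T e)\<rparr>)) g)"
        using v H3(1)[OF v(1) _ g] H3(2)[OF _ g, of v] tg[OF v(1)] tgt[OF v(1)] by (auto simp: T(6))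
    qed
  moreover have "hurwitz_H4 G T Gv" unfolding hurwitz_H4_def
      using H4 src tg tgt by (auto simp: T)
  moreover have "hurwitz_H5 p G T Gv" unfolding hurwitz_H5_def lv T using H5 by auto
  ultimately have "hurwitz_tree G p T" unfolding hurwitz_tree_def using rep by blast
  moreover have "tree_depth T = \<delta> r" unfolding tree_depth_def T ..
  moreover have "\<forall>v\<in>V - {r}. par v = r \<longrightarrow> tree_artin T = a v"
    unfolding tree_artin_def using trunk_eq[OF T(1-3)] tgt by (auto simp: T(6))
  ultimately show ?thesis by blast
qed

subsection \<open>Clusters of a finite ultrametric space\<close>

text \<open>\<open>d x y\<close> stands for the valuation of \<open>x - y\<close>: large values mean
  close points, and the ultrametric inequality is reversed accordingly. The value
  \<open>d x x\<close> carries no information, so equal points are treated separately throughout.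
  \<open>c\<close> stands for the Gauss valuation of the displacement
  \<open>\<sigma>(z) - z\<close>.\<close>

locale cluster_action = group G for G (structure) +
  fixes D :: "'x set" and d :: "'x \<Rightarrow> 'x \<Rightarrow> rat" and act :: "'a \<Rightarrow> 'x \<Rightarrow> 'x" and c :: "'a \<Rightarrow> rat"
  assumes fin: "finite (carrier G)" and finD: "finite D" and D_nonempty: "D \<noteq> {}"
    and act_closed: "g \<in> carrier G \<Longrightarrow> x \<in> D \<Longrightarrow> act g x \<in> D"
    and act_one: "x \<in> D \<Longrightarrow> act \<one> x = x"
    and act_mult: "g \<in> carrier G \<Longrightarrow> h \<in> carrier G \<Longrightarrow> x \<in> D \<Longrightarrow> act (g \<otimes> h) x = act g (act h x)"
    and d_sym: "d x y = d y x"
    and d_pos: "x \<in> D \<Longrightarrow> y \<in> D \<Longrightarrow> x \<noteq> y \<Longrightarrow> 0 < d x y"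
    and ultra: "x \<in> D \<Longrightarrow> y \<in> D \<Longrightarrow> z \<in> D \<Longrightarrow> x \<noteq> y \<Longrightarrow> y \<noteq> z \<Longrightarrow> x \<noteq> z \<Longrightarrow> min (d x y) (d y z) \<le> d x z"
    and iso: "g \<in> carrier G \<Longrightarrow> x \<in> D \<Longrightarrow> y \<in> D \<Longrightarrow> d (act g x) (act g y) = d x y"
    and c_conj: "h \<in> carrier G \<Longrightarrow> g \<in> carrier G \<Longrightarrow> g \<noteq> \<one> \<Longrightarrow> c (inv h \<otimes> g \<otimes> h) = c g"
begin

abbreviation orb :: "'a \<Rightarrow> 'x set \<Rightarrow> 'x set" where "orb g C \<equiv> act g ` C"

definition near :: "rat \<Rightarrow> 'x \<Rightarrow> 'x \<Rightarrow> bool" where "near r x y \<longleftrightarrow> x = y \<or> r \<le> d x y"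

definition ball :: "'x \<Rightarrow> rat \<Rightarrow> 'x set" where "ball x r = {y \<in> D. near r x y}"

definition fixes_of :: "'a \<Rightarrow> 'x set" where "fixes_of g = {x \<in> D. act g x = x}"

text \<open>\<open>trunc r x a\<close> is the valuation of \<open>y - a\<close> for a generic point \<open>y\<close> of the closed
  disk of radius \<open>r\<close> around \<open>x\<close>, and \<open>level x r g\<close> that of \<open>(g(y) - y) / \<pi>\<^sup>r\<close>.\<close>

definition trunc :: "rat \<Rightarrow> 'x \<Rightarrow> 'x \<Rightarrow> rat" where "trunc r x a = (if a = x then r else min r (d x a))"

definition level :: "'x \<Rightarrow> rat \<Rightarrow> 'a \<Rightarrow> rat" where
  "level x r g = c g + (\<Sum>a\<in>fixes_of g. trunc r x a) - r"

text \<open>A ball of radius \<open>d x y\<close> with \<open>x \<noteq> y\<close> has at least two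
  points, so the singletons, which become the leaves, are added by hand.\<close>

definition clusters :: "'x set set" where
  "clusters = {ball x (d x y) | x y. x \<in> D \<and> y \<in> D \<and> x \<noteq> y} \<union> (\<lambda>x. {x}) ` D"

text \<open>The radius at which the disk around \<open>C\<close> first catches another point of
  \<open>D\<close>. It is meaningful only for \<open>C \<noteq> D\<close>, since otherwise the set
  under \<open>Max\<close> is empty.\<close>

definition outer :: "'x set \<Rightarrow> rat" where "outer C = Max {d x y | x y. x \<in> C \<and> y \<in> D - C}"

definition parent :: "'x set \<Rightarrow> 'x set" where "parent C = {z \<in> D. \<exists>x\<in>C. near (outer C) x z}"

text \<open>A singleton receives the radius of its parent, or 0 if it is all of \<open>D\<close>;
  this gives the edges to leaves thickness 0. For a larger cluster the minimum is the radius of the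
  smallest disk containing it, radii being valuations.\<close>

definition radius :: "'x set \<Rightarrow> rat" where
  "radius C = (if card C = 1 then if C = D then 0 else outer C
     else Min {d x y | x y. x \<in> C \<and> y \<in> C \<and> x \<noteq> y})"

definition stab :: "'x set \<Rightarrow> 'a set" where "stab C = {g \<in> carrier G. orb g C = C}"

section \<open>Balls, translates and stabilizers\<close>

lemma in_ball: "y \<in> ball x r \<longleftrightarrow> y \<in> D \<and> (x = y \<or> r \<le> d x y)"
  unfolding ball_def near_def by blast

lemma near_mono: "near r x y \<Longrightarrow> s \<le> r \<Longrightarrow> near s x y"
  unfolding near_def by auto

lemma near_sym: "near r x y \<longleftrightarrow> near r y x"
  unfolding near_def by (auto simp: d_sym)

lemma near_trans:
  assumes "x \<in> D" "y \<in> D" "z \<in> D" "near r x y" "near r y z"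
  shows "near r x z"
proof (cases "x = y \<or> y = z \<or> x = z")
  case False
  then have "min (d x y) (d y z) \<le> d x z" using ultra assms(1-3) by blast
  then show ?thesis using assms(4,5) False unfolding near_def by auto
qed (use assms in \<open>auto simp: near_def\<close>)

lemma near_act: "g \<in> carrier G \<Longrightarrow> x \<in> D \<Longrightarrow> y \<in> D \<Longrightarrow> near r x y \<Longrightarrow> near r (act g x) (act g y)"
  unfolding near_def by (auto simp: iso)

lemma act_inv:
  assumes "g \<in> carrier G" "x \<in> D"
  shows "act (inv g) (act g x) = x" "act g (act (inv g) x) = x"
  using act_mult[of "inv g" g x] act_mult[of g "inv g" x] assms act_one by auto

lemma orb_sub: "g \<in> carrier G \<Longrightarrow> C \<subseteq> D \<Longrightarrow> orb g C \<subseteq> D"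
  using act_closed by auto

lemma orb_one: "C \<subseteq> D \<Longrightarrow> orb \<one> C = C"
  using act_one by force

lemma orb_mult:
  assumes "g \<in> carrier G" "h \<in> carrier G" "C \<subseteq> D"
  shows "orb (g \<otimes> h) C = orb g (orb h C)"
proof -
  have "act (g \<otimes> h) x = act g (act h x)" if "x \<in> C" for x using assms that act_mult by blast
  then show ?thesis by (auto simp: image_image)
qed

lemma orb_inv: "g \<in> carrier G \<Longrightarrow> C \<subseteq> D \<Longrightarrow> orb (inv g) (orb g C) = C" "g \<in> carrier G \<Longrightarrow> C \<subseteq> D \<Longrightarrow> orb g (orb (inv g) C) = C"
  using orb_mult[of "inv g" g C] orb_mult[of g "inv g" C] orb_one by auto

lemma orb_D: "g \<in> carrier G \<Longrightarrow> orb g D = D"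
  using orb_sub[of g D] orb_sub[of "inv g" D] orb_inv(2)[of g D] by (metis image_mono inv_closed subset_antisym subset_refl)

lemma inj_act: "g \<in> carrier G \<Longrightarrow> inj_on (act g) D"
  by (rule inj_on_inverseI[of _ "act (inv g)"]) (simp add: act_inv)

lemma card_orb: "g \<in> carrier G \<Longrightarrow> C \<subseteq> D \<Longrightarrow> card (orb g C) = card C"
  by (meson card_image inj_act inj_on_subset)

lemma stab_subgroup: "C \<subseteq> D \<Longrightarrow> subgroup (stab C) G"
proof (rule subgroupI)
  assume C: "C \<subseteq> D"
  show "stab C \<noteq> {}" using orb_one[OF C] unfolding stab_def by blast
  fix g assume g: "g \<in> stab C"
  then show "inv g \<in> stab C" using orb_inv(1)[of g C] C unfolding stab_def by auto
  fix h assume "h \<in> stab C"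
  then show "g \<otimes> h \<in> stab C" using g orb_mult[of g h C] C unfolding stab_def by auto
qed (auto simp: stab_def)

lemma conjugators_stab:
  assumes g: "g \<in> carrier G" and C: "C \<subseteq> D"
  shows "conjugators G (stab C) g = {x \<in> carrier G. orb g (orb x C) = orb x C}"
proof -
  have "orb (inv x \<otimes> g \<otimes> x) C = C \<longleftrightarrow> orb g (orb x C) = orb x C" if x: "x \<in> carrier G" for x
  proof -
    have "orb (inv x \<otimes> g \<otimes> x) C = orb (inv x) (orb g (orb x C))"
      using x g C orb_sub by (simp add: orb_mult m_assoc)
    also have "\<dots> = C \<longleftrightarrow> orb g (orb x C) = orb x C"
      using x C g orb_inv orb_sub by metis
    finally show ?thesis .
  qed
  then have "inv x \<otimes> g \<otimes> x \<in> stab C \<longleftrightarrow> orb g (orb x C) = orb x C" if "x \<in> carrier G" for x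
    using that g unfolding stab_def by (simp only: mem_Collect_eq m_closed inv_closed simp_thms)
  then show ?thesis unfolding conjugators_def by blast
qed

lemma trunc_act: "g \<in> carrier G \<Longrightarrow> x \<in> D \<Longrightarrow> a \<in> D \<Longrightarrow> trunc r (act g x) (act g a) = trunc r x a"
  unfolding trunc_def using iso inj_act[of g] by (auto simp: inj_on_eq_iff)

lemma fixes_of_conj:
  assumes "x \<in> carrier G" "g \<in> carrier G"
  shows "orb x (fixes_of (inv x \<otimes> g \<otimes> x)) = fixes_of g"
proof -
  have e: "act (inv x \<otimes> g \<otimes> x) y = act (inv x) (act g (act x y))" if "y \<in> D" for y
    using assms that by (simp add: act_mult act_closed)
  have "act x y \<in> fixes_of g" if "y \<in> fixes_of (inv x \<otimes> g \<otimes> x)" for y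
  proof -
    have y: "y \<in> D" "act (inv x) (act g (act x y)) = y" using that e unfolding fixes_of_def by auto
    then have "act g (act x y) = act x y" using assms act_inv(2) act_closed by metis
    then show ?thesis using y assms act_closed unfolding fixes_of_def by auto
  qed
  moreover have "z \<in> orb x (fixes_of (inv x \<otimes> g \<otimes> x))" if "z \<in> fixes_of g" for z
  proof -
    have z: "z \<in> D" "act g z = z" using that unfolding fixes_of_def by auto
    then have "act (inv x) z \<in> fixes_of (inv x \<otimes> g \<otimes> x)"
      using assms e[of "act (inv x) z"] act_inv act_closed unfolding fixes_of_def by auto
    then show ?thesis using z assms act_inv(2)[of x z] by (metis imageI)
  qed
  ultimately show ?thesis by auto
qed

text \<open>The action carries the fixed points of the conjugate to those of \<open>g\<close> and
  preserves truncated distances.\<close>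

lemma level_conj:
  assumes x: "x \<in> carrier G" and g: "g \<in> carrier G" "g \<noteq> \<one>" and y: "y \<in> D"
  shows "level y r (inv x \<otimes> g \<otimes> x) = level (act x y) r g"
proof -
  have sub: "fixes_of (inv x \<otimes> g \<otimes> x) \<subseteq> D" unfolding fixes_of_def by auto
  have "(\<Sum>a\<in>fixes_of g. trunc r (act x y) a) = (\<Sum>a\<in>fixes_of (inv x \<otimes> g \<otimes> x). trunc r (act x y) (act x a))"
    unfolding fixes_of_conj[OF x g(1), symmetric]
    using inj_on_subset[OF inj_act[OF x] sub] by (simp add: sum.reindex)
  also have "\<dots> = (\<Sum>a\<in>fixes_of (inv x \<otimes> g \<otimes> x). trunc r y a)"
    using x y sub by (intro sum.cong refl trunc_act) auto
  finally show ?thesis using x g unfolding level_def by (simp add: c_conj)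
qed

section \<open>The tree of clusters\<close>

lemma cluster_sub: "C \<in> clusters \<Longrightarrow> C \<subseteq> D"
  unfolding clusters_def ball_def by auto

lemma cluster_nonempty: "C \<in> clusters \<Longrightarrow> C \<noteq> {}"
  unfolding clusters_def ball_def near_def by auto

lemma cluster_cases:
  assumes "C \<in> clusters"
  obtains x where "x \<in> D" "C = {x}" | x y where "x \<in> D" "y \<in> D" "x \<noteq> y" "C = ball x (d x y)"
  using assms unfolding clusters_def by auto

lemma ball_recenter:
  assumes "x \<in> D" "y \<in> ball x r"
  shows "ball y r = ball x r"
  using assms near_trans near_sym unfolding ball_def by blast

lemma orb_ball:
  assumes g: "g \<in> carrier G" and x: "x \<in> D"
  shows "orb g (ball x r) = ball (act g x) r"
proof
  show "orb g (ball x r) \<subseteq> ball (act g x) r"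
    using assms near_act act_closed unfolding ball_def by auto
  show "ball (act g x) r \<subseteq> orb g (ball x r)"
  proof
    fix z assume z: "z \<in> ball (act g x) r"
    then have zD: "z \<in> D" and n: "near r (act g x) z" unfolding ball_def by auto
    have "near r (act (inv g) (act g x)) (act (inv g) z)"
      using near_act[OF inv_closed[OF g] act_closed[OF g x] zD n] .
    then have "act (inv g) z \<in> ball x r"
      using act_inv(1)[OF g x] zD g act_closed unfolding ball_def by auto
    then show "z \<in> orb g (ball x r)" using act_inv(2)[OF g zD] by (metis imageI)
  qed
qed

lemma orb_cluster:
  assumes g: "g \<in> carrier G" and C: "C \<in> clusters"
  shows "orb g C \<in> clusters"
  using C
proof (cases rule: cluster_cases)
  case (1 x)
  then show ?thesis using act_closed[OF g] unfolding clusters_def by auto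
next
  case (2 x y)
  have "orb g C = ball (act g x) (d (act g x) (act g y))"
    using 2 orb_ball[OF g] iso[OF g] by simp
  moreover have "act g x \<noteq> act g y" using 2 inj_act[OF g] by (auto simp: inj_on_eq_iff)
  ultimately show ?thesis using 2 act_closed[OF g] unfolding clusters_def by blast
qed

lemma pair_sets_orb:
  assumes g: "g \<in> carrier G" and C: "C \<subseteq> D"
  shows "{d x y | x y. x \<in> orb g C \<and> y \<in> orb g C \<and> x \<noteq> y} = {d x y | x y. x \<in> C \<and> y \<in> C \<and> x \<noteq> y}"
    and "{d x y | x y. x \<in> orb g C \<and> y \<in> D - orb g C} = {d x y | x y. x \<in> C \<and> y \<in> D - C}"
proof -
  have i: "act g x = act g y \<longleftrightarrow> x = y" if "x \<in> D" "y \<in> D" for x y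
    using inj_act[OF g] that by (simp add: inj_on_eq_iff)
  have e: "d (act g x) (act g y) = d x y" if "x \<in> D" "y \<in> D" for x y using iso[OF g that] .
  have c: "D - orb g C = orb g (D - C)"
    using orb_D[OF g] inj_on_image_set_diff[OF inj_act[OF g], of D C] C by simp
  have im: "{d x y | x y. x \<in> orb g A \<and> y \<in> orb g B \<and> x \<noteq> y} = {d x y | x y. x \<in> A \<and> y \<in> B \<and> x \<noteq> y}"
    if AB: "A \<subseteq> D" "B \<subseteq> D" for A B
  proof (intro equalityI subsetI)
    fix t assume "t \<in> {d x y | x y. x \<in> orb g A \<and> y \<in> orb g B \<and> x \<noteq> y}"
    then obtain x y where xy: "x \<in> A" "y \<in> B" "act g x \<noteq> act g y" "t = d (act g x) (act g y)" by blast
    then have "x \<noteq> y" "t = d x y" using e AB by blast+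
    then show "t \<in> {d x y | x y. x \<in> A \<and> y \<in> B \<and> x \<noteq> y}" using xy by blast
  next
    fix t assume "t \<in> {d x y | x y. x \<in> A \<and> y \<in> B \<and> x \<noteq> y}"
    then obtain x y where xy: "x \<in> A" "y \<in> B" "x \<noteq> y" "t = d x y" by blast
    then have "act g x \<noteq> act g y" "t = d (act g x) (act g y)" using e i AB by (metis subsetD)+
    then show "t \<in> {d x y | x y. x \<in> orb g A \<and> y \<in> orb g B \<and> x \<noteq> y}" using xy by blast
  qed
  show "{d x y | x y. x \<in> orb g C \<and> y \<in> orb g C \<and> x \<noteq> y} = {d x y | x y. x \<in> C \<and> y \<in> C \<and> x \<noteq> y}"
    using im[OF C C] .
  have dj: "{d x y | x y. x \<in> A \<and> y \<in> D - A} = {d x y | x y. x \<in> A \<and> y \<in> D - A \<and> x \<noteq> y}" for A by blast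
  show "{d x y | x y. x \<in> orb g C \<and> y \<in> D - orb g C} = {d x y | x y. x \<in> C \<and> y \<in> D - C}"
    unfolding dj unfolding c using im[OF C, of "D - C"] by blast
qed

lemma outer_orb: "g \<in> carrier G \<Longrightarrow> C \<subseteq> D \<Longrightarrow> outer (orb g C) = outer C"
  unfolding outer_def by (simp only: pair_sets_orb(2))

lemma orb_eq_D: "g \<in> carrier G \<Longrightarrow> C \<subseteq> D \<Longrightarrow> orb g C = D \<longleftrightarrow> C = D"
  using orb_D orb_inv(1) by (metis inv_closed)

lemma radius_orb: "g \<in> carrier G \<Longrightarrow> C \<subseteq> D \<Longrightarrow> radius (orb g C) = radius C"
  unfolding radius_def by (simp only: pair_sets_orb(1) card_orb outer_orb orb_eq_D)

lemma outer_ge: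
  assumes "C \<subseteq> D" "x \<in> C" "y \<in> D - C"
  shows "d x y \<le> outer C"
proof -
  have "{d x y | x y. x \<in> C \<and> y \<in> D - C} \<subseteq> (\<lambda>(x,y). d x y) ` (D \<times> D)" using assms(1) by auto
  then have "finite {d x y | x y. x \<in> C \<and> y \<in> D - C}" using finD by (meson finite_SigmaI finite_imageI finite_subset)
  then show ?thesis unfolding outer_def using assms by (intro Max_ge) auto
qed

lemma outer_attained:
  assumes "C \<subseteq> D" "C \<noteq> {}" "C \<noteq> D"
  obtains x y where "x \<in> C" "y \<in> D - C" "outer C = d x y"
proof -
  have "{d x y | x y. x \<in> C \<and> y \<in> D - C} \<subseteq> (\<lambda>(x,y). d x y) ` (D \<times> D)" using assms(1) by auto
  then have f: "finite {d x y | x y. x \<in> C \<and> y \<in> D - C}" using finD by (meson finite_SigmaI finite_imageI finite_subset)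
  have "{d x y | x y. x \<in> C \<and> y \<in> D - C} \<noteq> {}" using assms by auto
  then have "outer C \<in> {d x y | x y. x \<in> C \<and> y \<in> D - C}" unfolding outer_def by (intro Max_in f)
  then show ?thesis using that by blast
qed

text \<open>The isosceles principle: two points of a ball are closer to each other than to any point
  outside, so an outside point has the same distance from both.\<close>

lemma cluster_far:
  assumes C: "C \<in> clusters" and "x \<in> C" "x' \<in> C" "y \<in> D - C"
  shows "d x y = d x' y"
  using C
proof (cases rule: cluster_cases)
  case (2 a b)
  let ?r = "d a b"
  have xD: "x \<in> D" "x' \<in> D" using assms cluster_sub by auto
  have "x \<in> ball a ?r" "x' \<in> ball a ?r" using assms(2,3) 2(4) by blast+
  then have "ball x ?r = ball a ?r" "ball x' ?r = ball a ?r" using ball_recenter[OF 2(1)] by blast+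
  then have e: "C = ball x ?r" "C = ball x' ?r" using 2(4) by blast+
  have "y \<notin> ball x ?r" "y \<notin> ball x' ?r" "y \<in> D" using assms(4) e by blast+
  then have lt: "d x y < ?r" "d x' y < ?r" "x \<noteq> y" "x' \<noteq> y" unfolding in_ball by auto
  have "x' \<in> ball x ?r" using assms(3) e(1) by blast
  then have "x = x' \<or> ?r \<le> d x x'" unfolding in_ball by blast
  then show ?thesis
  proof
    assume r: "?r \<le> d x x'"
    show ?thesis
    proof (cases "x = x'")
      case False
      have "min (d x x') (d x' y) \<le> d x y" using ultra[of x x' y] xD assms(4) lt False by auto
      moreover have "min (d x' x) (d x y) \<le> d x' y" using ultra[of x' x y] xD assms(4) lt False by auto
      ultimately show ?thesis using r lt d_sym[of x x'] by auto
    qed auto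
  qed auto
qed (use assms in auto)

lemma parent_ball:
  assumes C: "C \<in> clusters" and x: "x \<in> C"
  shows "parent C = ball x (outer C) \<union> C"
proof
  have CD: "C \<subseteq> D" using cluster_sub[OF C] .
  show "parent C \<subseteq> ball x (outer C) \<union> C"
  proof
    fix z assume "z \<in> parent C"
    then obtain x' where z: "z \<in> D" "x' \<in> C" "near (outer C) x' z" unfolding parent_def by auto
    show "z \<in> ball x (outer C) \<union> C"
    proof (cases "z \<in> C")
      case False
      then have "d x z = d x' z" using cluster_far[OF C x z(2)] z(1) by auto
      then show ?thesis using z False unfolding ball_def near_def by auto
    qed auto
  qed
  show "ball x (outer C) \<union> C \<subseteq> parent C" using x CD unfolding ball_def parent_def near_def by auto
qed

lemma radius_ball:
  assumes "x \<in> D" "y \<in> D" "x \<noteq> y"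
  shows "radius (ball x (d x y)) = d x y" "1 < card (ball x (d x y))"
proof -
  let ?C = "ball x (d x y)"
  have CD: "?C \<subseteq> D" unfolding ball_def by auto
  have xy: "x \<in> ?C" "y \<in> ?C" using assms unfolding ball_def near_def by auto
  have "{x,y} \<subseteq> ?C" using xy by auto
  then have "card {x,y} \<le> card ?C" using finite_subset[OF CD finD] by (intro card_mono)
  then show c: "1 < card ?C" using assms by simp
  have "{d x y | x y. x \<in> ?C \<and> y \<in> ?C \<and> x \<noteq> y} \<subseteq> (\<lambda>(x,y). d x y) ` (D \<times> D)" using CD by auto
  then have f: "finite {d x y | x y. x \<in> ?C \<and> y \<in> ?C \<and> x \<noteq> y}" using finD by (meson finite_SigmaI finite_imageI finite_subset)
  have "Min {d x y | x y. x \<in> ?C \<and> y \<in> ?C \<and> x \<noteq> y} = d x y"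
  proof (rule Min_eqI[OF f])
    show "d x y \<in> {d x y | x y. x \<in> ?C \<and> y \<in> ?C \<and> x \<noteq> y}" using xy assms by blast
    fix t assume "t \<in> {d x y | x y. x \<in> ?C \<and> y \<in> ?C \<and> x \<noteq> y}"
    then obtain a b where ab: "t = d a b" "a \<in> ?C" "b \<in> ?C" "a \<noteq> b" by auto
    then have "b \<in> ball a (d x y)" using ball_recenter[OF assms(1) ab(2)] by blast
    then show "d x y \<le> t" using ab(1,4) unfolding in_ball by auto
  qed
  then show "radius ?C = d x y" unfolding radius_def using c by simp
qed

text \<open>The radius is attained from every centre \<open>x\<close>. If all other points of the
  ball were strictly closer to \<open>x\<close>, then the two points \<open>a\<close> and
  \<open>b\<close> that define the radius would be strictly closer to each other.\<close>

lemma big_cluster: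
  assumes C: "C \<in> clusters" "1 < card C" and x: "x \<in> C"
  obtains y where "y \<in> C" "y \<noteq> x" "radius C = d x y" "C = ball x (d x y)"
  using C(1)
proof (cases rule: cluster_cases)
  case (2 a b)
  have r: "radius C = d a b" using radius_ball(1)[OF 2(1-3)] 2(4) by blast
  have "x \<in> ball a (d a b)" using x 2(4) by blast
  then have "ball x (d a b) = ball a (d a b)" by (rule ball_recenter[OF 2(1)])
  then have e: "C = ball x (d a b)" using 2(4) by blast
  have "a \<in> ball a (d a b)" "b \<in> ball a (d a b)" using 2(1,2) unfolding in_ball by auto
  then have aC: "a \<in> C" "b \<in> C" using 2(4) by blast+
  have aD: "x \<in> D" using x cluster_sub[OF C(1)] by auto
  have "\<exists>y\<in>C. y \<noteq> x \<and> d x y = d a b"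
  proof (rule ccontr)
    assume n: "\<not> ?thesis"
    have g: "d a b < d x y" if "y \<in> C" "y \<noteq> x" for y
    proof -
      have "y \<in> ball x (d a b)" using that(1) e by blast
      then have "d a b \<le> d x y" using that(2) unfolding in_ball by auto
      moreover have "d x y \<noteq> d a b" using n that by blast
      ultimately show ?thesis by simp
    qed
    have "a \<noteq> x" using n aC(2) 2(3) by metis
    moreover have "b \<noteq> x" using n aC(1) 2(3) d_sym[of a b] by metis
    ultimately have "a \<noteq> x" "b \<noteq> x" by auto
    then have "d a b < min (d a x) (d x b)" using g aC d_sym[of a x] by auto
    also have "\<dots> \<le> d a b" using ultra[of a x b] 2 aD \<open>a \<noteq> x\<close> \<open>b \<noteq> x\<close> by auto
    finally show False by simp
  qed
  then obtain y where "y \<in> C" "y \<noteq> x" "d x y = d a b" by blast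
  then show ?thesis using that[of y] r e by simp
qed (use C(2) in auto)

lemma card_cluster: "C \<in> clusters \<Longrightarrow> card C = 1 \<or> 1 < card C"
proof -
  assume C: "C \<in> clusters"
  have "card C \<noteq> 0" using cluster_nonempty[OF C] finite_subset[OF cluster_sub[OF C] finD] by auto
  then show ?thesis by auto
qed

lemma singleton_cluster: "x \<in> D \<Longrightarrow> {x} \<in> clusters"
  unfolding clusters_def by auto

lemma outer_lt_radius:
  assumes C: "C \<in> clusters" "1 < card C" "C \<noteq> D"
  shows "outer C < radius C"
proof -
  obtain x y where xy: "x \<in> C" "y \<in> D - C" "outer C = d x y"
    using outer_attained[OF cluster_sub cluster_nonempty] C by blast
  obtain z where z: "radius C = d x z" "C = ball x (d x z)" using big_cluster[OF C(1,2) xy(1)] by metis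
  have "y \<in> D" "y \<notin> ball x (d x z)" using xy(2) z(2) by blast+
  then show ?thesis unfolding in_ball xy(3) z(1) by auto
qed

lemma radius_near:
  assumes C: "C \<in> clusters" and "x \<in> C" "y \<in> C"
  shows "near (radius C) x y"
proof (cases "1 < card C")
  case True
  obtain z where "radius C = d x z" "C = ball x (d x z)" using big_cluster[OF C True assms(2)] by metis
  then have "y \<in> ball x (radius C)" using assms(3) by simp
  then show ?thesis unfolding in_ball near_def by blast
next
  case False
  then have "card C = 1" using card_cluster[OF C] by auto
  then have "x = y" using assms by (auto simp: card_1_singleton_iff)
  then show ?thesis unfolding near_def by simp
qed

lemma parent_props:
  assumes C: "C \<in> clusters" "C \<noteq> D"
  shows "C \<subset> parent C" "parent C \<in> clusters" "1 < card (parent C)" "radius (parent C) = outer C"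
    "\<And>x. x \<in> C \<Longrightarrow> parent C = ball x (outer C)"
proof -
  have CD: "C \<subseteq> D" using cluster_sub[OF C(1)] .
  \<comment> \<open>The points of \<open>C\<close> are within \<open>outer C\<close> of each other,
    so the union in \<open>parent_ball\<close> reduces to the ball.\<close>
  have le: "near (outer C) x z" if "x \<in> C" "z \<in> C" for x z
  proof (cases "1 < card C")
    case True
    show ?thesis
      by (rule near_mono[OF radius_near[OF C(1) that] less_imp_le[OF outer_lt_radius[OF C(1) True C(2)]]])
  next
    case False
    then have "card C = 1" using card_cluster[OF C(1)] by auto
    then obtain w where "C = {w}" using card_1_singletonE by blast
    then show ?thesis using that unfolding near_def by blast
  qed
  show pb: "parent C = ball x (outer C)" if "x \<in> C" for x
    using parent_ball[OF C(1) that] le[OF that] CD unfolding ball_def by blast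
  obtain x y where xy: "x \<in> C" "y \<in> D - C" "outer C = d x y"
    using outer_attained[OF CD cluster_nonempty] C by blast
  have e: "parent C = ball x (d x y)" using pb[OF xy(1)] xy(3) by simp
  have ne: "x \<in> D" "y \<in> D" "x \<noteq> y" using xy CD by auto
  show "parent C \<in> clusters" unfolding e clusters_def using ne by blast
  show "1 < card (parent C)" "radius (parent C) = outer C" unfolding e xy(3) using radius_ball[OF ne] by blast+
  have "y \<in> parent C" unfolding e in_ball using ne by blast
  moreover have "C \<subseteq> parent C" unfolding parent_ball[OF C(1) xy(1)] by blast
  ultimately show "C \<subset> parent C" using xy(2) by blast
qed

text \<open>\<open>C'\<close> contains a point outside \<open>C\<close>, so its radius is at most
  \<open>outer C\<close>, and \<open>C'\<close> contains the whole ball of radius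
  \<open>outer C\<close>.\<close>

lemma parent_least:
  assumes C: "C \<in> clusters" and C': "C' \<in> clusters" and "C \<subset> C'"
  shows "C \<noteq> D" "parent C \<subseteq> C'"
proof -
  show CD: "C \<noteq> D" using assms(3) cluster_sub[OF C'] by blast
  obtain x where x: "x \<in> C" using cluster_nonempty[OF C] by auto
  obtain z where z: "z \<in> C'" "z \<notin> C" using assms(3) by auto
  have "x \<noteq> z" using x z by auto
  have "card C' \<noteq> 1"
  proof
    assume "card C' = 1"
    then obtain w where "C' = {w}" using card_1_singletonE by blast
    then show False using x z assms(3) by blast
  qed
  then have c: "1 < card C'" using card_cluster[OF C'] by auto
  obtain y where y: "C' = ball x (d x y)" using big_cluster[OF C' c, of x] x assms(3) by blast
  have "z \<in> ball x (d x y)" using z(1) y by blast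
  then have "d x y \<le> d x z" using \<open>x \<noteq> z\<close> unfolding in_ball by blast
  also have "\<dots> \<le> outer C" using outer_ge[OF cluster_sub[OF C] x, of z] z cluster_sub[OF C'] by auto
  finally have "d x y \<le> outer C" .
  then have "ball x (outer C) \<subseteq> ball x (d x y)" unfolding ball_def near_def by auto
  then show "parent C \<subseteq> C'" unfolding parent_props(5)[OF C CD x] using y by blast
qed

lemma clusters_chain:
  assumes C: "C \<in> clusters" and C': "C' \<in> clusters" and x: "x \<in> C" "x \<in> C'"
  shows "C \<subseteq> C' \<or> C' \<subseteq> C"
proof -
  consider "card C = 1" | "card C' = 1" | "1 < card C" "1 < card C'" using card_cluster C C' by blast
  then show ?thesis
  proof cases
    case 3
    obtain y where y: "C = ball x (d x y)" using big_cluster[OF C 3(1) x(1)] by metis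
    obtain z where z: "C' = ball x (d x z)" using big_cluster[OF C' 3(2) x(2)] by metis
    have "d x y \<le> d x z \<or> d x z \<le> d x y" by linarith
    then have "ball x (d x z) \<subseteq> ball x (d x y) \<or> ball x (d x y) \<subseteq> ball x (d x z)"
      unfolding ball_def near_def by (blast intro: order_trans)
    then show ?thesis using y z by blast
  qed (use x in \<open>auto simp: card_1_singleton_iff\<close>)
qed

text \<open>Translates of a cluster have equally many points, so one common point makes them equal.
  In particular an element that maps some point of a cluster into the cluster stabilizes it.\<close>

lemma clusters_eq:
  assumes "C \<in> clusters" "C' \<in> clusters" "x \<in> C" "x \<in> C'" "card C = card C'"
  shows "C = C'"
  using clusters_chain[OF assms(1-4)] assms(5) finite_subset[OF cluster_sub finD] assms(1,2)
  by (metis card_subset_eq)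

lemma parent_orb:
  assumes g: "g \<in> carrier G" and C: "C \<in> clusters" "C \<noteq> D"
  shows "parent (orb g C) = orb g (parent C)"
proof -
  obtain x where x: "x \<in> C" using cluster_nonempty[OF C(1)] by auto
  have xD: "x \<in> D" using x cluster_sub[OF C(1)] by auto
  have "parent (orb g C) = ball (act g x) (outer (orb g C))"
    using parent_props(5)[OF orb_cluster[OF g C(1)]] orb_eq_D[OF g cluster_sub[OF C(1)]] C(2) x by blast
  then show ?thesis
    unfolding parent_props(5)[OF C x] orb_ball[OF g xD] outer_orb[OF g cluster_sub[OF C(1)]] .
qed

text \<open>A child through \<open>x\<close> is a proper subcluster containing \<open>x\<close> with
  as many points as possible; \<open>{x}\<close> shows that there are candidates.\<close>

lemma child_exists:
  assumes C: "C \<in> clusters" "1 < card C" and x: "x \<in> C"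
  obtains W where "W \<in> clusters" "x \<in> W" "W \<noteq> D" "parent W = C"
proof -
  define S where "S = {W \<in> clusters. x \<in> W \<and> W \<subset> C}"
  have xD: "x \<in> D" using x cluster_sub[OF C(1)] by auto
  have "{x} \<in> S" unfolding S_def using singleton_cluster[OF xD] x C(2) by auto
  then have ne: "card ` S \<noteq> {}" by blast
  have "S \<subseteq> Pow D" unfolding S_def using cluster_sub by blast
  then have fS: "finite (card ` S)" using finD by (intro finite_imageI) (auto intro: finite_subset)
  obtain W where W: "W \<in> S" "card W = Max (card ` S)" using Max_in[OF fS ne] by (metis imageE)
  have W2: "card W' \<le> card W" if "W' \<in> S" for W' using Max_ge[OF fS imageI[OF that]] W(2) by simp
  have WC: "W \<in> clusters" "x \<in> W" "W \<subset> C" using W(1) unfolding S_def by auto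
  note p = parent_least[OF WC(1) C(1) WC(3)]
  note q = parent_props[OF WC(1) p(1)]
  have "parent W = C"
  proof (rule ccontr)
    assume "parent W \<noteq> C"
    then have "parent W \<in> S" using p q WC unfolding S_def by auto
    then have "card (parent W) \<le> card W" by (rule W2)
    moreover have "card W < card (parent W)"
      using q(1) finite_subset[OF cluster_sub[OF q(2)] finD] by (intro psubset_card_mono)
    ultimately show False by simp
  qed
  then show ?thesis using that WC p by blast
qed

lemma D_cluster: "D \<in> clusters"
proof -
  obtain x where x: "x \<in> D" using D_nonempty by auto
  show ?thesis
  proof (cases "D = {x}")
    case True
    then show ?thesis using singleton_cluster[OF x] by simp
  next
    case False
    then have ne: "d x ` (D - {x}) \<noteq> {}" using x by auto
    have f: "finite (d x ` (D - {x}))" using finD by auto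
    obtain y where y: "y \<in> D - {x}" "d x y = Min (d x ` (D - {x}))"
      using Min_in[OF f ne] by (metis imageE)
    have "ball x (d x y) = D" unfolding ball_def near_def using y(2) Min_le[OF f] by auto
    then show ?thesis unfolding clusters_def using x y(1) by blast
  qed
qed

lemma stab_D: "stab D = carrier G"
  unfolding stab_def using orb_D by auto

lemma stab_parent:
  assumes "C \<in> clusters" "C \<noteq> D"
  shows "stab C \<subseteq> stab (parent C)"
proof
  fix g assume "g \<in> stab C"
  then have g: "g \<in> carrier G" "orb g C = C" unfolding stab_def by auto
  then have "orb g (parent C) = parent C" using parent_orb[OF g(1) assms] by simp
  then show "g \<in> stab (parent C)" unfolding stab_def using g(1) by blast
qed

section \<open>Orbits of clusters\<close>

lemma finite_clusters: "finite clusters"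
  using finD cluster_sub by (auto intro: finite_subset[of _ "Pow D"])

lemma finite_stab: "finite (stab C)" unfolding stab_def using fin by auto

lemma card_stab: "C \<subseteq> D \<Longrightarrow> 0 < card (stab C)"
  using subgroup.one_closed[OF stab_subgroup] finite_stab card_gt_0_iff by blast

text \<open>The choice is made from the set of all translates of \<open>C\<close> and so depends
  only on the orbit. The chosen clusters serve as vertices of the tree.\<close>

definition rep :: "'x set \<Rightarrow> 'x set" where "rep C = (SOME C'. \<exists>g\<in>carrier G. C' = orb g C)"

definition reps :: "'x set set" where "reps = rep ` clusters"

definition saturation :: "'x set \<Rightarrow> 'x set" where "saturation C = (\<Union>g\<in>carrier G. orb g C)"

lemma rep_orb:
  assumes "C \<in> clusters"
  obtains g where "g \<in> carrier G" "rep C = orb g C"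
proof -
  have "\<exists>C'. \<exists>g\<in>carrier G. C' = orb g C" using one_closed by blast
  from someI_ex[OF this] show ?thesis using that unfolding rep_def by blast
qed

lemma rep_of_orb:
  assumes g: "g \<in> carrier G" and C: "C \<in> clusters"
  shows "rep (orb g C) = rep C"
proof -
  have CD: "C \<subseteq> D" using cluster_sub[OF C] .
  have "(\<exists>h\<in>carrier G. C' = orb h (orb g C)) \<longleftrightarrow> (\<exists>h\<in>carrier G. C' = orb h C)" for C'
  proof
    assume "\<exists>h\<in>carrier G. C' = orb h (orb g C)"
    then obtain h where h: "h \<in> carrier G" "C' = orb h (orb g C)" by blast
    then have "C' = orb (h \<otimes> g) C" using orb_mult[OF h(1) g CD] by simp
    then show "\<exists>h\<in>carrier G. C' = orb h C" using h(1) g by blast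
  next
    assume "\<exists>h\<in>carrier G. C' = orb h C"
    then obtain h where h: "h \<in> carrier G" "C' = orb h C" by blast
    have "orb (h \<otimes> inv g) (orb g C) = orb h (orb (inv g) (orb g C))"
      using orb_mult[OF h(1) inv_closed[OF g] orb_sub[OF g CD]] .
    also have "\<dots> = C'" using orb_inv(1)[OF g CD] h(2) by simp
    finally show "\<exists>h\<in>carrier G. C' = orb h (orb g C)" using h(1) g by blast
  qed
  then show ?thesis unfolding rep_def by simp
qed

lemma rep_cluster: "C \<in> clusters \<Longrightarrow> rep C \<in> clusters"
  using rep_orb orb_cluster by metis

lemma rep_rep: "C \<in> clusters \<Longrightarrow> rep (rep C) = rep C"
  by (metis rep_orb rep_of_orb)

lemma rep_eq_orb:
  assumes C: "C \<in> clusters" and C': "C' \<in> clusters" and "rep C = rep C'"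
  obtains g where "g \<in> carrier G" "C' = orb g C"
proof -
  obtain h where h: "h \<in> carrier G" "rep C = orb h C" using rep_orb[OF C] .
  obtain k where k: "k \<in> carrier G" "rep C' = orb k C'" using rep_orb[OF C'] .
  have "C' = orb (inv k) (orb k C')" using orb_inv(1)[OF k(1) cluster_sub[OF C']] by simp
  also have "\<dots> = orb (inv k) (orb h C)" using h k assms(3) by simp
  also have "\<dots> = orb (inv k \<otimes> h) C" using orb_mult[OF inv_closed[OF k(1)] h(1) cluster_sub[OF C]] by simp
  finally show ?thesis using that h k by blast
qed

lemma reps_clusters: "reps \<subseteq> clusters"
  unfolding reps_def using rep_cluster by auto

lemma reps_fixed: "C \<in> reps \<Longrightarrow> rep C = C"
  unfolding reps_def using rep_rep by auto

lemma rep_in_reps: "C \<in> clusters \<Longrightarrow> rep C \<in> reps"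
  unfolding reps_def by auto

lemma finite_reps: "finite reps"
  using finite_subset[OF reps_clusters finite_clusters] .

lemma rep_D: "rep D = D"
  using rep_orb[OF D_cluster] orb_D by metis

lemma D_reps: "D \<in> reps"
  using rep_in_reps[OF D_cluster] rep_D by simp

lemma rep_eq_D: "C \<in> clusters \<Longrightarrow> rep C = D \<longleftrightarrow> C = D"
  using rep_orb[of C] orb_eq_D[OF _ cluster_sub] rep_D by metis

lemma card_rep: "C \<in> clusters \<Longrightarrow> card (rep C) = card C"
  by (metis rep_orb card_orb cluster_sub)

lemma radius_rep: "C \<in> clusters \<Longrightarrow> radius (rep C) = radius C"
  by (metis rep_orb radius_orb cluster_sub)

lemma saturation_orb:
  assumes g: "g \<in> carrier G" and C: "C \<subseteq> D"
  shows "saturation (orb g C) = saturation C"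
proof -
  have sub: "saturation (orb g C) \<subseteq> saturation C" if "g \<in> carrier G" "C \<subseteq> D" for g C
  proof
    fix x assume "x \<in> saturation (orb g C)"
    then obtain h where h: "h \<in> carrier G" "x \<in> orb h (orb g C)" unfolding saturation_def by blast
    then have "x \<in> orb (h \<otimes> g) C" using orb_mult[OF h(1) that] by simp
    then show "x \<in> saturation C" unfolding saturation_def using h that by blast
  qed
  have "saturation (orb (inv g) (orb g C)) \<subseteq> saturation (orb g C)"
    using sub[OF inv_closed[OF g] orb_sub[OF g C]] .
  then show ?thesis using sub[OF g C] orb_inv(1)[OF g C] by auto
qed

lemma saturation_rep: "C \<in> clusters \<Longrightarrow> saturation (rep C) = saturation C"
  by (metis rep_orb saturation_orb cluster_sub)

lemma saturation_sub: "C \<subseteq> D \<Longrightarrow> saturation C \<subseteq> D"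
  unfolding saturation_def using orb_sub by blast

lemma saturation_D: "saturation D = D"
  unfolding saturation_def using orb_D one_closed by blast

lemma in_saturation: "C \<subseteq> D \<Longrightarrow> x \<in> C \<Longrightarrow> x \<in> saturation C"
  unfolding saturation_def using orb_one[of C] one_closed by blast

lemma fixes_of_sub: "fixes_of g \<subseteq> D" unfolding fixes_of_def by auto

lemma finite_fixes: "finite (fixes_of g)" using finite_subset[OF fixes_of_sub finD] .

text \<open>All translates through \<open>y\<close> coincide, so the elements in question form one
  coset \<open>x0 (stab C)\<close>.\<close>

lemma card_transporter:
  assumes C: "C \<in> clusters" and y: "y \<in> saturation C"
  shows "card {x \<in> carrier G. y \<in> orb x C} = card (stab C)"
proof -
  have CD: "C \<subseteq> D" using cluster_sub[OF C] .
  obtain x0 where x0: "x0 \<in> carrier G" "y \<in> orb x0 C" using y unfolding saturation_def by blast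
  have eq: "orb x C = orb x0 C" if "x \<in> carrier G" "y \<in> orb x C" for x
    using clusters_eq[OF orb_cluster[OF that(1) C] orb_cluster[OF x0(1) C] that(2) x0(2)]
      card_orb[OF that(1) CD] card_orb[OF x0(1) CD] by simp
  have "bij_betw (\<lambda>k. x0 \<otimes> k) (stab C) {x \<in> carrier G. y \<in> orb x C}"
  proof (rule bij_betw_byWitness[where f' = "\<lambda>x. inv x0 \<otimes> x"])
    show "\<forall>a\<in>stab C. inv x0 \<otimes> (x0 \<otimes> a) = a" using x0 unfolding stab_def by (auto simp flip: m_assoc)
    show "\<forall>a'\<in>{x \<in> carrier G. y \<in> orb x C}. x0 \<otimes> (inv x0 \<otimes> a') = a'" using x0 by (auto simp flip: m_assoc)
    show "(\<lambda>k. x0 \<otimes> k) ` stab C \<subseteq> {x \<in> carrier G. y \<in> orb x C}"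
      using x0 orb_mult[OF x0(1) _ CD] unfolding stab_def by auto
    show "(\<lambda>x. inv x0 \<otimes> x) ` {x \<in> carrier G. y \<in> orb x C} \<subseteq> stab C"
    proof
      fix z assume "z \<in> (\<lambda>x. inv x0 \<otimes> x) ` {x \<in> carrier G. y \<in> orb x C}"
      then obtain x where x: "x \<in> carrier G" "y \<in> orb x C" and z: "z = inv x0 \<otimes> x" by blast
      have "orb (inv x0 \<otimes> x) C = orb (inv x0) (orb x C)" using orb_mult[OF inv_closed[OF x0(1)] x(1) CD] .
      also have "\<dots> = C" using eq[OF x] orb_inv(1)[OF x0(1) CD] by simp
      finally show "z \<in> stab C" using x0 x z unfolding stab_def by auto
    qed
  qed
  then show ?thesis by (rule bij_betw_same_card[symmetric])
qed

text \<open>Double count of the pairs \<open>(x, y)\<close> with \<open>y\<close> fixed by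
  \<open>g\<close> and contained in \<open>x C\<close>: every \<open>y\<close> in the saturation
  occurs with \<open>card (stab C)\<close> elements \<open>x\<close>.\<close>

lemma sum_fixed_in_orbit:
  assumes C: "C \<in> clusters"
  shows "(\<Sum>x\<in>carrier G. card (fixes_of g \<inter> orb x C)) = card (stab C) * card (fixes_of g \<inter> saturation C)"
proof -
  have "(\<Sum>x\<in>carrier G. card (fixes_of g \<inter> orb x C)) = (\<Sum>x\<in>carrier G. \<Sum>y\<in>fixes_of g. if y \<in> orb x C then 1 else 0)"
    using finite_fixes by (simp add: sum.If_cases)
  also have "\<dots> = (\<Sum>y\<in>fixes_of g. \<Sum>x\<in>carrier G. if y \<in> orb x C then 1 else 0)" by (rule sum.swap)
  also have "\<dots> = (\<Sum>y\<in>fixes_of g. card {x \<in> carrier G. y \<in> orb x C})"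
    using fin by (simp add: sum.If_cases Int_def)
  also have "\<dots> = (\<Sum>y\<in>fixes_of g. if y \<in> saturation C then card (stab C) else 0)"
  proof (intro sum.cong refl)
    fix y assume "y \<in> fixes_of g"
    show "card {x \<in> carrier G. y \<in> orb x C} = (if y \<in> saturation C then card (stab C) else 0)"
      using card_transporter[OF C, of y] unfolding saturation_def by (auto simp: card_eq_0_iff)
  qed
  also have "\<dots> = card (stab C) * card (fixes_of g \<inter> saturation C)"
    using finite_fixes by (simp add: sum.If_cases)
  finally show ?thesis .
qed

text \<open>For the saturation of a cluster this is the Artin character of the edge into it: minus
  the number of fixed points beyond the edge, completed to sum zero.\<close>

definition fixed_char :: "'x set \<Rightarrow> 'a \<Rightarrow> complex" where
  "fixed_char S = zero_sum G (\<lambda>g. - of_nat (card (fixes_of g \<inter> S)))"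

text \<open>An element conjugating \<open>h\<close> into the stabilizer of \<open>b\<close> is an
  \<open>x\<close> for which \<open>h\<close> fixes \<open>x b\<close>, and each fixed point in the
  orbit arises from \<open>card (stab {b})\<close> such \<open>x\<close>.\<close>

lemma fixed_char_singleton:
  assumes b: "b \<in> D" and g: "g \<in> carrier G"
  shows "fixed_char (saturation {b}) g = induced_char G (stab {b}) (u_char (G\<lparr>carrier := stab {b}\<rparr>)) g"
proof -
  have bc: "{b} \<in> clusters" using singleton_cluster[OF b] .
  have bD: "{b} \<subseteq> D" using b by auto
  show ?thesis
    unfolding fixed_char_def induced_u_zero_sum[OF stab_subgroup[OF bD] fin g]
  proof (rule zero_sum_cong[OF _ g])
    fix h assume h: "h \<in> carrier G" "h \<noteq> \<one>"
    have "card (conjugators G (stab {b}) h) = (\<Sum>x\<in>carrier G. if orb h (orb x {b}) = orb x {b} then 1 else 0)"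
      using fin by (simp add: conjugators_stab[OF h(1) bD] sum.If_cases Int_def)
    also have "\<dots> = (\<Sum>x\<in>carrier G. card (fixes_of h \<inter> orb x {b}))"
    proof (intro sum.cong refl)
      fix x assume "x \<in> carrier G"
      then have "act x b \<in> D" using act_closed b by blast
      then show "(if orb h (orb x {b}) = orb x {b} then 1 else 0) = card (fixes_of h \<inter> orb x {b})"
        unfolding fixes_of_def by (auto simp: card_eq_0_iff)
    qed
    also have "\<dots> = card (stab {b}) * card (fixes_of h \<inter> saturation {b})" by (rule sum_fixed_in_orbit[OF bc])
    finally show "- of_nat (card (fixes_of h \<inter> saturation {b})) = - of_nat (card (conjugators G (stab {b}) h)) / (of_nat (card (stab {b})) :: complex)"
      using card_stab[OF bD] by simp
  qed
qed

text \<open>An invariant set is a disjoint union of orbits, and the orbit of \<open>b\<close>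
  contributes the augmentation character induced from the stabilizer of \<open>b\<close>.\<close>

lemma fixed_char_true:
  assumes "S \<subseteq> D" "\<And>g x. g \<in> carrier G \<Longrightarrow> x \<in> S \<Longrightarrow> act g x \<in> S"
  shows "fixed_char S \<in> true_characters G"
  using assms
proof (induction "card S" arbitrary: S rule: less_induct)
  case less
  have fS: "finite S" using less.prems(1) finD finite_subset by auto
  show ?case
  proof (cases "S = {}")
    case True
    have "fixed_char S = (\<lambda>g. 0)" unfolding fixed_char_def True by (auto simp: zero_sum_def)
    then show ?thesis using true_characters_zero by simp
  next
    case False
    then obtain b where b: "b \<in> S" by auto
    have bD: "b \<in> D" "{b} \<subseteq> D" using b less.prems(1) by auto
    let ?O = "saturation {b}"
    have OS: "?O \<subseteq> S" unfolding saturation_def using less.prems(2) b by auto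
    have bO: "b \<in> ?O" using in_saturation[OF bD(2)] by simp
    have st: "act g x \<in> S - ?O" if g: "g \<in> carrier G" and x: "x \<in> S - ?O" for g x
    proof -
      have xD: "x \<in> D" using x less.prems(1) by auto
      have "act g x \<notin> ?O"
      proof
        assume "act g x \<in> ?O"
        then obtain h where h: "h \<in> carrier G" "act g x = act h b" unfolding saturation_def by auto
        have "x = act (inv g) (act h b)" using act_inv(1)[OF g xD] h(2) by simp
        also have "\<dots> = act (inv g \<otimes> h) b" using act_mult[OF inv_closed[OF g] h(1) bD(1)] by simp
        finally have "x \<in> ?O" unfolding saturation_def using g h by blast
        then show False using x by simp
      qed
      then show ?thesis using less.prems(2)[OF g] x by auto
    qed
    have "card (S - ?O) < card S" using b bO fS by (intro psubset_card_mono) auto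
    then have IH: "fixed_char (S - ?O) \<in> true_characters G"
      using less.hyps[of "S - ?O"] less.prems(1) st by blast
    have e: "fixed_char (S - ?O) g + induced_char G (stab {b}) (u_char (G\<lparr>carrier := stab {b}\<rparr>)) g = fixed_char S g"
      if g: "g \<in> carrier G" for g
    proof -
      have "card (fixes_of h \<inter> S) = card (fixes_of h \<inter> (S - ?O)) + card (fixes_of h \<inter> ?O)" for h
        using OS finite_fixes[of h] by (subst card_Un_disjoint[symmetric]) (auto intro!: arg_cong[of _ _ card])
      then show ?thesis
        unfolding fixed_char_singleton[OF bD(1) g, symmetric]
        unfolding fixed_char_def zero_sum_add[symmetric] by simp
    qed
    show ?thesis
      by (rule true_characters_cong[OF true_characters_add[OF IH induced_u_true_character[OF stab_subgroup[OF bD(2)] fin]] e])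
  qed
qed

text \<open>The pair \<open>(P, s)\<close> is either the parent cluster of \<open>C\<close> with its radius, or \<open>(D, 0)\<close> when \<open>C = D\<close>.\<close>

definition up :: "'x set \<Rightarrow> 'x set \<times> rat" where
  "up C = (if C = D then (D, 0) else (parent C, radius (parent C)))"

text \<open>The base point is arbitrary: by \<open>level_recenter\<close> its choice has no
  influence as long as all points of \<open>C\<close> are within \<open>r\<close> of each
  other.\<close>

definition cluster_depth :: "'x set \<Rightarrow> rat \<Rightarrow> 'a \<Rightarrow> complex" where
  "cluster_depth C r = conj_depth G (stab C) (level (SOME x. x \<in> C) r)"

lemma fixes_stab:
  assumes C: "C \<in> clusters" and g: "g \<in> carrier G" and a: "a \<in> fixes_of g" "a \<in> C"
  shows "orb g C = C"
proof -
  have "a = act g a" using a unfolding fixes_of_def by simp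
  then have "a \<in> orb g C" using a(2) by (metis imageI)
  then show ?thesis using clusters_eq[OF orb_cluster[OF g C] C _ a(2)] card_orb[OF g cluster_sub[OF C]] by simp
qed

lemma trunc_pos_root: "x \<in> D \<Longrightarrow> a \<in> D \<Longrightarrow> trunc 0 x a = 0"
  unfolding trunc_def using d_pos[of x a] by auto

text \<open>Radius 0 is the boundary of the open unit disk. The points of \<open>D\<close> have
  positive mutual distance, so all distances truncated at 0 vanish.\<close>

lemma level_root: "x \<in> D \<Longrightarrow> level x 0 g = c g"
  unfolding level_def using trunc_pos_root fixes_of_sub by (simp add: subset_iff)

text \<open>By the ultrametric inequality, centres within \<open>r\<close> of each other have the
  same distances to all points once these are truncated at \<open>r\<close>.\<close>

lemma level_recenter:
  assumes x: "x \<in> D" and y: "y \<in> D" and n: "near r x y"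
  shows "level x r g = level y r g"
proof -
  have "trunc r x a = trunc r y a" if a: "a \<in> D" for a
  proof -
    have le: "trunc r u a \<le> trunc r v a" if "u \<in> D" "v \<in> D" "near r u v" for u v
    proof (cases "u = v \<or> a = v")
      case False
      then have uv: "r \<le> d u v" using that(3) unfolding near_def by auto
      show ?thesis
      proof (cases "a = u")
        case True
        then show ?thesis using uv d_sym[of u v] unfolding trunc_def by auto
      next
        case au: False
        have "min (d v u) (d u a) \<le> d v a" using ultra[of v u a] that a False au by auto
        then show ?thesis using uv False au d_sym[of u v] unfolding trunc_def by auto
      qed
    qed (auto simp: trunc_def)
    show ?thesis using le[OF x y n] le[OF y x] n near_sym[of r x y] by auto
  qed
  then show ?thesis unfolding level_def using fixes_of_sub by (simp add: subset_iff)
qed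

lemma up_props:
  assumes C: "C \<in> clusters"
  shows "fst (up C) \<in> clusters" "C \<subseteq> fst (up C)" "snd (up C) \<le> radius C"
    "\<And>x y. x \<in> C \<Longrightarrow> y \<in> fst (up C) \<Longrightarrow> near (snd (up C)) x y"
    "\<And>x y. x \<in> C \<Longrightarrow> y \<in> D - C \<Longrightarrow> d x y \<le> snd (up C)"
    "stab C \<subseteq> stab (fst (up C))"
    "snd (up C) = radius C \<longleftrightarrow> card C = 1"
proof -
  have CD: "C \<subseteq> D" using cluster_sub[OF C] .
  have "fst (up C) \<in> clusters \<and> C \<subseteq> fst (up C) \<and> snd (up C) \<le> radius C \<and>
    (\<forall>x\<in>C. \<forall>y\<in>fst (up C). near (snd (up C)) x y) \<and> (\<forall>x\<in>C. \<forall>y\<in>D - C. d x y \<le> snd (up C))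
    \<and> stab C \<subseteq> stab (fst (up C)) \<and> (snd (up C) = radius C \<longleftrightarrow> card C = 1)"
  proof (cases "C = D")
    case True
    have u: "up C = (D, 0)" unfolding up_def using True by simp
    have r: "0 \<le> radius D \<and> (0 = radius D \<longleftrightarrow> card D = 1)"
    proof (cases "card D = 1")
      case False
      then have "1 < card D" using card_cluster[OF D_cluster] by auto
      moreover obtain x where "x \<in> D" using D_nonempty by auto
      ultimately obtain y where y: "y \<in> D" "y \<noteq> x" "radius D = d x y" using big_cluster[OF D_cluster] by metis
      then have "0 < radius D" using d_pos \<open>x \<in> D\<close> by simp
      then show ?thesis using False by simp
    qed (simp add: radius_def)
    have "near 0 x y" if "x \<in> D" "y \<in> D" for x y
      using d_pos[OF that] unfolding near_def by force
    then show ?thesis unfolding u using True r D_cluster by simp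
  next
    case False
    note q = parent_props[OF C False]
    have u: "up C = (parent C, outer C)" unfolding up_def using False q(4) by simp
    have n: "near (outer C) x y" if "x \<in> C" "y \<in> parent C" for x y
      using that(2) q(5)[OF that(1)] unfolding ball_def by blast
    have r: "outer C \<le> radius C \<and> (outer C = radius C \<longleftrightarrow> card C = 1)"
    proof (cases "card C = 1")
      case True
      then show ?thesis unfolding radius_def using False by simp
    next
      case b: False
      then have "1 < card C" using card_cluster[OF C] by auto
      then show ?thesis using outer_lt_radius[OF C _ False] b by auto
    qed
    have o: "d x y \<le> outer C" if "x \<in> C" "y \<in> D - C" for x y using outer_ge[OF CD that] .
    show ?thesis unfolding u fst_conv snd_conv using q(1,2) r n o stab_parent[OF C False] by blast
  qed
  then show "fst (up C) \<in> clusters" "C \<subseteq> fst (up C)" "snd (up C) \<le> radius C"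
    "\<And>x y. x \<in> C \<Longrightarrow> y \<in> fst (up C) \<Longrightarrow> near (snd (up C)) x y"
    "\<And>x y. x \<in> C \<Longrightarrow> y \<in> D - C \<Longrightarrow> d x y \<le> snd (up C)"
    "stab C \<subseteq> stab (fst (up C))" "snd (up C) = radius C \<longleftrightarrow> card C = 1" by blast+
qed

lemma up_orb:
  assumes g: "g \<in> carrier G" and C: "C \<in> clusters"
  shows "up (orb g C) = (orb g (fst (up C)), snd (up C))"
  unfolding up_def using orb_eq_D[OF g cluster_sub[OF C]] parent_orb[OF g C] orb_D[OF g]
    radius_orb[OF g cluster_sub[OF parent_props(2)[OF C]]] by auto

text \<open>Between the two radii only the truncated distances to fixed points inside
  \<open>C\<close> grow, each by the difference of the radii; the summand \<open>- r\<close> in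
  \<open>level\<close> accounts for the \<open>- 1\<close>. This is (H4) before induction.\<close>

lemma level_diff:
  assumes C: "C \<in> clusters" and x: "x \<in> C"
  shows "level x (radius C) g = level x (snd (up C)) g + (radius C - snd (up C)) * (of_nat (card (fixes_of g \<inter> C)) - 1)"
proof -
  note u = up_props[OF C]
  have xD: "x \<in> D" using x cluster_sub[OF C] by auto
  have "(\<Sum>a\<in>fixes_of g. trunc (radius C) x a)
      = (\<Sum>a\<in>fixes_of g. trunc (snd (up C)) x a + (if a \<in> C then radius C - snd (up C) else 0))"
  proof (intro sum.cong refl)
    fix a assume a: "a \<in> fixes_of g"
    show "trunc (radius C) x a = trunc (snd (up C)) x a + (if a \<in> C then radius C - snd (up C) else 0)"
    proof (cases "a \<in> C")
      case True
      then have "near (radius C) x a" using radius_near[OF C x] by auto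
      then show ?thesis using True u(3) unfolding trunc_def near_def by auto
    next
      case False
      then have "d x a \<le> snd (up C)" "a \<noteq> x" using u(5)[OF x, of a] a x fixes_of_sub by auto
      then show ?thesis using False u(3) unfolding trunc_def by auto
    qed
  qed
  also have "\<dots> = (\<Sum>a\<in>fixes_of g. trunc (snd (up C)) x a) + (radius C - snd (up C)) * of_nat (card (fixes_of g \<inter> C))"
    using finite_fixes by (simp add: sum.distrib sum.If_cases)
  finally show ?thesis unfolding level_def by (simp add: algebra_simps)
qed

text \<open>Rewrites the sum over conjugators so that the group element stays fixed while the
  cluster and its base point move. In this form a cluster and its parent can be compared term by
  term.\<close>

lemma cluster_depth_eq:
  assumes C: "C \<in> clusters" and n: "\<And>x y. x \<in> C \<Longrightarrow> y \<in> C \<Longrightarrow> near r x y" and pt: "pt \<in> C" and g: "g \<in> carrier G"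
  shows "cluster_depth C r g = zero_sum G (\<lambda>g. - of_rat (\<Sum>x\<in>{x \<in> carrier G. orb g (orb x C) = orb x C}. level (act x pt) r g)) g"
  unfolding cluster_depth_def conj_depth_def
proof (rule zero_sum_cong[OF _ g])
  fix h assume h: "h \<in> carrier G" "h \<noteq> \<one>"
  have CD: "C \<subseteq> D" using cluster_sub[OF C] .
  define y where "y = (SOME x. x \<in> C)"
  have y: "y \<in> C" unfolding y_def using pt by (rule someI)
  have e: "level y r = level pt r" using level_recenter[OF _ _ n[OF y pt]] y pt CD by blast
  show "- of_rat (\<Sum>x\<in>conjugators G (stab C) h. level (SOME x. x \<in> C) r (inv x \<otimes> h \<otimes> x)) =
     (- of_rat (\<Sum>x\<in>{x \<in> carrier G. orb h (orb x C) = orb x C}. level (act x pt) r h) :: complex)"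
    unfolding conjugators_stab[OF h(1) CD] y_def[symmetric] e
    using level_conj h pt CD by (auto intro!: arg_cong[of _ _ of_rat] sum.cong)
qed

text \<open>The depth is a sum over all translates of \<open>C\<close>, so replacing
  \<open>C\<close> by \<open>k C\<close> only reindexes it by right multiplication by
  \<open>k\<close>.\<close>

lemma cluster_depth_orb:
  assumes C: "C \<in> clusters" and n: "\<And>x y. x \<in> C \<Longrightarrow> y \<in> C \<Longrightarrow> near r x y" and k: "k \<in> carrier G" and g: "g \<in> carrier G"
  shows "cluster_depth (orb k C) r g = cluster_depth C r g"
proof -
  have CD: "C \<subseteq> D" using cluster_sub[OF C] .
  obtain pt where pt: "pt \<in> C" using cluster_nonempty[OF C] by auto
  have ptD: "pt \<in> D" using pt CD by auto
  have n': "near r x y" if xy: "x \<in> orb k C" "y \<in> orb k C" for x y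
  proof -
    from xy obtain x' y' where xy': "x' \<in> C" "y' \<in> C" and e: "x = act k x'" "y = act k y'" by blast
    have "x' \<in> D" "y' \<in> D" using xy' CD by blast+
    then show ?thesis unfolding e using near_act[OF k] n[OF xy'] by blast
  qed
  have pt': "act k pt \<in> orb k C" using pt by auto
  have "cluster_depth (orb k C) r g = zero_sum G (\<lambda>h. - of_rat (\<Sum>x\<in>{x \<in> carrier G. orb h (orb x (orb k C)) = orb x (orb k C)}. level (act x (act k pt)) r h)) g"
    by (rule cluster_depth_eq[OF orb_cluster[OF k C] n' pt' g])
  also have "\<dots> = zero_sum G (\<lambda>h. - of_rat (\<Sum>x\<in>{x \<in> carrier G. orb h (orb x C) = orb x C}. level (act x pt) r h)) g"
  proof (rule zero_sum_cong[OF _ g])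
    fix h assume h: "h \<in> carrier G" "h \<noteq> \<one>"
    have "(\<Sum>x\<in>{x \<in> carrier G. orb h (orb x (orb k C)) = orb x (orb k C)}. level (act x (act k pt)) r h)
      = (\<Sum>x\<in>{x \<in> carrier G. orb h (orb x C) = orb x C}. level (act x pt) r h)"
    proof (rule sum.reindex_bij_witness[of _ "\<lambda>x. x \<otimes> inv k" "\<lambda>x. x \<otimes> k"])
      fix a assume a: "a \<in> {x \<in> carrier G. orb h (orb x (orb k C)) = orb x (orb k C)}"
      then show "a \<otimes> k \<otimes> inv k = a" using k by (simp add: m_assoc)
      show "a \<otimes> k \<in> {x \<in> carrier G. orb h (orb x C) = orb x C}"
        using a k orb_mult[OF _ k CD, of a] by simp
      show "level (act (a \<otimes> k) pt) r h = level (act a (act k pt)) r h" using act_mult[OF _ k ptD, of a] a by simp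
    next
      fix b assume b: "b \<in> {x \<in> carrier G. orb h (orb x C) = orb x C}"
      then show "b \<otimes> inv k \<otimes> k = b" using k by (simp add: m_assoc)
      have "orb (b \<otimes> inv k) (orb k C) = orb b (orb (inv k) (orb k C))"
        using orb_mult[OF _ inv_closed[OF k] orb_sub[OF k CD], of b] b by simp
      then have "orb (b \<otimes> inv k) (orb k C) = orb b C" using orb_inv(1)[OF k CD] by simp
      then show "b \<otimes> inv k \<in> {x \<in> carrier G. orb h (orb x (orb k C)) = orb x (orb k C)}" using b k by simp
    qed
    then show "- of_rat (\<Sum>x\<in>{x \<in> carrier G. orb h (orb x (orb k C)) = orb x (orb k C)}. level (act x (act k pt)) r h)
      = (- of_rat (\<Sum>x\<in>{x \<in> carrier G. orb h (orb x C) = orb x C}. level (act x pt) r h) :: complex)" by simp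
  qed
  also have "\<dots> = cluster_depth C r g" by (rule cluster_depth_eq[OF C n pt g, symmetric])
  finally show ?thesis .
qed

end

text \<open>The arithmetic input in combinatorial form. The axioms on \<open>level\<close> concern
  the radii \<open>d x y\<close> at which clusters with several points occur;
  \<open>level_pos\<close> says that a positive level forces \<open>g\<close> to preserve all
  residue classes of the disk. \<open>point_level\<close> will identify the level at a leaf with the
  valuation of a root of unity minus 1.\<close>

locale hurwitz_action = cluster_action +
  fixes p :: nat
  assumes prime_p: "Factorial_Ring.prime p"
    and c_nonneg: "g \<in> carrier G \<Longrightarrow> g \<noteq> \<one> \<Longrightarrow> 0 \<le> c g"
    and c_filtration: "0 < s \<Longrightarrow> subgroup {g \<in> carrier G. g = \<one> \<or> s \<le> c g} G"
    and level_nonneg: "x \<in> D \<Longrightarrow> y \<in> D \<Longrightarrow> x \<noteq> y \<Longrightarrow> g \<in> carrier G \<Longrightarrow> g \<noteq> \<one> \<Longrightarrow>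
      near (d x y) x (act g x) \<Longrightarrow> 0 \<le> level x (d x y) g"
    and level_filtration: "x \<in> D \<Longrightarrow> y \<in> D \<Longrightarrow> x \<noteq> y \<Longrightarrow> 0 < s \<Longrightarrow>
      subgroup {g \<in> carrier G. near (d x y) x (act g x) \<and> (g = \<one> \<or> s \<le> level x (d x y) g)} G"
    and level_pos: "x \<in> D \<Longrightarrow> y \<in> D \<Longrightarrow> x \<noteq> y \<Longrightarrow> g \<in> carrier G \<Longrightarrow> g \<noteq> \<one> \<Longrightarrow>
      near (d x y) x (act g x) \<Longrightarrow> 0 < level x (d x y) g \<Longrightarrow> z \<in> D \<Longrightarrow> near (d x y) x z \<Longrightarrow>
      act g z = z \<or> d x y < d z (act g z)"
    and point_stab: "x \<in> D \<Longrightarrow> \<exists>s\<in>carrier G. s \<noteq> \<one> \<and> {g \<in> carrier G. act g x = x} = generate G {s}"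
    and point_level: "x \<in> D \<Longrightarrow> g \<in> carrier G \<Longrightarrow> g \<noteq> \<one> \<Longrightarrow> act g x = x \<Longrightarrow>
      c g + (\<Sum>a\<in>fixes_of g - {x}. d x a) = cyclotomic_val p (ord g)"
begin

lemma stab_near:
  assumes C: "C \<in> clusters" and x: "x \<in> C" and big: "1 < card C"
  shows "stab C = {g \<in> carrier G. near (radius C) x (act g x)}"
proof -
  have xD: "x \<in> D" using x cluster_sub[OF C] by auto
  obtain y where y: "C = ball x (d x y)" "radius C = d x y" using big_cluster[OF C big x] by metis
  then have e: "C = ball x (radius C)" by simp
  have "orb g C = C \<longleftrightarrow> near (radius C) x (act g x)" if g: "g \<in> carrier G" for g
  proof
    assume "orb g C = C"
    then have "act g x \<in> C" using x by blast
    then show "near (radius C) x (act g x)" using radius_near[OF C x] by blast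
  next
    assume n: "near (radius C) x (act g x)"
    have "act g x \<in> ball x (radius C)" using n act_closed[OF g xD] unfolding ball_def by blast
    then have "act g x \<in> C" using e by blast
    moreover have "act g x \<in> orb g C" using x by blast
    ultimately show "orb g C = C"
      using clusters_eq[OF orb_cluster[OF g C] C] card_orb[OF g cluster_sub[OF C]] by blast
  qed
  then show ?thesis unfolding stab_def by blast
qed

lemma big_level:
  assumes C: "C \<in> clusters" and x: "x \<in> C" and big: "1 < card C"
  shows "\<And>g. g \<in> stab C \<Longrightarrow> g \<noteq> \<one> \<Longrightarrow> 0 \<le> level x (radius C) g"
    and "\<And>s. 0 < s \<Longrightarrow> subgroup {g \<in> stab C. g = \<one> \<or> s \<le> level x (radius C) g} G"
    and "\<And>g z. g \<in> stab C \<Longrightarrow> g \<noteq> \<one> \<Longrightarrow> 0 < level x (radius C) g \<Longrightarrow> z \<in> C \<Longrightarrow> act g z = z \<or> radius C < d z (act g z)"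
proof -
  obtain y where y: "y \<in> C" "y \<noteq> x" "radius C = d x y" using big_cluster[OF C big x] by metis
  have xy: "x \<in> D" "y \<in> D" "x \<noteq> y" using x y(1,2) cluster_sub[OF C] by auto
  note st = stab_near[OF C x big]
  show "0 \<le> level x (radius C) g" if "g \<in> stab C" "g \<noteq> \<one>" for g
    using level_nonneg[OF xy] that unfolding st y(3) by blast
  have "{g \<in> stab C. g = \<one> \<or> s \<le> level x (radius C) g}
    = {g \<in> carrier G. near (d x y) x (act g x) \<and> (g = \<one> \<or> s \<le> level x (d x y) g)}" for s
    unfolding st y(3) by blast
  then show "subgroup {g \<in> stab C. g = \<one> \<or> s \<le> level x (radius C) g} G" if "0 < s" for s
    using level_filtration[OF xy that] by simp
  show "act g z = z \<or> radius C < d z (act g z)"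
    if "g \<in> stab C" "g \<noteq> \<one>" "0 < level x (radius C) g" "z \<in> C" for g z
  proof -
    have "z \<in> D" using that(4) cluster_sub[OF C] by blast
    then show ?thesis using level_pos[OF xy, of g z] that radius_near[OF C x that(4)] unfolding st y(3) by blast
  qed
qed

lemma big_depth_nonneg:
  assumes C: "C \<in> clusters" and big: "1 < card C"
  shows "cluster_depth C (radius C) \<in> nonneg_rational_characters G"
proof -
  have "(SOME x. x \<in> C) \<in> C" using cluster_nonempty[OF C] by (simp add: some_in_eq)
  then show ?thesis unfolding cluster_depth_def
    using big_level[OF C _ big] by (intro conj_depth_nonneg_rational stab_subgroup cluster_sub[OF C] fin) auto
qed

lemma root_depth:
  assumes g: "g \<in> carrier G"
  shows "cluster_depth D 0 g = conj_depth G (carrier G) c g"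
    "cluster_depth D 0 g = zero_sum G (\<lambda>g. - of_nat (card (carrier G)) * of_rat (c g)) g"
proof -
  have s: "(SOME x. x \<in> D) \<in> D" using D_nonempty by (simp add: some_in_eq)
  show e: "cluster_depth D 0 g = conj_depth G (carrier G) c g"
    unfolding cluster_depth_def stab_D by (rule conj_depth_cong[OF _ g]) (simp add: level_root[OF s])
  show "cluster_depth D 0 g = zero_sum G (\<lambda>g. - of_nat (card (carrier G)) * of_rat (c g)) g"
    unfolding e conj_depth_def
  proof (rule zero_sum_cong[OF _ g])
    fix h assume h: "h \<in> carrier G" "h \<noteq> \<one>"
    have "conjugators G (carrier G) h = carrier G" unfolding conjugators_def using h by auto
    then have "(\<Sum>x\<in>conjugators G (carrier G) h. c (inv x \<otimes> h \<otimes> x)) = of_nat (card (carrier G)) * c h"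
      using c_conj[OF _ h] by simp
    then show "- of_rat (\<Sum>x\<in>conjugators G (carrier G) h. c (inv x \<otimes> h \<otimes> x)) = (- of_nat (card (carrier G)) * of_rat (c h) :: complex)"
      by (simp add: of_rat_mult)
  qed
qed

lemma root_depth_nonneg: "cluster_depth D 0 \<in> nonneg_rational_characters G"
proof -
  have "conj_depth G (carrier G) c \<in> nonneg_rational_characters G"
    by (rule conj_depth_nonneg_rational[OF subgroup_self fin]) (auto simp: c_nonneg c_filtration)
  then show ?thesis by (rule nonneg_rational_cong) (simp add: root_depth(1))
qed

text \<open>If \<open>g\<close> preserves the parent disk \<open>P\<close> but moves \<open>C\<close>, then \<open>g\<close> acts nontrivially on the
  residue classes of \<open>P\<close>, so its level at \<open>P\<close> vanishes.\<close>

lemma level_up_zero: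
  assumes C: "C \<in> clusters" and g: "g \<in> carrier G" "g \<noteq> \<one>" and x: "x \<in> C"
    and P: "orb g (fst (up C)) = fst (up C)" and nC: "orb g C \<noteq> C"
  shows "level x (snd (up C)) g = 0"
proof (cases "C = D")
  case True
  then show ?thesis using nC orb_D[OF g(1)] by simp
next
  case False
  have u: "up C = (parent C, radius (parent C))" unfolding up_def using False by simp
  note q = parent_props[OF C False]
  have xP: "x \<in> parent C" using q(1) x by blast
  have gP: "g \<in> stab (parent C)" using P g(1) unfolding u stab_def by simp
  note b = big_level[OF q(2) xP q(3)]
  show ?thesis
  proof (rule ccontr)
    assume "level x (snd (up C)) g \<noteq> 0"
    then have "0 < level x (radius (parent C)) g" using b(1)[OF gP g(2)] unfolding u by simp
    then have "act g x = x \<or> radius (parent C) < d x (act g x)" using b(3)[OF gP g(2) _ xP] by blast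
    moreover have xD: "x \<in> D" using x cluster_sub[OF C] by blast
    have "act g x \<notin> C"
    proof
      assume "act g x \<in> C"
      moreover have "act g x \<in> orb g C" using x by blast
      ultimately have "orb g C = C"
        using clusters_eq[OF orb_cluster[OF g(1) C] C] card_orb[OF g(1) cluster_sub[OF C]] by blast
      then show False using nC by blast
    qed
    then have "d x (act g x) \<le> radius (parent C)" "act g x \<noteq> x"
      using up_props(5)[OF C x, of "act g x"] act_closed[OF g(1) xD] x unfolding u by auto
    ultimately show False by auto
  qed
qed

text \<open>This is (H4) for the edge into \<open>C\<close>. Both depths are sums over translates.
  Where \<open>h\<close> stabilizes the translate of \<open>C\<close>, the terms differ by
  \<open>level_diff\<close>; where it stabilizes only that of the parent, the term vanishes by
  \<open>level_up_zero\<close>. Counting fixed points over all translates produces the factor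
  \<open>card (stab C)\<close>, which is absorbed into the thickness.\<close>

lemma depth_recursion:
  assumes C: "C \<in> clusters" and g: "g \<in> carrier G"
  shows "cluster_depth C (radius C) g = cluster_depth (fst (up C)) (snd (up C)) g
    + of_rat (of_nat (card (stab C)) * (radius C - snd (up C))) *
      (fixed_char (saturation C) g - induced_char G (stab C) (u_char (G\<lparr>carrier := stab C\<rparr>)) g)"
proof -
  note u = up_props[OF C]
  obtain x where x: "x \<in> C" using cluster_nonempty[OF C] by auto
  have CD: "C \<subseteq> D" using cluster_sub[OF C] .
  let ?P = "fst (up C)" and ?s = "snd (up C)"
  have xP: "x \<in> ?P" using u(2) x by blast
  have nP: "near ?s a b" if "a \<in> ?P" "b \<in> ?P" for a b
    using near_trans[of a x b ?s] u(4)[OF x] near_sym that x CD cluster_sub[OF u(1)] by blast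
  have key: "- of_rat (\<Sum>k\<in>{k \<in> carrier G. orb h (orb k C) = orb k C}. level (act k x) (radius C) h)
     = - of_rat (\<Sum>k\<in>{k \<in> carrier G. orb h (orb k ?P) = orb k ?P}. level (act k x) ?s h)
       + of_rat (of_nat (card (stab C)) * (radius C - ?s)) *
         (- of_nat (card (fixes_of h \<inter> saturation C)) + (-1) * (- of_nat (card (conjugators G (stab C) h)) / (of_nat (card (stab C)) :: complex)))"
    if h: "h \<in> carrier G" "h \<noteq> \<one>" for h
  proof -
    define S where "S = {k \<in> carrier G. orb h (orb k C) = orb k C}"
    have fS: "finite S" unfolding S_def using fin by auto
    have SP: "orb h (orb k ?P) = orb k ?P" if k: "k \<in> S" for k
    proof -
      have kG: "k \<in> carrier G" using k S_def by auto
      have "h \<in> stab (orb k C)" using k h unfolding S_def stab_def by auto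
      then have "h \<in> stab (fst (up (orb k C)))" using up_props(6)[OF orb_cluster[OF kG C]] by blast
      then show ?thesis unfolding up_orb[OF kG C] stab_def by simp
    qed
    have zero: "level (act k x) ?s h = 0" if k: "k \<in> carrier G" "orb h (orb k ?P) = orb k ?P" "k \<notin> S" for k
      using level_up_zero[OF orb_cluster[OF k(1) C] h, of "act k x"] k x unfolding up_orb[OF k(1) C] S_def by auto
    have "(\<Sum>k\<in>S. level (act k x) (radius C) h)
      = (\<Sum>k\<in>S. level (act k x) ?s h + (radius C - ?s) * (of_nat (card (fixes_of h \<inter> orb k C)) - 1))"
    proof (intro sum.cong refl)
      fix k assume "k \<in> S"
      then have k: "k \<in> carrier G" unfolding S_def by auto
      show "level (act k x) (radius C) h = level (act k x) ?s h + (radius C - ?s) * (of_nat (card (fixes_of h \<inter> orb k C)) - 1)"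
        using level_diff[OF orb_cluster[OF k C], of "act k x" h] x unfolding up_orb[OF k C] radius_orb[OF k CD] by simp
    qed
    also have "\<dots> = (\<Sum>k\<in>S. level (act k x) ?s h) + (radius C - ?s) * (of_nat (\<Sum>k\<in>S. card (fixes_of h \<inter> orb k C)) - of_nat (card S))"
      by (simp add: sum.distrib sum_distrib_left[symmetric] sum_subtractf)
    \<comment> \<open>A translate that contains a fixed point of \<open>h\<close> is stabilized by
      \<open>h\<close>, so the translates outside \<open>S\<close> contribute nothing.\<close>
    also have "(\<Sum>k\<in>S. card (fixes_of h \<inter> orb k C)) = (\<Sum>k\<in>carrier G. card (fixes_of h \<inter> orb k C))"
    proof (rule sum.mono_neutral_left[OF fin])
      show "S \<subseteq> carrier G" unfolding S_def by auto
      show "\<forall>i\<in>carrier G - S. card (fixes_of h \<inter> orb i C) = 0"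
      proof
        fix k assume k: "k \<in> carrier G - S"
        have "fixes_of h \<inter> orb k C = {}"
          using fixes_stab[OF orb_cluster[of k C] h(1)] k C unfolding S_def by blast
        then show "card (fixes_of h \<inter> orb k C) = 0" by simp
      qed
    qed
    also have "\<dots> = card (stab C) * card (fixes_of h \<inter> saturation C)" by (rule sum_fixed_in_orbit[OF C])
    also have "(\<Sum>k\<in>S. level (act k x) ?s h) = (\<Sum>k\<in>{k \<in> carrier G. orb h (orb k ?P) = orb k ?P}. level (act k x) ?s h)"
    proof (rule sum.mono_neutral_left)
      show "finite {k \<in> carrier G. orb h (orb k ?P) = orb k ?P}" using fin by simp
      show "S \<subseteq> {k \<in> carrier G. orb h (orb k ?P) = orb k ?P}"
      proof
        fix k assume k: "k \<in> S"
        then have "k \<in> carrier G" unfolding S_def by blast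
        then show "k \<in> {k \<in> carrier G. orb h (orb k ?P) = orb k ?P}" using SP[OF k] by blast
      qed
      show "\<forall>k\<in>{k \<in> carrier G. orb h (orb k ?P) = orb k ?P} - S. level (act k x) ?s h = 0"
        using zero by blast
    qed
    finally have e: "(\<Sum>k\<in>S. level (act k x) (radius C) h) = (\<Sum>k\<in>{k \<in> carrier G. orb h (orb k ?P) = orb k ?P}. level (act k x) ?s h)
       + (radius C - ?s) * (of_nat (card (stab C) * card (fixes_of h \<inter> saturation C)) - of_nat (card S))" .
    have cS: "conjugators G (stab C) h = S" unfolding S_def conjugators_stab[OF h(1) CD] ..
    have n0: "(of_nat (card (stab C)) :: complex) \<noteq> 0" using card_stab[OF CD] by simp
    show ?thesis
      unfolding cS S_def[symmetric] e using n0
      by (simp add: of_rat_add of_rat_mult of_rat_diff field_simps)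
  qed
  have comb: "zero_sum G (\<lambda>h. B h + k * (F h + (-1) * I h)) g = zero_sum G B g + k * (zero_sum G F g - zero_sum G I g)"
    for B F I :: "'a \<Rightarrow> complex" and k
    by (simp only: zero_sum_add zero_sum_scale) simp
  have e1: "cluster_depth C (radius C) g = zero_sum G (\<lambda>h. - of_rat (\<Sum>k\<in>{k \<in> carrier G. orb h (orb k C) = orb k C}. level (act k x) (radius C) h)) g"
    by (rule cluster_depth_eq[OF C radius_near[OF C] x g])
  have e2: "cluster_depth ?P ?s g = zero_sum G (\<lambda>h. - of_rat (\<Sum>k\<in>{k \<in> carrier G. orb h (orb k ?P) = orb k ?P}. level (act k x) ?s h)) g"
    by (rule cluster_depth_eq[OF u(1) nP xP g])
  show ?thesis
    unfolding e1 e2 induced_u_zero_sum[OF stab_subgroup[OF CD] fin g] fixed_char_def comb[symmetric]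
    by (rule zero_sum_cong[OF key g])
qed

section \<open>Children of an orbit: conditions (H1) and (H3)\<close>

definition kids where
  "kids C = {W \<in> reps. W \<noteq> D \<and> rep (parent W) = C}"

lemma kid_of_child:
  assumes W: "W \<in> clusters" "W \<noteq> D" and C: "parent W = C" "C \<in> reps"
  shows "rep W \<in> kids C"
proof -
  obtain h where h: "h \<in> carrier G" "rep W = orb h W" using rep_orb[OF W(1)] .
  have "parent (rep W) = orb h C" unfolding h(2) using parent_orb[OF h(1) W] C(1) by simp
  then have "rep (parent (rep W)) = rep C" using rep_of_orb[OF h(1)] C(2) reps_clusters by auto
  then show ?thesis
    unfolding kids_def using rep_in_reps[OF W(1)] rep_eq_D[OF W(1)] W(2) reps_fixed[OF C(2)] by auto
qed

text \<open>The parent of a kid is only a translate of \<open>C\<close>; moving it onto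
  \<open>C\<close> turns the kid into a genuine child.\<close>

lemma child_of_kid:
  assumes C: "C \<in> reps" and W: "W \<in> kids C"
  obtains h where "h \<in> carrier G" "orb h W \<in> clusters" "orb h W \<noteq> D" "parent (orb h W) = C"
proof -
  have W': "W \<in> clusters" "W \<noteq> D" "rep (parent W) = C" using W reps_clusters unfolding kids_def by auto
  note q = parent_props(2)[OF W'(1,2)]
  obtain h where h: "h \<in> carrier G" "rep (parent W) = orb h (parent W)" using rep_orb[OF q] .
  show ?thesis
    using that[OF h(1) orb_cluster[OF h(1) W'(1)]] orb_eq_D[OF h(1) cluster_sub[OF W'(1)]] W'(2,3)
      parent_orb[OF h(1) W'(1,2)] h(2) by simp
qed

lemma kids_empty_iff:
  assumes C: "C \<in> reps"
  shows "kids C = {} \<longleftrightarrow> card C = 1"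
proof
  have Cc: "C \<in> clusters" using C reps_clusters by auto
  {
    assume k: "kids C = {}"
    show "card C = 1"
    proof (rule ccontr)
      assume "card C \<noteq> 1"
      then have big: "1 < card C" using card_cluster[OF Cc] by auto
      obtain x where "x \<in> C" using cluster_nonempty[OF Cc] by auto
      then obtain W where "W \<in> clusters" "W \<noteq> D" "parent W = C" using child_exists[OF Cc big] by metis
      then show False using kid_of_child C k by blast
    qed
  next
    assume c: "card C = 1"
    show "kids C = {}"
    proof (rule ccontr)
      assume "kids C \<noteq> {}"
      then obtain W where "W \<in> kids C" by auto
      then obtain h where "orb h W \<in> clusters" "orb h W \<noteq> D" "parent (orb h W) = C" using child_of_kid[OF C] by metis
      then show False using parent_props(3) c by fastforce
    qed
  }
qed

lemma stab_conj_sub: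
  assumes h: "h \<in> carrier G" and C: "C \<subseteq> D"
  shows "conjugate G h (stab C) \<subseteq> stab (orb h C)"
proof
  fix y assume "y \<in> conjugate G h (stab C)"
  then obtain k where k: "k \<in> carrier G" "orb k C = C" "y = h \<otimes> k \<otimes> inv h" unfolding conjugate_def stab_def by auto
  have "orb y (orb h C) = orb h (orb k (orb (inv h) (orb h C)))"
    unfolding k(3) using h k(1) C orb_sub by (simp add: orb_mult m_assoc)
  also have "\<dots> = orb h C" using orb_inv(1)[OF h C] k(2) by simp
  finally show "y \<in> stab (orb h C)" using k h unfolding stab_def by auto
qed

lemma card_stab_orb:
  assumes h: "h \<in> carrier G" and C: "C \<subseteq> D"
  shows "card (stab (orb h C)) = card (stab C)"
proof -
  have le: "card (stab C) \<le> card (stab (orb h C))" if h: "h \<in> carrier G" and C: "C \<subseteq> D" for h C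
  proof -
    have "inj_on (\<lambda>k. h \<otimes> k \<otimes> inv h) (stab C)"
      using h by (auto intro!: inj_onI simp: stab_def)
    then have "card (conjugate G h (stab C)) = card (stab C)" unfolding conjugate_def by (rule card_image)
    then show ?thesis using card_mono[OF finite_stab stab_conj_sub[OF h C]] by simp
  qed
  show ?thesis using le[OF h C] le[OF inv_closed[OF h] orb_sub[OF h C]] orb_inv(1)[OF h C] by simp
qed

lemma finite_kids: "finite (kids C)" unfolding kids_def using finite_reps by auto

lemma kid_index:
  assumes C: "C \<in> reps" and W: "W \<in> kids C"
  shows "card (stab W) \<le> card (stab C)"
proof -
  have WD: "W \<subseteq> D" using W reps_clusters cluster_sub unfolding kids_def by auto
  obtain h where h: "h \<in> carrier G" "orb h W \<in> clusters" "orb h W \<noteq> D" "parent (orb h W) = C"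
    using child_of_kid[OF C W] .
  have "card (stab W) = card (stab (orb h W))" using card_stab_orb[OF h(1) WD] by simp
  also have "\<dots> \<le> card (stab C)" using stab_parent[OF h(2,3)] h(4) finite_stab by (auto intro: card_mono)
  finally show ?thesis .
qed

text \<open>\<open>C\<close> has at least two children. If two of them lie in different orbits, the
  sum has two terms that are at least 1. If both lie in one orbit, an element of
  \<open>stab C\<close> moves the first to the second, so a single index already exceeds 1.\<close>

lemma index_sum:
  assumes C: "C \<in> reps" "1 < card C"
  shows "(1::rat) < (\<Sum>W\<in>kids C. of_nat (card (stab C)) / of_nat (card (stab W)))"
proof -
  have Cc: "C \<in> clusters" using C reps_clusters by auto
  let ?f = "\<lambda>W. of_nat (card (stab C)) / of_nat (card (stab W)) :: rat"
  have f1: "1 \<le> ?f W" if "W \<in> kids C" for W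
  proof -
    have "W \<subseteq> D" using that reps_clusters cluster_sub unfolding kids_def by auto
    then show ?thesis using kid_index[OF C(1) that] card_stab[of W] by simp
  qed
  obtain x where x: "x \<in> C" using cluster_nonempty[OF Cc] by auto
  obtain W where W: "W \<in> clusters" "x \<in> W" "W \<noteq> D" "parent W = C" using child_exists[OF Cc C(2) x] .
  have WC: "W \<subset> C" using parent_props(1)[OF W(1,3)] W(4) by simp
  then obtain y where y: "y \<in> C" "y \<notin> W" by auto
  obtain W2 where W2: "W2 \<in> clusters" "y \<in> W2" "W2 \<noteq> D" "parent W2 = C" using child_exists[OF Cc C(2) y(1)] .
  have k1: "rep W \<in> kids C" using kid_of_child[OF W(1,3,4) C(1)] .
  have k2: "rep W2 \<in> kids C" using kid_of_child[OF W2(1,3,4) C(1)] .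
  show ?thesis
  proof (cases "rep W = rep W2")
    case False
    have "(2::rat) \<le> (\<Sum>W\<in>{rep W, rep W2}. ?f W)" using False f1[OF k1] f1[OF k2] by simp
    also have "\<dots> \<le> (\<Sum>W\<in>kids C. ?f W)" using k1 k2 finite_kids by (intro sum_mono2) auto
    finally show ?thesis by simp
  next
    case True
    obtain g where g: "g \<in> carrier G" "W2 = orb g W" using rep_eq_orb[OF W(1) W2(1) True] .
    have "orb g C = C" using parent_orb[OF g(1) W(1,3)] W(4) W2(4) g(2) by simp
    then have "g \<in> stab C" using g unfolding stab_def by auto
    moreover have "g \<notin> stab W" using g(2) y(2) W2(2) unfolding stab_def by auto
    moreover have "stab W \<subseteq> stab C" using stab_parent[OF W(1,3)] W(4) by simp
    ultimately have "card (stab W) < card (stab C)" using finite_stab by (intro psubset_card_mono) auto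
    moreover obtain h where h: "h \<in> carrier G" "rep W = orb h W" using rep_orb[OF W(1)] .
    ultimately have "card (stab (rep W)) < card (stab C)" using card_stab_orb[OF h(1) cluster_sub[OF W(1)]] by simp
    then have "1 < ?f (rep W)" using card_stab[OF cluster_sub[OF rep_cluster[OF W(1)]]] by simp
    also have "?f (rep W) \<le> (\<Sum>W\<in>kids C. ?f W)"
      using k1 finite_kids f1 by (intro member_le_sum) auto
    finally show ?thesis .
  qed
qed

text \<open>The saturations of the kids partition the saturation of \<open>C\<close>, so fixed
  points can be counted kid by kid.\<close>

lemma fixed_char_kids:
  assumes C: "C \<in> reps" "1 < card C" and g: "g \<in> carrier G"
  shows "fixed_char (saturation C) g = (\<Sum>W\<in>kids C. fixed_char (saturation W) g)"
proof -
  have Cc: "C \<in> clusters" using C reps_clusters by auto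
  have CD: "C \<subseteq> D" using cluster_sub[OF Cc] .
  have Wc: "W \<in> clusters" if "W \<in> kids C" for W using that reps_clusters unfolding kids_def by auto
  have U: "saturation C = (\<Union>W\<in>kids C. saturation W)"
  proof (intro equalityI subsetI)
    fix x assume "x \<in> saturation C"
    then obtain h z where h: "h \<in> carrier G" "z \<in> C" "x = act h z" unfolding saturation_def by auto
    obtain W where W: "W \<in> clusters" "z \<in> W" "W \<noteq> D" "parent W = C" using child_exists[OF Cc C(2) h(2)] .
    have "x \<in> saturation W" unfolding saturation_def using h W(2) by auto
    then have "x \<in> saturation (rep W)" using saturation_rep[OF W(1)] by simp
    then show "x \<in> (\<Union>W\<in>kids C. saturation W)" using kid_of_child[OF W(1,3,4) C(1)] by blast
  next
    fix x assume "x \<in> (\<Union>W\<in>kids C. saturation W)"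
    then obtain W where W: "W \<in> kids C" "x \<in> saturation W" by auto
    obtain h where h: "h \<in> carrier G" "orb h W \<in> clusters" "orb h W \<noteq> D" "parent (orb h W) = C"
      using child_of_kid[OF C(1) W(1)] .
    have "x \<in> saturation (orb h W)" using W(2) saturation_orb[OF h(1) cluster_sub[OF Wc[OF W(1)]]] by simp
    moreover have "orb h W \<subseteq> C" using parent_props(1)[OF h(2,3)] h(4) by auto
    ultimately show "x \<in> saturation C" unfolding saturation_def by blast
  qed
  \<comment> \<open>A common point forces the parents of the two translates to coincide, both having
    as many points as \<open>C\<close>. Siblings that meet are nested, and a proper inclusion would
    put the common parent inside the larger sibling.\<close>
  have disj: "saturation W \<inter> saturation W' = {}" if W: "W \<in> kids C" and W': "W' \<in> kids C" and ne: "W \<noteq> W'" for W W'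
  proof (rule ccontr)
    assume "saturation W \<inter> saturation W' \<noteq> {}"
    then obtain x h h' where x: "h \<in> carrier G" "h' \<in> carrier G" "x \<in> orb h W" "x \<in> orb h' W'"
      unfolding saturation_def by blast
    have nD: "W \<noteq> D" "W' \<noteq> D" using W W' unfolding kids_def by auto
    have r: "rep W = W" "rep W' = W'" using W W' reps_fixed unfolding kids_def by auto
    let ?A = "orb h W" and ?B = "orb h' W'"
    have A: "?A \<in> clusters" "?A \<noteq> D" using orb_cluster[OF x(1) Wc[OF W]] orb_eq_D[OF x(1) cluster_sub[OF Wc[OF W]]] nD by auto
    have B: "?B \<in> clusters" "?B \<noteq> D" using orb_cluster[OF x(2) Wc[OF W']] orb_eq_D[OF x(2) cluster_sub[OF Wc[OF W']]] nD by auto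
    have cp: "card (parent (orb k V)) = card C" if V: "V \<in> kids C" and k: "k \<in> carrier G" for k V
    proof -
      have VD: "V \<noteq> D" "rep (parent V) = C" using V unfolding kids_def by auto
      note q = parent_props(2)[OF Wc[OF V] VD(1)]
      have "card (parent (orb k V)) = card (parent V)"
        using parent_orb[OF k Wc[OF V] VD(1)] card_orb[OF k cluster_sub[OF q]] by simp
      also have "\<dots> = card C" using card_rep[OF q] VD(2) by simp
      finally show ?thesis .
    qed
    have "x \<in> parent ?A" "x \<in> parent ?B" using x parent_props(1)[OF A] parent_props(1)[OF B] by auto
    then have P: "parent ?A = parent ?B"
      using clusters_eq[OF parent_props(2)[OF A] parent_props(2)[OF B]] cp W W' x(1,2) by simp
    have "?A = ?B"
    proof (rule ccontr)
      assume n: "?A \<noteq> ?B"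
      then consider "?A \<subset> ?B" | "?B \<subset> ?A" using clusters_chain[OF A(1) B(1) x(3,4)] by blast
      then show False
      proof cases
        case 1
        then show False using parent_least(2)[OF A(1) B(1)] parent_props(1)[OF B] P by blast
      next
        case 2
        then show False using parent_least(2)[OF B(1) A(1)] parent_props(1)[OF A] P by blast
      qed
    qed
    then have "rep W = rep W'" using rep_of_orb[OF x(1) Wc[OF W]] rep_of_orb[OF x(2) Wc[OF W']] by metis
    then show False using r ne by simp
  qed
  have "card (fixes_of k \<inter> saturation C) = (\<Sum>W\<in>kids C. card (fixes_of k \<inter> saturation W))" for k
  proof -
    have "fixes_of k \<inter> saturation C = (\<Union>W\<in>kids C. fixes_of k \<inter> saturation W)" unfolding U by blast
    moreover have "card (\<Union>W\<in>kids C. fixes_of k \<inter> saturation W) = (\<Sum>W\<in>kids C. card (fixes_of k \<inter> saturation W))"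
    proof (rule card_UN_disjoint)
      show "\<forall>W\<in>kids C. finite (fixes_of k \<inter> saturation W)" using finite_fixes by blast
      show "\<forall>i\<in>kids C. \<forall>j\<in>kids C. i \<noteq> j \<longrightarrow> fixes_of k \<inter> saturation i \<inter> (fixes_of k \<inter> saturation j) = {}"
        using disj by blast
    qed (rule finite_kids)
    ultimately show ?thesis by (simp only:)
  qed
  then show ?thesis
    unfolding fixed_char_def zero_sum_sum[symmetric] by (simp add: sum_negf)
qed

text \<open>No value \<open>d b a\<close> exceeds the radius of the leaf \<open>b\<close>, so
  truncation has no effect on the other fixed points, and the summand for \<open>b\<close> itself
  cancels the \<open>- r\<close> in \<open>level\<close>.\<close>

lemma point_depth:
  assumes b: "b \<in> D" and g: "g \<in> carrier G"
  shows "cluster_depth {b} (radius {b}) g = conj_depth G (stab {b}) (\<lambda>h. cyclotomic_val p (ord h)) g"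
proof -
  have bc: "{b} \<in> clusters" using singleton_cluster[OF b] .
  have rb: "snd (up {b}) = radius {b}" using up_props(7)[OF bc] by simp
  show ?thesis unfolding cluster_depth_def
  proof (rule conj_depth_cong[OF _ g])
    fix h assume h: "h \<in> stab {b}" "h \<noteq> \<one>"
    then have hG: "h \<in> carrier G" and hb: "act h b = b" unfolding stab_def by auto
    have bf: "b \<in> fixes_of h" unfolding fixes_of_def using b hb by simp
    have "level b (radius {b}) h = c h + (trunc (radius {b}) b b + (\<Sum>a\<in>fixes_of h - {b}. trunc (radius {b}) b a)) - radius {b}"
      unfolding level_def using sum.remove[OF finite_fixes bf] by simp
    also have "trunc (radius {b}) b b = radius {b}" unfolding trunc_def by simp
    also have "(\<Sum>a\<in>fixes_of h - {b}. trunc (radius {b}) b a) = (\<Sum>a\<in>fixes_of h - {b}. d b a)"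
    proof (intro sum.cong refl)
      fix a assume a: "a \<in> fixes_of h - {b}"
      then have "d b a \<le> radius {b}" using up_props(5)[OF bc, of b a] fixes_of_sub rb by auto
      then show "trunc (radius {b}) b a = d b a" unfolding trunc_def using a by auto
    qed
    finally show "level (SOME x. x \<in> {b}) (radius {b}) h = cyclotomic_val p (ord h)"
      using point_level[OF b hG h(2) hb] by simp
  qed
qed

section \<open>Assembly of the Hurwitz tree\<close>

lemma stab_point: "b \<in> D \<Longrightarrow> stab {b} = {g \<in> carrier G. act g b = b}"
  unfolding stab_def by auto

text \<open>Vertex 0 is the additional root, whose only child is the orbit of \<open>D\<close>.
  Orbits are numbered from 1 on.\<close>

theorem hurwitz_tree_exists:
  "\<exists>T :: (nat, 'a) hurwitz_datum. hurwitz_tree G p T \<and>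
    (\<forall>g\<in>carrier G. tree_depth T g = zero_sum G (\<lambda>g. - of_nat (card (carrier G)) * of_rat (c g)) g) \<and>
    (\<forall>g\<in>carrier G. tree_artin T g = zero_sum G (\<lambda>g. - of_nat (card (fixes_of g))) g)"
proof -
  define num where "num C = Suc (to_nat_on reps C)" for C
  have inj: "inj_on num reps"
    using inj_on_to_nat_on[OF countable_finite[OF finite_reps]] unfolding num_def by (auto simp: inj_on_def)
  define cl where "cl = inv_into reps num"
  have cl: "cl (num C) = C" if "C \<in> reps" for C unfolding cl_def using inv_into_f_f[OF inj that] .
  define V where "V = insert 0 (num ` reps)"
  have V0: "V - {0} = num ` reps" unfolding V_def num_def by auto
  define par where "par v = (if cl v = D then 0 else num (rep (parent (cl v))))" for v
  \<comment> \<open>Parents have more points, so the rank counts missing points; the successor puts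
    \<open>D\<close> strictly above the rank of the root.\<close>
  define rk where "rk v = (if v = 0 then 0 else Suc (card D) - card (cl v))" for v
  have cases: "\<exists>C\<in>reps. v = num C \<and> cl v = C" if "v \<in> V - {0}" for v using that cl unfolding V0 by auto
  have nz: "num C \<noteq> 0" for C unfolding num_def by simp
  have pr: "rep (parent C) \<in> reps" if "C \<in> reps" "C \<noteq> D" for C
    using rep_in_reps[OF parent_props(2)] that reps_clusters by auto
  have cardle: "card C \<le> card D" if "C \<in> clusters" for C using card_mono[OF finD cluster_sub[OF that]] .
  have tree: "parent_tree V 0 par rk"
  proof
    show "finite V" unfolding V_def using finite_reps by simp
    show "0 \<in> V" unfolding V_def by simp
    fix v assume v: "v \<in> V - {0}"
    then obtain C where C: "C \<in> reps" "v = num C" "cl v = C" using cases by blast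
    have Cc: "C \<in> clusters" using C reps_clusters by auto
    show "par v \<in> V" unfolding par_def C(3) using pr[OF C(1)] unfolding V_def by auto
    show "rk (par v) < rk v"
    proof (cases "C = D")
      case True
      then show ?thesis unfolding par_def rk_def C(3) using nz C(2) by simp
    next
      case False
      note q = parent_props(1,2)[OF Cc False]
      have "card C < card (parent C)" using q finite_subset[OF cluster_sub[OF q(2)] finD] by (intro psubset_card_mono)
      then have "card C < card (rep (parent C))" using card_rep[OF q(2)] by simp
      moreover have "card (rep (parent C)) \<le> card D" using cardle[OF rep_cluster[OF q(2)]] .
      moreover have "cl (num (rep (parent C))) = rep (parent C)" using cl[OF pr[OF C(1) False]] .
      ultimately show ?thesis unfolding par_def rk_def C(3) using nz C(2) False by simp
    qed
  next
    show "\<exists>!v. v \<in> V - {0} \<and> par v = 0"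
    proof (rule ex1I[of _ "num D"])
      show "num D \<in> V - {0} \<and> par (num D) = 0" unfolding V0 par_def using cl[OF D_reps] D_reps by simp
      fix v assume v: "v \<in> V - {0} \<and> par v = 0"
      then obtain C where C: "C \<in> reps" "v = num C" "cl v = C" using cases by blast
      have "C = D" using v nz[of "rep (parent C)"] unfolding par_def C(3) by metis
      then show "v = num D" using C(2) by blast
    qed
  qed
  define Gv where "Gv v = (if v = 0 then carrier G else stab (cl v))" for v
  define a where "a v = fixed_char (saturation (cl v))" for v
  define dl where "dl v = (if v = 0 then cluster_depth D 0 else cluster_depth (cl v) (radius (cl v)))" for v
  \<comment> \<open>The order of the stabilizer comes from \<open>depth_recursion\<close>. For a
    singleton both radii agree and the thickness is 0.\<close>
  define ep where "ep v = of_nat (card (stab (cl v))) * (radius (cl v) - snd (up (cl v)))" for v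
  have ch: "{w \<in> V - {0}. par w = num C} = num ` kids C" if C: "C \<in> reps" for C
  proof (intro equalityI subsetI)
    fix w assume "w \<in> {w \<in> V - {0}. par w = num C}"
    then have w: "w \<in> V - {0}" "par w = num C" by auto
    then obtain W where W: "W \<in> reps" "w = num W" "cl w = W" using cases by blast
    have WD: "W \<noteq> D" using w(2) nz unfolding par_def W(3) by metis
    then have "num (rep (parent W)) = num C" using w(2) unfolding par_def W(3) by simp
    then have "rep (parent W) = C" using inj_onD[OF inj] pr[OF W(1) WD] C by blast
    then show "w \<in> num ` kids C" unfolding kids_def using W WD by blast
  next
    fix w assume "w \<in> num ` kids C"
    then obtain W where "w = num W" "W \<in> reps" "W \<noteq> D" "rep (parent W) = C" unfolding kids_def by auto
    then show "w \<in> {w \<in> V - {0}. par w = num C}" unfolding V0 par_def using cl by simp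
  qed
  have kid_inj: "inj_on num (kids C)" for C using inj unfolding kids_def by (auto simp: inj_on_def)
  have lf: "num C \<in> {v \<in> V. \<forall>w\<in>V - {0}. par w \<noteq> v} \<longleftrightarrow> card C = 1" if C: "C \<in> reps" for C
  proof -
    have "num C \<in> {v \<in> V. \<forall>w\<in>V - {0}. par w \<noteq> v} \<longleftrightarrow> {w \<in> V - {0}. par w = num C} = {}"
      unfolding V_def using C by blast
    then show ?thesis unfolding ch[OF C] using kids_empty_iff[OF C] by simp
  qed
  have lf0: "0 \<notin> {v \<in> V. \<forall>w\<in>V - {0}. par w \<noteq> v}"
  proof -
    have "num D \<in> V - {0}" "par (num D) = 0" unfolding V0 par_def using cl[OF D_reps] D_reps by auto
    then show ?thesis by blast
  qed
  have lf_cases: "\<exists>b\<in>D. {b} \<in> reps \<and> v = num {b} \<and> cl v = {b} \<and> v \<noteq> 0" if v: "v \<in> {v \<in> V. \<forall>w\<in>V - {0}. par w \<noteq> v}" for v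
  proof -
    have "v \<in> V - {0}" using v lf0 by fastforce
    then obtain C where C: "C \<in> reps" "v = num C" "cl v = C" using cases by blast
    then have "card C = 1" using lf v by blast
    then obtain b where b: "C = {b}" using card_1_singletonE by blast
    then have "b \<in> D" using C(1) reps_clusters cluster_sub by blast
    then show ?thesis using C nz b by blast
  qed
  have rec: "dl (num C) g = dl (par (num C)) g + of_rat (ep (num C)) * (a (num C) g - induced_char G (Gv (num C)) (u_char (G\<lparr>carrier := Gv (num C)\<rparr>)) g)"
    if C: "C \<in> reps" and g: "g \<in> carrier G" for C g
  proof -
    have Cc: "C \<in> clusters" using C reps_clusters by auto
    have "dl (par (num C)) g = cluster_depth (fst (up C)) (snd (up C)) g"
    proof (cases "C = D")
      case True
      then show ?thesis unfolding dl_def par_def cl[OF C] up_def by simp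
    next
      case False
      note q = parent_props(2)[OF Cc False]
      obtain h where h: "h \<in> carrier G" "rep (parent C) = orb h (parent C)" using rep_orb[OF q] .
      have "dl (par (num C)) g = cluster_depth (rep (parent C)) (radius (rep (parent C))) g"
        unfolding dl_def par_def cl[OF C] using False cl[OF pr[OF C False]] by (simp add: nz)
      also have "\<dots> = cluster_depth (parent C) (radius (parent C)) g"
        unfolding radius_rep[OF q] unfolding h(2) by (rule cluster_depth_orb[OF q radius_near[OF q] h(1) g])
      finally show ?thesis unfolding up_def using False by simp
    qed
    then show ?thesis
      using depth_recursion[OF Cc g] unfolding dl_def ep_def a_def Gv_def cl[OF C] by (simp add: nz)
  qed
  have nonneg: "dl v \<in> nonneg_rational_characters G" if v: "v \<in> V" for v
  proof (cases "v = 0")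
    case True
    then show ?thesis unfolding dl_def using root_depth_nonneg by simp
  next
    case False
    then obtain C where C: "C \<in> reps" "v = num C" "cl v = C" using cases v by blast
    have Cc: "C \<in> clusters" using C reps_clusters by auto
    have big: "dl (num C) \<in> nonneg_rational_characters G" if "C \<in> reps" "1 < card C" for C
      unfolding dl_def cl[OF that(1)] using big_depth_nonneg[OF _ that(2)] that(1) reps_clusters by (auto simp: nz)
    show ?thesis
    proof (cases "1 < card C")
      case True
      then show ?thesis using big C by simp
    next
      case False
      then have c1: "card C = 1" using card_cluster[OF Cc] by auto
      \<comment> \<open>Nonnegativity at a leaf is inherited: across an edge of thickness 0 the
        depth equals that of the parent, which is the root or a cluster with several points.\<close>
      have "ep (num C) = 0" unfolding ep_def cl[OF C(1)] using up_props(7)[OF Cc] c1 by simp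
      then have e: "dl (par (num C)) g = dl v g" if "g \<in> carrier G" for g
        using rec[OF C(1) that] C(2) by simp
      have "dl (par (num C)) \<in> nonneg_rational_characters G"
      proof (cases "C = D")
        case True
        then show ?thesis unfolding par_def cl[OF C(1)] dl_def using root_depth_nonneg by simp
      next
        case nD: False
        have "1 < card (rep (parent C))" using parent_props(2,3)[OF Cc nD] card_rep by simp
        then show ?thesis unfolding par_def cl[OF C(1)] using big[OF pr[OF C(1) nD]] nD by simp
      qed
      then show ?thesis by (rule nonneg_rational_cong) (rule e)
    qed
  qed
  have "\<exists>T :: (nat, 'a) hurwitz_datum. hurwitz_tree G p T \<and> tree_depth T = dl 0 \<and>
     (\<forall>v\<in>V - {0}. par v = 0 \<longrightarrow> tree_artin T = a v)"
  proof (rule hurwitz_tree_of_parents[OF tree, where Gv = Gv and a = a and \<delta> = dl and \<epsilon> = ep])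
    fix v assume v: "v \<in> V - {0}"
    then obtain C where C: "C \<in> reps" "v = num C" "cl v = C" using cases by blast
    have Cc: "C \<in> clusters" using C reps_clusters by auto
    note u = up_props(3,7)[OF Cc]
    have n0: "(0::rat) < of_nat (card (stab C))" using card_stab[OF cluster_sub[OF Cc]] by simp
    have "0 \<le> radius C - snd (up C)" using u(1) by simp
    moreover have "radius C - snd (up C) = 0 \<longleftrightarrow> card C = 1" unfolding u(2)[symmetric] by auto
    ultimately have "0 \<le> ep v \<and> (ep v = 0 \<longleftrightarrow> card C = 1)" unfolding ep_def C(3) using n0
      by (metis mult_eq_0_iff mult_nonneg_nonneg order_less_imp_le order_less_irrefl)
    then show "0 \<le> ep v \<and> (ep v = 0 \<longleftrightarrow> v \<in> {v \<in> V. \<forall>w\<in>V - {0}. par w \<noteq> v})"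
      using lf[OF C(1)] C(2) by blast
    have "\<And>g x. g \<in> carrier G \<Longrightarrow> x \<in> saturation C \<Longrightarrow> act g x \<in> saturation C"
      using saturation_orb[OF _ cluster_sub[OF Cc]] cluster_sub[OF Cc] orb_mult
    proof -
      fix g x assume g: "g \<in> carrier G" and "x \<in> saturation C"
      then obtain h where h: "h \<in> carrier G" "x \<in> orb h C" unfolding saturation_def by blast
      have "act g x \<in> orb g (orb h C)" using h by blast
      then have "act g x \<in> orb (g \<otimes> h) C" using orb_mult[OF g h(1) cluster_sub[OF Cc]] by simp
      then show "act g x \<in> saturation C" unfolding saturation_def using g h by blast
    qed
    then show "a v \<in> true_characters G" unfolding a_def C(3)
      by (intro fixed_char_true saturation_sub cluster_sub[OF Cc])
    show "\<exists>x\<in>carrier G. conjugate G x (Gv v) \<subseteq> Gv (par v)"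
    proof (cases "C = D")
      case True
      have "conjugate G \<one> (stab C) \<subseteq> carrier G" unfolding conjugate_def stab_def by auto
      then show ?thesis unfolding Gv_def par_def C(3) using True v by auto
    next
      case False
      note q = parent_props(2)[OF Cc False]
      obtain h where h: "h \<in> carrier G" "rep (parent C) = orb h (parent C)" using rep_orb[OF q] .
      have "conjugate G h (stab C) \<subseteq> conjugate G h (stab (parent C))"
        using stab_parent[OF Cc False] unfolding conjugate_def by blast
      also have "\<dots> \<subseteq> stab (rep (parent C))" unfolding h(2) by (rule stab_conj_sub[OF h(1) cluster_sub[OF q]])
      finally have "conjugate G h (stab C) \<subseteq> stab (rep (parent C))" .
      then show ?thesis unfolding Gv_def par_def C(3) using False v cl[OF pr[OF C(1) False]] h(1) by (auto simp: nz)
    qed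
    show "Gv v = carrier G" if "par v = 0"
    proof -
      have "C = D" using that nz[of "rep (parent C)"] unfolding par_def C(3) by metis
      then show ?thesis unfolding Gv_def C(3) using stab_D by simp
    qed
    assume nl: "v \<notin> {v \<in> V. \<forall>w\<in>V - {0}. par w \<noteq> v}"
    then have big: "1 < card C" using lf[OF C(1)] C(2) card_cluster[OF Cc] by blast
    have "(\<Sum>w\<in>num ` kids C. of_nat (card (Gv v)) / of_nat (card (Gv w)) :: rat)
      = (\<Sum>W\<in>kids C. of_nat (card (stab C)) / of_nat (card (stab W)))"
      unfolding sum.reindex[OF kid_inj] comp_def Gv_def C(3)
      using v cl by (intro sum.cong refl) (auto simp: kids_def nz)
    then show "1 < (\<Sum>w\<in>{w \<in> V - {0}. par w = v}. of_nat (card (Gv v)) / of_nat (card (Gv w)) :: rat)"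
      using index_sum[OF C(1) big] ch[OF C(1)] C(2) by simp
    fix g assume g: "g \<in> carrier G"
    have "(\<Sum>w\<in>num ` kids C. a w g) = (\<Sum>W\<in>kids C. fixed_char (saturation W) g)"
      unfolding sum.reindex[OF kid_inj] comp_def a_def
      using cl by (intro sum.cong refl) (auto simp: kids_def)
    then show "a v g = (\<Sum>w\<in>{w \<in> V - {0}. par w = v}. a w g)"
      using fixed_char_kids[OF C(1) big g] ch[OF C(1)] C(2) unfolding a_def C(3) by simp
  next
    fix v assume v: "v \<in> V"
    show "dl v \<in> nonneg_rational_characters G" by (rule nonneg[OF v])
    show "subgroup (Gv v) G"
    proof (cases "v = 0")
      case True
      then show ?thesis unfolding Gv_def using subgroup_self by simp
    next
      case False
      then obtain C where C: "C \<in> reps" "cl v = C" using cases v by blast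
      then show ?thesis unfolding Gv_def using False stab_subgroup[OF cluster_sub] reps_clusters by auto
    qed
  next
    show "Gv 0 = carrier G" unfolding Gv_def by simp
  next
    fix v g assume v: "v \<in> V - {0}" and g: "g \<in> carrier G"
    then obtain C where C: "C \<in> reps" "v = num C" using cases by blast
    show "dl v g = dl (par v) g + of_rat (ep v) * (a v g - induced_char G (Gv v) (u_char (G\<lparr>carrier := Gv v\<rparr>)) g)"
      unfolding C(2) by (rule rec[OF C(1) g])
  next
    fix v assume "v \<in> {v \<in> V. \<forall>w\<in>V - {0}. par w \<noteq> v}"
    then obtain b where b: "b \<in> D" "cl v = {b}" "v \<noteq> 0" using lf_cases by blast
    have Gb: "Gv v = stab {b}" unfolding Gv_def b(2) using b(3) by simp
    obtain s where s: "s \<in> carrier G" "s \<noteq> \<one>" "stab {b} = generate G {s}"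
      using point_stab[OF b(1)] stab_point[OF b(1)] by auto
    have "s \<in> stab {b}" unfolding s(3) by (intro generate.incl) simp
    moreover have "G\<lparr>carrier := stab {b}\<rparr> = subgroup_generated G {s}"
      unfolding subgroup_generated_def s(3) using s(1) by simp
    ultimately show "Gv v \<noteq> {\<one>} \<and> cyclic_group (G\<lparr>carrier := Gv v\<rparr>)"
      unfolding Gb using cyclic_group_generated[of s] s(2) by auto
    show "\<exists>P. sylow_subgroup p (G\<lparr>carrier := Gv v\<rparr>) P \<and>
        (\<forall>g\<in>carrier G. dl v g = induced_char G P (delta_mult p (G\<lparr>carrier := P\<rparr>)) g)"
      unfolding Gb dl_def b(2) using conj_depth_cyclic[OF fin prime_p s(1,3)] point_depth[OF b(1)] b(3) by simp
    show "a v g = induced_char G (Gv v) (u_char (G\<lparr>carrier := Gv v\<rparr>)) g" if "g \<in> carrier G" for g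
      unfolding Gb a_def b(2) by (rule fixed_char_singleton[OF b(1) that])
  qed
  then obtain T :: "(nat, 'a) hurwitz_datum" where T: "hurwitz_tree G p T" "tree_depth T = dl 0"
    "\<forall>v\<in>V - {0}. par v = 0 \<longrightarrow> tree_artin T = a v" by blast
  have nD: "num D \<in> V - {0}" "par (num D) = 0" unfolding V0 par_def using cl[OF D_reps] D_reps by auto
  then have "tree_artin T = a (num D)" using T(3) by blast
  then have "tree_artin T = fixed_char D" unfolding a_def cl[OF D_reps] saturation_D .
  then have "tree_artin T g = zero_sum G (\<lambda>g. - of_nat (card (fixes_of g))) g" for g
    unfolding fixed_char_def using fixes_of_sub by (simp add: Int_absorb2)
  moreover have "tree_depth T g = zero_sum G (\<lambda>g. - of_nat (card (carrier G)) * of_rat (c g)) g" if "g \<in> carrier G" for g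
    unfolding T(2) dl_def using root_depth(2)[OF that] by simp
  ultimately show ?thesis using T(1) by blast
qed

end

subsection \<open>Valuations\<close>

text \<open>The bound \<open>q \<le> v x\<close> with 0 counted as having infinite valuation,
  independent of the arbitrary value \<open>v 0\<close>.\<close>

definition vge :: "('a::field \<Rightarrow> rat) \<Rightarrow> rat \<Rightarrow> 'a \<Rightarrow> bool" where
  "vge v q x \<longleftrightarrow> x = 0 \<or> q \<le> v x"

lemma vge_zero [simp]: "vge v q 0" by (simp add: vge_def)

lemma vge_mono: "vge v q x \<Longrightarrow> r \<le> q \<Longrightarrow> vge v r x" by (auto simp: vge_def)

context valuation
begin

lemma val_one: "v 1 = 0"
  using val_mult[of 1 1] by simp

lemma val_minus_one: "v (-1) = 0"
proof -
  have "v ((-1) * (-1)) = v (-1) + v (-1)" by (rule val_mult) auto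
  then show ?thesis using val_one by simp
qed

lemma val_uminus: "v (- x) = v x"
proof (cases "x = 0")
  case False
  then show ?thesis using val_mult[of "-1" x] val_minus_one by simp
qed simp

lemma val_diff_swap: "v (x - y) = v (y - x)"
  using val_uminus[of "x - y"] by simp

lemma val_inverse: "x \<noteq> 0 \<Longrightarrow> v (inverse x) = - v x"
  using val_mult[of x "inverse x"] val_one by simp

lemma val_power: "x \<noteq> 0 \<Longrightarrow> v (x ^ n) = of_nat n * v x"
  by (induction n) (auto simp: val_one val_mult algebra_simps)

lemma val_prod: "finite S \<Longrightarrow> (\<And>s. s \<in> S \<Longrightarrow> f s \<noteq> 0) \<Longrightarrow> v (\<Prod>s\<in>S. f s) = (\<Sum>s\<in>S. v (f s))"
  by (induction S rule: finite_induct) (auto simp: val_one val_mult)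

lemma vge_uminus: "vge v q (- x) \<longleftrightarrow> vge v q x"
  by (simp add: vge_def val_uminus)

lemma vge_add: "vge v q x \<Longrightarrow> vge v q y \<Longrightarrow> vge v q (x + y)"
  using val_add[of x y] unfolding vge_def by fastforce

lemma vge_diff: "vge v q x \<Longrightarrow> vge v q y \<Longrightarrow> vge v q (x - y)"
  using vge_add[of q x "- y"] vge_uminus by simp

lemma vge_sum: "(\<And>s. s \<in> S \<Longrightarrow> vge v q (f s)) \<Longrightarrow> vge v q (\<Sum>s\<in>S. f s)"
  by (induction S rule: infinite_finite_induct) (auto simp: vge_add)

lemma vge_mult: "vge v q x \<Longrightarrow> vge v r y \<Longrightarrow> vge v (q + r) (x * y)"
  by (cases "x = 0 \<or> y = 0") (auto simp: vge_def val_mult)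

lemma vge_mult_int: "vge v q x \<Longrightarrow> vge v 0 y \<Longrightarrow> vge v q (x * y)" "vge v 0 x \<Longrightarrow> vge v q y \<Longrightarrow> vge v q (x * y)"
  using vge_mult[of q x 0 y] vge_mult[of 0 x q y] by auto

lemma vge_one: "vge v 0 1"
  by (simp add: vge_def val_one)

lemma vge_of_nat: "vge v 0 (of_nat n)"
  by (induction n) (auto simp: vge_add vge_one)

lemma vge_power: "vge v q x \<Longrightarrow> vge v (of_nat n * q) (x ^ n)"
proof (induction n)
  case (Suc n)
  then show ?case using vge_mult[of q x "of_nat n * q" "x ^ n"] by (simp add: algebra_simps)
qed (simp add: vge_one)

lemma vge_power_int: "vge v 0 x \<Longrightarrow> vge v 0 (x ^ n)"
  using vge_power[of 0 x n] by simp

lemma val_add_dominant: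
  assumes x: "x \<noteq> 0" and y: "y = 0 \<or> v x < v y"
  shows "x + y \<noteq> 0 \<and> v (x + y) = v x"
proof (cases "y = 0")
  case False
  then have lt: "v x < v y" using y by simp
  have ne: "x + y \<noteq> 0"
  proof
    assume "x + y = 0"
    then have "y = - x" by (simp add: eq_neg_iff_add_eq_0 add.commute)
    then show False using lt val_uminus[of x] by simp
  qed
  have "v x \<le> v (x + y)" using val_add[OF x False ne] lt by simp
  moreover have "min (v (x + y)) (v (- y)) \<le> v ((x + y) + - y)"
    using val_add[OF ne, of "- y"] False x by simp
  then have "min (v (x + y)) (v y) \<le> v x" by (simp add: val_uminus)
  ultimately show ?thesis using lt ne by auto
qed (use x in simp)

text \<open>By the Archimedean property no nonzero element satisfies all these bounds. Later proofs
  use this in place of limits: a difference that is small to every order is zero.\<close>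

lemma vge_all_zero:
  assumes r: "0 < r" and all: "\<And>n::nat. N \<le> n \<Longrightarrow> vge v (of_nat n * r) x"
  shows "x = 0"
proof (rule ccontr)
  assume x: "x \<noteq> 0"
  obtain n :: nat where n: "v x / r < of_nat n" using reals_Archimedean2 by blast
  have "v x < of_nat n * r" using n r by (simp add: field_simps)
  also have "\<dots> \<le> of_nat (max n N) * r" using r by (intro mult_right_mono) auto
  also have "\<dots> \<le> v x" using all[of "max n N"] x by (simp add: vge_def)
  finally show False by simp
qed

definition fge :: "rat \<Rightarrow> 'a fps \<Rightarrow> bool" where "fge q f \<longleftrightarrow> (\<forall>n. vge v q (fps_nth f n))"

lemma fge_zero [simp]: "fge q 0" by (simp add: fge_def)

lemma fge_add: "fge q f \<Longrightarrow> fge q g \<Longrightarrow> fge q (f + g)" by (simp add: fge_def vge_add)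

lemma fge_diff: "fge q f \<Longrightarrow> fge q g \<Longrightarrow> fge q (f - g)" by (simp add: fge_def vge_diff)

lemma fge_uminus: "fge q f \<Longrightarrow> fge q (- f)" by (simp add: fge_def vge_uminus)

lemma fge_mult: "fge q f \<Longrightarrow> fge r g \<Longrightarrow> fge (q + r) (f * g)"
  unfolding fge_def fps_mult_nth by (auto intro!: vge_sum vge_mult)

lemma fge_mult_int: "fge 0 f \<Longrightarrow> fge 0 g \<Longrightarrow> fge 0 (f * g)"
  using fge_mult[of 0 f 0 g] by simp

lemma fge_const: "vge v q c \<Longrightarrow> fge q (fps_const c)" by (simp add: fge_def)

lemma fge_one: "fge 0 1" by (simp add: fge_def vge_one)

lemma fge_X: "fge 0 fps_X" by (simp add: fge_def fps_X_def vge_one)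

lemma fge_power: "fge 0 f \<Longrightarrow> fge 0 (f ^ n)"
  by (induction n) (auto intro: fge_mult_int fge_one)

lemma fge_sum: "(\<And>s. s \<in> S \<Longrightarrow> fge q (f s)) \<Longrightarrow> fge q (\<Sum>s\<in>S. f s)"
  by (induction S rule: infinite_finite_induct) (auto simp: fge_add)

lemma fge_shift: "fge q f \<Longrightarrow> fge q (fps_shift n f)" by (simp add: fge_def)

lemma fge_deriv: "fge q f \<Longrightarrow> fge q (fps_deriv f)"
  unfolding fge_def fps_deriv_nth by (metis vge_mult_int(2) vge_of_nat)

lemma fge_mono: "fge q f \<Longrightarrow> r \<le> q \<Longrightarrow> fge r f"
  unfolding fge_def by (meson vge_mono)

text \<open>The coefficients of the inverse satisfy a recursion whose only division is by the
  constant term, a unit.\<close>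

lemma fge_inverse:
  assumes f: "fge 0 f" and u: "fps_nth f 0 \<noteq> 0" "v (fps_nth f 0) = 0"
  shows "fge 0 (inverse f)" "fps_nth (inverse f) 0 \<noteq> 0" "v (fps_nth (inverse f) 0) = 0"
proof -
  have i0: "fps_nth (inverse f) 0 = inverse (fps_nth f 0)" by simp
  show "fps_nth (inverse f) 0 \<noteq> 0" "v (fps_nth (inverse f) 0) = 0" using i0 u val_inverse by auto
  have "vge v 0 (fps_nth (inverse f) n)" for n
  proof (induction n rule: less_induct)
    case (less n)
    show ?case
    proof (cases "n = 0")
      case True
      then show ?thesis using i0 u val_inverse by (simp add: vge_def)
    next
      case False
      have "fps_nth (f * inverse f) n = 0" using u(1) False by (simp add: inverse_mult_eq_1')
      then have "(\<Sum>i=0..n. fps_nth f i * fps_nth (inverse f) (n - i)) = 0" by (simp add: fps_mult_nth)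
      then have "fps_nth f 0 * fps_nth (inverse f) n + (\<Sum>i=1..n. fps_nth f i * fps_nth (inverse f) (n - i)) = 0"
        by (simp add: sum.atLeast_Suc_atMost)
      then have e: "fps_nth (inverse f) n = - inverse (fps_nth f 0) * (\<Sum>i=1..n. fps_nth f i * fps_nth (inverse f) (n - i))"
        using u(1) by (simp add: field_simps eq_neg_iff_add_eq_0)
      have "vge v 0 (\<Sum>i=1..n. fps_nth f i * fps_nth (inverse f) (n - i))"
        using f less by (intro vge_sum vge_mult_int) (auto simp: fge_def)
      moreover have "vge v 0 (- inverse (fps_nth f 0))" using u val_inverse by (simp add: vge_def val_uminus)
      ultimately show ?thesis unfolding e by (rule vge_mult_int(1)[rotated])
    qed
  qed
  then show "fge 0 (inverse f)" unfolding fge_def by blast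
qed

end

subsection \<open>Weierstrass division and preparation\<close>

context complete_dvf
begin

abbreviation e0 :: rat where "e0 \<equiv> val \<pi>"

lemma val_pos_ge: "x \<noteq> 0 \<Longrightarrow> 0 < val x \<Longrightarrow> e0 \<le> val x"
proof -
  assume x: "x \<noteq> 0" "0 < val x"
  obtain n :: int where n: "val x = of_int n * e0" using discrete[OF x(1)] by blast
  then have "0 < n" using x(2) prime_elem(2) by (simp add: zero_less_mult_iff)
  then have "1 \<le> (of_int n :: rat)" by simp
  then show "e0 \<le> val x" unfolding n using prime_elem(2) mult_right_mono[of 1 "of_int n" e0] by simp
qed

text \<open>\<open>Z -> h - \<pi> F Z\<close> contracts by the factor \<open>\<pi>\<close>, so its
  iterates from 0 are Cauchy in every coefficient, uniformly in the index. Completeness of the base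
  field enters here.\<close>

lemma contraction_fixpoint:
  fixes F :: "'k fps \<Rightarrow> 'k fps"
  assumes add: "\<And>f g. F (f - g) = F f - F g" and int: "\<And>q f. fge q f \<Longrightarrow> fge q (F f)" and h: "fge 0 h"
  shows "\<exists>Z. fge 0 Z \<and> Z = h - fps_const \<pi> * F Z"
proof -
  define S where "S = rec_nat (0::'k fps) (\<lambda>_ Z. h - fps_const \<pi> * F Z)"
  have S0: "S 0 = 0" and SS: "S (Suc n) = h - fps_const \<pi> * F (S n)" for n unfolding S_def by auto
  have pi: "fge (q + e0) (fps_const \<pi> * f)" if "fge q f" for q f
    using fge_mult[OF fge_const that, of e0 \<pi>] by (simp add: vge_def add.commute)
  have step: "fge (of_nat n * e0) (S (Suc n) - S n)" for n
  proof (induction n)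
    case 0
    have "F 0 = 0" using add[of 0 0] by simp
    then show ?case using h by (simp add: S0 SS)
  next
    case (Suc n)
    have "S (Suc (Suc n)) - S (Suc n) = (h - fps_const \<pi> * F (S (Suc n))) - (h - fps_const \<pi> * F (S n))"
      by (simp only: SS[of "Suc n"] SS[of n])
    also have "\<dots> = - (fps_const \<pi> * F (S (Suc n) - S n))" unfolding add by (simp add: algebra_simps)
    finally have eq: "S (Suc (Suc n)) - S (Suc n) = - (fps_const \<pi> * F (S (Suc n) - S n))" .
    have e: "of_nat (Suc n) * e0 = of_nat n * e0 + e0" by (simp add: algebra_simps)
    show ?case unfolding eq e by (rule fge_uminus[OF pi[OF int[OF Suc]]])
  qed
  have diff: "fge (of_nat n * e0) (S (n + k) - S n)" for n k
  proof (induction k)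
    case (Suc k)
    have "of_nat n * e0 \<le> of_nat (n + k) * e0" using prime_elem(2) by (intro mult_right_mono) auto
    then have "fge (of_nat n * e0) (S (Suc (n + k)) - S (n + k))" using step[of "n + k"] fge_mono by blast
    then show ?case using fge_add[OF _ Suc, of "S (Suc (n + k)) - S (n + k)"] by simp
  qed simp
  have lim: "\<exists>l. val_tendsto val (\<lambda>n. fps_nth (S n) i) l" for i
  proof (rule complete, unfold val_Cauchy_def, rule allI)
    fix C :: rat
    obtain N :: nat where N: "C / e0 < of_nat N" using reals_Archimedean2 by blast
    then have NC: "C < of_nat N * e0" using prime_elem(2) by (simp add: field_simps)
    show "\<exists>N. \<forall>m\<ge>N. \<forall>n\<ge>N. val_close val C (fps_nth (S m) i) (fps_nth (S n) i)"
    proof (intro exI[of _ N] allI impI)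
      fix m n assume mn: "N \<le> m" "N \<le> n"
      have "vge val (of_nat N * e0) (fps_nth (S m) i - fps_nth (S N) i)" "vge val (of_nat N * e0) (fps_nth (S n) i - fps_nth (S N) i)"
        using diff[of N "m - N"] diff[of N "n - N"] mn unfolding fge_def by auto
      then have "vge val (of_nat N * e0) ((fps_nth (S m) i - fps_nth (S N) i) - (fps_nth (S n) i - fps_nth (S N) i))"
        by (rule vge_diff)
      then have "vge val (of_nat N * e0) (fps_nth (S m) i - fps_nth (S n) i)" by simp
      then show "val_close val C (fps_nth (S m) i) (fps_nth (S n) i)"
        using NC unfolding val_close_def vge_def by auto
    qed
  qed
  define Z where "Z = Abs_fps (\<lambda>i. SOME l. val_tendsto val (\<lambda>n. fps_nth (S n) i) l)"
  have Zl: "val_tendsto val (\<lambda>n. fps_nth (S n) i) (fps_nth Z i)" for i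
    unfolding Z_def using someI_ex[OF lim[of i]] by simp
  \<comment> \<open>The rate of convergence survives in the limit; it bounds the defect of
    \<open>Z\<close> in the fixed point equation by every power of \<open>\<pi>\<close>.\<close>
  have ZS: "fge (of_nat n * e0) (Z - S n)" for n
    unfolding fge_def
  proof
    fix i
    obtain N where N: "\<And>m. m \<ge> N \<Longrightarrow> val_close val (of_nat n * e0) (fps_nth (S m) i) (fps_nth Z i)"
      using Zl[of i] unfolding val_tendsto_def by blast
    let ?m = "n + N"
    have "vge val (of_nat n * e0) (fps_nth (S ?m) i - fps_nth Z i)"
      using N[of ?m] unfolding val_close_def vge_def by auto
    moreover have "vge val (of_nat n * e0) (fps_nth (S ?m) i - fps_nth (S n) i)" using diff[of n N] unfolding fge_def by simp
    ultimately have "vge val (of_nat n * e0) ((fps_nth (S ?m) i - fps_nth (S n) i) - (fps_nth (S ?m) i - fps_nth Z i))"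
      by (rule vge_diff[rotated])
    then show "vge val (of_nat n * e0) (fps_nth (Z - S n) i)" by simp
  qed
  have Z0: "fge 0 Z" using ZS[of 0] by (simp add: S0)
  have "fps_nth (Z - (h - fps_const \<pi> * F Z)) i = 0" for i
  proof (rule vge_all_zero[OF prime_elem(2), of 0])
    fix n :: nat
    have "fge (of_nat n * e0 + e0) (fps_const \<pi> * F (Z - S n))" by (rule pi[OF int[OF ZS]])
    then have 1: "fge (of_nat n * e0) (fps_const \<pi> * F (Z - S n))" using fge_mono prime_elem(2) by (metis add_increasing2 less_imp_le order_refl)
    have 2: "fge (of_nat n * e0) (Z - S (Suc n))"
      using fge_mono[OF ZS[of "Suc n"], of "of_nat n * e0"] prime_elem(2) by (simp add: algebra_simps)
    have "Z - (h - fps_const \<pi> * F Z) = (Z - S (Suc n)) + fps_const \<pi> * F (Z - S n)"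
      unfolding SS add by (simp add: algebra_simps)
    then show "vge val (of_nat n * e0) (fps_nth (Z - (h - fps_const \<pi> * F Z)) i)"
      using fge_add[OF 2 1] unfolding fge_def by metis
  qed
  then have "Z - (h - fps_const \<pi> * F Z) = 0" by (simp add: fps_eq_iff)
  then show ?thesis using Z0 by auto
qed

text \<open>The reduction of \<open>f\<close> modulo \<open>\<pi>\<close> is nonzero of order
  \<open>d\<close>.\<close>

definition regular :: "'k fps \<Rightarrow> nat \<Rightarrow> bool" where
  "regular f d \<longleftrightarrow> fge 0 f \<and> (\<forall>i<d. vge val e0 (fps_nth f i)) \<and> fps_nth f d \<noteq> 0 \<and> val (fps_nth f d) = 0"

text \<open>Write \<open>f = \<pi> a + X^d b\<close> with a unit \<open>b\<close>. The remainder has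
  degree below \<open>d\<close> exactly when \<open>shift_d (g - q f) = 0\<close>, and in terms of
  \<open>Z = q b\<close> this is the fixed point equation
  \<open>Z = shift_d g - \<pi> shift_d (Z b^-1 a)\<close>.\<close>

lemma weierstrass_division:
  assumes f: "regular f d" and g: "fge 0 g"
  shows "\<exists>q r. fge 0 q \<and> fge 0 (fps_of_poly r) \<and> (\<forall>i\<ge>d. coeff r i = 0) \<and> g = q * f + fps_of_poly r"
proof -
  define b where "b = fps_shift d f"
  have b: "fge 0 b" "fps_nth b 0 \<noteq> 0" "val (fps_nth b 0) = 0"
    using f unfolding regular_def b_def by (auto intro: fge_shift)
  note ib = fge_inverse[OF b]
  define a where "a = fps_const (inverse \<pi>) * fps_cutoff d f"
  have a: "fge 0 a" unfolding fge_def a_def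
  proof
    fix n
    have "vge val 0 (inverse \<pi> * fps_nth f n)" if "n < d"
    proof -
      have "vge val e0 (fps_nth f n)" using f that unfolding regular_def by auto
      moreover have "vge val (- e0) (inverse \<pi>)" using prime_elem val_inverse by (simp add: vge_def)
      ultimately show ?thesis using vge_mult[of "- e0" "inverse \<pi>" e0 "fps_nth f n"] by simp
    qed
    then show "vge val 0 (fps_nth (fps_const (inverse \<pi>) * fps_cutoff d f) n)" by simp
  qed
  have fab: "f = fps_const \<pi> * a + fps_X ^ d * b"
    using prime_elem(1) unfolding a_def b_def by (intro fps_ext) (auto simp: fps_X_power_mult_nth)
  define F where "F Z = fps_shift d (Z * (inverse b * a))" for Z
  have "\<exists>Z. fge 0 Z \<and> Z = fps_shift d g - fps_const \<pi> * F Z"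
  proof (rule contraction_fixpoint)
    show "F (f - g) = F f - F g" for f g unfolding F_def by (simp add: left_diff_distrib fps_shift_diff)
    show "fge q (F f)" if "fge q f" for q f
      unfolding F_def using fge_mult[OF that fge_mult_int[OF ib(1) a]] by (intro fge_shift) simp
  qed (rule fge_shift[OF g])
  then obtain Z where Z: "fge 0 Z" "Z = fps_shift d g - fps_const \<pi> * F Z" by blast
  define q where "q = Z * inverse b"
  have qb: "q * b = Z" unfolding q_def using b(2) by (simp add: mult.assoc inverse_mult_eq_1)
  have q: "fge 0 q" unfolding q_def using Z(1) ib(1) by (rule fge_mult_int)
  have "q * f = fps_const \<pi> * (q * a) + fps_X ^ d * Z" unfolding fab qb[symmetric] by (simp add: algebra_simps)
  moreover have "fps_shift d (fps_const \<pi> * (q * a)) = fps_const \<pi> * F Z"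
    unfolding F_def q_def by (simp add: fps_eq_iff mult.assoc)
  moreover have "fps_shift d (fps_X ^ d * Z) = Z" by (simp add: fps_eq_iff fps_X_power_mult_nth)
  ultimately have "fps_shift d (q * f) = fps_const \<pi> * F Z + Z" by (simp add: fps_shift_add)
  then have "fps_shift d (g - q * f) = fps_shift d g - fps_const \<pi> * F Z - Z" by (simp add: fps_shift_diff)
  then have sz: "fps_shift d (g - q * f) = 0" using Z(2) by simp
  define r where "r = (\<Sum>i<d. monom (fps_nth (g - q * f) i) i)"
  have cr: "coeff r i = (if i < d then fps_nth (g - q * f) i else 0)" for i
    unfolding r_def by (simp add: coeff_sum sum.delta')
  have "fps_nth (g - q * f) i = 0" if "d \<le> i" for i
    using arg_cong[OF sz, of "\<lambda>f. fps_nth f (i - d)"] that by simp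
  then have rg: "fps_of_poly r = g - q * f" by (intro fps_ext) (simp add: cr)
  have "fge 0 (g - q * f)" using g q f fge_mult_int unfolding regular_def by (intro fge_diff) auto
  then show ?thesis using q rg cr by (intro exI[of _ q] exI[of _ r]) auto
qed

definition distinguished :: "'k poly \<Rightarrow> bool" where
  "distinguished P \<longleftrightarrow> lead_coeff P = 1 \<and> (\<forall>i<degree P. vge val e0 (coeff P i))"

lemma distinguished_regular: "distinguished P \<Longrightarrow> regular (fps_of_poly P) (degree P)"
  unfolding distinguished_def regular_def fge_def
proof (intro conjI allI)
  fix n assume d: "lead_coeff P = 1 \<and> (\<forall>i<degree P. vge val e0 (coeff P i))"
  show "vge val 0 (fps_nth (fps_of_poly P) n)"
  proof (cases n "degree P" rule: linorder_cases)
    case less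
    then show ?thesis using d vge_mono[of val e0 _ 0] prime_elem(2) by simp
  next
    case equal
    then show ?thesis using d vge_one by simp
  next
    case greater
    then show ?thesis by (simp add: coeff_eq_0)
  qed
qed (auto simp: val_one)

text \<open>Divide \<open>X^d\<close> by \<open>f\<close>, so that \<open>q f = X^d - r\<close>. The
  coefficients below \<open>d\<close> on the left are divisible by \<open>\<pi>\<close>, hence the
  right side is distinguished; the coefficient at \<open>d\<close> shows that the constant term of
  \<open>q\<close> is a unit.\<close>

lemma weierstrass_preparation:
  assumes f: "regular f d"
  shows "\<exists>u P. fge 0 u \<and> fps_nth u 0 \<noteq> 0 \<and> val (fps_nth u 0) = 0 \<and> distinguished P \<and> degree P = d \<and> f = u * fps_of_poly P"
proof -
  have f': "fge 0 f" "\<And>i. i < d \<Longrightarrow> vge val e0 (fps_nth f i)" "fps_nth f d \<noteq> 0" "val (fps_nth f d) = 0"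
    using f unfolding regular_def by auto
  obtain q r where q: "fge 0 q" and r: "\<And>i. d \<le> i \<Longrightarrow> coeff r i = 0" and e: "fps_X ^ d = q * f + fps_of_poly r"
    using weierstrass_division[OF f fge_power[OF fge_X]] by blast
  define P where "P = monom 1 d - r"
  have qf: "q * f = fps_of_poly P" unfolding P_def fps_of_poly_diff using e by (simp add: fps_of_poly_monom' algebra_simps)
  have cP: "coeff P d = 1" "\<And>i. d < i \<Longrightarrow> coeff P i = 0" unfolding P_def using r by auto
  have "degree P \<le> d" by (rule degree_le) (use cP in auto)
  then have dP: "degree P = d" using le_degree[of P d] cP(1) by simp
  have small: "vge val e0 (coeff P i)" if "i < d" for i
  proof -
    have "coeff P i = (\<Sum>j=0..i. fps_nth q j * fps_nth f (i - j))"
      using arg_cong[OF qf, of "\<lambda>f. fps_nth f i"] by (simp add: fps_mult_nth)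
    also have "vge val e0 \<dots>" using q f' that by (intro vge_sum vge_mult_int(2)) (auto simp: fge_def)
    finally show ?thesis .
  qed
  have dist: "distinguished P" unfolding distinguished_def dP using cP(1) small by auto
  have s: "1 = (\<Sum>j=0..d. fps_nth q j * fps_nth f (d - j))"
    using arg_cong[OF qf, of "\<lambda>f. fps_nth f d"] cP(1) by (simp add: fps_mult_nth)
  also have "\<dots> = fps_nth q 0 * fps_nth f d + (\<Sum>j=1..d. fps_nth q j * fps_nth f (d - j))"
    by (simp add: sum.atLeast_Suc_atMost)
  finally have s: "fps_nth q 0 * fps_nth f d = 1 + - (\<Sum>j=1..d. fps_nth q j * fps_nth f (d - j))" by (simp add: algebra_simps)
  have "vge val e0 (\<Sum>j=1..d. fps_nth q j * fps_nth f (d - j))"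
    using q f' by (intro vge_sum vge_mult_int(2)) (auto simp: fge_def)
  then have "fps_nth q 0 * fps_nth f d \<noteq> 0 \<and> val (fps_nth q 0 * fps_nth f d) = 0"
    unfolding s using val_add_dominant[of 1 "- (\<Sum>j=1..d. fps_nth q j * fps_nth f (d - j))"] prime_elem(2)
    by (auto simp: vge_def val_one val_uminus)
  then have q0: "fps_nth q 0 \<noteq> 0" "val (fps_nth q 0) = 0" using val_mult f'(3,4) by auto
  have "f = inverse q * fps_of_poly P" unfolding qf[symmetric] using q0(1) by (simp add: mult.assoc[symmetric] inverse_mult_eq_1)
  then show ?thesis using fge_inverse[OF q q0] dist dP by blast
qed

text \<open>Divides by a coefficient of least valuation. It exists because the valuations of the
  nonzero coefficients are natural multiples of \<open>val \<pi>\<close>.\<close>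

lemma regular_multiple:
  assumes h: "fge 0 h" "h \<noteq> 0"
  obtains c f d where "c \<noteq> 0" "vge val 0 c" "regular f d" "h = fps_const c * f"
    "\<And>i. vge val (val c) (fps_nth h i)" "\<exists>i. fps_nth h i \<noteq> 0 \<and> val (fps_nth h i) = val c"
proof -
  obtain i where i: "fps_nth h i \<noteq> 0" using h(2) by (auto simp: fps_eq_iff)
  define N where "N i = nat \<lfloor>val (fps_nth h i) / e0\<rfloor>" for i
  have N: "val (fps_nth h i) = of_nat (N i) * e0" if n: "fps_nth h i \<noteq> 0" for i
  proof -
    obtain n :: int where n: "val (fps_nth h i) = of_int n * e0" using discrete[OF n] by blast
    have "0 \<le> val (fps_nth h i)" using h(1) that unfolding fge_def vge_def by auto
    then have "0 \<le> n" using n prime_elem(2) by (simp add: zero_le_mult_iff)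
    then show ?thesis unfolding N_def n using prime_elem(2) by simp
  qed
  obtain k where k: "fps_nth h k \<noteq> 0" "\<And>j. fps_nth h j \<noteq> 0 \<Longrightarrow> N k \<le> N j"
    using ex_has_least_nat[of "\<lambda>i. fps_nth h i \<noteq> 0" i N] i by blast
  define c where "c = fps_nth h k"
  have c: "c \<noteq> 0" "vge val 0 c" using k(1) h(1) unfolding c_def fge_def by auto
  have min: "vge val (val c) (fps_nth h i)" for i
    using N k prime_elem(2) unfolding c_def vge_def by (metis less_imp_le mult_right_mono of_nat_le_iff)
  define f where "f = fps_const (inverse c) * h"
  have hf: "h = fps_const c * f" unfolding f_def using c(1) by (simp add: mult.assoc[symmetric] fps_const_mult[symmetric] del: fps_const_mult)
  have f0: "vge val 0 (fps_nth f i)" for i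
    using vge_mult[of "- val c" "inverse c" "val c" "fps_nth h i"] min[of i] c(1) val_inverse
    unfolding f_def by (simp add: vge_def)
  define d where "d = (LEAST i. fps_nth f i \<noteq> 0 \<and> val (fps_nth f i) = 0)"
  have "fps_nth f k \<noteq> 0 \<and> val (fps_nth f k) = 0" unfolding f_def using c(1) val_one by (simp add: c_def[symmetric])
  then have d: "fps_nth f d \<noteq> 0 \<and> val (fps_nth f d) = 0" unfolding d_def by (rule LeastI)
  have "vge val e0 (fps_nth f i)" if "i < d" for i
    using not_less_Least[of i "\<lambda>i. fps_nth f i \<noteq> 0 \<and> val (fps_nth f i) = 0"] that f0[of i] val_pos_ge[of "fps_nth f i"]
    unfolding d_def[symmetric] vge_def by force
  then have "regular f d" unfolding regular_def fge_def using f0 d by auto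
  then show ?thesis using that[OF c _ hf min] c_def k(1) by blast
qed

end

subsection \<open>Evaluation of power series at geometric points\<close>

locale disk = K: complete_dvf val \<pi> p + L: valuation_extension valbar val
  for val :: "'k::field_char_0 \<Rightarrow> rat" and \<pi> :: 'k and p :: nat and valbar :: "'k alg_closure \<Rightarrow> rat"
begin

abbreviation pts :: "'k alg_closure set" where "pts \<equiv> disk_points valbar"

text \<open>The junk value \<open>valbar 0\<close> is replaced by an arbitrary positive number.\<close>

definition wt :: "'k alg_closure \<Rightarrow> rat" where "wt x = (if x = 0 then 1 else valbar x)"

definition trunc_poly :: "nat \<Rightarrow> 'k fps \<Rightarrow> 'k alg_closure poly" where
  "trunc_poly n f = (\<Sum>i<n. monom (to_ac (fps_nth f i)) i)"

text \<open>Convergence with a rate: the error of the \<open>n\<close>-th partial sum has valuation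
  at least \<open>n * wt x\<close>, as is to be expected for integral coefficients. Uniqueness, sums
  and products then follow from estimates before any value is known to exist.\<close>

definition evals :: "'k fps \<Rightarrow> 'k alg_closure \<Rightarrow> 'k alg_closure \<Rightarrow> bool" where
  "evals f x y \<longleftrightarrow> (\<forall>n. vge valbar (of_nat n * wt x) (y - poly (trunc_poly n f) x))"

definition ev :: "'k alg_closure \<Rightarrow> 'k fps \<Rightarrow> 'k alg_closure" where "ev x f = (THE y. evals f x y)"

lemma wt_pos: "x \<in> pts \<Longrightarrow> 0 < wt x"
  unfolding disk_points_def wt_def by auto

lemma vge_wt: "vge valbar (wt x) x"
  unfolding wt_def vge_def by auto

lemma vge_to_ac: "vge valbar q (to_ac a) \<longleftrightarrow> vge val q a"
  by (cases "a = 0") (auto simp: vge_def L.extends)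

lemma coeff_trunc_poly: "coeff (trunc_poly n f) i = (if i < n then to_ac (fps_nth f i) else 0)"
  unfolding trunc_poly_def by (simp add: coeff_sum sum.delta')

lemma trunc_poly_add: "trunc_poly n (f + g) = trunc_poly n f + trunc_poly n g"
  by (rule poly_eqI) (simp add: coeff_trunc_poly)

lemma poly_trunc: "poly (trunc_poly n f) x = (\<Sum>i<n. to_ac (fps_nth f i) * x ^ i)"
  unfolding trunc_poly_def by (simp add: poly_sum poly_monom)

lemma vge_poly_high:
  assumes x: "x \<in> pts" and int: "\<And>i. vge valbar 0 (coeff Q i)" and z: "\<And>i. i < n \<Longrightarrow> coeff Q i = 0"
  shows "vge valbar (of_nat n * wt x) (poly Q x)"
  unfolding poly_altdef
proof (rule L.vge_sum)
  fix i
  show "vge valbar (of_nat n * wt x) (coeff Q i * x ^ i)"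
  proof (cases "i < n")
    case False
    have "vge valbar (of_nat i * wt x) (coeff Q i * x ^ i)"
      using L.vge_mult_int(2)[OF int L.vge_power[OF vge_wt]] .
    moreover have "of_nat n * wt x \<le> of_nat i * wt x"
      using False wt_pos[OF x] by (intro mult_right_mono) auto
    ultimately show ?thesis using vge_mono by blast
  qed (simp add: z)
qed

lemma vge_coeff_trunc: "K.fge 0 f \<Longrightarrow> vge valbar 0 (coeff (trunc_poly n f) i)"
  unfolding coeff_trunc_poly K.fge_def by (simp add: vge_to_ac)

lemma vge_coeff_mult:
  assumes "\<And>i. vge valbar 0 (coeff P i)" "\<And>i. vge valbar 0 (coeff Q i)"
  shows "vge valbar 0 (coeff (P * Q) i)"
  unfolding coeff_mult using assms by (intro L.vge_sum L.vge_mult_int) auto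

lemma vge_poly:
  assumes "x \<in> pts" "\<And>i. vge valbar 0 (coeff Q i)"
  shows "vge valbar 0 (poly Q x)"
  using vge_poly_high[of x Q 0] assms by simp

lemma evals_unique:
  assumes x: "x \<in> pts" and "evals f x y" "evals f x y'"
  shows "y = y'"
proof -
  have "y - y' = 0"
  proof (rule L.vge_all_zero[OF wt_pos[OF x], of 0])
    fix n :: nat
    have "vge valbar (of_nat n * wt x) ((y - poly (trunc_poly n f) x) - (y' - poly (trunc_poly n f) x))"
      using assms(2,3) L.vge_diff unfolding evals_def by blast
    then show "vge valbar (of_nat n * wt x) (y - y')" by simp
  qed
  then show ?thesis by simp
qed

lemma ev_eqI: "x \<in> pts \<Longrightarrow> evals f x y \<Longrightarrow> ev x f = y"
  unfolding ev_def using evals_unique by (intro the_equality) auto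

lemma evals_int: "x \<in> pts \<Longrightarrow> K.fge 0 f \<Longrightarrow> evals f x y \<Longrightarrow> vge valbar 0 y"
  unfolding evals_def by (drule spec[of _ 0]) (simp add: trunc_poly_def)

lemma evals_fps_value:
  assumes x: "x \<in> pts" and e: "evals f x y"
  shows "fps_value valbar f x y"
  unfolding fps_value_def val_tendsto_def
proof
  fix C :: rat
  obtain N :: nat where N: "C / wt x < of_nat N" using reals_Archimedean2 by blast
  then have NC: "C < of_nat N * wt x" using wt_pos[OF x] by (simp add: field_simps)
  show "\<exists>N. \<forall>n\<ge>N. val_close valbar C (\<Sum>i<n. to_ac (fps_nth f i) * x ^ i) y"
  proof (intro exI[of _ N] allI impI)
    fix n assume n: "N \<le> n"
    have "of_nat N * wt x \<le> of_nat n * wt x" using n wt_pos[OF x] by (intro mult_right_mono) auto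
    moreover have "vge valbar (of_nat n * wt x) (y - poly (trunc_poly n f) x)" using e unfolding evals_def by blast
    ultimately have "vge valbar (of_nat N * wt x) (poly (trunc_poly n f) x - y)"
      using L.vge_uminus[of _ "y - poly (trunc_poly n f) x"] vge_mono by simp
    then show "val_close valbar C (\<Sum>i<n. to_ac (fps_nth f i) * x ^ i) y"
      unfolding poly_trunc val_close_def vge_def using NC by auto
  qed
qed

lemma fps_value_unique:
  assumes "fps_value valbar f x y" "fps_value valbar f x y'"
  shows "y = y'"
proof (rule ccontr)
  assume ne: "y \<noteq> y'"
  let ?C = "valbar (y - y')"
  obtain N where N: "\<And>n. n \<ge> N \<Longrightarrow> val_close valbar ?C (\<Sum>i<n. to_ac (fps_nth f i) * x ^ i) y"
    using assms(1) unfolding fps_value_def val_tendsto_def by blast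
  obtain M where M: "\<And>n. n \<ge> M \<Longrightarrow> val_close valbar ?C (\<Sum>i<n. to_ac (fps_nth f i) * x ^ i) y'"
    using assms(2) unfolding fps_value_def val_tendsto_def by blast
  define s where "s = (\<Sum>i<max N M. to_ac (fps_nth f i) * x ^ i)"
  have c: "s = y \<or> ?C < valbar (s - y)" "s = y' \<or> ?C < valbar (s - y')"
    using N[of "max N M"] M[of "max N M"] unfolding s_def val_close_def by auto
  consider "s = y" | "s = y'" | "s \<noteq> y" "s \<noteq> y'" by blast
  then show False
  proof cases
    case 1
    then show False using c(2) ne by simp
  next
    case 2
    then show False using c(1) ne L.val_diff_swap[of y y'] by simp
  next
    case 3
    have "min (valbar (s - y')) (valbar (- (s - y))) \<le> valbar ((s - y') + - (s - y))"
      using 3 ne by (intro L.val_add) auto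
    moreover have "valbar (- (s - y)) = valbar (s - y)" by (rule L.val_uminus)
    ultimately show False using c 3 by simp
  qed
qed

text \<open>The two polynomials agree in degrees below \<open>n\<close>, and integral terms of
  degree at least \<open>n\<close> are small at \<open>x\<close>.\<close>

lemma vge_trunc_mult:
  assumes x: "x \<in> pts" and f: "K.fge 0 f" and g: "K.fge 0 g"
  shows "vge valbar (of_nat n * wt x) (poly (trunc_poly n f) x * poly (trunc_poly n g) x - poly (trunc_poly n (f * g)) x)"
proof -
  let ?Q = "trunc_poly n f * trunc_poly n g - trunc_poly n (f * g)"
  have "vge valbar (of_nat n * wt x) (poly ?Q x)"
  proof (rule vge_poly_high[OF x])
    fix i
    have "vge valbar 0 (coeff (trunc_poly n f * trunc_poly n g) i)"
      using vge_coeff_trunc f g by (intro vge_coeff_mult) auto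
    then show "vge valbar 0 (coeff ?Q i)"
      using vge_coeff_trunc[OF K.fge_mult_int[OF f g]] by (simp add: L.vge_diff)
    assume i: "i < n"
    have "coeff (trunc_poly n f * trunc_poly n g) i = (\<Sum>j\<le>i. to_ac (fps_nth f j) * to_ac (fps_nth g (i - j)))"
      unfolding coeff_mult coeff_trunc_poly using i by (intro sum.cong) auto
    then show "coeff ?Q i = 0" using i by (simp add: coeff_trunc_poly fps_mult_nth to_ac_sum atLeast0AtMost)
  qed
  then show ?thesis by simp
qed

lemma vge_trunc: "x \<in> pts \<Longrightarrow> K.fge 0 f \<Longrightarrow> vge valbar 0 (poly (trunc_poly n f) x)"
  by (rule vge_poly) (auto intro: vge_coeff_trunc)

lemma evals_add: "evals f x y \<Longrightarrow> evals g x z \<Longrightarrow> evals (f + g) x (y + z)"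
  unfolding evals_def trunc_poly_add
proof
  fix n assume "\<forall>n. vge valbar (of_nat n * wt x) (y - poly (trunc_poly n f) x)" "\<forall>n. vge valbar (of_nat n * wt x) (z - poly (trunc_poly n g) x)"
  then have "vge valbar (of_nat n * wt x) ((y - poly (trunc_poly n f) x) + (z - poly (trunc_poly n g) x))"
    using L.vge_add by blast
  then show "vge valbar (of_nat n * wt x) (y + z - poly (trunc_poly n f + trunc_poly n g) x)" by (simp add: algebra_simps)
qed

lemma evals_mult:
  assumes x: "x \<in> pts" and f: "K.fge 0 f" "evals f x y" and g: "K.fge 0 g" "evals g x z"
  shows "evals (f * g) x (y * z)"
  unfolding evals_def
proof
  fix n
  let ?f = "poly (trunc_poly n f) x" and ?g = "poly (trunc_poly n g) x" and ?q = "of_nat n * wt x"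
  have "vge valbar ?q ((y - ?f) * z)" using f(2) evals_int[OF x g] unfolding evals_def by (intro L.vge_mult_int(1)) auto
  moreover have "vge valbar ?q (?f * (z - ?g))" using g(2) vge_trunc[OF x f(1)] unfolding evals_def by (intro L.vge_mult_int(2)) auto
  ultimately have "vge valbar ?q ((y - ?f) * z + ?f * (z - ?g) + (?f * ?g - poly (trunc_poly n (f * g)) x))"
    using vge_trunc_mult[OF x f(1) g(1), of n] by (intro L.vge_add)
  then show "vge valbar ?q (y * z - poly (trunc_poly n (f * g)) x)" by (simp add: algebra_simps)
qed

lemma evals_poly:
  assumes x: "x \<in> pts" and P: "K.fge 0 (fps_of_poly P)"
  shows "evals (fps_of_poly P) x (poly (map_poly to_ac P) x)"
  unfolding evals_def
proof
  fix n
  have c: "coeff (map_poly to_ac P) i = to_ac (coeff P i)" for i by (simp add: coeff_map_poly)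
  have "vge valbar (of_nat n * wt x) (poly (map_poly to_ac P - trunc_poly n (fps_of_poly P)) x)"
    by (rule vge_poly_high[OF x])
      (use P in \<open>auto simp: c coeff_trunc_poly K.fge_def vge_to_ac\<close>)
  then show "vge valbar (of_nat n * wt x) (poly (map_poly to_ac P) x - poly (trunc_poly n (fps_of_poly P)) x)" by simp
qed

lemma unit_trunc:
  assumes x: "x \<in> pts" and u: "K.fge 0 u" "fps_nth u 0 \<noteq> 0" "val (fps_nth u 0) = 0" and n: "0 < n"
  shows "poly (trunc_poly n u) x \<noteq> 0 \<and> valbar (poly (trunc_poly n u) x) = 0"
proof -
  let ?Q = "trunc_poly n u - [:to_ac (fps_nth u 0):]"
  have "vge valbar (of_nat 1 * wt x) (poly ?Q x)"
    by (rule vge_poly_high[OF x])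
      (use u n in \<open>auto simp: coeff_trunc_poly K.fge_def vge_to_ac coeff_pCons split: nat.splits\<close>)
  then have "poly ?Q x = 0 \<or> valbar (to_ac (fps_nth u 0)) < valbar (poly ?Q x)"
    using wt_pos[OF x] u L.extends[OF u(2)] unfolding vge_def by auto
  then have "to_ac (fps_nth u 0) + poly ?Q x \<noteq> 0 \<and> valbar (to_ac (fps_nth u 0) + poly ?Q x) = valbar (to_ac (fps_nth u 0))"
    using u(2) by (intro L.val_add_dominant) auto
  then show ?thesis using L.extends[OF u(2)] u(3) by simp
qed

lemma unit_evals:
  assumes x: "x \<in> pts" and u: "K.fge 0 u" "fps_nth u 0 \<noteq> 0" "val (fps_nth u 0) = 0" and y: "evals u x y"
  shows "y \<noteq> 0 \<and> valbar y = 0"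
proof -
  note t = unit_trunc[OF x u, of 1]
  have "vge valbar (wt x) (y - poly (trunc_poly 1 u) x)" using y unfolding evals_def by (metis of_nat_1 mult_1)
  then have "y - poly (trunc_poly 1 u) x = 0 \<or> valbar (poly (trunc_poly 1 u) x) < valbar (y - poly (trunc_poly 1 u) x)"
    using t wt_pos[OF x] unfolding vge_def by auto
  then have "poly (trunc_poly 1 u) x + (y - poly (trunc_poly 1 u) x) \<noteq> 0
    \<and> valbar (poly (trunc_poly 1 u) x + (y - poly (trunc_poly 1 u) x)) = valbar (poly (trunc_poly 1 u) x)"
    using t by (intro L.val_add_dominant) auto
  then show ?thesis using t by simp
qed

lemma distinguished_int: "K.distinguished P \<Longrightarrow> K.fge 0 (fps_of_poly P)"
  using K.distinguished_regular unfolding K.regular_def by blast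

text \<open>\<open>x\<close> is a root of a polynomial \<open>Q\<close> over the base field; after
  scaling, preparation writes it as a unit \<open>u\<close> times a distinguished \<open>P\<close>.
  The value of \<open>u\<close> at \<open>x\<close> is not yet available, but its truncations have
  valuation 0 there, so the value of \<open>P\<close> at \<open>x\<close> is small to every
  order.\<close>

lemma root_of_distinguished:
  assumes x: "x \<in> pts"
  obtains P where "K.distinguished P" "poly (map_poly to_ac P) x = 0"
proof -
  obtain Q where Q: "Q \<noteq> 0" "poly (map_poly to_ac Q) x = 0" using alg_closure_algebraic[of x] by blast
  define S where "S = (\<lambda>i. val (coeff Q i)) ` {i. i \<le> degree Q \<and> coeff Q i \<noteq> 0}"
  have fS: "finite S" unfolding S_def by auto
  have neS: "S \<noteq> {}" unfolding S_def using Q(1) leading_coeff_0_iff by blast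
  obtain k where k: "coeff Q k \<noteq> 0" "val (coeff Q k) = Min S" using Min_in[OF fS neS] unfolding S_def by auto
  define h where "h = fps_of_poly (smult (inverse (coeff Q k)) Q)"
  have Sle: "vge val (Min S) (coeff Q i)" for i
  proof (cases "coeff Q i = 0")
    case False
    then have "i \<le> degree Q" by (rule le_degree)
    then show ?thesis using False Min_le[OF fS] unfolding vge_def S_def by auto
  qed simp
  have h0: "K.fge 0 h" unfolding K.fge_def h_def
  proof
    fix n
    have "vge val (- Min S + Min S) (inverse (coeff Q k) * coeff Q n)"
      using k K.val_inverse by (intro K.vge_mult[OF _ Sle]) (simp add: vge_def)
    then show "vge val 0 (fps_nth (fps_of_poly (smult (inverse (coeff Q k)) Q)) n)" by simp
  qed
  have hk: "fps_nth h k = 1" unfolding h_def using k(1) by simp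
  then have "h \<noteq> 0" by auto
  then obtain c f d where c: "c \<noteq> 0" and f: "K.regular f d" "h = fps_const c * f"
    using K.regular_multiple[OF h0] by metis
  obtain u P where u: "K.fge 0 u" "fps_nth u 0 \<noteq> 0" "val (fps_nth u 0) = 0" and P: "K.distinguished P" "f = u * fps_of_poly P"
    using K.weierstrass_preparation[OF f(1)] by blast
  let ?Q = "smult (inverse (coeff Q k * c)) Q"
  have fQ: "u * fps_of_poly P = fps_of_poly ?Q"
  proof -
    have "fps_of_poly ?Q = fps_const (inverse c) * h"
      unfolding h_def by (simp add: fps_of_poly_smult fps_const_mult[symmetric] mult.assoc mult.commute del: fps_const_mult)
    also have "\<dots> = f" unfolding f(2) using c by (simp add: mult.assoc[symmetric])
    finally show ?thesis unfolding P(2) by simp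
  qed
  have "poly (map_poly to_ac P) x = 0"
  proof (rule L.vge_all_zero[OF wt_pos[OF x], of "Suc (max (degree P) (degree ?Q))"])
    fix n assume n: "Suc (max (degree P) (degree ?Q)) \<le> n"
    \<comment> \<open>Beyond the degree, truncation leaves a polynomial unchanged, so only
      \<open>u\<close> is really truncated below.\<close>
    have full: "trunc_poly n (fps_of_poly R) = map_poly to_ac R" if "degree R < n" for R
      using that by (intro poly_eqI) (auto simp: coeff_trunc_poly coeff_map_poly coeff_eq_0)
    have "poly (map_poly to_ac ?Q) x = poly (smult (to_ac (inverse (coeff Q k * c))) (map_poly to_ac Q)) x"
      by (intro arg_cong2[where f = poly] poly_eqI refl) (simp add: coeff_map_poly)
    then have z: "poly (map_poly to_ac ?Q) x = 0" using Q(2) by simp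
    have "vge valbar (of_nat n * wt x) (poly (trunc_poly n u) x * poly (trunc_poly n (fps_of_poly P)) x - poly (trunc_poly n (u * fps_of_poly P)) x)"
      by (rule vge_trunc_mult[OF x u(1) distinguished_int[OF P(1)]])
    moreover have "trunc_poly n (fps_of_poly P) = map_poly to_ac P" using n by (intro full) simp
    moreover have "trunc_poly n (u * fps_of_poly P) = map_poly to_ac ?Q" unfolding fQ using n by (intro full) simp
    ultimately have "vge valbar (of_nat n * wt x) (poly (trunc_poly n u) x * poly (map_poly to_ac P) x)" using z by simp
    moreover have "poly (trunc_poly n u) x \<noteq> 0 \<and> valbar (poly (trunc_poly n u) x) = 0" using unit_trunc[OF x u] n by simp
    ultimately show "vge valbar (of_nat n * wt x) (poly (map_poly to_ac P) x)"
      using L.val_mult unfolding vge_def by (metis add_0 mult_eq_0_iff)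
  qed
  then show ?thesis using that P(1) by blast
qed

text \<open>With a distinguished \<open>P\<close> that vanishes at \<open>x\<close>, division gives
  \<open>f = q P + r\<close>, and the polynomial value \<open>r(x)\<close> is the value of
  \<open>f\<close>.\<close>

lemma evals_exists:
  assumes x: "x \<in> pts" and f: "K.fge 0 f"
  shows "\<exists>y. evals f x y"
proof -
  obtain P where P: "K.distinguished P" "poly (map_poly to_ac P) x = 0" using root_of_distinguished[OF x] .
  obtain q r where q: "K.fge 0 q" and r: "K.fge 0 (fps_of_poly r)" and e: "f = q * fps_of_poly P + fps_of_poly r"
    using K.weierstrass_division[OF K.distinguished_regular[OF P(1)] f] by blast
  \<comment> \<open>\<open>q\<close> has no value at \<open>x\<close> so far; it suffices that its
    truncations are integral there while those of \<open>P\<close> are small.\<close>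
  have "evals (q * fps_of_poly P) x 0" unfolding evals_def
  proof
    fix n
    let ?q = "poly (trunc_poly n q) x" and ?P = "poly (trunc_poly n (fps_of_poly P)) x"
    have "vge valbar (of_nat n * wt x) (0 - ?P)"
      using evals_poly[OF x distinguished_int[OF P(1)]] P(2) unfolding evals_def by metis
    then have "vge valbar (of_nat n * wt x) (?q * ?P)"
      using L.vge_uminus vge_trunc[OF x q] by (intro L.vge_mult_int(2)) auto
    then have "vge valbar (of_nat n * wt x) ((?q * ?P - poly (trunc_poly n (q * fps_of_poly P)) x) - ?q * ?P)"
      by (rule L.vge_diff[OF vge_trunc_mult[OF x q distinguished_int[OF P(1)]]])
    then show "vge valbar (of_nat n * wt x) (0 - poly (trunc_poly n (q * fps_of_poly P)) x)" by simp
  qed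
  then have "evals f x (0 + poly (map_poly to_ac r) x)" unfolding e using evals_poly[OF x r] by (rule evals_add)
  then show ?thesis by blast
qed

lemma evals_ev: "x \<in> pts \<Longrightarrow> K.fge 0 f \<Longrightarrow> evals f x (ev x f)"
  using evals_exists ev_eqI by metis

lemma ev_int: "x \<in> pts \<Longrightarrow> K.fge 0 f \<Longrightarrow> vge valbar 0 (ev x f)"
  using evals_int evals_ev by blast

lemma ev_add: "x \<in> pts \<Longrightarrow> K.fge 0 f \<Longrightarrow> K.fge 0 g \<Longrightarrow> ev x (f + g) = ev x f + ev x g"
  by (intro ev_eqI evals_add evals_ev)

lemma ev_mult: "x \<in> pts \<Longrightarrow> K.fge 0 f \<Longrightarrow> K.fge 0 g \<Longrightarrow> ev x (f * g) = ev x f * ev x g"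
  by (intro ev_eqI evals_mult evals_ev)

lemma ev_poly: "x \<in> pts \<Longrightarrow> K.fge 0 (fps_of_poly P) \<Longrightarrow> ev x (fps_of_poly P) = poly (map_poly to_ac P) x"
  by (intro ev_eqI evals_poly)

lemma ev_const: "x \<in> pts \<Longrightarrow> vge val 0 c \<Longrightarrow> ev x (fps_const c) = to_ac c"
  using ev_poly[of x "[:c:]"] K.fge_const by (simp add: fps_of_poly_const Polynomial.map_poly_pCons)

lemma ev_X: "x \<in> pts \<Longrightarrow> ev x fps_X = x"
  using ev_poly[of x "[:0, 1:]"] K.fge_X by (simp add: fps_of_poly_pCons Polynomial.map_poly_pCons)

lemma ev_diff:
  assumes "x \<in> pts" "K.fge 0 f" "K.fge 0 g"
  shows "ev x (f - g) = ev x f - ev x g"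
  using ev_add[of x "f - g" g] K.fge_diff assms by simp

lemma ev_power: "x \<in> pts \<Longrightarrow> K.fge 0 f \<Longrightarrow> ev x (f ^ n) = ev x f ^ n"
proof (induction n)
  case 0
  then show ?case using ev_const[of x 1] K.vge_one by simp
qed (simp add: ev_mult K.fge_power)

lemma ev_unit:
  "x \<in> pts \<Longrightarrow> K.fge 0 u \<Longrightarrow> fps_nth u 0 \<noteq> 0 \<Longrightarrow> val (fps_nth u 0) = 0 \<Longrightarrow> ev x u \<noteq> 0 \<and> valbar (ev x u) = 0"
  using unit_evals evals_ev by blast

lemma ev_fps_value: "x \<in> pts \<Longrightarrow> K.fge 0 f \<Longrightarrow> fps_value valbar f x y \<longleftrightarrow> ev x f = y"
  using evals_fps_value evals_ev fps_value_unique by metis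

text \<open>Integral power series do not increase distances, since \<open>x - y\<close> divides
  \<open>x^i - y^i\<close>. The cutoff \<open>n\<close> makes both truncation errors at least as
  small as \<open>x - y\<close>.\<close>

lemma ev_lipschitz:
  assumes x: "x \<in> pts" and y: "y \<in> pts" and f: "K.fge 0 f"
  shows "ev x f = ev y f \<or> (x \<noteq> y \<and> valbar (x - y) \<le> valbar (ev x f - ev y f))"
proof (cases "x = y")
  case False
  define q where "q = valbar (x - y)"
  define w where "w = min (wt x) (wt y)"
  have w: "0 < w" unfolding w_def using wt_pos x y by simp
  obtain n :: nat where "q / w < of_nat n" using reals_Archimedean2 by blast
  then have n: "q < of_nat n * w" using w by (simp add: field_simps)
  have xy: "vge valbar q (x ^ i - y ^ i)" for i
  proof (induction i)
    case (Suc i)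
    have ix: "vge valbar 0 x" "vge valbar 0 y" using x y unfolding disk_points_def vge_def by auto
    have "x ^ Suc i - y ^ Suc i = x * (x ^ i - y ^ i) + (x - y) * y ^ i" by (simp add: algebra_simps)
    moreover have "vge valbar q (x * (x ^ i - y ^ i))" by (rule L.vge_mult_int(2)[OF ix(1) Suc])
    moreover have "vge valbar q ((x - y) * y ^ i)"
      by (rule L.vge_mult_int(1)[OF _ L.vge_power_int[OF ix(2)]]) (simp add: vge_def q_def)
    ultimately show ?case by (simp add: L.vge_add)
  qed simp
  have a: "vge valbar q (poly (trunc_poly n f) x - poly (trunc_poly n f) y)"
    unfolding poly_trunc sum_subtractf[symmetric] right_diff_distrib[symmetric]
    using f by (intro L.vge_sum L.vge_mult_int(2) xy) (simp add: vge_to_ac K.fge_def)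
  have b: "vge valbar q (ev z f - poly (trunc_poly n f) z)" if z: "z \<in> pts" "w \<le> wt z" for z
  proof -
    have "q \<le> of_nat n * w" using n by simp
    also have "\<dots> \<le> of_nat n * wt z" using z(2) by (intro mult_left_mono) auto
    finally show ?thesis using evals_ev[OF z(1) f] vge_mono unfolding evals_def by blast
  qed
  have "vge valbar q ((ev x f - poly (trunc_poly n f) x) - (ev y f - poly (trunc_poly n f) y)
      + (poly (trunc_poly n f) x - poly (trunc_poly n f) y))"
    by (intro L.vge_add[OF L.vge_diff[OF b b] a] x y) (auto simp: w_def)
  then have "vge valbar q (ev x f - ev y f)" by (simp add: algebra_simps)
  then show ?thesis using False unfolding vge_def q_def by auto
qed auto

end

subsection \<open>Taylor expansion of an automorphism\<close>

text \<open>\<open>layered g\<close> is the formal sum of the series \<open>X\<^sup>k * g k\<close>.\<close>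

definition layered :: "(nat \<Rightarrow> 'a::comm_ring_1 fps) \<Rightarrow> 'a fps" where
  "layered g = Abs_fps (\<lambda>n. \<Sum>k\<le>n. fps_nth (g k) (n - k))"

lemma layered_step: "layered g = g 0 + fps_X * layered (\<lambda>k. g (Suc k))"
proof (rule fps_ext)
  fix n
  show "fps_nth (layered g) n = fps_nth (g 0 + fps_X * layered (\<lambda>k. g (Suc k))) n"
  proof (cases n)
    case (Suc m)
    have "(\<Sum>k\<le>Suc m. fps_nth (g k) (Suc m - k)) = fps_nth (g 0) (Suc m) + (\<Sum>k\<le>m. fps_nth (g (Suc k)) (m - k))"
      by (simp add: sum.atMost_Suc_shift del: sum.atMost_Suc)
    then show ?thesis using Suc by (simp add: layered_def)
  qed (simp add: layered_def)
qed

lemma layered_unfold: "layered g = (\<Sum>k<N. fps_X ^ k * g k) + fps_X ^ N * layered (\<lambda>k. g (k + N))"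
proof (induction N)
  case (Suc N)
  have "layered (\<lambda>k. g (k + N)) = g N + fps_X * layered (\<lambda>k. g (Suc k + N))"
    using layered_step[of "\<lambda>k. g (k + N)"] by simp
  then show ?case using Suc by (simp add: algebra_simps)
qed simp

text \<open>The X-adic test by which identities for homomorphisms of power series rings are reduced
  to finite expansions.\<close>

lemma fps_adic_eqI:
  fixes f g :: "'a::comm_ring_1 fps"
  assumes "\<And>N. \<exists>w. f - g = fps_X ^ N * w"
  shows "f = g"
proof (rule fps_ext)
  fix n
  obtain w where "f - g = fps_X ^ Suc n * w" using assms by blast
  then have "fps_nth (f - g) n = fps_nth (fps_X ^ Suc n * w) n" by simp
  also have "\<dots> = 0" by (simp only: fps_X_power_mult_nth) simp
  finally show "fps_nth f n = fps_nth g n" by simp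
qed

lemma layered_mult: "a * layered g = layered (\<lambda>k. a * g k)"
proof (rule fps_adic_eqI)
  fix N
  have "a * layered g - layered (\<lambda>k. a * g k) = fps_X ^ N * (a * layered (\<lambda>k. g (k + N)) - layered (\<lambda>k. a * g (k + N)))"
    unfolding layered_unfold[of g N] layered_unfold[of "\<lambda>k. a * g k" N]
    by (simp add: algebra_simps sum_distrib_left)
  then show "\<exists>w. a * layered g - layered (\<lambda>k. a * g k) = fps_X ^ N * w" by blast
qed

lemma layered_diff: "layered f - layered g = layered (\<lambda>k. f k - g k)"
  by (rule fps_ext) (simp add: layered_def sum_subtractf)

text \<open>The coefficient of \<open>X^(n+1)\<close> in \<open>f\<close> contributes to degree
  \<open>n\<close> once for each \<open>k \<le> n\<close>, which gives the factor
  \<open>n + 1\<close> of the derivative.\<close>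

lemma layered_shift: "fps_deriv f = layered (\<lambda>k. fps_shift (Suc k) f)"
proof (rule fps_ext)
  fix n
  have "(\<Sum>k\<le>n. fps_nth f (n - k + Suc k)) = (\<Sum>k\<le>n. fps_nth f (Suc n))" by (intro sum.cong) auto
  then show "fps_nth (fps_deriv f) n = fps_nth (layered (\<lambda>k. fps_shift (Suc k) f)) n"
    by (simp add: layered_def)
qed

lemma fps_shift_step: "fps_shift k f = fps_const (fps_nth f k) + fps_X * fps_shift (Suc k) f"
  for f :: "'a::comm_ring_1 fps"
proof (rule fps_ext)
  fix n show "fps_nth (fps_shift k f) n = fps_nth (fps_const (fps_nth f k) + fps_X * fps_shift (Suc k) f) n"
    by (cases n) auto
qed

lemma fps_split: "f = (\<Sum>k<N. fps_X ^ k * fps_const (fps_nth f k)) + fps_X ^ N * fps_shift N f"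
  for f :: "'a::comm_ring_1 fps"
proof (induction N)
  case (Suc N)
  show ?case
    by (subst Suc, subst fps_shift_step) (simp add: algebra_simps)
qed simp

context valuation
begin

lemma fge_layered: "(\<And>k. fge 0 (g k)) \<Longrightarrow> fge 0 (layered g)"
  unfolding fge_def layered_def by (auto intro!: vge_sum)

definition const_hom :: "('a fps \<Rightarrow> 'a fps) \<Rightarrow> bool" where
  "const_hom \<sigma> \<longleftrightarrow> (\<forall>f. fge 0 f \<longrightarrow> fge 0 (\<sigma> f)) \<and> (\<forall>f g. fge 0 f \<longrightarrow> fge 0 g \<longrightarrow> \<sigma> (f + g) = \<sigma> f + \<sigma> g \<and> \<sigma> (f * g) = \<sigma> f * \<sigma> g)
     \<and> (\<forall>c. vge v 0 c \<longrightarrow> \<sigma> (fps_const c) = fps_const c)"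

lemma const_homD:
  assumes "const_hom \<sigma>"
  shows "fge 0 f \<Longrightarrow> fge 0 (\<sigma> f)" "fge 0 f \<Longrightarrow> fge 0 g \<Longrightarrow> \<sigma> (f + g) = \<sigma> f + \<sigma> g"
    "fge 0 f \<Longrightarrow> fge 0 g \<Longrightarrow> \<sigma> (f * g) = \<sigma> f * \<sigma> g" "vge v 0 c \<Longrightarrow> \<sigma> (fps_const c) = fps_const c"
  using assms unfolding const_hom_def by auto

lemma const_hom_diff:
  assumes s: "const_hom \<sigma>" and "fge 0 f" "fge 0 g"
  shows "\<sigma> (f - g) = \<sigma> f - \<sigma> g"
  using const_homD(2)[OF s, of "f - g" g] assms fge_diff by (simp add: eq_diff_eq)

lemma const_hom_one: "const_hom \<sigma> \<Longrightarrow> \<sigma> 1 = 1"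
  using const_homD(4)[of \<sigma> 1] vge_one by simp

lemma const_hom_power: "const_hom \<sigma> \<Longrightarrow> fge 0 f \<Longrightarrow> \<sigma> (f ^ n) = \<sigma> f ^ n"
  by (induction n) (simp_all add: const_hom_one const_homD(3) fge_power)

text \<open>The quotient \<open>(\<sigma> f - f) / (\<sigma> X - X)\<close>, written as a series
  that makes sense also when \<open>\<sigma> X = X\<close>.\<close>

definition quot :: "('a fps \<Rightarrow> 'a fps) \<Rightarrow> 'a fps \<Rightarrow> 'a fps" where
  "quot \<sigma> f = layered (\<lambda>k. \<sigma> (fps_shift (Suc k) f))"

text \<open>\<open>\<sigma>\<close> is not assumed to commute with infinite sums, so
  \<open>f\<close> is split into a polynomial and \<open>X^N\<close> times a tail. The finite sum
  telescopes, and all that remains is divisible by \<open>X^N\<close>.\<close>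

lemma hom_difference:
  assumes s: "const_hom \<sigma>" and f: "fge 0 f"
  shows "\<sigma> f - f = (\<sigma> fps_X - fps_X) * quot \<sigma> f"
proof (rule fps_adic_eqI)
  fix N
  have sh: "\<sigma> (fps_shift k f) = fps_const (fps_nth f k) + \<sigma> fps_X * \<sigma> (fps_shift (Suc k) f)" for k
  proof -
    have c: "vge v 0 (fps_nth f k)" using f unfolding fge_def by blast
    show ?thesis
      by (subst fps_shift_step)
        (simp add: const_homD[OF s] fge_const[OF c] fge_mult_int fge_X fge_shift[OF f] c)
  qed
  have tele: "(\<Sum>k<N. fps_X ^ k * ((\<sigma> fps_X - fps_X) * \<sigma> (fps_shift (Suc k) f)))
     = \<sigma> f - fps_X ^ N * \<sigma> (fps_shift N f) - (\<Sum>k<N. fps_X ^ k * fps_const (fps_nth f k))"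
  proof (induction N)
    case (Suc N)
    have "(\<sigma> fps_X - fps_X) * \<sigma> (fps_shift (Suc N) f)
        = \<sigma> (fps_shift N f) - fps_const (fps_nth f N) - fps_X * \<sigma> (fps_shift (Suc N) f)"
      unfolding sh[of N] by (simp add: algebra_simps)
    then have "(\<Sum>k<Suc N. fps_X ^ k * ((\<sigma> fps_X - fps_X) * \<sigma> (fps_shift (Suc k) f)))
      = (\<sigma> f - fps_X ^ N * \<sigma> (fps_shift N f) - (\<Sum>k<N. fps_X ^ k * fps_const (fps_nth f k)))
        + fps_X ^ N * (\<sigma> (fps_shift N f) - fps_const (fps_nth f N) - fps_X * \<sigma> (fps_shift (Suc N) f))"
      by (simp only: sum.lessThan_Suc Suc)
    then show ?case by (simp add: algebra_simps)
  qed simp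
  have q: "(\<sigma> fps_X - fps_X) * quot \<sigma> f = (\<Sum>k<N. fps_X ^ k * ((\<sigma> fps_X - fps_X) * \<sigma> (fps_shift (Suc k) f)))
     + fps_X ^ N * ((\<sigma> fps_X - fps_X) * layered (\<lambda>k. \<sigma> (fps_shift (Suc (k + N)) f)))"
    unfolding quot_def layered_unfold[of "\<lambda>k. \<sigma> (fps_shift (Suc k) f)" N]
    by (simp add: algebra_simps sum_distrib_left)
  have "\<sigma> f - f - (\<sigma> fps_X - fps_X) * quot \<sigma> f = fps_X ^ N * (\<sigma> (fps_shift N f) - fps_shift N f - (\<sigma> fps_X - fps_X) * layered (\<lambda>k. \<sigma> (fps_shift (Suc (k + N)) f)))"
    unfolding q tele by (subst (2) fps_split[of f N]) (simp add: algebra_simps)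
  then show "\<exists>w. \<sigma> f - f - (\<sigma> fps_X - fps_X) * quot \<sigma> f = fps_X ^ N * w" by blast
qed

lemma fge_quot:
  assumes "const_hom \<sigma>" "fge 0 f"
  shows "fge 0 (quot \<sigma> f)"
  unfolding quot_def by (rule fge_layered, rule const_homD(1)[OF assms(1)], rule fge_shift[OF assms(2)])

text \<open>\<open>hom_difference\<close> is applied once more, to the terms of
  \<open>quot \<sigma> f\<close>: removing \<open>\<sigma>\<close> from them turns the quotient into
  the derivative, with an error divisible by \<open>\<sigma> X - X\<close>.\<close>

lemma hom_taylor:
  assumes s: "const_hom \<sigma>" and f: "fge 0 f"
  obtains g where "fge 0 g" "\<sigma> f = f + (\<sigma> fps_X - fps_X) * (fps_deriv f + (\<sigma> fps_X - fps_X) * g)"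
proof -
  let ?h = "\<sigma> fps_X - fps_X"
  define g where "g = layered (\<lambda>k. quot \<sigma> (fps_shift (Suc k) f))"
  have "quot \<sigma> f - fps_deriv f = layered (\<lambda>k. \<sigma> (fps_shift (Suc k) f) - fps_shift (Suc k) f)"
    unfolding quot_def layered_shift layered_diff ..
  also have "\<dots> = ?h * g" unfolding g_def layered_mult hom_difference[OF s fge_shift[OF f]] ..
  finally have "quot \<sigma> f = fps_deriv f + ?h * g" by (simp only: diff_eq_eq add.commute)
  moreover have "\<sigma> f = f + ?h * quot \<sigma> f"
    using hom_difference[OF s f] by (simp only: diff_eq_eq add.commute)
  ultimately have "\<sigma> f = f + ?h * (fps_deriv f + ?h * g)" by (simp only:)
  moreover have "fge 0 g" unfolding g_def by (rule fge_layered, rule fge_quot[OF s], rule fge_shift[OF f])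
  ultimately show ?thesis using that by blast
qed

end

subsection \<open>Zeros of power series\<close>

text \<open>A double root would also be a root of the derivative, so every linear factor of
  \<open>Q\<close> occurs once.\<close>

lemma simple_roots_product:
  fixes Q :: "'a::alg_closed_field poly"
  assumes Q: "lead_coeff Q = 1" and simple: "\<And>x. poly Q x = 0 \<Longrightarrow> poly (pderiv Q) x \<noteq> 0"
  shows "Q = (\<Prod>a\<in>{a. poly Q a = 0}. [:- a, 1:])" "card {a. poly Q a = 0} = degree Q"
proof -
  have "Q \<noteq> 0" using Q by auto
  then obtain A where A: "size A = degree Q" "Q = smult (lead_coeff Q) (\<Prod>x\<in>#A. [:- x, 1:])"
    using alg_closed_imp_factorization[of Q] by blast
  have QA: "Q = (\<Prod>x\<in>#A. [:- x, 1:])" using A(2) Q by simp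
  have c1: "count A x \<le> 1" for x
  proof (rule ccontr)
    assume "\<not> count A x \<le> 1"
    then have "{#x, x#} \<subseteq># A" by (simp add: subseteq_mset_def)
    then obtain B where B: "A = {#x, x#} + B" using subset_mset.le_iff_add by blast
    have "Q = [:- x, 1:] * ([:- x, 1:] * (\<Prod>y\<in>#B. [:- y, 1:]))" unfolding QA B by (simp add: mult.assoc)
    then obtain W where W: "Q = [:- x, 1:] * ([:- x, 1:] * W)" by blast
    have z: "poly [:- x, 1:] x = 0" by simp
    have "poly Q x = 0" "poly (pderiv Q) x = 0"
      unfolding W pderiv_mult poly_add poly_mult z by simp_all
    then show False using simple by blast
  qed
  have "set_mset A = {a. poly Q a = 0}"
  proof -
    have "poly (\<Prod>x\<in>#A. [:- x, 1:]) a = 0 \<longleftrightarrow> a \<in># A" for a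
      by (induction A) auto
    then show ?thesis unfolding QA[symmetric] by auto
  qed
  moreover have "A = mset_set (set_mset A)"
  proof (rule multiset_eqI)
    fix x
    show "count A x = count (mset_set (set_mset A)) x"
    proof (cases "x \<in># A")
      case True
      then have "count A x = 1" using c1[of x] by (simp add: Suc_leI le_antisym)
      then show ?thesis using True by simp
    next
      case False
      then show ?thesis by (simp add: not_in_iff)
    qed
  qed
  ultimately have AS: "A = mset_set {a. poly Q a = 0}" by simp
  show "Q = (\<Prod>a\<in>{a. poly Q a = 0}. [:- a, 1:])" using QA unfolding AS prod_unfold_prod_mset .
  show "card {a. poly Q a = 0} = degree Q" using A(1) AS by (metis size_mset_set)
qed

context disk
begin

definition factors :: "'k fps \<Rightarrow> 'k \<Rightarrow> 'k fps \<Rightarrow> 'k poly \<Rightarrow> bool" where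
  "factors h c u P \<longleftrightarrow> c \<noteq> 0 \<and> vge val 0 c \<and> K.fge 0 u \<and> fps_nth u 0 \<noteq> 0 \<and> val (fps_nth u 0) = 0 \<and>
     K.distinguished P \<and> h = fps_const c * u * fps_of_poly P"

lemma gauss_val_eq:
  assumes "\<And>i. vge val (val c) (fps_nth h i)" "fps_nth h i \<noteq> 0" "val (fps_nth h i) = val c"
  shows "gauss_val val h = val c"
  unfolding gauss_val_def
proof (rule Least_equality)
  show "\<exists>i. fps_nth h i \<noteq> 0 \<and> val c = val (fps_nth h i)" using assms by metis
  fix q assume "\<exists>i. fps_nth h i \<noteq> 0 \<and> q = val (fps_nth h i)"
  then show "val c \<le> q" using assms(1) unfolding vge_def by blast
qed

lemma val_ring_carrier: "carrier (val_ring val) = {x. vge val 0 x}"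
  unfolding val_ring_def vge_def by simp

lemma val_ring_cring: "cring (val_ring val)"
proof (rule cringI)
  show "abelian_group (val_ring val)"
  proof (rule abelian_groupI)
    fix x assume "x \<in> carrier (val_ring val)"
    then show "\<exists>y\<in>carrier (val_ring val). y \<oplus>\<^bsub>val_ring val\<^esub> x = \<zero>\<^bsub>val_ring val\<^esub>"
      unfolding val_ring_carrier by (intro bexI[of _ "- x"]) (auto simp: val_ring_def ring_of_type_algebra_def K.vge_uminus)
  qed (auto simp: val_ring_carrier, auto simp: val_ring_def ring_of_type_algebra_def K.vge_add)
  show "comm_monoid (val_ring val)"
    by (rule comm_monoidI) (auto simp: val_ring_carrier K.vge_one, auto simp: val_ring_def ring_of_type_algebra_def K.vge_one K.vge_mult_int)
qed (auto simp: val_ring_def ring_of_type_algebra_def algebra_simps)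

lemma prime_ideal_eq: "prime_ideal_of val \<pi> = {x. vge val K.e0 x}"
proof -
  have "PIdl\<^bsub>val_ring val\<^esub> \<pi> = {x * \<pi> | x. vge val 0 x}"
    unfolding cgenideal_def val_ring_carrier by (auto simp: val_ring_def ring_of_type_algebra_def)
  also have "\<dots> = {x. vge val K.e0 x}"
  proof (intro equalityI subsetI)
    fix y assume "y \<in> {x * \<pi> | x. vge val 0 x}"
    then obtain x where "y = x * \<pi>" "vge val 0 x" by blast
    then show "y \<in> {x. vge val K.e0 x}" using K.vge_mult_int(2)[of x K.e0 \<pi>] by (simp add: vge_def)
  next
    fix y assume "y \<in> {x. vge val K.e0 x}"
    then have "vge val (K.e0 + - K.e0) (y * inverse \<pi>)"
      using K.prime_elem K.val_inverse by (intro K.vge_mult) (auto simp: vge_def)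
    moreover have "y = (y * inverse \<pi>) * \<pi>" using K.prime_elem(1) by simp
    ultimately show "y \<in> {x * \<pi> | x. vge val 0 x}" by force
  qed
  finally show ?thesis .
qed

lemma reduction_zero_iff:
  assumes "K.fge 0 f"
  shows "fps_reduction val \<pi> f n = \<zero>\<^bsub>residue_field val \<pi>\<^esub> \<longleftrightarrow> vge val K.e0 (fps_nth f n)"
proof -
  interpret R: cring "val_ring val" by (rule val_ring_cring)
  have pc: "\<pi> \<in> carrier (val_ring val)" unfolding val_ring_carrier vge_def using K.prime_elem(2) by simp
  interpret I: ideal "prime_ideal_of val \<pi>" "val_ring val" by (rule R.cgenideal_ideal[OF pc])
  have fc: "fps_nth f n \<in> carrier (val_ring val)" using assms unfolding val_ring_carrier K.fge_def by auto
  have z: "\<zero>\<^bsub>residue_field val \<pi>\<^esub> = prime_ideal_of val \<pi>" unfolding residue_field_def FactRing_def by simp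
  have "prime_ideal_of val \<pi> +>\<^bsub>val_ring val\<^esub> fps_nth f n = prime_ideal_of val \<pi> \<longleftrightarrow> fps_nth f n \<in> prime_ideal_of val \<pi>"
    using I.a_rcos_const[of "fps_nth f n"] I.a_rcos_self[OF fc] by metis
  then show ?thesis unfolding fps_reduction_def z prime_ideal_eq by simp
qed

lemma factors_exist:
  assumes h: "K.fge 0 h" "h \<noteq> 0"
  obtains c u P where "factors h c u P" "gauss_val val h = val c" "num_zeros val \<pi> h = degree P"
    "\<And>i. vge val (val c) (fps_nth h i)"
proof -
  obtain c f d where c: "c \<noteq> 0" "vge val 0 c" and f: "K.regular f d" "h = fps_const c * f"
    and m: "\<And>i. vge val (val c) (fps_nth h i)" and ex: "\<exists>i. fps_nth h i \<noteq> 0 \<and> val (fps_nth h i) = val c"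
    using K.regular_multiple[OF h] by metis
  obtain u P where u: "K.fge 0 u" "fps_nth u 0 \<noteq> 0" "val (fps_nth u 0) = 0" "K.distinguished P" "degree P = d" "f = u * fps_of_poly P"
    using K.weierstrass_preparation[OF f(1)] by blast
  have fac: "factors h c u P" unfolding factors_def f(2) using c u by (simp add: mult.assoc)
  have g: "gauss_val val h = val c" using gauss_val_eq m ex by blast
  \<comment> \<open>The scalar selected by \<open>num_zeros\<close> differs from \<open>c\<close> by
    a factor of valuation 0, which does not change which coefficients reduce to zero.\<close>
  define c' where "c' = (SOME c. c \<in> carrier (val_ring val) \<and> c \<noteq> 0 \<and> val c = gauss_val val h)"
  have ex': "\<exists>c. c \<in> carrier (val_ring val) \<and> c \<noteq> 0 \<and> val c = gauss_val val h" using c g unfolding val_ring_carrier by auto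
  have "c' \<in> carrier (val_ring val) \<and> c' \<noteq> 0 \<and> val c' = gauss_val val h" unfolding c'_def by (rule someI_ex[OF ex'])
  then have c': "c' \<noteq> 0" "val c' = val c" using g by simp_all
  define f' where "f' = fps_const (inverse c') * h"
  have f': "fps_nth f' i = (inverse c' * c) * fps_nth f i" for i unfolding f'_def f(2) by simp
  have w: "inverse c' * c \<noteq> 0" "val (inverse c' * c) = 0" using c c' K.val_mult K.val_inverse by auto
  have vf: "vge val q (fps_nth f' i) \<longleftrightarrow> vge val q (fps_nth f i)" for q i
    unfolding f' using w K.val_mult by (cases "fps_nth f i = 0") (auto simp: vge_def)
  have f'0: "K.fge 0 f'" using f(1) vf unfolding K.regular_def K.fge_def by blast
  have "ord_z (residue_field val \<pi>) (fps_reduction val \<pi> f') = d"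
    unfolding ord_z_def reduction_zero_iff[OF f'0] vf
  proof (rule Least_equality)
    show "\<not> vge val K.e0 (fps_nth f d)" using f(1) K.prime_elem(2) unfolding K.regular_def vge_def by auto
    fix y assume "\<not> vge val K.e0 (fps_nth f y)"
    then show "d \<le> y" using f(1) unfolding K.regular_def by (meson not_le)
  qed
  then have "num_zeros val \<pi> h = degree P" unfolding num_zeros_def Let_def c'_def[symmetric] f'_def[symmetric] u(5) .
  then show ?thesis using that fac g m by blast
qed

lemma ev_factors:
  assumes "factors h c u P" and x: "x \<in> pts"
  shows "ev x h = to_ac c * ev x u * poly (map_poly to_ac P) x"
    and "ev x u \<noteq> 0" "valbar (ev x u) = 0"
proof -
  note f = assms(1)[unfolded factors_def]
  have i: "K.fge 0 (fps_const c)" "K.fge 0 u" "K.fge 0 (fps_of_poly P)" using f K.fge_const distinguished_int by auto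
  show "ev x h = to_ac c * ev x u * poly (map_poly to_ac P) x"
    using f ev_mult[OF x K.fge_mult_int[OF i(1,2)] i(3)] ev_mult[OF x i(1,2)] ev_const[OF x] ev_poly[OF x i(3)] by simp
  show "ev x u \<noteq> 0" "valbar (ev x u) = 0" using ev_unit[OF x] f by auto
qed

text \<open>If \<open>valbar x \<le> 0\<close>, the leading term of a distinguished polynomial
  strictly dominates all others, so the value cannot vanish.\<close>

lemma distinguished_root_in_disk:
  assumes P: "K.distinguished P" and x: "poly (map_poly to_ac P) x = 0"
  shows "x \<in> pts"
proof (rule ccontr)
  assume "x \<notin> pts"
  then have nz: "x \<noteq> 0" and v: "valbar x \<le> 0" unfolding disk_points_def by auto
  let ?d = "degree P"
  have "poly (map_poly to_ac P) x = (\<Sum>i\<le>?d. to_ac (coeff P i) * x ^ i)"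
    unfolding poly_altdef by (simp add: coeff_map_poly degree_map_poly)
  also have "\<dots> = x ^ ?d + (\<Sum>i<?d. to_ac (coeff P i) * x ^ i)"
    using P unfolding K.distinguished_def by (simp add: lessThan_Suc_atMost[symmetric])
  finally have e: "x ^ ?d + (\<Sum>i<?d. to_ac (coeff P i) * x ^ i) = 0" using x by simp
  have "vge valbar (K.e0 + of_nat ?d * valbar x) (\<Sum>i<?d. to_ac (coeff P i) * x ^ i)"
  proof (rule L.vge_sum)
    fix i assume i: "i \<in> {..<?d}"
    have "vge valbar K.e0 (to_ac (coeff P i))" using P i unfolding K.distinguished_def vge_to_ac by auto
    moreover have "of_nat ?d * valbar x \<le> of_nat i * valbar x" using v i by (intro mult_right_mono_neg) auto
    then have "vge valbar (of_nat ?d * valbar x) (x ^ i)" using L.val_power[OF nz] by (simp add: vge_def)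
    ultimately show "vge valbar (K.e0 + of_nat ?d * valbar x) (to_ac (coeff P i) * x ^ i)" by (rule L.vge_mult)
  qed
  then have "(\<Sum>i<?d. to_ac (coeff P i) * x ^ i) = 0 \<or> valbar (x ^ ?d) < valbar (\<Sum>i<?d. to_ac (coeff P i) * x ^ i)"
    using K.prime_elem(2) L.val_power[OF nz, of ?d] unfolding vge_def by auto
  then show False using L.val_add_dominant[of "x ^ ?d" "\<Sum>i<?d. to_ac (coeff P i) * x ^ i"] nz e by simp
qed

end

subsection \<open>Roots of unity\<close>

definition exact_order :: "'a::field \<Rightarrow> nat \<Rightarrow> bool" where
  "exact_order z n \<longleftrightarrow> 0 < n \<and> (\<forall>t. z ^ t = 1 \<longleftrightarrow> n dvd t)"

lemma exact_orderI:
  assumes "0 < n" "z ^ n = 1" "\<And>t. z ^ t = 1 \<Longrightarrow> n dvd t"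
  shows "exact_order z n"
  unfolding exact_order_def using assms by (auto simp: power_mult)

lemma exact_orderD: "exact_order z n \<Longrightarrow> 0 < n" "exact_order z n \<Longrightarrow> z ^ t = 1 \<longleftrightarrow> n dvd t"
  unfolding exact_order_def by auto

lemma exact_order_power:
  assumes "exact_order z (a * b)" "0 < a"
  shows "exact_order (z ^ a) b"
  using assms unfolding exact_order_def by (auto simp: power_mult[symmetric])

lemma degree_monom_minus_const:
  assumes "0 < q"
  shows "degree (monom 1 q - [:w:]) = q" "coeff (monom 1 q - [:w:]) q = (1::'a::comm_ring_1)"
proof -
  have c: "coeff (monom 1 q - [:w:]) i = (if i = q then 1 else if i = 0 then - w else 0)" for i
    using assms by (auto simp: coeff_pCons split: nat.splits)
  show "coeff (monom 1 q - [:w:]) q = 1" unfolding c by simp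
  show "degree (monom 1 q - [:w:]) = q"
    by (intro antisym degree_le le_degree) (auto simp: c simp del: coeff_diff)
qed

text \<open>Let \<open>n = q m\<close> with \<open>q\<close> prime and \<open>w\<close> of order
  \<open>m\<close>. If \<open>q\<close> divides \<open>m\<close>, a \<open>q\<close>-th root of
  \<open>w\<close> has order \<open>n\<close>. Otherwise \<open>w\<close> is multiplied by a root of
  \<open>1 + X + ... + X^(q-1)\<close>; it differs from 1 because \<open>q \<noteq> 0\<close> in
  characteristic zero, and so it has order \<open>q\<close>.\<close>

lemma exact_order_exists:
  assumes "0 < n"
  shows "\<exists>z :: 'a :: {alg_closed_field, field_char_0}. exact_order z n"
  using assms
proof (induction n rule: less_induct)
  case (less n)
  show ?case
  proof (cases "n = 1")
    case True
    have "exact_order (1::'a) 1" unfolding exact_order_def by simp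
    then show ?thesis using True by blast
  next
    case False
    then obtain q where q: "Factorial_Ring.prime q" "q dvd n" using prime_factor_nat by blast
    then obtain m where m: "n = q * m" by auto
    have q1: "1 < q" using q(1) prime_gt_1_nat by blast
    have m0: "0 < m" using less.prems m by simp
    have "m < n" using m q1 m0 by simp
    then obtain w :: 'a where w: "exact_order w m" using less.IH m0 by blast
    note wm = exact_orderD(2)[OF w]
    show ?thesis
    proof (cases "q dvd m")
      case True
      then obtain l where l: "m = q * l" by auto
      have l0: "0 < l" using l m0 by simp
      have "degree (monom 1 q - [:w:]) = q"
        using q1 by (intro degree_monom_minus_const) simp
      then obtain z where "poly (monom 1 q - [:w:]) z = 0"
        using alg_closed_imp_poly_has_root[of "monom 1 q - [:w:]"] q1 by auto
      then have z: "z ^ q = w" by (simp add: poly_monom)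
      have "exact_order z n"
      proof (rule exact_orderI[OF less.prems])
        show "z ^ n = 1" unfolding m power_mult z using wm by simp
        fix t assume t: "z ^ t = 1"
        have "w ^ t = 1" unfolding z[symmetric] power_mult[symmetric] using t by (simp add: mult.commute[of q] power_mult)
        then have "m dvd t" using wm by simp
        then obtain s where s: "t = m * s" by auto
        have "w ^ (l * s) = 1" unfolding z[symmetric] power_mult[symmetric] using t s l by (simp add: mult.assoc)
        then have "q * l dvd l * s" using wm l by simp
        then have "q dvd s" using l0 by (metis dvd_mult_cancel2 mult.commute nat_mult_dvd_cancel_disj not_gr_zero)
        then show "n dvd t" unfolding m s by (metis dvd_triv_right mult.commute mult_dvd_mono dvd_refl)
      qed
      then show ?thesis by blast
    next
      case False
      define S where "S = (\<Sum>i<q. monom (1::'a) i)"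
      have cS: "coeff S i = (if i < q then 1 else 0)" for i unfolding S_def by (simp add: coeff_sum sum.delta)
      have "degree S = q - 1"
      proof (rule antisym)
        show "degree S \<le> q - 1" by (rule degree_le) (use cS q1 in auto)
        show "q - 1 \<le> degree S" by (rule le_degree) (use q1 in \<open>simp add: cS\<close>)
      qed
      then obtain x where x: "poly S x = 0" using alg_closed_imp_poly_has_root[of S] q1 by auto
      then have s0: "(\<Sum>i<q. x ^ i) = 0" by (simp add: S_def poly_sum poly_monom)
      have xq: "x ^ q = 1" using power_diff_1_eq[of x q] s0 by simp
      have x1: "x \<noteq> 1" using s0 q1 by auto
      have x: "exact_order x q"
      proof (rule exact_orderI[OF _ xq])
        fix t assume t: "x ^ t = 1"
        show "q dvd t"
        proof (rule ccontr)
          assume "\<not> q dvd t"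
          then have "coprime t q" using q(1) by (metis coprime_commute prime_imp_coprime_nat)
          then obtain a b where "t * a = q * b + 1" using coprime_bezout_strong[of t q] q1 by (metis coprime_Suc_0_right One_nat_def less_irrefl)
          then have "x ^ (t * a) = x ^ (q * b + 1)" by simp
          then show False using t xq x1 by (simp add: power_mult power_add)
        qed
      qed (use q1 in simp)
      have cop: "coprime m q" using False q(1) by (metis coprime_commute prime_imp_coprime_nat)
      have "exact_order (w * x) n"
      proof (rule exact_orderI[OF less.prems])
        show "(w * x) ^ n = 1" unfolding power_mult_distrib using wm[of n] exact_orderD(2)[OF x, of n] m by simp
        fix t assume t: "(w * x) ^ t = 1"
        have "(w * x) ^ (t * q) = 1" using t by (simp add: power_mult)
        moreover have "x ^ (t * q) = 1" using exact_orderD(2)[OF x] by simp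
        ultimately have "w ^ (t * q) = 1" unfolding power_mult_distrib by simp
        then have "m dvd t" using wm cop coprime_dvd_mult_left_iff by blast
        moreover have "w ^ t = 1" using wm calculation by simp
        then have "x ^ t = 1" using t unfolding power_mult_distrib by simp
        then have "q dvd t" using exact_orderD(2)[OF x] by simp
        ultimately show "n dvd t" unfolding m using cop by (simp add: divides_mult coprime_commute)
      qed
      then show ?thesis by blast
    qed
  qed
qed

text \<open>\<open>X^n - 1\<close> is separable, so its \<open>n\<close> roots are the distinct
  powers of \<open>z\<close>. The product is the value at 1 of
  \<open>(X^n - 1) / (X - 1) = 1 + ... + X^(n-1)\<close>.\<close>

lemma roots_of_unity:
  fixes z :: "'a :: {alg_closed_field, field_char_0}"
  assumes z: "exact_order z n"
  shows "{x. x ^ n = 1} = (\<lambda>a. z ^ a) ` {..<n}" "inj_on (\<lambda>a. z ^ a) {..<n}"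
    "(\<Prod>a\<in>{1..<n}. (1 - z ^ a)) = of_nat n"
proof -
  have n: "0 < n" using exact_orderD(1)[OF z] .
  have z0: "z \<noteq> 0" using exact_orderD[OF z] by (metis dvd_refl zero_neq_one zero_power)
  show inj: "inj_on (\<lambda>a. z ^ a) {..<n}"
  proof (rule linorder_inj_onI')
    fix i j assume ij: "i \<in> {..<n}" "j \<in> {..<n}" "i < j"
    show "z ^ i \<noteq> z ^ j"
    proof
      assume e: "z ^ i = z ^ j"
      have "z ^ j = z ^ i * z ^ (j - i)" using ij(3) by (simp flip: power_add)
      then have "z ^ (j - i) = 1" using e z0 by simp
      then have "n dvd j - i" using exact_orderD(2)[OF z] by simp
      then show False using ij by (auto dest: dvd_imp_le)
    qed
  qed
  let ?Q = "monom 1 n - [:1:] :: 'a poly"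
  note dQ = degree_monom_minus_const(1)[OF n, of "1::'a"]
  have pQ: "poly ?Q x = x ^ n - 1" for x by (simp add: poly_monom)
  have lead: "lead_coeff ?Q = 1" unfolding dQ by (rule degree_monom_minus_const(2)[OF n])
  have simple: "poly (pderiv ?Q) x \<noteq> 0" if "poly ?Q x = 0" for x
  proof -
    have xn: "x ^ n = 1" using that pQ by simp
    then have "x \<noteq> 0" using n by (metis zero_power zero_neq_one)
    then show ?thesis using n by (simp add: pderiv_diff pderiv_monom poly_monom pderiv_pCons)
  qed
  note sp = simple_roots_product[OF lead simple]
  have rt: "{a. poly ?Q a = 0} = {x. x ^ n = 1}" using pQ by auto
  have nz: "?Q \<noteq> 0" using lead by (metis coeff_0 zero_neq_one)
  have "finite {x::'a. x ^ n = 1}" using poly_roots_finite[OF nz] unfolding rt .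
  moreover have "(\<lambda>a. z ^ a) ` {..<n} \<subseteq> {x. x ^ n = 1}"
    using exact_orderD(2)[OF z] by (auto simp: power_mult[symmetric])
  moreover have "card ((\<lambda>a. z ^ a) ` {..<n}) = card {x::'a. x ^ n = 1}"
    using sp(2) unfolding dQ rt card_image[OF inj] by simp
  ultimately show set: "{x. x ^ n = 1} = (\<lambda>a. z ^ a) ` {..<n}" using card_subset_eq by metis
  have "?Q = (\<Prod>a\<in>{..<n}. [:- (z ^ a), 1:])"
    using sp(1) unfolding rt set prod.reindex[OF inj] by simp
  also have "{..<n} = insert 0 {1..<n}" using n by auto
  also have "(\<Prod>a\<in>insert 0 {1..<n}. [:- (z ^ a), 1:]) = [:- 1, 1:] * (\<Prod>a\<in>{1..<n}. [:- (z ^ a), 1:])" by simp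
  finally have 1: "?Q = [:- 1, 1:] * (\<Prod>a\<in>{1..<n}. [:- (z ^ a), 1:])" .
  have "[:0, 1:] ^ n - 1 = ([:0, 1:] - 1) * (\<Sum>i<n. [:0, 1::'a:] ^ i)" by (rule power_diff_1_eq)
  moreover have "[:0, 1:] - 1 = [:- 1, 1::'a:]" by (simp add: one_pCons)
  ultimately have "?Q = [:- 1, 1:] * (\<Sum>i<n. [:0, 1:] ^ i)" by (simp add: monom_altdef one_pCons)
  then have "[:- 1, 1:] * (\<Prod>a\<in>{1..<n}. [:- (z ^ a), 1:]) = [:- 1, 1:] * (\<Sum>i<n. [:0, 1:] ^ i)" using 1 by (simp only:)
  then have "(\<Prod>a\<in>{1..<n}. [:- (z ^ a), 1:]) = (\<Sum>i<n. [:0, 1:] ^ i)"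
    by (subst (asm) mult_left_cancel) auto
  then have "poly (\<Prod>a\<in>{1..<n}. [:- (z ^ a), 1:]) 1 = poly (\<Sum>i<n. [:0, 1:] ^ i) 1" by simp
  then show "(\<Prod>a\<in>{1..<n}. (1 - z ^ a)) = of_nat n" by (simp add: poly_prod poly_sum)
qed

context disk
begin

lemma valbar_p: "valbar (of_nat p) = 1"
  using L.extends[of "of_nat p"] K.val_p K.prime_p not_prime_0 by auto

text \<open>By Bezout some multiple of \<open>n\<close> has the form \<open>p b + 1\<close>, which
  has valuation 0, and both factors of that multiple have nonnegative valuation.\<close>

lemma valbar_of_nat_coprime:
  assumes "\<not> p dvd n"
  shows "valbar (of_nat n) = 0"
proof -
  have n0: "n \<noteq> 0" using assms by (metis dvd_0_right)
  have "coprime n p" using K.prime_p assms by (metis coprime_commute prime_imp_coprime_nat)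
  then obtain a b where ab: "n * a = p * b + 1" using coprime_bezout_strong[of n p] K.prime_p by (metis not_prime_1)
  have ge: "0 \<le> valbar (of_nat n)" using L.vge_of_nat[of n] n0 unfolding vge_def by simp
  have "vge valbar (1 + 0) (of_nat p * of_nat b)"
    using L.vge_of_nat by (intro L.vge_mult) (simp_all add: vge_def valbar_p)
  then have "(1::'k alg_closure) + of_nat p * of_nat b \<noteq> 0 \<and> valbar (1 + of_nat p * of_nat b) = valbar 1"
    by (intro L.val_add_dominant) (auto simp: vge_def L.val_one)
  moreover have "(1::'k alg_closure) + of_nat p * of_nat b = of_nat n * of_nat a"
    using arg_cong[OF ab, of "of_nat :: nat \<Rightarrow> 'k alg_closure"] by simp
  ultimately have "(of_nat n * of_nat a :: 'k alg_closure) \<noteq> 0" "valbar (of_nat n * of_nat a) = 0" using L.val_one by auto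
  then have "valbar (of_nat n) + valbar (of_nat a) = 0" "a \<noteq> 0" using L.val_mult[of "of_nat n" "of_nat a"] by auto
  moreover have "0 \<le> valbar (of_nat a)" using L.vge_of_nat[of a] calculation(2) unfolding vge_def by simp
  ultimately show ?thesis using ge by simp
qed

text \<open>\<open>1 - z\<close> divides \<open>1 - z^a\<close> with the integral quotient
  \<open>1 + z + ... + z^(a-1)\<close>.\<close>

lemma valbar_root_of_unity_power:
  assumes z: "exact_order z n" and a: "\<not> n dvd a"
  shows "1 - z ^ a \<noteq> 0" "valbar (1 - z) \<le> valbar (1 - z ^ a)" "0 \<le> valbar (1 - z)"
proof -
  note e = exact_orderD[OF z]
  have zn: "z ^ n = 1" using e by simp
  have z0: "z \<noteq> 0" using zn e(1) by (metis zero_power zero_neq_one)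
  have "of_nat n * valbar z = 0" using L.val_power[OF z0, of n] zn L.val_one by simp
  then have "valbar z = 0" using e(1) by simp
  then have iz: "vge valbar 0 z" by (simp add: vge_def)
  show n1: "1 - z ^ a \<noteq> 0" using e(2)[of a] a by auto
  have "1 - z \<noteq> 0" using n1 by auto
  moreover have "vge valbar 0 (1 - z)" using L.vge_diff[OF L.vge_one iz] .
  ultimately show "0 \<le> valbar (1 - z)" by (simp add: vge_def)
  have "vge valbar (valbar (1 - z)) ((1 - z) * (\<Sum>i<a. z ^ i))"
    using iz by (intro L.vge_mult_int(1) L.vge_sum L.vge_power_int) (auto simp: vge_def)
  moreover have "1 - z ^ a = (1 - z) * (\<Sum>i<a. z ^ i)" by (rule one_diff_power_eq)
  ultimately have "vge valbar (valbar (1 - z)) (1 - z ^ a)" by simp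
  then show "valbar (1 - z) \<le> valbar (1 - z ^ a)" using n1 by (simp add: vge_def)
qed

lemma sum_valbar_roots:
  assumes z: "exact_order z n"
  shows "(\<Sum>a\<in>{1..<n}. valbar (1 - z ^ a)) = valbar (of_nat n)"
proof -
  have "valbar (\<Prod>a\<in>{1..<n}. (1 - z ^ a)) = (\<Sum>a\<in>{1..<n}. valbar (1 - z ^ a))"
    by (rule L.val_prod) (use valbar_root_of_unity_power(1)[OF z] nat_dvd_not_less in auto)
  then show ?thesis using roots_of_unity(3)[OF z] by simp
qed

text \<open>If \<open>n\<close> is not a power of \<open>p\<close>, some power \<open>w\<close> of
  \<open>z\<close> has order \<open>m > 1\<close> prime to \<open>p\<close>. The differences
  \<open>1 - w^a\<close> multiply to the unit \<open>m\<close>, and \<open>1 - z\<close> divides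
  \<open>1 - w\<close>. If \<open>n = p^(j+1)\<close>, the valuations of all \<open>1 - z^a\<close>
  add up to \<open>j + 1\<close>. Exponents divisible by \<open>p\<close> account for
  \<open>j\<close>, and the other \<open>p^j (p - 1)\<close> valuations are equal, so each is
  \<open>1 / (p^j (p - 1))\<close>.\<close>

lemma valbar_root_of_unity:
  assumes z: "exact_order z n" and n: "1 < n"
  shows "valbar (1 - z) = cyclotomic_val p n"
proof -
  have p1: "1 < p" using K.prime_p prime_gt_1_nat by blast
  define k where "k = multiplicity p n"
  obtain m where m: "n = p ^ k * m" "\<not> p dvd m"
    unfolding k_def using multiplicity_decompose'[of n p] n p1 by (metis nat_dvd_1_iff_1 less_irrefl not_one_less_zero)
  show ?thesis
  proof (cases "m = 1")
    case False
    have m0: "0 < m" using m n by (cases m) auto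
    have "1 < m" using False m0 by simp
    define w where "w = z ^ (p ^ k)"
    have w: "exact_order w m" unfolding w_def using z p1 unfolding m(1) by (intro exact_order_power) auto
    have "0 \<le> valbar (1 - w ^ a)" if a: "a \<in> {1..<m}" for a
      using valbar_root_of_unity_power(2,3)[OF w, of a] a nat_dvd_not_less[of a m] by auto
    then have "valbar (1 - w ^ 1) \<le> (\<Sum>a\<in>{1..<m}. valbar (1 - w ^ a))"
      using \<open>1 < m\<close> by (intro member_le_sum) auto
    then have "valbar (1 - w) \<le> 0" using sum_valbar_roots[OF w] valbar_of_nat_coprime[OF m(2)] by simp
    moreover have pk: "0 < p ^ k" "p ^ k < n" unfolding m(1) using \<open>1 < m\<close> p1 by simp_all
    have "\<not> n dvd p ^ k" by (rule nat_dvd_not_less[OF pk])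
    then have "valbar (1 - z) \<le> valbar (1 - w)" "0 \<le> valbar (1 - z)" unfolding w_def using valbar_root_of_unity_power[OF z] by blast+
    moreover have "n \<noteq> p ^ multiplicity p n" using pk(2) unfolding k_def by simp
    ultimately show ?thesis unfolding cyclotomic_val_def by simp
  next
    case True
    then have nk: "n = p ^ k" using m by simp
    then have k0: "0 < k" using n by (cases k) auto
    then obtain j where j: "k = Suc j" by (cases k) auto
    have n': "n = p * p ^ j" using nk j by simp
    have w: "exact_order (z ^ p) (p ^ j)" using z p1 unfolding n' by (intro exact_order_power) auto
    have vk: "valbar (of_nat (p ^ i)) = of_nat i" for i
    proof -
      have "(of_nat p :: 'k alg_closure) \<noteq> 0" using p1 by simp
      then show ?thesis using L.val_power[of "of_nat p" i] valbar_p by simp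
    qed
    let ?D = "{a\<in>{1..<n}. p dvd a}" and ?N = "{a\<in>{1..<n}. \<not> p dvd a}"
    have D: "?D = (*) p ` {1..<p^j}"
    proof (intro equalityI subsetI)
      fix a assume "a \<in> ?D"
      then obtain b where b: "a = p * b" "1 \<le> a" "a < n" by auto
      then have "p * b < p * p ^ j" "0 < p * b" using n' by auto
      then have "b \<in> {1..<p^j}" by (simp only: nat_mult_less_cancel_disj nat_0_less_mult_iff) auto
      then show "a \<in> (*) p ` {1..<p^j}" using b(1) by blast
    qed (use p1 n' in auto)
    have injp: "inj_on ((*) p) {1..<p^j}" using p1 by (simp add: inj_on_def)
    have "(\<Sum>a\<in>?D. valbar (1 - z ^ a)) = (\<Sum>b\<in>{1..<p^j}. valbar (1 - (z ^ p) ^ b))"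
      unfolding D sum.reindex[OF injp] comp_def power_mult ..
    then have SD: "(\<Sum>a\<in>?D. valbar (1 - z ^ a)) = of_nat j" using sum_valbar_roots[OF w] vk by simp
    \<comment> \<open>For \<open>a\<close> prime to \<open>n\<close>, each of \<open>z\<close> and
      \<open>z^a\<close> is a power of the other, so the two valuations bound each other.\<close>
    have "valbar (1 - z ^ a) = valbar (1 - z)" if a: "a \<in> ?N" for a
    proof (rule antisym)
      have na: "\<not> n dvd a" using a nat_dvd_not_less[of a n] by auto
      show "valbar (1 - z) \<le> valbar (1 - z ^ a)" by (rule valbar_root_of_unity_power(2)[OF z na])
      have "coprime a n" using a K.prime_p unfolding nk
        by (metis (mono_tags, lifting) coprime_commute coprime_power_right_iff mem_Collect_eq prime_imp_coprime_nat)
      then obtain x y where xy: "a * x = n * y + 1" using coprime_bezout_strong[of a n] n by (metis less_irrefl)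
      have za: "exact_order (z ^ a) n"
      proof (rule exact_orderI)
        fix t assume "(z ^ a) ^ t = 1"
        then have "n dvd a * t" using exact_orderD(2)[OF z, of "a * t"] by (simp add: power_mult)
        then show "n dvd t" using \<open>coprime a n\<close> by (simp add: coprime_commute coprime_dvd_mult_right_iff)
      qed (use n exact_orderD(2)[OF z] in \<open>auto simp: power_mult[symmetric]\<close>)
      have "(z ^ a) ^ x = z ^ (n * y + 1)" using xy by (simp flip: power_mult)
      also have "\<dots> = z" using exact_orderD(2)[OF z, of "n * y"] by simp
      finally have zx: "(z ^ a) ^ x = z" .
      have "\<not> n dvd x"
      proof
        assume "n dvd x"
        then have "(z ^ a) ^ x = 1" using exact_orderD(2)[OF za] by simp
        then have "z ^ 1 = 1" using zx by simp
        then show False using exact_orderD(2)[OF z, of 1] n by simp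
      qed
      then show "valbar (1 - z ^ a) \<le> valbar (1 - z)" using valbar_root_of_unity_power(2)[OF za] zx by metis
    qed
    then have SN: "(\<Sum>a\<in>?N. valbar (1 - z ^ a)) = of_nat (card ?N) * valbar (1 - z)" by simp
    have DN: "{1..<n} = ?D \<union> ?N" by auto
    have "(\<Sum>a\<in>{1..<n}. valbar (1 - z ^ a)) = (\<Sum>a\<in>?D \<union> ?N. valbar (1 - z ^ a))" by (rule arg_cong[OF DN])
    also have "\<dots> = of_nat j + of_nat (card ?N) * valbar (1 - z)"
      unfolding SD[symmetric] SN[symmetric] by (rule sum.union_disjoint) auto
    finally have S: "of_nat k = of_nat j + of_nat (card ?N) * valbar (1 - z)"
      using sum_valbar_roots[OF z] vk[of k] nk by simp
    have "card {1..<n} = card ?D + card ?N" unfolding arg_cong[OF DN, of card] by (rule card_Un_disjoint) auto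
    moreover have "card ?D = p ^ j - 1" unfolding D card_image[OF injp] by simp
    moreover have "1 \<le> p ^ j" using p1 by simp
    moreover have "card {1..<n} = n - 1" by simp
    ultimately have "card ?N + p ^ j = p * p ^ j" using n' n by linarith
    then have cN: "(of_nat (card ?N) :: rat) = of_nat (p ^ j) * (of_nat p - 1)"
    proof -
      have "(of_nat (card ?N) :: rat) + of_nat (p ^ j) = of_nat p * of_nat (p ^ j)"
        using \<open>card ?N + p ^ j = p * p ^ j\<close> by (metis of_nat_add of_nat_mult)
      then have "(of_nat (card ?N) :: rat) = of_nat p * of_nat (p ^ j) - of_nat (p ^ j)" by (simp only: eq_diff_eq)
      then show ?thesis by (simp only: right_diff_distrib mult_1_right mult.commute[of "of_nat p"])
    qed
    have ne: "of_nat (p ^ j) * (of_nat p - 1) \<noteq> (0::rat)" using p1 by simp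
    have "of_nat (p ^ j) * (of_nat p - 1) * valbar (1 - z) = 1" using S unfolding cN j by simp
    then have "valbar (1 - z) = 1 / (of_nat (p ^ j) * (of_nat p - 1))" using ne by (simp add: field_simps)
    then show ?thesis unfolding nk using cyclotomic_val_prime_power[OF K.prime_p k0] j by simp
  qed
qed

end

text \<open>\<open>\<chi>\<close> embeds \<open>H\<close> into the roots of unity of order dividing
  \<open>card H\<close>. There are exactly \<open>card H\<close> of these, so the image contains a
  primitive one, and its preimage generates \<open>H\<close>.\<close>

lemma (in group) cyclic_of_field_embedding:
  fixes \<chi> :: "'a \<Rightarrow> 'c :: {alg_closed_field, field_char_0}"
  assumes H: "subgroup H G" and fin: "finite H"
    and one: "\<chi> \<one> = 1" and mult: "\<And>g h. g \<in> H \<Longrightarrow> h \<in> H \<Longrightarrow> \<chi> (g \<otimes> h) = \<chi> g * \<chi> h"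
    and inj: "\<And>g. g \<in> H \<Longrightarrow> \<chi> g = 1 \<Longrightarrow> g = \<one>"
  shows "\<exists>s\<in>H. H = generate G {s}" "\<And>g. g \<in> H \<Longrightarrow> exact_order (\<chi> g) (ord g)"
proof -
  interpret H: subgroup H G by fact
  have pw: "g [^] (t::nat) \<in> H \<and> \<chi> (g [^] t) = \<chi> g ^ t" if "g \<in> H" for g t
    using that one mult by (induction t) (auto simp: mult.commute)
  have o0: "0 < ord g" if g: "g \<in> H" for g
  proof -
    interpret HG: group "G\<lparr>carrier := H\<rparr>" by (rule H.subgroup_is_group[OF group_axioms])
    have "g [^]\<^bsub>G\<lparr>carrier := H\<rparr>\<^esub> card H = \<one>"
      using HG.pow_order_eq_1[of g] g unfolding Coset.order_def by simp
    then have "g [^] card H = \<one>" by (simp add: nat_pow_consistent[symmetric])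
    then have "ord g dvd card H" using pow_eq_id g by auto
    moreover have "card H \<noteq> 0" using fin H.one_closed card_0_eq by blast
    ultimately show ?thesis using dvd_pos_nat by blast
  qed
  show eo: "exact_order (\<chi> g) (ord g)" if g: "g \<in> H" for g
    unfolding exact_order_def
  proof (intro conjI allI o0[OF g])
    fix t
    have "\<chi> g ^ t = 1 \<longleftrightarrow> g [^] t = \<one>" using pw[OF g, of t] inj one by metis
    then show "\<chi> g ^ t = 1 \<longleftrightarrow> ord g dvd t" using pow_eq_id g by auto
  qed
  define n where "n = card H"
  have n0: "0 < n" unfolding n_def using fin H.one_closed card_gt_0_iff by blast
  obtain z :: 'c where z: "exact_order z n" using exact_order_exists[OF n0] by blast
  have injH: "inj_on \<chi> H"
  proof (rule inj_onI)
    fix x y assume xy: "x \<in> H" "y \<in> H" "\<chi> x = \<chi> y"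
    have "\<chi> (inv y) * \<chi> y = 1" using mult[of "inv y" y] xy one by simp
    then have "\<chi> (inv y \<otimes> x) = 1" using mult[of "inv y" x] xy by simp
    then have "inv y \<otimes> x = \<one>" using inj xy by simp
    then show "x = y" using xy by (metis H.mem_carrier inv_closed inv_equality inv_inv)
  qed
  have "\<chi> ` H \<subseteq> {x. x ^ n = 1}"
  proof
    fix x assume "x \<in> \<chi> ` H"
    then obtain g where g: "g \<in> H" "x = \<chi> g" by auto
    interpret HG: group "G\<lparr>carrier := H\<rparr>" by (rule H.subgroup_is_group[OF group_axioms])
    have "g [^]\<^bsub>G\<lparr>carrier := H\<rparr>\<^esub> card H = \<one>"
      using HG.pow_order_eq_1[of g] g unfolding Coset.order_def by simp
    then have "g [^] n = \<one>" unfolding n_def by (simp add: nat_pow_consistent[symmetric])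
    then show "x \<in> {x. x ^ n = 1}" using pw[OF g(1), of n] one g(2) by simp
  qed
  moreover have "card {x::'c. x ^ n = 1} = n"
    by (simp only: roots_of_unity(1)[OF z] card_image[OF roots_of_unity(2)[OF z]] card_lessThan)
  then have "card (\<chi> ` H) = card {x::'c. x ^ n = 1}"
    unfolding n_def using card_image[OF injH] by simp
  moreover have "finite {x::'c. x ^ n = 1}" unfolding roots_of_unity(1)[OF z] by simp
  ultimately have "\<chi> ` H = {x. x ^ n = 1}" using card_subset_eq by metis
  moreover have "z \<in> {x. x ^ n = 1}" using exact_orderD(2)[OF z] by simp
  ultimately have "z \<in> \<chi> ` H" by simp
  then obtain s where s: "s \<in> H" "\<chi> s = z" by blast
  have "ord s = n"
    using eo[OF s(1)] z unfolding s(2) exact_order_def by (metis dvd_antisym dvd_refl)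
  then have "card (generate G {s}) = card H" using generate_pow_card[of s] s(1) n_def by auto
  moreover have "generate G {s} \<subseteq> H" using s(1) by (intro generate_subgroup_incl H) auto
  ultimately have "generate G {s} = H" using fin card_subset_eq by blast
  then show "\<exists>s\<in>H. H = generate G {s}" using s(1) by blast
qed

subsection \<open>Groups of automorphisms\<close>

context disk
begin

definition integral_fps :: "'k fps set" where "integral_fps = {f. K.fge 0 f}"

lemma integral_iff: "f \<in> integral_fps \<longleftrightarrow> K.fge 0 f" unfolding integral_fps_def by simp

lemma disk_ring_carrier: "carrier (disk_ring val) = integral_fps"
  unfolding disk_ring_def integral_fps_def K.fge_def val_ring_carrier by simp

lemma in_aut_iff: "\<sigma> \<in> carrier (disk_aut val) \<longleftrightarrow> \<sigma> \<in> Bij integral_fps \<and> K.const_hom \<sigma>"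
proof -
  have "\<sigma> \<in> ring_iso (disk_ring val) (disk_ring val) \<and> (\<forall>c\<in>carrier (val_ring val). \<sigma> (fps_const c) = fps_const c)
      \<longleftrightarrow> K.const_hom \<sigma>" if b: "\<sigma> \<in> Bij integral_fps"
  proof
    assume "\<sigma> \<in> ring_iso (disk_ring val) (disk_ring val) \<and> (\<forall>c\<in>carrier (val_ring val). \<sigma> (fps_const c) = fps_const c)"
    then show "K.const_hom \<sigma>"
      unfolding ring_iso_def Ring.ring_hom_def K.const_hom_def disk_ring_carrier val_ring_carrier
      by (auto simp: integral_iff disk_ring_def ring_of_type_algebra_def Pi_iff)
  next
    assume h: "K.const_hom \<sigma>"
    have "bij_betw \<sigma> integral_fps integral_fps" using b unfolding Bij_def by auto
    then show "\<sigma> \<in> ring_iso (disk_ring val) (disk_ring val) \<and> (\<forall>c\<in>carrier (val_ring val). \<sigma> (fps_const c) = fps_const c)"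
      unfolding ring_iso_def Ring.ring_hom_def disk_ring_carrier val_ring_carrier
      using K.const_homD[OF h] K.const_hom_one[OF h]
      by (auto simp: integral_iff disk_ring_def ring_of_type_algebra_def)
  qed
  then show ?thesis unfolding disk_aut_def disk_ring_carrier by auto
qed

lemma aut_mult: "\<sigma> \<in> carrier (disk_aut val) \<Longrightarrow> \<tau> \<in> carrier (disk_aut val) \<Longrightarrow> \<sigma> \<otimes>\<^bsub>disk_aut val\<^esub> \<tau> = compose integral_fps \<sigma> \<tau>"
  unfolding in_aut_iff by (simp add: disk_aut_def BijGroup_def disk_ring_carrier)

lemma aut_one: "\<one>\<^bsub>disk_aut val\<^esub> = (\<lambda>f\<in>integral_fps. f)"
  by (simp add: disk_aut_def BijGroup_def disk_ring_carrier)

lemma aut_hom: "\<sigma> \<in> carrier (disk_aut val) \<Longrightarrow> K.const_hom \<sigma>"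
  unfolding in_aut_iff by simp

lemma aut_apply:
  assumes "\<sigma> \<in> carrier (disk_aut val)" "\<tau> \<in> carrier (disk_aut val)" "K.fge 0 f"
  shows "(\<sigma> \<otimes>\<^bsub>disk_aut val\<^esub> \<tau>) f = \<sigma> (\<tau> f)"
  unfolding aut_mult[OF assms(1,2)] using assms(3) by (simp add: compose_def integral_iff)

text \<open>The substance is that the inverse map of an automorphism again respects sums, products
  and constants. Outside the integral series the maps carry no information, by the extensionality
  built into \<open>Bij\<close>.\<close>

lemma aut_group: "group (disk_aut val)"
proof (rule groupI)
  fix \<sigma> \<tau> assume s: "\<sigma> \<in> carrier (disk_aut val)" and t: "\<tau> \<in> carrier (disk_aut val)"
  have "compose integral_fps \<sigma> \<tau> \<in> Bij integral_fps" using s t compose_Bij unfolding in_aut_iff by blast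
  moreover have "K.const_hom (compose integral_fps \<sigma> \<tau>)"
    unfolding K.const_hom_def compose_def
    using K.const_homD[OF aut_hom[OF s]] K.const_homD[OF aut_hom[OF t]] K.fge_add K.fge_mult_int K.fge_const
    by (simp add: integral_iff)
  ultimately show "\<sigma> \<otimes>\<^bsub>disk_aut val\<^esub> \<tau> \<in> carrier (disk_aut val)" unfolding aut_mult[OF s t] in_aut_iff by blast
  fix \<rho> assume r: "\<rho> \<in> carrier (disk_aut val)"
  have cl: "\<sigma> \<otimes>\<^bsub>disk_aut val\<^esub> \<tau> \<in> carrier (disk_aut val)" by fact
  have "compose integral_fps \<tau> \<rho> \<in> Bij integral_fps" using t r compose_Bij unfolding in_aut_iff by blast
  moreover have "K.const_hom (compose integral_fps \<tau> \<rho>)"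
    unfolding K.const_hom_def compose_def
    using K.const_homD[OF aut_hom[OF t]] K.const_homD[OF aut_hom[OF r]] K.fge_add K.fge_mult_int K.fge_const
    by (simp add: integral_iff)
  ultimately have cr: "\<tau> \<otimes>\<^bsub>disk_aut val\<^esub> \<rho> \<in> carrier (disk_aut val)" unfolding aut_mult[OF t r] in_aut_iff by blast
  have "\<rho> \<in> integral_fps \<rightarrow> integral_fps" using r Bij_imp_funcset unfolding in_aut_iff by blast
  then have "compose integral_fps (compose integral_fps \<sigma> \<tau>) \<rho> = compose integral_fps \<sigma> (compose integral_fps \<tau> \<rho>)"
    by (rule compose_assoc[symmetric])
  then show "\<sigma> \<otimes>\<^bsub>disk_aut val\<^esub> \<tau> \<otimes>\<^bsub>disk_aut val\<^esub> \<rho> = \<sigma> \<otimes>\<^bsub>disk_aut val\<^esub> (\<tau> \<otimes>\<^bsub>disk_aut val\<^esub> \<rho>)"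
    using aut_mult[OF cl r] aut_mult[OF s cr] aut_mult[OF s t] aut_mult[OF t r] by metis
next
  show "\<one>\<^bsub>disk_aut val\<^esub> \<in> carrier (disk_aut val)"
    unfolding in_aut_iff aut_one K.const_hom_def
    by (auto simp: id_Bij integral_iff K.fge_add K.fge_mult_int K.fge_const)
next
  fix \<sigma> assume s: "\<sigma> \<in> carrier (disk_aut val)"
  have one: "\<one>\<^bsub>disk_aut val\<^esub> \<in> carrier (disk_aut val)"
    unfolding in_aut_iff aut_one K.const_hom_def
    by (auto simp: id_Bij integral_iff K.fge_add K.fge_mult_int K.fge_const)
  have sB: "\<sigma> \<in> Bij integral_fps" using s unfolding in_aut_iff by blast
  show "\<one>\<^bsub>disk_aut val\<^esub> \<otimes>\<^bsub>disk_aut val\<^esub> \<sigma> = \<sigma>"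
    using Id_compose[OF Bij_imp_funcset[OF sB] Bij_imp_extensional[OF sB]] aut_mult[OF one s] aut_one by metis
  define \<tau> where "\<tau> = (\<lambda>f\<in>integral_fps. inv_into integral_fps \<sigma> f)"
  have tB: "\<tau> \<in> Bij integral_fps" unfolding \<tau>_def by (rule restrict_inv_into_Bij[OF sB])
  have bij: "bij_betw \<sigma> integral_fps integral_fps" using sB unfolding Bij_def by auto
  have st: "\<sigma> (\<tau> f) = f" "\<tau> f \<in> integral_fps" if "f \<in> integral_fps" for f
    using that bij unfolding \<tau>_def by (auto simp: bij_betw_inv_into_right bij_betw_def inv_into_into)
  have ts: "\<tau> (\<sigma> f) = f" if "f \<in> integral_fps" for f
    using that bij unfolding \<tau>_def by (auto simp: bij_betw_inv_into_left bij_betw_apply)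
  note h = K.const_homD[OF aut_hom[OF s]]
  have "K.const_hom \<tau>"
    unfolding K.const_hom_def integral_iff[symmetric]
  proof (intro conjI allI impI)
    fix f g assume f: "f \<in> integral_fps" and g: "g \<in> integral_fps"
    have "\<tau> (\<sigma> (\<tau> f + \<tau> g)) = \<tau> f + \<tau> g" "\<tau> (\<sigma> (\<tau> f * \<tau> g)) = \<tau> f * \<tau> g"
      using st(2)[OF f] st(2)[OF g] K.fge_add K.fge_mult_int by (auto intro!: ts simp: integral_iff)
    then show "\<tau> (f + g) = \<tau> f + \<tau> g" "\<tau> (f * g) = \<tau> f * \<tau> g"
      using h(2,3)[of "\<tau> f" "\<tau> g"] st[OF f] st[OF g] by (simp_all add: integral_iff)
  next
    fix c assume c: "vge val 0 c"
    have "\<tau> (\<sigma> (fps_const c)) = fps_const c" by (rule ts) (simp add: integral_iff K.fge_const c)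
    then show "\<tau> (fps_const c) = fps_const c" using h(4)[OF c] by simp
  qed (use st in simp)
  then have t: "\<tau> \<in> carrier (disk_aut val)" unfolding in_aut_iff using tB by blast
  have "\<tau> \<otimes>\<^bsub>disk_aut val\<^esub> \<sigma> = \<one>\<^bsub>disk_aut val\<^esub>"
    unfolding aut_mult[OF t s] aut_one using ts by (auto simp: compose_def)
  then show "\<exists>y\<in>carrier (disk_aut val). y \<otimes>\<^bsub>disk_aut val\<^esub> \<sigma> = \<one>\<^bsub>disk_aut val\<^esub>" using t by blast
qed

text \<open>A series with all coefficients of valuation at least \<open>val c\<close> is
  \<open>c\<close> times an integral series, and \<open>\<sigma>\<close> fixes
  \<open>c\<close>.\<close>

lemma hom_fge:
  assumes s: "K.const_hom \<sigma>" and c: "c \<noteq> 0" "vge val 0 c" and f: "K.fge (val c) f"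
  shows "K.fge (val c) (\<sigma> f)"
proof -
  define g where "g = fps_const (inverse c) * f"
  have g: "K.fge 0 g"
    using K.fge_mult[OF K.fge_const f, of "- val c" "inverse c"] c(1) K.val_inverse unfolding g_def by (simp add: vge_def)
  have e: "f = fps_const c * g" unfolding g_def using c(1) by (simp add: mult.assoc[symmetric])
  have "\<sigma> f = fps_const c * \<sigma> g"
    unfolding e using K.const_homD(3)[OF s K.fge_const[OF c(2)] g] K.const_homD(4)[OF s c(2)] by simp
  then show ?thesis using K.fge_mult[OF K.fge_const K.const_homD(1)[OF s g], of "val c" c] by (simp add: vge_def)
qed

lemma gauss_props:
  assumes h: "K.fge 0 h" "h \<noteq> 0"
  obtains c where "c \<noteq> 0" "vge val 0 c" "gauss_val val h = val c" "K.fge (val c) h"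
proof -
  obtain c u P where "factors h c u P" "gauss_val val h = val c" "\<And>i. vge val (val c) (fps_nth h i)"
    using factors_exist[OF h] by metis
  then show ?thesis using that unfolding factors_def K.fge_def by blast
qed

lemma gauss_ge:
  assumes h: "K.fge 0 h" "h \<noteq> 0" and q: "K.fge q h"
  shows "q \<le> gauss_val val h"
proof -
  obtain c f d where "c \<noteq> 0" and m: "\<And>i. vge val (val c) (fps_nth h i)" and ex: "\<exists>i. fps_nth h i \<noteq> 0 \<and> val (fps_nth h i) = val c"
    using K.regular_multiple[OF h] by metis
  then obtain i where i: "fps_nth h i \<noteq> 0" "val (fps_nth h i) = val c" by blast
  have "gauss_val val h = val c" by (rule gauss_val_eq[OF m i])
  moreover have "q \<le> val c" using q i unfolding K.fge_def vge_def by metis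
  ultimately show ?thesis by simp
qed

end

locale disk_group = disk val \<pi> p valbar
  for val :: "'k::field_char_0 \<Rightarrow> rat" and \<pi> p valbar +
  fixes G :: "('k fps \<Rightarrow> 'k fps) set"
  assumes sub: "subgroup G (disk_aut val)" and finG: "finite G"
begin

abbreviation GG where "GG \<equiv> disk_aut val\<lparr>carrier := G\<rparr>"

sublocale grp: group GG
  using subgroup.subgroup_is_group[OF sub aut_group] .

lemma G_aut: "\<sigma> \<in> G \<Longrightarrow> \<sigma> \<in> carrier (disk_aut val)"
  using subgroup.subset[OF sub] by blast

lemma hom: "\<sigma> \<in> G \<Longrightarrow> K.const_hom \<sigma>"
  using aut_hom G_aut by blast

lemma mult_apply: "\<sigma> \<in> G \<Longrightarrow> \<tau> \<in> G \<Longrightarrow> K.fge 0 f \<Longrightarrow> (\<sigma> \<otimes>\<^bsub>GG\<^esub> \<tau>) f = \<sigma> (\<tau> f)"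
  using aut_apply G_aut by simp

lemma one_apply: "K.fge 0 f \<Longrightarrow> \<one>\<^bsub>GG\<^esub> f = f"
  by (simp add: aut_one integral_iff)

lemma inv_apply: "\<sigma> \<in> G \<Longrightarrow> K.fge 0 f \<Longrightarrow> (inv\<^bsub>GG\<^esub> \<sigma>) (\<sigma> f) = f" "\<sigma> \<in> G \<Longrightarrow> K.fge 0 f \<Longrightarrow> \<sigma> ((inv\<^bsub>GG\<^esub> \<sigma>) f) = f"
  using mult_apply[of "inv\<^bsub>GG\<^esub> \<sigma>" \<sigma> f] mult_apply[of \<sigma> "inv\<^bsub>GG\<^esub> \<sigma>" f] grp.l_inv[of \<sigma>] grp.r_inv[of \<sigma>]
    grp.inv_closed[of \<sigma>] one_apply by auto

lemma image_int: "\<sigma> \<in> G \<Longrightarrow> K.fge 0 f \<Longrightarrow> K.fge 0 (\<sigma> f)"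
  using K.const_homD(1)[OF hom] .

lemma X_int: "\<sigma> \<in> G \<Longrightarrow> K.fge 0 (\<sigma> fps_X)"
  using image_int K.fge_X by blast

definition displ :: "('k fps \<Rightarrow> 'k fps) \<Rightarrow> 'k fps" where "displ \<sigma> = \<sigma> fps_X - fps_X"

lemma displ_int: "\<sigma> \<in> G \<Longrightarrow> K.fge 0 (displ \<sigma>)"
  unfolding displ_def using X_int K.fge_X K.fge_diff by blast

lemma aut_eqI:
  assumes s: "\<sigma> \<in> G" and t: "\<tau> \<in> G" and e: "\<And>f. K.fge 0 f \<Longrightarrow> \<sigma> f = \<tau> f"
  shows "\<sigma> = \<tau>"
proof -
  have "\<sigma> \<in> extensional integral_fps" "\<tau> \<in> extensional integral_fps"
    using G_aut[OF s] G_aut[OF t] unfolding in_aut_iff Bij_def by auto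
  then show ?thesis using e integral_iff by (intro extensionalityI) auto
qed

text \<open>By \<open>hom_difference\<close>, an automorphism that fixes \<open>X\<close> fixes
  every integral series.\<close>

lemma displ_zero: "\<sigma> \<in> G \<Longrightarrow> displ \<sigma> = 0 \<longleftrightarrow> \<sigma> = \<one>\<^bsub>GG\<^esub>"
proof
  assume s: "\<sigma> \<in> G" and z: "displ \<sigma> = 0"
  show "\<sigma> = \<one>\<^bsub>GG\<^esub>"
  proof (rule aut_eqI[OF s])
    show "\<one>\<^bsub>GG\<^esub> \<in> G" using grp.one_closed by simp
    fix f assume f: "K.fge 0 f"
    have "\<sigma> f - f = 0" using K.hom_difference[OF hom[OF s] f] z unfolding displ_def by simp
    then show "\<sigma> f = \<one>\<^bsub>GG\<^esub> f" using one_apply[OF f] by simp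
  qed
next
  assume "\<sigma> = \<one>\<^bsub>GG\<^esub>"
  then show "displ \<sigma> = 0" unfolding displ_def using one_apply[OF K.fge_X] by simp
qed

text \<open>The group acts on points from the right, since \<open>\<sigma>\<close> is composed on the left.\<close>

definition rx :: "('k fps \<Rightarrow> 'k fps) \<Rightarrow> 'k alg_closure \<Rightarrow> 'k alg_closure" where "rx \<sigma> x = ev x (\<sigma> fps_X)"

text \<open>With a unit as constant term \<open>\<sigma> X\<close> would be invertible, and the
  inverse automorphism would make \<open>X\<close> invertible.\<close>

lemma X_nonunit:
  assumes s: "\<sigma> \<in> G"
  shows "vge val K.e0 (fps_nth (\<sigma> fps_X) 0)"
proof (rule ccontr)
  assume n: "\<not> ?thesis"
  have i: "vge val 0 (fps_nth (\<sigma> fps_X) 0)" using X_int[OF s] unfolding K.fge_def by blast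
  have nz: "fps_nth (\<sigma> fps_X) 0 \<noteq> 0" using n unfolding vge_def by blast
  have "val (fps_nth (\<sigma> fps_X) 0) = 0" using n i nz K.val_pos_ge[OF nz] unfolding vge_def by force
  note u = K.fge_inverse(1)[OF X_int[OF s] nz this]
  let ?v = "(inv\<^bsub>GG\<^esub> \<sigma>) (inverse (\<sigma> fps_X))"
  have iG: "inv\<^bsub>GG\<^esub> \<sigma> \<in> G" using grp.inv_closed[of \<sigma>] s by simp
  have "fps_X * ?v = (inv\<^bsub>GG\<^esub> \<sigma>) (\<sigma> fps_X) * ?v" using inv_apply(1)[OF s K.fge_X] by simp
  also have "\<dots> = (inv\<^bsub>GG\<^esub> \<sigma>) (\<sigma> fps_X * inverse (\<sigma> fps_X))"
    using K.const_homD(3)[OF hom[OF iG] X_int[OF s] u] by simp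
  also have "\<dots> = 1" using nz K.const_hom_one[OF hom[OF iG]] by (simp add: inverse_mult_eq_1')
  finally have "fps_nth (fps_X * ?v) 0 = 1" by simp
  then show False by simp
qed

lemma rx_pts:
  assumes s: "\<sigma> \<in> G" and x: "x \<in> pts"
  shows "rx \<sigma> x \<in> pts"
proof -
  let ?f = "\<sigma> fps_X"
  have c: "vge val 0 (fps_nth ?f 0)" using X_int[OF s] unfolding K.fge_def by blast
  have "?f = fps_const (fps_nth ?f 0) + fps_X * fps_shift 1 ?f" using fps_shift_step[of 0 ?f] by simp
  then have "rx \<sigma> x = ev x (fps_const (fps_nth ?f 0) + fps_X * fps_shift 1 ?f)" unfolding rx_def by simp
  also have "\<dots> = to_ac (fps_nth ?f 0) + x * ev x (fps_shift 1 ?f)"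
    using K.fge_const[OF c] K.fge_X K.fge_shift[OF X_int[OF s]] K.fge_mult_int
    by (simp add: ev_add[OF x] ev_mult[OF x] ev_const[OF x c] ev_X[OF x])
  finally have e: "rx \<sigma> x = to_ac (fps_nth ?f 0) + x * ev x (fps_shift 1 ?f)" .
  let ?m = "min K.e0 (wt x)"
  have "vge valbar ?m (to_ac (fps_nth ?f 0))" using X_nonunit[OF s] vge_mono unfolding vge_to_ac by force
  moreover have "vge valbar ?m (x * ev x (fps_shift 1 ?f))"
    using vge_mono[OF vge_wt] ev_int[OF x K.fge_shift[OF X_int[OF s]]] by (intro L.vge_mult_int(1)) auto
  ultimately have "vge valbar ?m (rx \<sigma> x)" unfolding e by (rule L.vge_add)
  moreover have "0 < ?m" using K.prime_elem(2) wt_pos[OF x] by simp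
  ultimately show ?thesis unfolding disk_points_def vge_def by auto
qed

text \<open>The substitution principle. \<open>f\<close> is split into a polynomial and
  \<open>X^n\<close> times an integral tail. The polynomial part evaluates as expected, and the tail
  contributes \<open>rx \<sigma> x ^ n\<close> times an integral value, which is just the error
  allowed by \<open>evals\<close>.\<close>

lemma ev_hom:
  assumes s: "\<sigma> \<in> G" and x: "x \<in> pts" and f: "K.fge 0 f"
  shows "ev x (\<sigma> f) = ev (rx \<sigma> x) f"
proof -
  have y: "rx \<sigma> x \<in> pts" using rx_pts[OF s x] .
  note h = K.const_homD[OF hom[OF s]]
  have part: "ev x (\<Sum>k<N. \<sigma> (fps_X ^ k * fps_const (fps_nth f k))) = poly (trunc_poly N f) (rx \<sigma> x)
     \<and> K.fge 0 (\<Sum>k<N. \<sigma> (fps_X ^ k * fps_const (fps_nth f k)))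
     \<and> \<sigma> (\<Sum>k<N. fps_X ^ k * fps_const (fps_nth f k)) = (\<Sum>k<N. \<sigma> (fps_X ^ k * fps_const (fps_nth f k)))
     \<and> K.fge 0 (\<Sum>k<N. fps_X ^ k * fps_const (fps_nth f k))" for N
  proof (induction N)
    case 0
    have "ev x 0 = 0" using ev_const[OF x, of 0] by simp
    moreover have "\<sigma> 0 = 0" using h(4)[of 0] by simp
    ultimately show ?case by (simp add: trunc_poly_def)
  next
    case (Suc N)
    have c: "vge val 0 (fps_nth f N)" using f unfolding K.fge_def by blast
    note i = K.fge_power[OF K.fge_X, of N] K.fge_const[OF c] K.fge_power[OF X_int[OF s], of N]
    have t: "\<sigma> (fps_X ^ N * fps_const (fps_nth f N)) = \<sigma> fps_X ^ N * fps_const (fps_nth f N)"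
      using h(3)[OF i(1,2)] h(4)[OF c] K.const_hom_power[OF hom[OF s] K.fge_X] by simp
    have "ev x (\<sigma> fps_X ^ N * fps_const (fps_nth f N)) = to_ac (fps_nth f N) * rx \<sigma> x ^ N"
      using ev_mult[OF x i(3,2)] ev_power[OF x X_int[OF s]] ev_const[OF x c] unfolding rx_def by simp
    then show ?case
      using Suc K.fge_mult_int[OF i(1,2)] K.fge_mult_int[OF i(3,2)]
      by (simp add: t ev_add[OF x] poly_trunc K.fge_add h(2))
  qed
  have "evals f (rx \<sigma> x) (ev x (\<sigma> f))"
    unfolding evals_def
  proof
    fix n
    let ?t = "fps_shift n f"
    have ti: "K.fge 0 ?t" by (rule K.fge_shift[OF f])
    note pn = part[of n]
    have Xt: "K.fge 0 (fps_X ^ n * ?t)" using K.fge_mult_int K.fge_power K.fge_X ti by blast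
    have "\<sigma> f = (\<Sum>k<n. \<sigma> (fps_X ^ k * fps_const (fps_nth f k))) + \<sigma> (fps_X ^ n * ?t)"
      using arg_cong[OF fps_split[of f n], of \<sigma>] h(2)[of "\<Sum>k<n. fps_X ^ k * fps_const (fps_nth f k)" "fps_X ^ n * ?t"] pn Xt by simp
    also have "\<sigma> (fps_X ^ n * ?t) = \<sigma> fps_X ^ n * \<sigma> ?t"
      using h(3)[OF K.fge_power[OF K.fge_X] ti] K.const_hom_power[OF hom[OF s] K.fge_X] by simp
    finally have "ev x (\<sigma> f) = poly (trunc_poly n f) (rx \<sigma> x) + rx \<sigma> x ^ n * ev x (\<sigma> ?t)"
      using pn h(1)[OF ti] K.fge_power[OF X_int[OF s]] K.fge_mult_int
      by (simp add: ev_add[OF x] ev_mult[OF x] ev_power[OF x X_int[OF s]] rx_def)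
    moreover have "vge valbar (of_nat n * wt (rx \<sigma> x)) (rx \<sigma> x ^ n * ev x (\<sigma> ?t))"
      using L.vge_power[OF vge_wt] ev_int[OF x h(1)[OF ti]] by (rule L.vge_mult_int(1))
    ultimately show "vge valbar (of_nat n * wt (rx \<sigma> x)) (ev x (\<sigma> f) - poly (trunc_poly n f) (rx \<sigma> x))" by simp
  qed
  then show ?thesis using ev_eqI[OF y] by simp
qed

lemma rx_mult: "\<sigma> \<in> G \<Longrightarrow> \<tau> \<in> G \<Longrightarrow> x \<in> pts \<Longrightarrow> rx (\<sigma> \<otimes>\<^bsub>GG\<^esub> \<tau>) x = rx \<tau> (rx \<sigma> x)"
  unfolding rx_def[of "\<sigma> \<otimes>\<^bsub>GG\<^esub> \<tau>"] using mult_apply[OF _ _ K.fge_X] ev_hom[OF _ _ X_int]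
  by (simp add: rx_def)

lemma rx_one: "x \<in> pts \<Longrightarrow> rx \<one>\<^bsub>GG\<^esub> x = x"
  unfolding rx_def using one_apply[OF K.fge_X] ev_X by simp

lemma rx_inv:
  assumes s: "\<sigma> \<in> G" and x: "x \<in> pts"
  shows "rx (inv\<^bsub>GG\<^esub> \<sigma>) (rx \<sigma> x) = x" "rx \<sigma> (rx (inv\<^bsub>GG\<^esub> \<sigma>) x) = x" "inv\<^bsub>GG\<^esub> \<sigma> \<in> G"
proof -
  show i: "inv\<^bsub>GG\<^esub> \<sigma> \<in> G" using grp.inv_closed[of \<sigma>] s by simp
  have "\<sigma> \<otimes>\<^bsub>GG\<^esub> inv\<^bsub>GG\<^esub> \<sigma> = \<one>\<^bsub>GG\<^esub>" "inv\<^bsub>GG\<^esub> \<sigma> \<otimes>\<^bsub>GG\<^esub> \<sigma> = \<one>\<^bsub>GG\<^esub>"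
    using grp.r_inv[of \<sigma>] grp.l_inv[of \<sigma>] s by simp_all
  then show "rx (inv\<^bsub>GG\<^esub> \<sigma>) (rx \<sigma> x) = x" "rx \<sigma> (rx (inv\<^bsub>GG\<^esub> \<sigma>) x) = x"
    using rx_mult[OF s i x] rx_mult[OF i s x] rx_one[OF x] by metis+
qed

text \<open>Neither \<open>rx \<sigma>\<close> nor its inverse increases distances, by
  \<open>ev_lipschitz\<close>.\<close>

lemma rx_iso:
  assumes s: "\<sigma> \<in> G" and x: "x \<in> pts" and y: "y \<in> pts"
  shows "rx \<sigma> x = rx \<sigma> y \<longleftrightarrow> x = y" "valbar (rx \<sigma> x - rx \<sigma> y) = valbar (x - y)"
proof -
  show inj: "rx \<sigma> x = rx \<sigma> y \<longleftrightarrow> x = y" using rx_inv(1)[OF s x] rx_inv(1)[OF s y] by metis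
  have le: "valbar (u - v) \<le> valbar (rx \<tau> u - rx \<tau> v)" if "\<tau> \<in> G" "u \<in> pts" "v \<in> pts" "rx \<tau> u \<noteq> rx \<tau> v" for \<tau> u v
    using ev_lipschitz[OF that(2,3) X_int[OF that(1)]] that(4) unfolding rx_def by auto
  show "valbar (rx \<sigma> x - rx \<sigma> y) = valbar (x - y)"
  proof (cases "x = y")
    case False
    have "valbar (rx \<sigma> x - rx \<sigma> y) \<le> valbar (x - y)"
      using le[OF rx_inv(3)[OF s x] rx_pts[OF s x] rx_pts[OF s y]] rx_inv(1)[OF s x] rx_inv(1)[OF s y] False by simp
    then show ?thesis using le[OF s x y] inj False by simp
  qed simp
qed

lemma ev_displ: "\<sigma> \<in> G \<Longrightarrow> x \<in> pts \<Longrightarrow> ev x (displ \<sigma>) = rx \<sigma> x - x"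
  unfolding displ_def rx_def using ev_diff[OF _ X_int K.fge_X] ev_X by simp

text \<open>At a fixed point this is the multiplier, the action of \<open>\<sigma>\<close> on the
  cotangent line at \<open>x\<close>.\<close>

definition chi :: "'k alg_closure \<Rightarrow> ('k fps \<Rightarrow> 'k fps) \<Rightarrow> 'k alg_closure" where
  "chi x \<sigma> = ev x (fps_deriv (\<sigma> fps_X))"

lemma chi_displ:
  assumes "\<sigma> \<in> G" "x \<in> pts"
  shows "ev x (fps_deriv (displ \<sigma>)) = chi x \<sigma> - 1"
proof -
  have "ev x 1 = 1" using ev_const[OF assms(2), of 1] K.vge_one by simp
  then show ?thesis
    unfolding displ_def chi_def using ev_diff[OF assms(2) K.fge_deriv[OF X_int[OF assms(1)]] K.fge_one] by simp
qed

lemma chi_one: "x \<in> pts \<Longrightarrow> chi x \<one>\<^bsub>GG\<^esub> = 1"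
  unfolding chi_def using one_apply[OF K.fge_X] ev_const[of x 1] K.vge_one by simp

text \<open>The chain rule at a fixed point. By the Taylor expansion
  \<open>\<sigma> (\<tau> X) = \<tau> X + h w\<close>, where \<open>h = \<sigma> X - X\<close>
  vanishes at \<open>x\<close> and \<open>w\<close> has the value \<open>chi x \<tau>\<close> there;
  it remains to differentiate.\<close>

lemma chi_mult:
  assumes s: "\<sigma> \<in> G" and t: "\<tau> \<in> G" and x: "x \<in> pts" and fx: "rx \<sigma> x = x"
  shows "chi x (\<sigma> \<otimes>\<^bsub>GG\<^esub> \<tau>) = chi x \<sigma> * chi x \<tau>"
proof -
  let ?h = "displ \<sigma>" and ?f = "\<tau> fps_X"
  obtain g where g: "K.fge 0 g" "\<sigma> ?f = ?f + ?h * (fps_deriv ?f + ?h * g)"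
    using K.hom_taylor[OF hom[OF s] X_int[OF t]] unfolding displ_def by blast
  note i = displ_int[OF s] K.fge_deriv[OF X_int[OF t]] K.fge_deriv[OF displ_int[OF s]] g(1)
  define w where "w = fps_deriv ?f + ?h * g"
  have w: "K.fge 0 w" unfolding w_def using i K.fge_add K.fge_mult_int by blast
  have z: "ev x ?h = 0" using ev_displ[OF s x] fx by simp
  have wx: "ev x w = chi x \<tau>"
    unfolding w_def using ev_add[OF x i(2) K.fge_mult_int[OF i(1,4)]] ev_mult[OF x i(1,4)] z by (simp add: chi_def)
  have "chi x (\<sigma> \<otimes>\<^bsub>GG\<^esub> \<tau>) = ev x (fps_deriv (?f + ?h * w))"
    unfolding chi_def mult_apply[OF s t K.fge_X] g(2) w_def ..
  also have "fps_deriv (?f + ?h * w) = fps_deriv ?f + (?h * fps_deriv w + fps_deriv ?h * w)" by simp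
  also have "ev x \<dots> = chi x \<tau> + (ev x ?h * ev x (fps_deriv w) + ev x (fps_deriv ?h) * ev x w)"
    using i w K.fge_deriv[OF w] K.fge_mult_int K.fge_add by (simp add: ev_add[OF x] ev_mult[OF x] chi_def)
  also have "\<dots> = chi x \<sigma> * chi x \<tau>" unfolding z wx chi_displ[OF s x] by (simp add: algebra_simps)
  finally show ?thesis .
qed

text \<open>The sum of the conjugates of \<open>X\<close> under the kernel of \<open>chi x\<close> is invariant under that kernel
  and has nonzero derivative at \<open>x\<close>; by the Taylor expansion this forces the kernel to be trivial.\<close>

lemma chi_injective:
  assumes s: "\<sigma> \<in> G" and x: "x \<in> pts" and fx: "rx \<sigma> x = x" and c1: "chi x \<sigma> = 1"
  shows "\<sigma> = \<one>\<^bsub>GG\<^esub>"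
proof (rule ccontr)
  assume "\<sigma> \<noteq> \<one>\<^bsub>GG\<^esub>"
  then have h0: "displ \<sigma> \<noteq> 0" using displ_zero[OF s] by simp
  define S where "S = {\<tau> \<in> G. rx \<tau> x = x \<and> chi x \<tau> = 1}"
  have fS: "finite S" and SG: "\<And>\<tau>. \<tau> \<in> S \<Longrightarrow> \<tau> \<in> G" unfolding S_def using finG by auto
  have sS: "\<sigma> \<in> S" unfolding S_def using s fx c1 by simp
  define w where "w = (\<Sum>\<tau>\<in>S. \<tau> fps_X)"
  have w: "K.fge 0 w" unfolding w_def using SG X_int by (intro K.fge_sum) blast
  have img: "(\<lambda>\<tau>. \<sigma> \<otimes>\<^bsub>GG\<^esub> \<tau>) ` S = S" and inj: "inj_on (\<lambda>\<tau>. \<sigma> \<otimes>\<^bsub>GG\<^esub> \<tau>) S"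
  proof -
    show inj: "inj_on (\<lambda>\<tau>. \<sigma> \<otimes>\<^bsub>GG\<^esub> \<tau>) S"
    proof (rule inj_onI)
      fix a b assume ab: "a \<in> S" "b \<in> S" "\<sigma> \<otimes>\<^bsub>GG\<^esub> a = \<sigma> \<otimes>\<^bsub>GG\<^esub> b"
      show "a = b" using grp.l_cancel[of \<sigma> a b] ab s SG by simp
    qed
    have "(\<lambda>\<tau>. \<sigma> \<otimes>\<^bsub>GG\<^esub> \<tau>) ` S \<subseteq> S"
    proof
      fix y assume "y \<in> (\<lambda>\<tau>. \<sigma> \<otimes>\<^bsub>GG\<^esub> \<tau>) ` S"
      then obtain \<tau> where t: "\<tau> \<in> S" "y = \<sigma> \<otimes>\<^bsub>GG\<^esub> \<tau>" by blast
      have tG: "\<tau> \<in> G" using SG t by blast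
      have "y \<in> G" using grp.m_closed[of \<sigma> \<tau>] s tG t(2) by simp
      moreover have "rx y x = x" unfolding t(2) rx_mult[OF s tG x] fx using t(1) S_def by simp
      moreover have "chi x y = 1" unfolding t(2) chi_mult[OF s tG x fx] c1 using t(1) S_def by simp
      ultimately show "y \<in> S" unfolding S_def by simp
    qed
    then show "(\<lambda>\<tau>. \<sigma> \<otimes>\<^bsub>GG\<^esub> \<tau>) ` S = S" using endo_inj_surj[OF fS _ inj] by blast
  qed
  have hom_sum: "\<sigma> (\<Sum>\<tau>\<in>R. \<tau> fps_X) = (\<Sum>\<tau>\<in>R. \<sigma> (\<tau> fps_X))" "K.fge 0 (\<Sum>\<tau>\<in>R. \<tau> fps_X)"
    "ev x (fps_deriv (\<Sum>\<tau>\<in>R. \<tau> fps_X)) = (\<Sum>\<tau>\<in>R. chi x \<tau>)" if "R \<subseteq> S" for R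
  proof -
    have "finite R" using that fS finite_subset by blast
    then have "R \<subseteq> S \<longrightarrow> \<sigma> (\<Sum>\<tau>\<in>R. \<tau> fps_X) = (\<Sum>\<tau>\<in>R. \<sigma> (\<tau> fps_X)) \<and> K.fge 0 (\<Sum>\<tau>\<in>R. \<tau> fps_X)
       \<and> ev x (fps_deriv (\<Sum>\<tau>\<in>R. \<tau> fps_X)) = (\<Sum>\<tau>\<in>R. chi x \<tau>)"
    proof (induction R rule: finite_induct)
      case empty
      show ?case using K.const_homD(4)[OF hom[OF s], of 0] ev_const[OF x, of 0] by simp
    next
      case (insert \<tau> R)
      show ?case
      proof
        assume ins: "insert \<tau> R \<subseteq> S"
        then have tG: "\<tau> \<in> G" using SG by blast
        have IH: "\<sigma> (\<Sum>\<tau>\<in>R. \<tau> fps_X) = (\<Sum>\<tau>\<in>R. \<sigma> (\<tau> fps_X))" "K.fge 0 (\<Sum>\<tau>\<in>R. \<tau> fps_X)"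
          "ev x (fps_deriv (\<Sum>\<tau>\<in>R. \<tau> fps_X)) = (\<Sum>\<tau>\<in>R. chi x \<tau>)" using insert.IH ins by auto
        show "\<sigma> (\<Sum>\<tau>\<in>insert \<tau> R. \<tau> fps_X) = (\<Sum>\<tau>\<in>insert \<tau> R. \<sigma> (\<tau> fps_X)) \<and> K.fge 0 (\<Sum>\<tau>\<in>insert \<tau> R. \<tau> fps_X)
          \<and> ev x (fps_deriv (\<Sum>\<tau>\<in>insert \<tau> R. \<tau> fps_X)) = (\<Sum>\<tau>\<in>insert \<tau> R. chi x \<tau>)"
          using insert.hyps IH K.const_homD(2)[OF hom[OF s] X_int[OF tG] IH(2)] K.fge_add[OF X_int[OF tG] IH(2)]
            ev_add[OF x K.fge_deriv[OF X_int[OF tG]] K.fge_deriv[OF IH(2)]]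
          by (simp add: chi_def)
      qed
    qed
    then show "\<sigma> (\<Sum>\<tau>\<in>R. \<tau> fps_X) = (\<Sum>\<tau>\<in>R. \<sigma> (\<tau> fps_X))" "K.fge 0 (\<Sum>\<tau>\<in>R. \<tau> fps_X)"
      "ev x (fps_deriv (\<Sum>\<tau>\<in>R. \<tau> fps_X)) = (\<Sum>\<tau>\<in>R. chi x \<tau>)" using that by auto
  qed
  have "\<sigma> w = (\<Sum>\<tau>\<in>S. (\<sigma> \<otimes>\<^bsub>GG\<^esub> \<tau>) fps_X)"
    unfolding w_def hom_sum(1)[OF order_refl] using mult_apply[OF s SG K.fge_X] by (intro sum.cong) auto
  also have "\<dots> = (\<Sum>\<tau>\<in>(\<lambda>\<tau>. \<sigma> \<otimes>\<^bsub>GG\<^esub> \<tau>) ` S. \<tau> fps_X)" unfolding sum.reindex[OF inj] comp_def ..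
  finally have inv: "\<sigma> w = w" unfolding img w_def .
  obtain g where g: "K.fge 0 g" "\<sigma> w = w + displ \<sigma> * (fps_deriv w + displ \<sigma> * g)"
    using K.hom_taylor[OF hom[OF s] w] unfolding displ_def by blast
  then have "displ \<sigma> * (fps_deriv w + displ \<sigma> * g) = 0" using inv by simp
  \<comment> \<open>Power series over a field form a domain, so the nonzero displacement cancels. At
    \<open>x\<close> this leaves \<open>w' (x) = 0\<close>, although this derivative is a sum of
    \<open>card S\<close> ones in characteristic zero.\<close>
  then have z: "fps_deriv w + displ \<sigma> * g = 0" using h0 by simp
  have "ev x (fps_deriv w + displ \<sigma> * g) = ev x (fps_deriv w) + ev x (displ \<sigma>) * ev x g"
    using ev_add[OF x K.fge_deriv[OF w] K.fge_mult_int[OF displ_int[OF s] g(1)]] ev_mult[OF x displ_int[OF s] g(1)] by simp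
  then have "ev x (fps_deriv w) = 0" using z ev_displ[OF s x] fx ev_const[OF x, of 0] by simp
  then have "(\<Sum>\<tau>\<in>S. chi x \<tau>) = 0" unfolding w_def using hom_sum(3)[OF order_refl] by simp
  then have "(of_nat (card S) :: 'k alg_closure) = 0" unfolding S_def by simp
  then have "card S = 0" by simp
  then show False using fS sS by auto
qed

subsection \<open>Fixed points and displacements\<close>

definition fixpts :: "('k fps \<Rightarrow> 'k fps) \<Rightarrow> 'k alg_closure set" where
  "fixpts \<sigma> = {x \<in> pts. rx \<sigma> x = x}"

definition gval :: "('k fps \<Rightarrow> 'k fps) \<Rightarrow> rat" where "gval \<sigma> = gauss_val val (displ \<sigma>)"

text \<open>The zeros of \<open>\<sigma> X - X\<close> are the fixed points, and its derivative
  there is \<open>chi x \<sigma> - 1\<close>, nonzero by \<open>chi_injective\<close>. So the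
  distinguished factor has simple roots, and the order of the reduction counts fixed points without
  multiplicity.\<close>

lemma displ_factorization:
  assumes s: "\<sigma> \<in> G" and n1: "\<sigma> \<noteq> \<one>\<^bsub>GG\<^esub>"
  obtains c u P where "factors (displ \<sigma>) c u P" "gval \<sigma> = val c" "num_zeros val \<pi> (displ \<sigma>) = card (fixpts \<sigma>)"
    "finite (fixpts \<sigma>)" "map_poly to_ac P = (\<Prod>a\<in>fixpts \<sigma>. [:- a, 1:])" "fixpts \<sigma> = {a. poly (map_poly to_ac P) a = 0}"
proof -
  have h: "K.fge 0 (displ \<sigma>)" "displ \<sigma> \<noteq> 0" using displ_int[OF s] displ_zero[OF s] n1 by auto
  obtain c u P where f: "factors (displ \<sigma>) c u P" and g: "gauss_val val (displ \<sigma>) = val c"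
    and nz: "num_zeros val \<pi> (displ \<sigma>) = degree P" using factors_exist[OF h] by metis
  note fd = f[unfolded factors_def]
  let ?Q = "map_poly to_ac P"
  have P: "K.distinguished P" using fd by blast
  have dQ: "degree ?Q = degree P" by (simp add: degree_map_poly)
  have lead: "lead_coeff ?Q = 1" using P unfolding dQ K.distinguished_def by (simp add: coeff_map_poly)
  have Qn: "?Q \<noteq> 0" using lead by (metis coeff_0 leading_coeff_0_iff zero_neq_one)
  have rt: "fixpts \<sigma> = {a. poly ?Q a = 0}"
  proof (intro equalityI subsetI)
    fix x assume "x \<in> fixpts \<sigma>"
    then have x: "x \<in> pts" "ev x (displ \<sigma>) = 0" unfolding fixpts_def using ev_displ[OF s] by auto
    then have "to_ac c * ev x u * poly ?Q x = 0" using ev_factors(1)[OF f x(1)] by simp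
    then show "x \<in> {a. poly ?Q a = 0}" using ev_factors(2)[OF f x(1)] fd by auto
  next
    fix x assume "x \<in> {a. poly ?Q a = 0}"
    then have q: "poly ?Q x = 0" by simp
    have x: "x \<in> pts" by (rule distinguished_root_in_disk[OF P q])
    have "ev x (displ \<sigma>) = 0" using ev_factors(1)[OF f x] q by simp
    then show "x \<in> fixpts \<sigma>" unfolding fixpts_def using ev_displ[OF s x] x by simp
  qed
  have simple: "poly (pderiv ?Q) x \<noteq> 0" if "poly ?Q x = 0" for x
  proof
    assume d0: "poly (pderiv ?Q) x = 0"
    have x: "x \<in> pts" by (rule distinguished_root_in_disk[OF P that])
    have fx: "rx \<sigma> x = x" using rt that unfolding fixpts_def by blast
    have "pderiv ?Q = map_poly to_ac (pderiv P)"
      by (rule poly_eqI) (simp add: coeff_map_poly coeff_pderiv)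
    then have e0: "ev x (fps_deriv (fps_of_poly P)) = 0"
      using ev_poly[OF x, of "pderiv P"] K.fge_deriv[OF distinguished_int[OF P]] d0 by (simp add: fps_of_poly_pderiv)
    let ?w = "fps_const c * u"
    have w: "K.fge 0 ?w" using fd K.fge_const K.fge_mult_int by blast
    have i: "K.fge 0 (fps_of_poly P)" by (rule distinguished_int[OF P])
    have p0: "ev x (fps_of_poly P) = 0" using ev_poly[OF x i] that by simp
    have hw: "displ \<sigma> = ?w * fps_of_poly P" using fd by simp
    have "fps_deriv (displ \<sigma>) = ?w * fps_deriv (fps_of_poly P) + fps_deriv ?w * fps_of_poly P"
      unfolding hw by (rule fps_deriv_mult)
    then have "ev x (fps_deriv (displ \<sigma>)) = ev x ?w * ev x (fps_deriv (fps_of_poly P)) + ev x (fps_deriv ?w) * ev x (fps_of_poly P)"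
      using ev_add[OF x K.fge_mult_int[OF w K.fge_deriv[OF i]] K.fge_mult_int[OF K.fge_deriv[OF w] i]]
        ev_mult[OF x w K.fge_deriv[OF i]] ev_mult[OF x K.fge_deriv[OF w] i] by metis
    then have "chi x \<sigma> = 1" using e0 p0 chi_displ[OF s x] by simp
    then show False using chi_injective[OF s x fx] n1 by blast
  qed
  note sp = simple_roots_product[OF lead simple]
  have "finite (fixpts \<sigma>)" unfolding rt using poly_roots_finite[OF Qn] .
  moreover have "num_zeros val \<pi> (displ \<sigma>) = card (fixpts \<sigma>)" using nz sp(2) rt dQ by simp
  moreover have "?Q = (\<Prod>a\<in>fixpts \<sigma>. [:- a, 1:])" unfolding rt by (rule sp(1))
  ultimately show ?thesis using that[OF f _ _ _ _ rt] g unfolding gval_def by blast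
qed

lemma finite_fixpts: "\<sigma> \<in> G \<Longrightarrow> \<sigma> \<noteq> \<one>\<^bsub>GG\<^esub> \<Longrightarrow> finite (fixpts \<sigma>)"
  using displ_factorization by metis

lemma num_zeros_fixpts: "\<sigma> \<in> G \<Longrightarrow> \<sigma> \<noteq> \<one>\<^bsub>GG\<^esub> \<Longrightarrow> num_zeros val \<pi> (displ \<sigma>) = card (fixpts \<sigma>)"
  using displ_factorization by metis

text \<open>In the factorization of \<open>\<sigma> X - X\<close> the unit has valuation 0 at
  \<open>y\<close>, so only the constant and the linear factors contribute.\<close>

lemma displacement:
  assumes s: "\<sigma> \<in> G" "\<sigma> \<noteq> \<one>\<^bsub>GG\<^esub>" and y: "y \<in> pts" "y \<notin> fixpts \<sigma>"
  shows "rx \<sigma> y \<noteq> y" "valbar (rx \<sigma> y - y) = gval \<sigma> + (\<Sum>a\<in>fixpts \<sigma>. valbar (y - a))"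
proof -
  obtain c u P where f: "factors (displ \<sigma>) c u P" "gval \<sigma> = val c" "finite (fixpts \<sigma>)"
    "map_poly to_ac P = (\<Prod>a\<in>fixpts \<sigma>. [:- a, 1:])"
    using displ_factorization[OF s] by metis
  have c0: "c \<noteq> 0" using f(1) unfolding factors_def by blast
  have e: "rx \<sigma> y - y = to_ac c * ev y u * (\<Prod>a\<in>fixpts \<sigma>. (y - a))"
    using ev_displ[OF s(1) y(1)] ev_factors(1)[OF f(1) y(1)] unfolding f(4) by (simp add: poly_prod)
  have p0: "(\<Prod>a\<in>fixpts \<sigma>. (y - a)) \<noteq> 0" using f(3) y(2) by auto
  show "rx \<sigma> y \<noteq> y" using y unfolding fixpts_def by auto
  have "valbar (rx \<sigma> y - y) = valbar (to_ac c) + valbar (ev y u) + valbar (\<Prod>a\<in>fixpts \<sigma>. (y - a))"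
    unfolding e using c0 ev_factors(2)[OF f(1) y(1)] p0 by (simp add: L.val_mult)
  also have "valbar (\<Prod>a\<in>fixpts \<sigma>. (y - a)) = (\<Sum>a\<in>fixpts \<sigma>. valbar (y - a))"
    using f(3) y(2) by (intro L.val_prod) auto
  finally show "valbar (rx \<sigma> y - y) = gval \<sigma> + (\<Sum>a\<in>fixpts \<sigma>. valbar (y - a))"
    using L.extends[OF c0] ev_factors(3)[OF f(1) y(1)] f(2) by simp
qed

text \<open>Differentiating the factorization at its zero \<open>x\<close> leaves the constant, the
  unit and all linear factors except that of \<open>x\<close>.\<close>

lemma valbar_chi:
  assumes s: "\<sigma> \<in> G" "\<sigma> \<noteq> \<one>\<^bsub>GG\<^esub>" and x: "x \<in> fixpts \<sigma>"
  shows "valbar (chi x \<sigma> - 1) = gval \<sigma> + (\<Sum>a\<in>fixpts \<sigma> - {x}. valbar (x - a))"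
proof -
  obtain c u P where f: "factors (displ \<sigma>) c u P" "gval \<sigma> = val c" "finite (fixpts \<sigma>)"
    "map_poly to_ac P = (\<Prod>a\<in>fixpts \<sigma>. [:- a, 1:])"
    using displ_factorization[OF s] by metis
  note fd = f(1)[unfolded factors_def]
  have c0: "c \<noteq> 0" and P: "K.distinguished P" using fd by blast+
  have xp: "x \<in> pts" using x unfolding fixpts_def by simp
  let ?Q = "map_poly to_ac P" and ?R = "\<Prod>a\<in>fixpts \<sigma> - {x}. [:- a, 1:]"
  have QR: "?Q = [:- x, 1:] * ?R" unfolding f(4) using prod.remove[OF f(3) x] .
  have "pderiv ?Q = [:- x, 1:] * pderiv ?R + ?R" unfolding QR pderiv_mult by (simp add: pderiv_pCons)
  then have dQ: "poly (pderiv ?Q) x = (\<Prod>a\<in>fixpts \<sigma> - {x}. (x - a))" by (simp add: poly_prod)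
  have "pderiv ?Q = map_poly to_ac (pderiv P)"
    by (rule poly_eqI) (simp add: coeff_map_poly coeff_pderiv)
  then have e0: "ev x (fps_deriv (fps_of_poly P)) = (\<Prod>a\<in>fixpts \<sigma> - {x}. (x - a))"
    using ev_poly[OF xp, of "pderiv P"] K.fge_deriv[OF distinguished_int[OF P]] dQ by (simp add: fps_of_poly_pderiv)
  let ?w = "fps_const c * u"
  have uc: "K.fge 0 (fps_const c)" "K.fge 0 u" using fd K.fge_const by blast+
  have w: "K.fge 0 ?w" using uc K.fge_mult_int by blast
  have i: "K.fge 0 (fps_of_poly P)" by (rule distinguished_int[OF P])
  have "poly ?Q x = 0" unfolding QR by simp
  then have p0: "ev x (fps_of_poly P) = 0" using ev_poly[OF xp i] by simp
  have hw: "displ \<sigma> = ?w * fps_of_poly P" using fd by simp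
  have "fps_deriv (displ \<sigma>) = ?w * fps_deriv (fps_of_poly P) + fps_deriv ?w * fps_of_poly P"
    unfolding hw by (rule fps_deriv_mult)
  then have "ev x (fps_deriv (displ \<sigma>)) = ev x ?w * ev x (fps_deriv (fps_of_poly P)) + ev x (fps_deriv ?w) * ev x (fps_of_poly P)"
    using ev_add[OF xp K.fge_mult_int[OF w K.fge_deriv[OF i]] K.fge_mult_int[OF K.fge_deriv[OF w] i]]
      ev_mult[OF xp w K.fge_deriv[OF i]] ev_mult[OF xp K.fge_deriv[OF w] i] by metis
  moreover have "ev x ?w = to_ac c * ev x u" using ev_mult[OF xp uc] ev_const[OF xp] fd by simp
  ultimately have c1: "chi x \<sigma> - 1 = to_ac c * ev x u * (\<Prod>a\<in>fixpts \<sigma> - {x}. (x - a))"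
    unfolding e0 p0 using chi_displ[OF s(1) xp] by simp
  have p0: "(\<Prod>a\<in>fixpts \<sigma> - {x}. (x - a)) \<noteq> 0" using f(3) by auto
  have "valbar (chi x \<sigma> - 1) = valbar (to_ac c) + valbar (ev x u) + valbar (\<Prod>a\<in>fixpts \<sigma> - {x}. (x - a))"
    unfolding c1 using c0 ev_factors(2)[OF f(1) xp] p0 by (simp add: L.val_mult)
  also have "valbar (\<Prod>a\<in>fixpts \<sigma> - {x}. (x - a)) = (\<Sum>a\<in>fixpts \<sigma> - {x}. valbar (x - a))"
    using f(3) by (intro L.val_prod) auto
  finally show ?thesis using L.extends[OF c0] ev_factors(3)[OF f(1) xp] f(2) by simp
qed

section \<open>The filtration by Gauss valuations of displacements\<close>

lemma gval_props:
  assumes s: "\<sigma> \<in> G" "\<sigma> \<noteq> \<one>\<^bsub>GG\<^esub>"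
  obtains c where "c \<noteq> 0" "vge val 0 c" "gval \<sigma> = val c" "K.fge (gval \<sigma>) (displ \<sigma>)"
  using gauss_props[OF displ_int[OF s(1)]] displ_zero[OF s(1)] s(2) unfolding gval_def by metis

lemma gval_ge: "\<sigma> \<in> G \<Longrightarrow> \<sigma> \<noteq> \<one>\<^bsub>GG\<^esub> \<Longrightarrow> K.fge q (displ \<sigma>) \<Longrightarrow> q \<le> gval \<sigma>"
  unfolding gval_def using gauss_ge[OF displ_int] displ_zero by blast

lemma hom_fge_gval:
  assumes s: "\<sigma> \<in> G" "\<sigma> \<noteq> \<one>\<^bsub>GG\<^esub>" and t: "\<tau> \<in> G" and f: "K.fge (gval \<sigma>) f"
  shows "K.fge (gval \<sigma>) (\<tau> f)"
proof -
  obtain c where c: "c \<noteq> 0" "vge val 0 c" "gval \<sigma> = val c" using gval_props[OF s] by metis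
  show ?thesis using hom_fge[OF hom[OF t] c(1,2)] f unfolding c(3) .
qed

lemma gval_nonneg: "\<sigma> \<in> G \<Longrightarrow> \<sigma> \<noteq> \<one>\<^bsub>GG\<^esub> \<Longrightarrow> 0 \<le> gval \<sigma>"
  using gval_props[of \<sigma>] unfolding vge_def by metis

text \<open>\<open>\<sigma> Y - Y\<close> is a multiple of \<open>\<sigma> X - X\<close> for every
  integral \<open>Y\<close>, here \<open>Y = \<tau> X\<close>, and automorphisms preserve Gauss
  bounds. This gives one inequality for every conjugation; conjugating back gives the other.\<close>

lemma gval_conj:
  assumes h: "\<tau> \<in> G" and s: "\<sigma> \<in> G" "\<sigma> \<noteq> \<one>\<^bsub>GG\<^esub>"
  shows "gval (inv\<^bsub>GG\<^esub> \<tau> \<otimes>\<^bsub>GG\<^esub> \<sigma> \<otimes>\<^bsub>GG\<^esub> \<tau>) = gval \<sigma>"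
proof -
  have le: "gval \<sigma> \<le> gval (inv\<^bsub>GG\<^esub> \<tau> \<otimes>\<^bsub>GG\<^esub> \<sigma> \<otimes>\<^bsub>GG\<^esub> \<tau>)" if h: "\<tau> \<in> G" and s: "\<sigma> \<in> G" "\<sigma> \<noteq> \<one>\<^bsub>GG\<^esub>" for \<sigma> \<tau>
  proof -
    let ?i = "inv\<^bsub>GG\<^esub> \<tau>"
    have iG: "?i \<in> G" using grp.inv_closed[of \<tau>] h by simp
    have isG: "?i \<otimes>\<^bsub>GG\<^esub> \<sigma> \<in> G" using grp.m_closed[of ?i \<sigma>] iG s by simp
    have cG: "?i \<otimes>\<^bsub>GG\<^esub> \<sigma> \<otimes>\<^bsub>GG\<^esub> \<tau> \<in> G" using grp.m_closed[of "?i \<otimes>\<^bsub>GG\<^esub> \<sigma>" \<tau>] isG h by simp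
    have c1: "?i \<otimes>\<^bsub>GG\<^esub> \<sigma> \<otimes>\<^bsub>GG\<^esub> \<tau> \<noteq> \<one>\<^bsub>GG\<^esub>" using grp.conj_one_iff[of \<tau> \<sigma>] h s by simp
    let ?Y = "\<tau> fps_X"
    have Y: "K.fge 0 ?Y" by (rule X_int[OF h])
    have "displ (?i \<otimes>\<^bsub>GG\<^esub> \<sigma> \<otimes>\<^bsub>GG\<^esub> \<tau>) = ?i (\<sigma> ?Y) - fps_X"
      unfolding displ_def mult_apply[OF isG h K.fge_X] mult_apply[OF iG s(1) Y] ..
    also have "\<dots> = ?i (\<sigma> ?Y) - ?i ?Y" using inv_apply(1)[OF h K.fge_X] by simp
    also have "\<dots> = ?i (\<sigma> ?Y - ?Y)" using K.const_hom_diff[OF hom[OF iG] image_int[OF s(1) Y] Y] by simp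
    finally have e: "displ (?i \<otimes>\<^bsub>GG\<^esub> \<sigma> \<otimes>\<^bsub>GG\<^esub> \<tau>) = ?i (\<sigma> ?Y - ?Y)" .
    have g: "K.fge (gval \<sigma>) (displ \<sigma>)" using gval_props[OF s] by metis
    have "K.fge (gval \<sigma> + 0) (displ \<sigma> * K.quot \<sigma> ?Y)" by (rule K.fge_mult[OF g K.fge_quot[OF hom[OF s(1)] Y]])
    then have "K.fge (gval \<sigma>) (\<sigma> ?Y - ?Y)" unfolding K.hom_difference[OF hom[OF s(1)] Y] displ_def by simp
    then have "K.fge (gval \<sigma>) (displ (?i \<otimes>\<^bsub>GG\<^esub> \<sigma> \<otimes>\<^bsub>GG\<^esub> \<tau>))" unfolding e by (rule hom_fge_gval[OF s iG])
    then show ?thesis by (rule gval_ge[OF cG c1])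
  qed
  let ?i = "inv\<^bsub>GG\<^esub> \<tau>"
  let ?c = "?i \<otimes>\<^bsub>GG\<^esub> \<sigma> \<otimes>\<^bsub>GG\<^esub> \<tau>"
  have iG: "?i \<in> G" using grp.inv_closed[of \<tau>] h by simp
  have cG: "?c \<in> G" using grp.m_closed[of "?i \<otimes>\<^bsub>GG\<^esub> \<sigma>" \<tau>] grp.m_closed[of ?i \<sigma>] iG s h by simp
  have c1: "?c \<noteq> \<one>\<^bsub>GG\<^esub>" using grp.conj_one_iff[of \<tau> \<sigma>] h s by simp
  have "inv\<^bsub>GG\<^esub> ?i \<otimes>\<^bsub>GG\<^esub> ?c \<otimes>\<^bsub>GG\<^esub> ?i = \<sigma>" using grp.conj_cancel(2)[of \<tau> \<sigma>] grp.inv_inv[of \<tau>] h s by simp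
  then show ?thesis using le[OF h s] le[OF iG cG c1] by simp
qed

text \<open>The displacement is a cocycle, \<open>displ (\<sigma> \<tau>) = \<sigma> (displ \<tau>)
  + displ \<sigma>\<close>, and automorphisms preserve Gauss bounds.\<close>

lemma gval_filtration:
  assumes q: "0 < q"
  shows "subgroup {\<sigma> \<in> carrier GG. \<sigma> = \<one>\<^bsub>GG\<^esub> \<or> q \<le> gval \<sigma>} GG"
proof (rule grp.subgroupI)
  have fge: "K.fge (gval \<sigma>) (displ \<sigma>)" if "\<sigma> \<in> G" "\<sigma> \<noteq> \<one>\<^bsub>GG\<^esub>" for \<sigma> using gval_props[OF that] by metis
  show "{\<sigma> \<in> carrier GG. \<sigma> = \<one>\<^bsub>GG\<^esub> \<or> q \<le> gval \<sigma>} \<noteq> {}" using grp.one_closed by blast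
  fix \<sigma> assume a: "\<sigma> \<in> {\<sigma> \<in> carrier GG. \<sigma> = \<one>\<^bsub>GG\<^esub> \<or> q \<le> gval \<sigma>}"
  then have s: "\<sigma> \<in> G" "\<sigma> = \<one>\<^bsub>GG\<^esub> \<or> q \<le> gval \<sigma>" by auto
  have iG: "inv\<^bsub>GG\<^esub> \<sigma> \<in> G" using grp.inv_closed[of \<sigma>] s(1) by simp
  show "inv\<^bsub>GG\<^esub> \<sigma> \<in> {\<sigma> \<in> carrier GG. \<sigma> = \<one>\<^bsub>GG\<^esub> \<or> q \<le> gval \<sigma>}"
  proof (cases "\<sigma> = \<one>\<^bsub>GG\<^esub>")
    case False
    have i1: "inv\<^bsub>GG\<^esub> \<sigma> \<noteq> \<one>\<^bsub>GG\<^esub>" using False grp.inv_eq_1_iff[of \<sigma>] s(1) by simp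
    have "displ (inv\<^bsub>GG\<^esub> \<sigma>) = - (inv\<^bsub>GG\<^esub> \<sigma>) (displ \<sigma>)"
      unfolding displ_def using K.const_hom_diff[OF hom[OF iG] X_int[OF s(1)] K.fge_X] inv_apply(1)[OF s(1) K.fge_X] by simp
    then have "K.fge (gval \<sigma>) (displ (inv\<^bsub>GG\<^esub> \<sigma>))"
      using K.fge_uminus[OF hom_fge_gval[OF s(1) False iG fge[OF s(1) False]]] by simp
    then show ?thesis using gval_ge[OF iG i1] s(2) False iG by force
  next
    case True
    then show ?thesis using grp.inv_one grp.one_closed by simp
  qed
  fix \<tau> assume "\<tau> \<in> {\<sigma> \<in> carrier GG. \<sigma> = \<one>\<^bsub>GG\<^esub> \<or> q \<le> gval \<sigma>}"
  then have t: "\<tau> \<in> G" "\<tau> = \<one>\<^bsub>GG\<^esub> \<or> q \<le> gval \<tau>" by auto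
  have mG: "\<sigma> \<otimes>\<^bsub>GG\<^esub> \<tau> \<in> G" using grp.m_closed[of \<sigma> \<tau>] s t by simp
  show "\<sigma> \<otimes>\<^bsub>GG\<^esub> \<tau> \<in> {\<sigma> \<in> carrier GG. \<sigma> = \<one>\<^bsub>GG\<^esub> \<or> q \<le> gval \<sigma>}"
  proof (cases "\<sigma> = \<one>\<^bsub>GG\<^esub> \<or> \<tau> = \<one>\<^bsub>GG\<^esub> \<or> \<sigma> \<otimes>\<^bsub>GG\<^esub> \<tau> = \<one>\<^bsub>GG\<^esub>")
    case True
    then show ?thesis using s t mG grp.l_one[of \<tau>] grp.r_one[of \<sigma>] by auto
  next
    case False
    let ?m = "min (gval \<sigma>) (gval \<tau>)"
    have "displ (\<sigma> \<otimes>\<^bsub>GG\<^esub> \<tau>) = \<sigma> (displ \<tau>) + displ \<sigma>"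
      unfolding displ_def mult_apply[OF s(1) t(1) K.fge_X] using K.const_hom_diff[OF hom[OF s(1)] X_int[OF t(1)] K.fge_X] by simp
    moreover have "K.fge ?m (\<sigma> (displ \<tau>))"
      using K.fge_mono[OF hom_fge_gval[OF t(1) _ s(1) fge[OF t(1)]]] False by simp
    moreover have "K.fge ?m (displ \<sigma>)" using K.fge_mono[OF fge[OF s(1)]] False by simp
    ultimately have "K.fge ?m (displ (\<sigma> \<otimes>\<^bsub>GG\<^esub> \<tau>))" using K.fge_add by simp
    then have "?m \<le> gval (\<sigma> \<otimes>\<^bsub>GG\<^esub> \<tau>)" using gval_ge[OF mG] False by blast
    then show ?thesis using s t mG False by auto
  qed
qed auto

section \<open>The ultrametric space of fixed points, and generic points\<close>

definition delta :: "'k alg_closure set" where "delta = (\<Union>\<sigma>\<in>G - {\<one>\<^bsub>GG\<^esub>}. fixpts \<sigma>)"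

lemma delta_pts: "delta \<subseteq> pts" unfolding delta_def fixpts_def by auto

lemma finite_delta: "finite delta" unfolding delta_def using finG finite_fixpts by auto

text \<open>The inverse turns the right action \<open>rx\<close> into a left action, as
  \<open>cluster_action\<close> requires.\<close>

definition act :: "('k fps \<Rightarrow> 'k fps) \<Rightarrow> 'k alg_closure \<Rightarrow> 'k alg_closure" where "act \<sigma> x = rx (inv\<^bsub>GG\<^esub> \<sigma>) x"

lemma act_fixed: "\<sigma> \<in> G \<Longrightarrow> x \<in> pts \<Longrightarrow> act \<sigma> x = x \<longleftrightarrow> rx \<sigma> x = x"
  unfolding act_def using rx_inv by metis

lemma valbar_act: "\<sigma> \<in> G \<Longrightarrow> x \<in> pts \<Longrightarrow> valbar (x - act \<sigma> x) = valbar (rx \<sigma> x - x)"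
  unfolding act_def using rx_iso(2)[of \<sigma> x "rx (inv\<^bsub>GG\<^esub> \<sigma>) x"] rx_pts rx_inv(2,3) by metis

text \<open>If \<open>\<tau>\<close> fixes \<open>x\<close>, a conjugate of \<open>\<tau>\<close> by
  \<open>\<sigma>\<close> fixes the image of \<open>x\<close>.\<close>

lemma act_delta:
  assumes s: "\<sigma> \<in> G" and x: "x \<in> delta"
  shows "act \<sigma> x \<in> delta"
proof -
  obtain \<tau> where t: "\<tau> \<in> G" "\<tau> \<noteq> \<one>\<^bsub>GG\<^esub>" "x \<in> fixpts \<tau>" using x unfolding delta_def by auto
  have xp: "x \<in> pts" "rx \<tau> x = x" using t(3) unfolding fixpts_def by auto
  let ?i = "inv\<^bsub>GG\<^esub> \<sigma>"
  have iG: "?i \<in> G" using rx_inv(3)[OF s xp(1)] .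
  have yp: "rx ?i x \<in> pts" by (rule rx_pts[OF iG xp(1)])
  let ?c = "\<sigma> \<otimes>\<^bsub>GG\<^esub> \<tau> \<otimes>\<^bsub>GG\<^esub> ?i"
  have stG: "\<sigma> \<otimes>\<^bsub>GG\<^esub> \<tau> \<in> G" using grp.m_closed[of \<sigma> \<tau>] s t by simp
  have cG: "?c \<in> G" using grp.m_closed[of "\<sigma> \<otimes>\<^bsub>GG\<^esub> \<tau>" ?i] stG iG by simp
  have c1: "?c \<noteq> \<one>\<^bsub>GG\<^esub>" using grp.conj_one_iff[of ?i \<tau>] grp.inv_inv[of \<sigma>] iG s t by simp
  have "rx ?c (rx ?i x) = rx ?i (rx \<tau> (rx \<sigma> (rx ?i x)))"
    using rx_mult[OF stG iG yp] rx_mult[OF s t(1) yp] by simp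
  then have "rx ?c (rx ?i x) = rx ?i x" using rx_inv(2)[OF s xp(1)] xp(2) by simp
  then have "rx ?i x \<in> fixpts ?c" unfolding fixpts_def using yp by simp
  then show ?thesis unfolding act_def delta_def using cG c1 by blast
qed

lemma vge_pts_diff: "x \<in> pts \<Longrightarrow> y \<in> pts \<Longrightarrow> x \<noteq> y \<Longrightarrow> 0 < valbar (x - y)"
proof -
  assume xy: "x \<in> pts" "y \<in> pts" "x \<noteq> y"
  have "vge valbar (min (wt x) (wt y)) (x - y)"
    using vge_mono[OF vge_wt] by (intro L.vge_diff) auto
  then show "0 < valbar (x - y)" using wt_pos[OF xy(1)] wt_pos[OF xy(2)] xy(3) unfolding vge_def by auto
qed

lemma cluster_action: "cluster_action GG delta (\<lambda>x y. valbar (x - y)) act gval" if ne: "delta \<noteq> {}"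
proof (unfold_locales)
  show "finite (carrier GG)" using finG by simp
  show "finite delta" by (rule finite_delta)
  show "delta \<noteq> {}" by (rule ne)
  fix g x assume g: "g \<in> carrier GG"
  then have gG: "g \<in> G" by simp
  assume x: "x \<in> delta"
  then have xp: "x \<in> pts" using delta_pts by blast
  show "act g x \<in> delta" by (rule act_delta[OF gG x])
  fix y assume "y \<in> delta"
  then have yp: "y \<in> pts" using delta_pts by blast
  have iG: "inv\<^bsub>GG\<^esub> g \<in> G" using rx_inv(3)[OF gG xp] .
  show "valbar (act g x - act g y) = valbar (x - y)" unfolding act_def by (rule rx_iso(2)[OF iG xp yp])
next
  fix x assume "x \<in> delta"
  then have xp: "x \<in> pts" using delta_pts by blast
  show "act \<one>\<^bsub>GG\<^esub> x = x" unfolding act_def using grp.inv_one rx_one[OF xp] by simp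
next
  fix g h x assume gh: "g \<in> carrier GG" "h \<in> carrier GG" and x: "x \<in> delta"
  have xp: "x \<in> pts" using x delta_pts by blast
  have "inv\<^bsub>GG\<^esub> (g \<otimes>\<^bsub>GG\<^esub> h) = inv\<^bsub>GG\<^esub> h \<otimes>\<^bsub>GG\<^esub> inv\<^bsub>GG\<^esub> g" by (rule grp.inv_mult_group[OF gh])
  moreover have "inv\<^bsub>GG\<^esub> h \<in> G" "inv\<^bsub>GG\<^esub> g \<in> G" using grp.inv_closed[OF gh(1)] grp.inv_closed[OF gh(2)] by simp_all
  ultimately show "act (g \<otimes>\<^bsub>GG\<^esub> h) x = act g (act h x)" unfolding act_def using rx_mult[OF _ _ xp] by simp
next
  show "valbar (x - y) = valbar (y - x)" for x y by (rule L.val_diff_swap)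
next
  show "0 < valbar (x - y)" if "x \<in> delta" "y \<in> delta" "x \<noteq> y" for x y
    using vge_pts_diff that delta_pts by blast
next
  fix x y z :: "'k alg_closure" assume ne: "x \<noteq> y" "y \<noteq> z" "x \<noteq> z"
  have "min (valbar (x - y)) (valbar (y - z)) \<le> valbar ((x - y) + (y - z))"
    using ne by (intro L.val_add) auto
  then show "min (valbar (x - y)) (valbar (y - z)) \<le> valbar (x - z)" by simp
next
  show "gval (inv\<^bsub>GG\<^esub> h \<otimes>\<^bsub>GG\<^esub> g \<otimes>\<^bsub>GG\<^esub> h) = gval g" if "h \<in> carrier GG" "g \<in> carrier GG" "g \<noteq> \<one>\<^bsub>GG\<^esub>" for g h
    using gval_conj that by simp
qed

text \<open>The generic point is a root of \<open>\<Prod>\<^sub>a (Y - a) - (y - x)\<^sup>n\<close>, with \<open>a\<close> running through the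
  \<open>n\<close> points of \<open>delta\<close> in the disk: all its distances to these points are then equal to the radius.\<close>

lemma generic_point:
  assumes x: "x \<in> delta" and y: "y \<in> delta" and ne: "x \<noteq> y" and r: "r = valbar (x - y)"
  obtains z where "z \<in> pts" "vge valbar r (z - x)" "\<And>a. a \<in> delta \<Longrightarrow> z \<noteq> a \<and> valbar (z - a) = (if a = x then r else min r (valbar (x - a)))"
proof -
  define C where "C = {a \<in> delta. vge valbar r (x - a)}"
  have fC: "finite C" unfolding C_def using finite_delta by simp
  have xC: "x \<in> C" unfolding C_def using x by simp
  define n where "n = card C"
  have n: "0 < n" unfolding n_def using fC xC card_gt_0_iff by blast
  have r0: "0 < r" unfolding r using vge_pts_diff x y ne delta_pts by blast
  let ?p = "(\<Prod>a\<in>C. [:- a, 1:]) :: 'k alg_closure poly" and ?w = "(x - y) ^ n"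
  have "degree ?p = n" unfolding n_def using degree_prod_sum_eq[of C "\<lambda>a. [:- a, 1:]"] by simp
  then have "degree (?p + [:- ?w:]) = n" using n degree_add_eq_left[of "[:- ?w:]" ?p] by simp
  moreover have "?p + [:- ?w:] = ?p - [:?w:]" by simp
  ultimately have "degree (?p - [:?w:]) = n" by metis
  then obtain z where "poly (?p - [:?w:]) z = 0" using alg_closed_imp_poly_has_root n by metis
  then have z: "(\<Prod>a\<in>C. (z - a)) = ?w" by (simp add: poly_prod)
  have w: "?w \<noteq> 0" "valbar ?w = of_nat n * r" using ne L.val_power[of "x - y" n] r by auto
  have zn: "z \<noteq> a" if "a \<in> C" for a
  proof
    assume "z = a"
    then have "(\<Prod>a\<in>C. (z - a)) = 0" using that fC by auto
    then show False using z w(1) by simp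
  qed
  have S: "(\<Sum>a\<in>C. valbar (z - a)) = of_nat n * r"
    using L.val_prod[OF fC, of "\<lambda>a. z - a"] zn z w(2) by simp
  \<comment> \<open>If one of the \<open>n\<close> valuations were below \<open>r\<close>, all would
    be, since the points of \<open>C\<close> are within \<open>r\<close> of each other, and their
    sum could not be \<open>n r\<close>. With all of them at least \<open>r\<close>, the same sum
    leaves no room for a larger one.\<close>
  have ge: "r \<le> valbar (z - a)" if a: "a \<in> C" for a
  proof (rule ccontr)
    assume lt: "\<not> r \<le> valbar (z - a)"
    have "valbar (z - b) < r" if b: "b \<in> C" for b
    proof -
      have "vge valbar r ((x - b) - (x - a))" using L.vge_diff[of r "x - b" "x - a"] a b unfolding C_def by blast
      then have "vge valbar r (a - b)" by simp
      then have "a - b = 0 \<or> valbar (z - a) < valbar (a - b)" using lt unfolding vge_def by auto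
      then have "valbar ((z - a) + (a - b)) = valbar (z - a)" using L.val_add_dominant[of "z - a" "a - b"] zn[OF a] by simp
      then show ?thesis using lt by simp
    qed
    then have "(\<Sum>b\<in>C. valbar (z - b)) < (\<Sum>b\<in>C. r)" using fC xC by (intro sum_strict_mono) auto
    then show False using S n_def by simp
  qed
  have eq: "valbar (z - a) = r" if a: "a \<in> C" for a
  proof (rule ccontr)
    assume "valbar (z - a) \<noteq> r"
    then have "r < valbar (z - a)" using ge[OF a] by simp
    then have "(\<Sum>b\<in>C. r) < (\<Sum>b\<in>C. valbar (z - b))" using fC a ge by (intro sum_strict_mono_ex1) auto
    then show False using S n_def by simp
  qed
  have zx: "vge valbar r (z - x)" using eq[OF xC] unfolding vge_def by simp
  have "x \<in> pts" using x delta_pts by blast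
  then have "vge valbar (min r (wt x)) ((z - x) + x)" using vge_mono[OF zx] vge_mono[OF vge_wt[of x]] by (intro L.vge_add) auto
  then have "vge valbar (min r (wt x)) z" by simp
  then have zp: "z \<in> pts" using r0 wt_pos[OF \<open>x \<in> pts\<close>] unfolding disk_points_def vge_def by auto
  have "z \<noteq> a \<and> valbar (z - a) = (if a = x then r else min r (valbar (x - a)))" if a: "a \<in> delta" for a
  proof (cases "a \<in> C")
    case True
    then have "a = x \<or> r \<le> valbar (x - a)" unfolding C_def vge_def by auto
    then show ?thesis using zn[OF True] eq[OF True] by auto
  next
    case False
    then have ax: "x - a \<noteq> 0" "valbar (x - a) < r" using a unfolding C_def vge_def by auto
    then have "z - x = 0 \<or> valbar (x - a) < valbar (z - x)" using zx unfolding vge_def by auto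
    then have "(x - a) + (z - x) \<noteq> 0 \<and> valbar ((x - a) + (z - x)) = valbar (x - a)"
      using ax by (intro L.val_add_dominant) auto
    then have "z - a \<noteq> 0 \<and> valbar (z - a) = valbar (x - a)" by (simp add: algebra_simps)
    then show ?thesis using ax by auto
  qed
  then show ?thesis using that zp zx by blast
qed

lemma vge_rx_diff:
  assumes s: "\<sigma> \<in> G" and x: "x \<in> pts" and y: "y \<in> pts"
  shows "vge valbar q (rx \<sigma> x - rx \<sigma> y) \<longleftrightarrow> vge valbar q (x - y)"
  using rx_iso[OF s x y] unfolding vge_def by simp

text \<open>\<open>rx\<close> preserves valuations of differences, so the displacement of
  \<open>z\<close> under a product is at least as small as the larger of the displacements under the
  factors.\<close>

lemma displacement_subgroup:
  assumes z: "z \<in> pts"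
  shows "subgroup {\<sigma> \<in> carrier GG. vge valbar q (rx \<sigma> z - z)} GG"
proof (rule grp.subgroupI)
  show "{\<sigma> \<in> carrier GG. vge valbar q (rx \<sigma> z - z)} \<subseteq> carrier GG" by blast
  have "\<one>\<^bsub>GG\<^esub> \<in> {\<sigma> \<in> carrier GG. vge valbar q (rx \<sigma> z - z)}" using grp.one_closed rx_one[OF z] by simp
  then show "{\<sigma> \<in> carrier GG. vge valbar q (rx \<sigma> z - z)} \<noteq> {}" by blast
  fix \<sigma> assume "\<sigma> \<in> {\<sigma> \<in> carrier GG. vge valbar q (rx \<sigma> z - z)}"
  then have s: "\<sigma> \<in> G" "vge valbar q (rx \<sigma> z - z)" by auto
  have i: "inv\<^bsub>GG\<^esub> \<sigma> \<in> G" using rx_inv(3)[OF s(1) z] .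
  have "vge valbar q (z - rx \<sigma> z)" using s(2) L.vge_uminus[of q "rx \<sigma> z - z"] by simp
  then have "vge valbar q (rx \<sigma> (rx (inv\<^bsub>GG\<^esub> \<sigma>) z) - rx \<sigma> z)" using rx_inv(2)[OF s(1) z] by simp
  then have "vge valbar q (rx (inv\<^bsub>GG\<^esub> \<sigma>) z - z)" using vge_rx_diff[OF s(1) rx_pts[OF i z] z] by simp
  then show "inv\<^bsub>GG\<^esub> \<sigma> \<in> {\<sigma> \<in> carrier GG. vge valbar q (rx \<sigma> z - z)}" using i by simp
  fix \<tau> assume "\<tau> \<in> {\<sigma> \<in> carrier GG. vge valbar q (rx \<sigma> z - z)}"
  then have t: "\<tau> \<in> G" "vge valbar q (rx \<tau> z - z)" by auto
  have m: "\<sigma> \<otimes>\<^bsub>GG\<^esub> \<tau> \<in> G" using grp.m_closed[of \<sigma> \<tau>] s t by simp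
  have "vge valbar q (rx \<tau> (rx \<sigma> z) - rx \<tau> z)" using vge_rx_diff[OF t(1) rx_pts[OF s(1) z] z] s(2) by simp
  then have "vge valbar q ((rx \<tau> (rx \<sigma> z) - rx \<tau> z) + (rx \<tau> z - z))" using t(2) by (rule L.vge_add)
  then have "vge valbar q (rx (\<sigma> \<otimes>\<^bsub>GG\<^esub> \<tau>) z - z)" using rx_mult[OF s(1) t(1) z] by simp
  then show "\<sigma> \<otimes>\<^bsub>GG\<^esub> \<tau> \<in> {\<sigma> \<in> carrier GG. vge valbar q (rx \<sigma> z - z)}" using m by simp
qed

text \<open>The multiplier at \<open>x\<close> embeds the stabilizer into the multiplicative group
  of a field of characteristic zero.\<close>

lemma chi_stabilizer:
  assumes x: "x \<in> pts"
  shows "\<exists>s\<in>{\<sigma> \<in> carrier GG. rx \<sigma> x = x}. {\<sigma> \<in> carrier GG. rx \<sigma> x = x} = generate GG {s}"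
    and "\<sigma> \<in> G \<Longrightarrow> rx \<sigma> x = x \<Longrightarrow> exact_order (chi x \<sigma>) (grp.ord \<sigma>)"
proof -
  let ?H = "{\<sigma> \<in> carrier GG. rx \<sigma> x = x}"
  have H: "subgroup ?H GG"
  proof (rule grp.subgroupI)
    show "?H \<subseteq> carrier GG" by blast
    show "?H \<noteq> {}" using grp.one_closed rx_one[OF x] by blast
    fix \<sigma> assume a: "\<sigma> \<in> ?H"
    then have s: "\<sigma> \<in> G" "rx \<sigma> x = x" by auto
    show "inv\<^bsub>GG\<^esub> \<sigma> \<in> ?H" using rx_inv(1,3)[OF s(1) x] s(2) by simp
    fix \<tau> assume "\<tau> \<in> ?H"
    then have t: "\<tau> \<in> G" "rx \<tau> x = x" by auto
    show "\<sigma> \<otimes>\<^bsub>GG\<^esub> \<tau> \<in> ?H"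
      using grp.m_closed[of \<sigma> \<tau>] s t rx_mult[OF s(1) t(1) x] by simp
  qed
  have fin: "finite ?H" using finG by simp
  note cyc = grp.cyclic_of_field_embedding[where \<chi> = "chi x", OF H fin chi_one[OF x]]
  have m: "chi x (g \<otimes>\<^bsub>GG\<^esub> h) = chi x g * chi x h" if "g \<in> ?H" "h \<in> ?H" for g h
    using chi_mult[of g h x] that x by simp
  have i: "g = \<one>\<^bsub>GG\<^esub>" if "g \<in> ?H" "chi x g = 1" for g
    using chi_injective[of g x] that x by simp
  show "\<exists>s\<in>?H. ?H = generate GG {s}" using cyc(1) m i by blast
  show "exact_order (chi x \<sigma>) (grp.ord \<sigma>)" if "\<sigma> \<in> G" "rx \<sigma> x = x"
    using cyc(2)[of \<sigma>] m i that by simp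
qed

text \<open>The axioms on levels are read off at a generic point \<open>z\<close>, whose
  displacement has valuation \<open>level + r\<close>. Nonnegativity means that \<open>z\<close>
  stays in the disk, the filtration is \<open>displacement_subgroup\<close> at \<open>z\<close>, and
  positivity transfers to all points of the disk because none is displaced further than
  \<open>z\<close>.\<close>

lemma hurwitz_action:
  assumes ne: "delta \<noteq> {}"
  shows "hurwitz_action GG delta (\<lambda>x y. valbar (x - y)) act gval p"
    and "g \<in> G \<Longrightarrow> g \<noteq> \<one>\<^bsub>GG\<^esub> \<Longrightarrow> cluster_action.fixes_of delta act g = fixpts g"
proof -
  interpret ca: cluster_action GG delta "\<lambda>x y. valbar (x - y)" act gval
    by (rule cluster_action[OF ne])
  have near: "ca.near r x y \<longleftrightarrow> vge valbar r (x - y)" for r x y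
    unfolding ca.near_def vge_def by auto
  have fx: "ca.fixes_of g = fixpts g" if g: "g \<in> G" "g \<noteq> \<one>\<^bsub>GG\<^esub>" for g
  proof -
    have "fixpts g \<subseteq> delta" unfolding delta_def using g by blast
    moreover have "x \<in> fixpts g \<longleftrightarrow> act g x = x" if "x \<in> delta" for x
      using act_fixed[OF g(1)] that delta_pts unfolding fixpts_def by blast
    ultimately show ?thesis unfolding ca.fixes_of_def by blast
  qed
  show "ca.fixes_of g = fixpts g" if "g \<in> G" "g \<noteq> \<one>\<^bsub>GG\<^esub>" using fx that .
  have near_act: "ca.near r x (act g x) \<longleftrightarrow> vge valbar r (rx g x - x)" if g: "g \<in> G" and x: "x \<in> pts" for g r x
    using act_fixed[OF g x] valbar_act[OF g x] unfolding ca.near_def vge_def by auto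
  \<comment> \<open>At an arbitrary point of the disk the truncated distances are lower bounds for
    the actual valuations, so the product formula turns into an inequality.\<close>
  have ball: "rx g w = w \<or> ca.level x r g + r \<le> valbar (rx g w - w)"
    if g: "g \<in> G" "g \<noteq> \<one>\<^bsub>GG\<^esub>" and x: "x \<in> delta" and w: "w \<in> pts" "vge valbar r (w - x)" for g w x r
  proof (cases "w \<in> fixpts g")
    case True
    then show ?thesis unfolding fixpts_def by blast
  next
    case False
    have "ca.trunc r x a \<le> valbar (w - a)" if a: "a \<in> fixpts g" for a
    proof -
      have wa: "w - a \<noteq> 0" using a False by auto
      show ?thesis
      proof (cases "a = x")
        case True
        then show ?thesis using w(2) wa unfolding ca.trunc_def vge_def by auto
      next
        case ax: False
        have "vge valbar (min r (valbar (x - a))) ((w - x) + (x - a))"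
          using vge_mono[OF w(2)] by (rule L.vge_add) (auto simp: vge_def)
        then show ?thesis using wa ax unfolding ca.trunc_def vge_def by simp
      qed
    qed
    then have "(\<Sum>a\<in>fixpts g. ca.trunc r x a) \<le> (\<Sum>a\<in>fixpts g. valbar (w - a))" by (rule sum_mono)
    then show ?thesis using displacement(2)[OF g w(1) False] fx[OF g] unfolding ca.level_def by simp
  qed
  have generic: "\<exists>z\<in>pts. vge valbar r (z - x) \<and> (\<forall>g\<in>G. g \<noteq> \<one>\<^bsub>GG\<^esub> \<longrightarrow> rx g z \<noteq> z \<and> valbar (rx g z - z) = ca.level x r g + r)"
    if xy: "x \<in> delta" "y \<in> delta" "x \<noteq> y" and r: "r = valbar (x - y)" for x y r
  proof -
    obtain z where z: "z \<in> pts" "vge valbar r (z - x)"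
      "\<And>a. a \<in> delta \<Longrightarrow> z \<noteq> a \<and> valbar (z - a) = (if a = x then r else min r (valbar (x - a)))"
      using generic_point[OF xy r] by metis
    have "rx g z \<noteq> z \<and> valbar (rx g z - z) = ca.level x r g + r" if g: "g \<in> G" "g \<noteq> \<one>\<^bsub>GG\<^esub>" for g
    proof -
      have sub: "fixpts g \<subseteq> delta" unfolding delta_def using g by blast
      then have zn: "z \<notin> fixpts g" using z(3) by blast
      have "(\<Sum>a\<in>fixpts g. valbar (z - a)) = (\<Sum>a\<in>fixpts g. ca.trunc r x a)"
        using z(3) sub unfolding ca.trunc_def by (intro sum.cong) auto
      then show ?thesis using displacement[OF g z(1) zn] fx[OF g] unfolding ca.level_def by simp
    qed
    then show ?thesis using z(1,2) by blast
  qed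
  \<comment> \<open>\<open>g\<close> preserves the difference of \<open>x\<close> and
    \<open>z\<close>, so their displacements differ by a quantity of valuation at least
    \<open>r\<close>.\<close>
  have near_generic: "vge valbar r (rx g x - x) \<longleftrightarrow> vge valbar r (rx g z - z)"
    if g: "g \<in> G" and x: "x \<in> pts" and z: "z \<in> pts" "vge valbar r (z - x)" for g x z r
  proof -
    have d: "vge valbar r ((rx g z - rx g x) - (z - x))"
      by (rule L.vge_diff[OF iffD2[OF vge_rx_diff[OF g z(1) x] z(2)] z(2)])
    have e: "rx g z - z = (rx g x - x) + ((rx g z - rx g x) - (z - x))"
      "rx g x - x = (rx g z - z) - ((rx g z - rx g x) - (z - x))" by simp_all
    show ?thesis using L.vge_add[OF _ d] L.vge_diff[OF _ d] e by metis
  qed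
  show "hurwitz_action GG delta (\<lambda>x y. valbar (x - y)) act gval p"
  proof (intro hurwitz_action.intro hurwitz_action_axioms.intro ca.cluster_action_axioms)
    show "Factorial_Ring.prime p" by (rule K.prime_p)
    show "0 \<le> gval g" if "g \<in> carrier GG" "g \<noteq> \<one>\<^bsub>GG\<^esub>" for g using gval_nonneg that by simp
    show "subgroup {g \<in> carrier GG. g = \<one>\<^bsub>GG\<^esub> \<or> s \<le> gval g} GG" if "0 < s" for s using gval_filtration[OF that] .
  next
    fix x y g assume xy: "x \<in> delta" "y \<in> delta" "x \<noteq> y" and g: "g \<in> carrier GG" "g \<noteq> \<one>\<^bsub>GG\<^esub>"
      and n: "ca.near (valbar (x - y)) x (act g x)"
    let ?r = "valbar (x - y)"
    have xp: "x \<in> pts" using xy delta_pts by blast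
    have gG: "g \<in> G" using g by simp
    obtain z where z: "z \<in> pts" "vge valbar ?r (z - x)" "rx g z \<noteq> z \<and> valbar (rx g z - z) = ca.level x ?r g + ?r"
      using generic[OF xy refl] gG g(2) by blast
    have "vge valbar ?r (rx g z - z)"
      using n near_act[OF gG xp] near_generic[OF gG xp z(1,2)] by blast
    then show "0 \<le> ca.level x ?r g" using z(3) unfolding vge_def by auto
  next
    fix x y and s :: rat assume xy: "x \<in> delta" "y \<in> delta" "x \<noteq> y" and s: "0 < s"
    let ?r = "valbar (x - y)"
    have xp: "x \<in> pts" using xy delta_pts by blast
    obtain z where z: "z \<in> pts" "vge valbar ?r (z - x)"
      "\<And>g. g \<in> G \<Longrightarrow> g \<noteq> \<one>\<^bsub>GG\<^esub> \<Longrightarrow> rx g z \<noteq> z \<and> valbar (rx g z - z) = ca.level x ?r g + ?r"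
      using generic[OF xy refl] by blast
    \<comment> \<open>Since \<open>s > 0\<close>, one bound \<open>r + s\<close> on the displacement
      of \<open>z\<close> expresses both conditions on \<open>g\<close>; for the identity the
      displacement is 0, which satisfies every bound.\<close>
    have "ca.near ?r x (act g x) \<and> (g = \<one>\<^bsub>GG\<^esub> \<or> s \<le> ca.level x ?r g) \<longleftrightarrow> vge valbar (?r + s) (rx g z - z)"
      if g: "g \<in> G" for g
    proof (cases "g = \<one>\<^bsub>GG\<^esub>")
      case True
      then show ?thesis using near_act[OF g xp] rx_one[OF xp] rx_one[OF z(1)] by simp
    next
      case False
      have "ca.near ?r x (act g x)" if "vge valbar (?r + s) (rx g z - z)"
        using vge_mono[OF that, of ?r] s near_act[OF g xp] near_generic[OF g xp z(1,2)] by simp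
      moreover have "vge valbar (?r + s) (rx g z - z) \<longleftrightarrow> s \<le> ca.level x ?r g"
        using z(3)[OF g False] unfolding vge_def by auto
      ultimately show ?thesis using False by blast
    qed
    then have "{g \<in> carrier GG. ca.near ?r x (act g x) \<and> (g = \<one>\<^bsub>GG\<^esub> \<or> s \<le> ca.level x ?r g)}
      = {g \<in> carrier GG. vge valbar (?r + s) (rx g z - z)}" by (intro Collect_cong) auto
    then show "subgroup {g \<in> carrier GG. ca.near ?r x (act g x) \<and> (g = \<one>\<^bsub>GG\<^esub> \<or> s \<le> ca.level x ?r g)} GG"
      using displacement_subgroup[OF z(1)] by simp
  next
    fix x y g z assume xy: "x \<in> delta" "y \<in> delta" "x \<noteq> y" and g: "g \<in> carrier GG" "g \<noteq> \<one>\<^bsub>GG\<^esub>"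
      and l: "0 < ca.level x (valbar (x - y)) g" and z: "z \<in> delta" "ca.near (valbar (x - y)) x z"
    let ?r = "valbar (x - y)"
    have gG: "g \<in> G" using g by simp
    have zp: "z \<in> pts" using z delta_pts by blast
    have "vge valbar ?r (z - x)" using z(2) L.vge_uminus[of ?r "x - z"] unfolding near by simp
    then have "rx g z = z \<or> ca.level x ?r g + ?r \<le> valbar (rx g z - z)" by (rule ball[OF gG g(2) xy(1) zp])
    then show "act g z = z \<or> ?r < valbar (z - act g z)"
      using act_fixed[OF gG zp] valbar_act[OF gG zp] l by auto
  next
    fix x assume x: "x \<in> delta"
    then have xp: "x \<in> pts" using delta_pts by blast
    have e: "{g \<in> carrier GG. act g x = x} = {g \<in> carrier GG. rx g x = x}"
      using act_fixed[OF _ xp] by (intro Collect_cong) auto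
    obtain s where s: "s \<in> carrier GG" "{g \<in> carrier GG. rx g x = x} = generate GG {s}" using chi_stabilizer(1)[OF xp] by blast
    obtain t where t: "t \<in> G" "t \<noteq> \<one>\<^bsub>GG\<^esub>" "rx t x = x" using x unfolding delta_def fixpts_def by blast
    have "s \<noteq> \<one>\<^bsub>GG\<^esub>"
    proof
      assume "s = \<one>\<^bsub>GG\<^esub>"
      then have "{g \<in> carrier GG. rx g x = x} = {\<one>\<^bsub>GG\<^esub>}" using s(2) grp.generate_one by metis
      moreover have "t \<in> {g \<in> carrier GG. rx g x = x}" using t by simp
      ultimately show False using t(2) by blast
    qed
    then show "\<exists>s\<in>carrier GG. s \<noteq> \<one>\<^bsub>GG\<^esub> \<and> {g \<in> carrier GG. act g x = x} = generate GG {s}"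
      using s e by auto
  next
    fix x g assume x: "x \<in> delta" and g: "g \<in> carrier GG" "g \<noteq> \<one>\<^bsub>GG\<^esub>" and a: "act g x = x"
    have xp: "x \<in> pts" using x delta_pts by blast
    have gG: "g \<in> G" using g by simp
    have fxx: "rx g x = x" using act_fixed[OF gG xp] a by simp
    have eo: "exact_order (chi x g) (grp.ord g)" by (rule chi_stabilizer(2)[OF xp gG fxx])
    have "grp.ord g \<noteq> 1" using grp.ord_eq_1[OF g(1)] g(2) by simp
    then have o1: "1 < grp.ord g" using exact_orderD(1)[OF eo] by simp
    have "x \<in> fixpts g" unfolding fixpts_def using xp fxx by simp
    then have "gval g + (\<Sum>b\<in>fixpts g - {x}. valbar (x - b)) = valbar (1 - chi x g)"
      using valbar_chi[OF gG g(2)] L.val_diff_swap[of "chi x g" 1] by simp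
    then show "gval g + (\<Sum>b\<in>ca.fixes_of g - {x}. valbar (x - b)) = cyclotomic_val p (grp.ord g)"
      using valbar_root_of_unity[OF eo o1] fx[OF gG g(2)] by simp
  qed
qed

lemma delta_eq: "all_fixed_points val valbar G = delta"
proof -
  have "fixed_points valbar \<sigma> = fixpts \<sigma>" if s: "\<sigma> \<in> G" for \<sigma>
    unfolding fixed_points_def fixpts_def rx_def using ev_fps_value[OF _ X_int[OF s]] by blast
  then show ?thesis unfolding all_fixed_points_def delta_def by simp
qed

theorem hurwitz_tree_of_disk:
  assumes ne: "all_fixed_points val valbar G \<noteq> {}"
  shows "\<exists>T :: (nat, 'k fps \<Rightarrow> 'k fps) hurwitz_datum. hurwitz_tree GG p T \<and>
    (\<forall>\<sigma>\<in>G. tree_depth T \<sigma> = disk_depth val G \<sigma>) \<and>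
    (\<forall>\<sigma>\<in>G. tree_artin T \<sigma> = disk_artin val \<pi> G \<sigma>)"
proof -
  have ne': "delta \<noteq> {}" using ne delta_eq by simp
  interpret ha: hurwitz_action GG delta "\<lambda>x y. valbar (x - y)" act gval p by (rule hurwitz_action(1)[OF ne'])
  have d: "disk_depth val G \<sigma> = zero_sum GG (\<lambda>g. - of_nat (card (carrier GG)) * of_rat (gval g)) \<sigma>" for \<sigma>
    unfolding disk_depth_def zero_sum_def gval_def displ_def Let_def by simp
  have f: "num_zeros val \<pi> (\<sigma> fps_X - fps_X) = card (ha.fixes_of \<sigma>)" if "\<sigma> \<in> G" "\<sigma> \<noteq> \<one>\<^bsub>disk_aut val\<^esub>" for \<sigma>
    using num_zeros_fixpts[of \<sigma>] hurwitz_action(2)[OF ne', of \<sigma>] that unfolding displ_def by simp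
  have "(\<Sum>\<tau>\<in>G - {\<one>\<^bsub>disk_aut val\<^esub>}. - of_nat (num_zeros val \<pi> (\<tau> fps_X - fps_X)))
      = (\<Sum>\<tau>\<in>G - {\<one>\<^bsub>disk_aut val\<^esub>}. - (of_nat (card (ha.fixes_of \<tau>)) :: complex))"
    using f by (intro sum.cong) auto
  then have a: "disk_artin val \<pi> G \<sigma> = zero_sum GG (\<lambda>g. - of_nat (card (ha.fixes_of g))) \<sigma>" if "\<sigma> \<in> G" for \<sigma>
    unfolding disk_artin_def zero_sum_def Let_def using f that by simp
  obtain T :: "(nat, 'k fps \<Rightarrow> 'k fps) hurwitz_datum" where T: "hurwitz_tree GG p T"
    "\<forall>g\<in>carrier GG. tree_depth T g = zero_sum GG (\<lambda>g. - of_nat (card (carrier GG)) * of_rat (gval g)) g"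
    "\<forall>g\<in>carrier GG. tree_artin T g = zero_sum GG (\<lambda>g. - of_nat (card (ha.fixes_of g))) g"
    using ha.hurwitz_tree_exists by blast
  have "tree_depth T \<sigma> = disk_depth val G \<sigma>" "tree_artin T \<sigma> = disk_artin val \<pi> G \<sigma>" if "\<sigma> \<in> G" for \<sigma>
    using T(2,3) that d[of \<sigma>] a[OF that] by simp_all
  then show ?thesis using T(1) by blast
qed

end

theorem theorem3p7:
  fixes val :: "'k::field_char_0 \<Rightarrow> rat" and valbar :: "'k alg_closure \<Rightarrow> rat"
    and \<pi> :: 'k and p :: nat and G :: "('k fps \<Rightarrow> 'k fps) set"
  assumes base_field: "complete_dvf val \<pi> p"
    and extension: "valuation_extension valbar val"
    and group: "subgroup G (disk_aut val)" "finite G"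
    and fixed_points: "all_fixed_points val valbar G \<noteq> {}"
  shows "\<exists>T :: (nat, 'k fps \<Rightarrow> 'k fps) hurwitz_datum.
    hurwitz_tree (disk_aut val\<lparr>carrier := G\<rparr>) p T \<and>
    (\<forall>\<sigma>\<in>G. tree_depth T \<sigma> = disk_depth val G \<sigma>) \<and>
    (\<forall>\<sigma>\<in>G. tree_artin T \<sigma> = disk_artin val \<pi> G \<sigma>)"
proof -
  interpret disk_group val \<pi> p valbar G
    using base_field extension group by (simp add: disk_group_def disk_def disk_group_axioms_def)
  show ?thesis using hurwitz_tree_of_disk[OF fixed_points] .
qed

end
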